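(* Let $\mathbf{T}=\{(z,w)\in\mathbf{C}^2 : |z|<|w|<1\}$ be the Hartogs triangle and let $W^1(\mathbf{T})$ be the Sobolev space of $L^2$ functions on $\mathbf{T}$ with weak first-order derivatives in $L^2$. Then the following statements hold: (1) (Smooth approximation) $C^\infty(\overline{\mathbf{T}})$ is dense in $W^1(\mathbf{T})$. (2) (Sobolev embedding) $W^1(\mathbf{T})\subset L^4(\mathbf{T})$, and the inclusion map is bounded. (3) (Rellich lemma) The inclusion $W^1(\mathbf{T})\subset L^2(\mathbf{T})$ is compact.
   Context: $C^\infty(\overline{\mathbf{T}})$ denotes functions smooth up to the boundary (restrictions to $\mathbf{T}$ of smooth functions on $\mathbf{C}^2$). $L^p(\mathbf{T})$ is taken with respect to Lebesgue measure on $\mathbf{C}^2\cong\mathbf{R}^4$, and derivatives are with respect to the real coordinates. *)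

theory Defs
  imports "HOL-Analysis.Analysis"
begin

definition hartogs_triangle :: "(complex \<times> complex) set" where
  "hartogs_triangle = {(z, w). norm z < norm w \<and> norm w < 1}"

primrec k_smooth :: "nat \<Rightarrow> ('a::real_normed_vector \<Rightarrow> 'b::real_normed_vector) \<Rightarrow> bool" where
  "k_smooth 0 f \<longleftrightarrow> continuous_on UNIV f"
| "k_smooth (Suc k) f \<longleftrightarrow>
     (\<forall>x. f differentiable (at x)) \<and>
     (\<forall>v. k_smooth k (\<lambda>x. frechet_derivative f (at x) v))"

definition smooth :: "('a::real_normed_vector \<Rightarrow> 'b::real_normed_vector) \<Rightarrow> bool" where
  "smooth f \<longleftrightarrow> (\<forall>k. k_smooth k f)"

(* Function spaces on U are sets of total functions whose values outside U are irrelevant;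
   functions agreeing almost everywhere on U are not identified, so the "norms" below are
   seminorms that vanish exactly on the functions that are zero almost everywhere on U. *)

definition smooth_up_to_boundary :: "'a::real_normed_vector set \<Rightarrow> ('a \<Rightarrow> complex) set" where
  "smooth_up_to_boundary U = {f. \<exists>F. smooth F \<and> (\<forall>x\<in>U. f x = F x)}"

definition Lp :: "real \<Rightarrow> 'a::euclidean_space set \<Rightarrow> ('a \<Rightarrow> complex) set" where
  "Lp p U = {f. f \<in> borel_measurable (lebesgue_on U) \<and>
                integrable (lebesgue_on U) (\<lambda>x. norm (f x) powr p)}"

definition Lp_norm :: "real \<Rightarrow> 'a::euclidean_space set \<Rightarrow> ('a \<Rightarrow> complex) \<Rightarrow> real" where
  "Lp_norm p U f = (LINT x|lebesgue_on U. norm (f x) powr p) powr (1 / p)"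

definition test_functions :: "'a::euclidean_space set \<Rightarrow> ('a \<Rightarrow> complex) set" where
  "test_functions U = {\<phi>. smooth \<phi> \<and> compact (closure {x. \<phi> x \<noteq> 0}) \<and> closure {x. \<phi> x \<noteq> 0} \<subseteq> U}"

definition locally_integrable :: "'a::euclidean_space set \<Rightarrow> ('a \<Rightarrow> complex) \<Rightarrow> bool" where
  "locally_integrable U f \<longleftrightarrow> (\<forall>K. compact K \<longrightarrow> K \<subseteq> U \<longrightarrow> set_integrable lebesgue K f)"

definition has_weak_derivative ::
    "'a::euclidean_space set \<Rightarrow> 'a \<Rightarrow> ('a \<Rightarrow> complex) \<Rightarrow> ('a \<Rightarrow> complex) \<Rightarrow> bool" where
  "has_weak_derivative U b f g \<longleftrightarrow>
     locally_integrable U f \<and> locally_integrable U g \<and>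
     (\<forall>\<phi>\<in>test_functions U.
        (LINT x|lebesgue_on U. f x * frechet_derivative \<phi> (at x) b) =
        - (LINT x|lebesgue_on U. g x * \<phi> x))"

(* On an open set a weak derivative is unique up to null sets, so the choice made here
   does not affect Lp membership or Lp norms. *)
definition weak_derivative :: "'a::euclidean_space set \<Rightarrow> 'a \<Rightarrow> ('a \<Rightarrow> complex) \<Rightarrow> 'a \<Rightarrow> complex" where
  "weak_derivative U b f = (SOME g. has_weak_derivative U b f g)"

(* On complex * complex, Basis = {(1,0), (i,0), (0,1), (0,i)}: the derivatives are those
   with respect to the four real coordinates. *)
definition W1 :: "'a::euclidean_space set \<Rightarrow> ('a \<Rightarrow> complex) set" where
  "W1 U = {f \<in> Lp 2 U. \<forall>b\<in>Basis. \<exists>g\<in>Lp 2 U. has_weak_derivative U b f g}"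

definition W1_norm :: "'a::euclidean_space set \<Rightarrow> ('a \<Rightarrow> complex) \<Rightarrow> real" where
  "W1_norm U f = sqrt ((Lp_norm 2 U f)\<^sup>2 + (\<Sum>b\<in>Basis. (Lp_norm 2 U (weak_derivative U b f))\<^sup>2))"

definition dense_in_seminormed ::
    "('a \<Rightarrow> complex) set \<Rightarrow> ('a \<Rightarrow> complex) set \<Rightarrow> (('a \<Rightarrow> complex) \<Rightarrow> real) \<Rightarrow> bool" where
  "dense_in_seminormed D V N \<longleftrightarrow>
     D \<subseteq> V \<and> (\<forall>f\<in>V. \<forall>\<epsilon>>0. \<exists>g\<in>D. N (\<lambda>x. f x - g x) < \<epsilon>)"

definition bounded_inclusion ::
    "('a \<Rightarrow> complex) set \<Rightarrow> (('a \<Rightarrow> complex) \<Rightarrow> real) \<Rightarrow> ('a \<Rightarrow> complex) set \<Rightarrow> (('a \<Rightarrow> complex) \<Rightarrow> real) \<Rightarrow> bool" where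
  "bounded_inclusion V N V' N' \<longleftrightarrow> V \<subseteq> V' \<and> (\<exists>C. \<forall>f\<in>V. N' f \<le> C * N f)"

definition compact_inclusion ::
    "('a \<Rightarrow> complex) set \<Rightarrow> (('a \<Rightarrow> complex) \<Rightarrow> real) \<Rightarrow> ('a \<Rightarrow> complex) set \<Rightarrow> (('a \<Rightarrow> complex) \<Rightarrow> real) \<Rightarrow> bool" where
  "compact_inclusion V N V' N' \<longleftrightarrow>
     V \<subseteq> V' \<and>
     (\<forall>f :: nat \<Rightarrow> 'a \<Rightarrow> complex. (\<forall>n. f n \<in> V) \<and> (\<exists>M. \<forall>n. N (f n) \<le> M) \<longrightarrow>
        (\<exists>g\<in>V'. \<exists>r. strict_mono r \<and> (\<lambda>n. N' (\<lambda>x. f (r n) x - g x)) \<longlonglongrightarrow> 0))"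

end

theory Submission
  imports Defs "HOL-Complex_Analysis.Great_Picard" "HOL-Library.Diagonal_Subsequence"
begin

text \<open>
  Write \<open>T\<close> for the Hartogs triangle.  Near the origin \<open>T\<close> is not a Lipschitz domain: after
  rescaling, it looks like the cone \<open>|z| < |w|\<close>, and no single direction points into \<open>T\<close> at all
  points close to \<open>0\<close>.  It does satisfy a uniform interior cone condition.  From a point with
  \<open>|w| < 1/2\<close> one may move in every direction close to \<open>(0, w/|w|)\<close>, and from the other points in
  every direction close to \<open>(-2z, -w)\<close>, in both cases over a fixed length.  These axes form a bounded
  set, so finitely many of them suffice up to a small change of the aperture
  (\<open>hartogs_triangle_cone_cover\<close>): \<open>T\<close> is a finite union of pieces on each of which the axis \<open>v\<close> of
  the cone is constant.  Parts (2) and (3) hold for every bounded open set with this property.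

  On a piece, regularise \<open>u\<close> with a kernel supported in a small ball around a small multiple of \<open>v\<close>.
  The regularised function at a point \<open>x\<close> of the piece, and on the segments starting at \<open>x\<close> in
  directions close to \<open>v\<close>, only sees values of \<open>u\<close> inside \<open>T\<close>; its derivatives are therefore the
  regularised weak derivatives of \<open>u\<close>, and the fundamental theorem of calculus applies along these
  segments.

  Rellich lemma (\<open>rellich\<close>): integrating over such segments bounds the \<open>L\<^sup>2\<close> norm of
  \<open>u(x + ty) - u(x)\<close> on a piece by \<open>t\<close> times the norm of the gradient, so a bounded sequence is
  uniformly close to its regularisations at a fixed scale, and these form a relatively compact family
  by the theorem of Arzela and Ascoli.

  Sobolev embedding (\<open>sobolev_inequality\<close>): this is the argument of Gagliardo and Nirenberg.  Near
  \<open>v\<close> there are four linearly independent directions \<open>e\<^sub>i\<close>.  For \<open>x\<close> in a piece, \<open>|u(x)|\<^sup>3\<close> is at most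
  the integral of \<open>|u|\<^sup>3 + |u|\<^sup>2 |Du|\<close> over the part in \<open>T\<close> of the line through \<open>x\<close> in direction
  \<open>e\<^sub>i\<close>, for each \<open>i\<close>.  Multiplying the four bounds and using the Loomis-Whitney inequality in the
  oblique coordinates given by the \<open>e\<^sub>i\<close> yields \<open>X\<^sup>3 \<le> C X\<^sup>2 N\<^sup>4\<close> with \<open>X\<close> the integral of \<open>|u|\<^sup>4\<close>
  and \<open>N\<close> the Sobolev norm.  A bounded truncation of \<open>|u|\<close> takes the place of \<open>|u|\<close> throughout,
  because \<open>X\<close> has to be known to be finite before it can be cancelled.

  Smooth approximation (\<open>smooth_approximation\<close>): the dilation \<open>(z, w) \<mapsto> (\<mu>\<^sup>2 z, \<mu> w)\<close> with \<open>0 < \<mu> < 1\<close>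
  maps the closure of \<open>T\<close> without the origin into \<open>T\<close>.  Composing a mollification of \<open>u\<close> with it
  gives globally smooth functions that converge to \<open>u\<close> together with their derivatives away from the
  origin.  A cutoff at scale \<open>s\<close> removes the origin; its derivative is of size \<open>1/s\<close> on a ball of
  volume comparable to \<open>s\<^sup>4\<close>, so by the Cauchy-Schwarz inequality its contribution is controlled by
  the \<open>L\<^sup>4\<close> norm of \<open>u\<close> on that ball.  This tends to \<open>0\<close> because \<open>u\<close> is in \<open>L\<^sup>4\<close> by (2).
\<close>


section \<open>Calculus of smooth functions\<close>

lemma k_smooth_SucI:
  assumes "\<And>x. (f has_derivative f' x) (at x)" "\<And>v. k_smooth k (\<lambda>x. f' x v)"
  shows "k_smooth (Suc k) f"
proof -
  have "frechet_derivative f (at x) = f' x" for x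
    using assms(1) frechet_derivative_at by metis
  then show ?thesis
    using assms by (auto simp: differentiable_def)
qed

lemma k_smooth_has_derivative:
  "k_smooth (Suc k) f \<Longrightarrow> (f has_derivative frechet_derivative f (at x)) (at x)"
  using frechet_derivative_works by auto

lemma k_smooth_continuous: "k_smooth k f \<Longrightarrow> continuous_on UNIV f"
  by (cases k) (auto intro: continuous_at_imp_continuous_on differentiable_imp_continuous_within)

lemma k_smooth_SucD: "k_smooth (Suc k) f \<Longrightarrow> k_smooth k f"
proof (induction k arbitrary: f)
  case 0
  then show ?case using k_smooth_continuous k_smooth.simps(1) by metis
next
  case (Suc k)
  then show ?case by (metis k_smooth.simps(2))
qed

lemma k_smooth_const: "k_smooth k (\<lambda>x. c)"
proof (induction k arbitrary: c)
  case (Suc k)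
  show ?case by (rule k_smooth_SucI[where f' = "\<lambda>x h. 0"]) (auto intro: Suc)
qed simp

lemma k_smooth_bounded_linear: "bounded_linear L \<Longrightarrow> k_smooth k L"
proof (cases k)
  case 0
  assume "bounded_linear L"
  with 0 show ?thesis by (simp add: linear_continuous_on)
next
  case (Suc m)
  assume L: "bounded_linear L"
  show ?thesis unfolding Suc
    by (rule k_smooth_SucI[where f' = "\<lambda>x. L"])
      (auto intro: k_smooth_const bounded_linear_imp_has_derivative L)
qed

lemma k_smooth_add: "k_smooth k f \<Longrightarrow> k_smooth k g \<Longrightarrow> k_smooth k (\<lambda>x. f x + g x)"
proof (induction k arbitrary: f g)
  case (Suc k)
  show ?case
  proof (rule k_smooth_SucI)
    show "((\<lambda>x. f x + g x) has_derivative
        (\<lambda>h. frechet_derivative f (at x) h + frechet_derivative g (at x) h)) (at x)" for x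
      by (rule has_derivative_add[OF k_smooth_has_derivative[OF Suc.prems(1)]
            k_smooth_has_derivative[OF Suc.prems(2)]])
    show "k_smooth k (\<lambda>x. frechet_derivative f (at x) v + frechet_derivative g (at x) v)" for v
      by (intro Suc.IH) (use Suc.prems in auto)
  qed
qed (auto intro: continuous_intros)

lemma k_smooth_bilinear:
  assumes "bounded_bilinear B"
  shows "k_smooth k f \<Longrightarrow> k_smooth k g \<Longrightarrow> k_smooth k (\<lambda>x. B (f x) (g x))"
proof (induction k arbitrary: f g)
  case 0
  then show ?case using bounded_bilinear.continuous_on[OF assms] by auto
next
  case (Suc k)
  show ?case
  proof (rule k_smooth_SucI)
    fix x
    show "((\<lambda>x. B (f x) (g x)) has_derivative
        (\<lambda>h. B (f x) (frechet_derivative g (at x) h) + B (frechet_derivative f (at x) h) (g x))) (at x)"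
      by (rule bounded_bilinear.FDERIV[OF assms k_smooth_has_derivative[OF Suc.prems(1)]
            k_smooth_has_derivative[OF Suc.prems(2)]])
    show "k_smooth k (\<lambda>x. B (f x) (frechet_derivative g (at x) v) + B (frechet_derivative f (at x) v) (g x))" for v
      by (intro k_smooth_add Suc.IH) (use Suc.prems k_smooth_SucD in auto)
  qed
qed

lemma k_smooth_affine:
  assumes "bounded_linear A"
  shows "k_smooth k f \<Longrightarrow> k_smooth k (\<lambda>x. f (A x + c))"
proof (induction k arbitrary: f)
  case 0
  then have "continuous_on UNIV f" by simp
  moreover have "continuous_on UNIV (\<lambda>x. A x + c)"
    by (intro continuous_intros linear_continuous_on assms)
  ultimately have "continuous_on UNIV (\<lambda>x. f (A x + c))"
    using continuous_on_compose2[of UNIV f UNIV "\<lambda>x. A x + c"] by simp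
  then show ?case by simp
next
  case (Suc k)
  show ?case
  proof (rule k_smooth_SucI)
    fix x
    have "((\<lambda>x. A x + c) has_derivative A) (at x)"
      using bounded_linear_imp_has_derivative[OF assms] by (auto intro!: derivative_eq_intros)
    from has_derivative_compose[OF this k_smooth_has_derivative[OF Suc.prems]]
    show "((\<lambda>x. f (A x + c)) has_derivative (\<lambda>h. frechet_derivative f (at (A x + c)) (A h))) (at x)" .
    show "k_smooth k (\<lambda>x. frechet_derivative f (at (A x + c)) (A v))" for v
      by (rule Suc.IH) (use Suc.prems in auto)
  qed
qed

lemma smooth_has_derivative:
  "smooth f \<Longrightarrow> (f has_derivative frechet_derivative f (at x)) (at x)"
  unfolding smooth_def using k_smooth_has_derivative by blast

lemma smooth_continuous: "smooth f \<Longrightarrow> continuous_on S f"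
  unfolding smooth_def using k_smooth_continuous continuous_on_subset by blast

lemma smooth_frechet_derivative:
  "smooth f \<Longrightarrow> smooth (\<lambda>x. frechet_derivative f (at x) v)"
  unfolding smooth_def by (metis k_smooth.simps(2))

lemma smooth_const: "smooth (\<lambda>x. c)"
  by (simp add: smooth_def k_smooth_const)

lemma smooth_add: "smooth f \<Longrightarrow> smooth g \<Longrightarrow> smooth (\<lambda>x. f x + g x)"
  by (simp add: smooth_def k_smooth_add)

lemma smooth_bilinear:
  "bounded_bilinear B \<Longrightarrow> smooth f \<Longrightarrow> smooth g \<Longrightarrow> smooth (\<lambda>x. B (f x) (g x))"
  by (simp add: smooth_def k_smooth_bilinear)

lemma smooth_mult:
  fixes f g :: "'a::real_normed_vector \<Rightarrow> 'b::real_normed_algebra"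
  shows "smooth f \<Longrightarrow> smooth g \<Longrightarrow> smooth (\<lambda>x. f x * g x)"
  by (rule smooth_bilinear[OF bounded_bilinear_mult])

lemma smooth_affine: "bounded_linear A \<Longrightarrow> smooth f \<Longrightarrow> smooth (\<lambda>x. f (A x + c))"
  by (simp add: smooth_def k_smooth_affine)

lemma smooth_linear_image:
  assumes "bounded_linear L" "smooth f"
  shows "smooth (\<lambda>x. L (f x))"
proof -
  interpret bounded_linear L by fact
  have "k_smooth k g \<Longrightarrow> k_smooth k (\<lambda>x. L (g x))" for k and g :: "'c \<Rightarrow> 'a"
  proof (induction k arbitrary: g)
    case 0
    then show ?case by (auto intro: continuous_on)
  next
    case (Suc k)
    show ?case
      by (rule k_smooth_SucI[where f' = "\<lambda>x h. L (frechet_derivative g (at x) h)"])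
        (use Suc in \<open>auto intro!: has_derivative k_smooth_has_derivative Suc.IH\<close>)
  qed
  then show ?thesis using assms(2) by (simp add: smooth_def)
qed

lemma smooth_of_real:
  fixes f :: "'a::real_normed_vector \<Rightarrow> real"
  shows "smooth f \<Longrightarrow> smooth (\<lambda>x. of_real (f x) :: complex)"
  by (rule smooth_linear_image[OF bounded_linear_of_real])

lemma smooth_translate: "smooth f \<Longrightarrow> smooth (\<lambda>x. f (x - c))"
  using smooth_affine[OF bounded_linear_ident, of f "-c"] by simp

section \<open>Smooth bump functions and mollifiers\<close>

text \<open>
  The flat functions \<open>p(1/t) exp(-1/t)\<close>, with \<open>p\<close> a polynomial, form a family that is closed under
  differentiation.  The smoothness of the bump function \<open>exp(-1/(1 - |x|\<^sup>2))\<close> is therefore proved by one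
  induction for the whole family.
\<close>
definition flat_exp :: "real poly \<Rightarrow> real \<Rightarrow> real" where
  "flat_exp p t = (if t > 0 then poly p (1 / t) * exp (- (1 / t)) else 0)"

lemma poly_times_exp_tendsto_0:
  fixes p :: "real poly"
  shows "((\<lambda>s. s ^ k * poly p s * exp (- s)) \<longlongrightarrow> 0) at_top"
proof (induction p arbitrary: k)
  case 0
  then show ?case by simp
next
  case (pCons a p)
  have "((\<lambda>s. a * (s ^ k / exp s) + s ^ Suc k * poly p s * exp (- s)) \<longlongrightarrow> a * 0 + 0) at_top"
    by (intro tendsto_intros tendsto_power_div_exp_0 pCons)
  then show ?case
    by (simp add: algebra_simps exp_minus divide_inverse)
qed

lemma flat_exp_tendsto_0: "(flat_exp p \<longlongrightarrow> 0) (at 0)"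
proof -
  have "((\<lambda>t. poly p (inverse t) * exp (- inverse t)) \<longlongrightarrow> 0) (at_right 0)"
    using filterlim_compose[OF poly_times_exp_tendsto_0[of 0 p] filterlim_inverse_at_top_right] by simp
  moreover have "\<forall>\<^sub>F t in at_right 0. poly p (inverse t) * exp (- inverse t) = flat_exp p t"
    unfolding eventually_at_right_field
    by (intro exI[of _ 1]) (auto simp: flat_exp_def field_simps)
  ultimately have "(flat_exp p \<longlongrightarrow> 0) (at_right 0)"
    by (rule Lim_transform_eventually)
  moreover have "(flat_exp p \<longlongrightarrow> 0) (at_left 0)"
    by (rule Lim_transform_eventually[OF tendsto_const])
      (auto simp: flat_exp_def eventually_at_left_field intro: exI[of _ "-1"])
  ultimately show ?thesis
    by (simp add: filterlim_at_split)
qed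

text \<open>
  Away from \<open>0\<close> this is the chain rule.  At \<open>0\<close> the difference quotient of the function belonging to
  \<open>p\<close> is the function belonging to \<open>X p\<close>, which tends to \<open>0\<close>.
\<close>
lemma flat_exp_has_derivative:
  "(flat_exp p has_real_derivative flat_exp ([:0, 0, 1:] * (p - pderiv p)) t) (at t)"
proof -
  consider "t > 0" | "t < 0" | "t = 0" by linarith
  then show ?thesis
  proof cases
    case 1
    have d: "((\<lambda>t. poly p (1 / t) * exp (- (1 / t))) has_real_derivative
        poly (pderiv p) (1 / t) * (- (1 / t\<^sup>2)) * exp (- (1 / t))
        + poly p (1 / t) * (exp (- (1 / t)) * (1 / t\<^sup>2))) (at t)"
      using 1 by (auto intro!: derivative_eq_intros DERIV_chain2[of "poly p"] poly_DERIV
          simp: power2_eq_square field_simps)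
    have "poly (pderiv p) (1 / t) * (- (1 / t\<^sup>2)) * exp (- (1 / t))
        + poly p (1 / t) * (exp (- (1 / t)) * (1 / t\<^sup>2)) = flat_exp ([:0, 0, 1:] * (p - pderiv p)) t"
      using 1 by (simp add: flat_exp_def power2_eq_square algebra_simps diff_divide_distrib)
    with d have d': "((\<lambda>t. poly p (1 / t) * exp (- (1 / t))) has_real_derivative
        flat_exp ([:0, 0, 1:] * (p - pderiv p)) t) (at t)" by simp
    show ?thesis
      by (rule has_field_derivative_transform_within_open[OF d', of "{0<..}"])
        (use 1 in \<open>auto simp: flat_exp_def\<close>)
  next
    case 2
    have "((\<lambda>t. 0) has_real_derivative flat_exp ([:0, 0, 1:] * (p - pderiv p)) t) (at t)"
      using 2 by (simp add: flat_exp_def)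
    then show ?thesis
      by (rule has_field_derivative_transform_within_open[of _ _ _ "{..<0}"])
        (use 2 in \<open>auto simp: flat_exp_def\<close>)
  next
    case 3
    have "(\<lambda>h. (flat_exp p h - flat_exp p 0) / h) = flat_exp ([:0, 1:] * p)"
      by (rule ext) (auto simp: flat_exp_def)
    then show ?thesis
      using flat_exp_tendsto_0[of "[:0, 1:] * p"] 3
      by (simp add: has_field_derivative_iff flat_exp_def)
  qed
qed

lemma smooth_flat_exp_norm:
  "smooth (\<lambda>x::'a::real_inner. flat_exp p (1 - x \<bullet> x))"
proof -
  have "k_smooth k (\<lambda>x::'a. flat_exp p (1 - x \<bullet> x))" for k
  proof (induction k arbitrary: p)
    case 0
    have "isCont (flat_exp p) t" for t
      using flat_exp_has_derivative DERIV_isCont by blast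
    then have "continuous_on UNIV (flat_exp p)"
      by (simp add: continuous_at_imp_continuous_on)
    then show ?case
      by (auto intro!: continuous_intros continuous_on_compose2[of UNIV "flat_exp p"])
  next
    case (Suc k)
    let ?q = "[:0, 0, 1:] * (p - pderiv p)"
    show ?case
    proof (rule k_smooth_SucI)
      fix x :: 'a
      have "((\<lambda>x::'a. 1 - x \<bullet> x) has_derivative (\<lambda>h. - 2 * (x \<bullet> h))) (at x)"
        by (auto intro!: derivative_eq_intros simp: inner_commute)
      from has_derivative_compose[OF this
          flat_exp_has_derivative[THEN has_field_derivative_imp_has_derivative]]
      show "((\<lambda>x::'a. flat_exp p (1 - x \<bullet> x)) has_derivative
          (\<lambda>h. flat_exp ?q (1 - x \<bullet> x) * (- 2 * (x \<bullet> h)))) (at x)" .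
      have "bounded_linear (\<lambda>x. - 2 * (x \<bullet> v))" for v :: 'a
        by (intro bounded_linear_intros)
      then show "k_smooth k (\<lambda>x::'a. flat_exp ?q (1 - x \<bullet> x) * (- 2 * (x \<bullet> v)))" for v
        by (intro k_smooth_bilinear[OF bounded_bilinear_mult] Suc k_smooth_bounded_linear)
    qed
  qed
  then show ?thesis by (simp add: smooth_def)
qed

text \<open>
  The set \<open>S\<close> is not required to be a neighbourhood of the origin: kernels that sit inside a cone
  with vertex \<open>0\<close> are the important ones below.
\<close>
definition mollifier :: "('a::euclidean_space \<Rightarrow> real) \<Rightarrow> 'a set \<Rightarrow> bool" where
  "mollifier K S \<longleftrightarrow> smooth K \<and> (\<forall>x. 0 \<le> K x) \<and> (\<forall>x. x \<notin> S \<longrightarrow> K x = 0)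
     \<and> integrable lborel K \<and> (LINT x|lborel. K x) = 1"

lemma integrable_continuous_bounded_support:
  fixes f :: "'a::euclidean_space \<Rightarrow> 'b::{banach, second_countable_topology}"
  assumes "continuous_on UNIV f" "bounded S" "\<And>x. x \<notin> S \<Longrightarrow> f x = 0"
  shows "integrable lborel f"
proof -
  have "set_integrable lborel (closure S) f"
    unfolding set_integrable_def
    by (rule borel_integrable_compact)
       (use assms(2) continuous_on_subset[OF assms(1)] in \<open>auto simp: compact_closure\<close>)
  moreover have "(\<lambda>x. indicator (closure S) x *\<^sub>R f x) = f"
  proof
    fix x
    show "indicator (closure S) x *\<^sub>R f x = f x"
      using assms(3)[of x] closure_subset[of S] by (cases "x \<in> closure S") auto
  qed
  ultimately show ?thesis by (simp add: set_integrable_def)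
qed

lemma mollifier_exists:
  fixes c :: "'a::euclidean_space"
  assumes "0 < \<rho>"
  shows "\<exists>K. mollifier K (ball c \<rho>)"
proof -
  define B :: "'a \<Rightarrow> real" where "B x = flat_exp 1 (1 - x \<bullet> x)" for x
  define K where "K x = B ((1/\<rho>) *\<^sub>R x + (- (1/\<rho>) *\<^sub>R c))" for x
  have B_pos: "B x > 0 \<longleftrightarrow> norm x < 1" and B0: "norm x \<ge> 1 \<Longrightarrow> B x = 0" and B_nn: "0 \<le> B x" for x
    using power_mono_iff[of 1 "norm x" 2] power_less_one_iff[of "norm x" 2]
    by (auto simp: B_def flat_exp_def power2_norm_eq_inner[symmetric] abs_square_less_1)
  have eq: "(1/\<rho>) *\<^sub>R x + (- (1/\<rho>) *\<^sub>R c) = (1/\<rho>) *\<^sub>R (x - c)" for x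
    by (simp add: algebra_simps)
  have nrm: "norm ((1/\<rho>) *\<^sub>R x + (- (1/\<rho>) *\<^sub>R c)) < 1 \<longleftrightarrow> x \<in> ball c \<rho>" for x
    unfolding eq using assms by (simp add: dist_norm norm_minus_commute)
  have "smooth B" unfolding B_def by (rule smooth_flat_exp_norm)
  then have sK: "smooth K"
    unfolding K_def by (intro smooth_affine bounded_linear_scaleR_right)
  have K_nn: "0 \<le> K x" for x by (simp add: K_def B_nn)
  have K_supp: "x \<notin> ball c \<rho> \<Longrightarrow> K x = 0" for x
    using nrm[of x] B0[of "(1/\<rho>) *\<^sub>R x + (- (1/\<rho>) *\<^sub>R c)"] unfolding K_def by linarith
  have K_pos: "K x > 0 \<longleftrightarrow> x \<in> ball c \<rho>" for x
    unfolding K_def B_pos nrm ..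
  have int: "integrable lborel K"
    by (rule integrable_continuous_bounded_support[where S="ball c \<rho>"])
       (use smooth_continuous[OF sK] K_supp in auto)
  have "(LINT x|lborel. K x) \<noteq> 0"
  proof
    assume "(LINT x|lborel. K x) = 0"
    then have "AE x in lborel. K x = 0"
      using integral_nonneg_eq_0_iff_AE[OF int] K_nn by auto
    then have "AE x in lborel. x \<notin> ball c \<rho>"
      by eventually_elim (use K_pos in force)
    then have "ball c \<rho> \<in> null_sets lborel"
      by (subst (asm) AE_iff_null_sets[symmetric]) auto
    then have "negligible (ball c \<rho>)"
      using null_sets_completionI negligible_iff_null_sets by blast
    then show False using assms open_not_negligible[of "ball c \<rho>"] by auto
  qed
  moreover have "(LINT x|lborel. K x) \<ge> 0" using K_nn by simp
  ultimately have pos: "(LINT x|lborel. K x) > 0" by linarith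
  have "mollifier (\<lambda>x. inverse (LINT x|lborel. K x) * K x) (ball c \<rho>)"
    unfolding mollifier_def
    using pos K_nn K_supp int by (auto intro!: smooth_mult smooth_const sK mult_nonneg_nonneg)
  then show ?thesis by blast
qed


section \<open>Convolution with a smooth kernel\<close>

text \<open>
  The kernel is not reflected, so that \<open>conv f K x\<close> is the average of \<open>f(x + y)\<close> with weight \<open>K(y)\<close>:
  a kernel supported in a cone with vertex \<open>0\<close> averages \<open>f\<close> over the translated cone with vertex \<open>x\<close>.
\<close>
definition conv :: "('a::euclidean_space \<Rightarrow> complex) \<Rightarrow> ('a \<Rightarrow> real) \<Rightarrow> 'a \<Rightarrow> complex" where
  "conv f K x = (LINT z|lborel. f z * of_real (K (z - x)))"

lemma bounded_support_bounded:
  fixes f :: "'a::euclidean_space \<Rightarrow> 'b::real_normed_vector"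
  assumes "continuous_on UNIV f" "bounded S" "\<And>x. x \<notin> S \<Longrightarrow> f x = 0"
  obtains M where "\<And>x. norm (f x) \<le> M" "0 \<le> M"
proof -
  have "compact (f ` closure S)"
    using assms(2) continuous_on_subset[OF assms(1)]
    by (intro compact_continuous_image) (auto simp: compact_closure)
  then obtain M where M: "\<And>y. y \<in> f ` closure S \<Longrightarrow> norm y \<le> M"
    using compact_imp_bounded bounded_iff by metis
  have "norm (f x) \<le> max M 0" for x
  proof (cases "x \<in> S")
    case True
    then have "norm (f x) \<le> M" using closure_subset[of S] by (intro M) auto
    then show ?thesis by simp
  qed (simp add: assms(3))
  then show ?thesis using that[of "max M 0"] by auto
qed

lemma bounded_support_uniformly_continuous:
  fixes f :: "'a::euclidean_space \<Rightarrow> 'b::real_normed_vector"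
  assumes "continuous_on UNIV f" "bounded S" "\<And>x. x \<notin> S \<Longrightarrow> f x = 0" "0 < e"
  obtains d where "0 < d" "\<And>x y. dist x y < d \<Longrightarrow> dist (f x) (f y) < e"
proof -
  obtain R where R: "\<And>x. x \<in> S \<Longrightarrow> norm x \<le> R"
    using assms(2) bounded_iff by metis
  have "uniformly_continuous_on (cball 0 (R + 1)) f"
    using continuous_on_subset[OF assms(1)] by (intro compact_uniformly_continuous) auto
  then obtain d where d: "0 < d"
    "\<And>x y. x \<in> cball 0 (R + 1) \<Longrightarrow> y \<in> cball 0 (R + 1) \<Longrightarrow> dist y x < d \<Longrightarrow> dist (f y) (f x) < e"
    using \<open>0 < e\<close> unfolding uniformly_continuous_on_def by meson
  have "dist (f x) (f y) < e" if "dist x y < min d 1" for x y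
  proof (cases "x \<in> cball 0 (R + 1) \<and> y \<in> cball 0 (R + 1)")
    case True
    then show ?thesis using d(2)[of y x] that by auto
  next
    case False
    have "norm x \<le> norm y + dist x y" "norm y \<le> norm x + dist x y"
      by (metis dist_norm norm_triangle_sub add.commute,
          metis dist_norm dist_commute norm_triangle_sub add.commute)
    with False that have "norm x > R" "norm y > R" by auto
    then have "f x = 0" "f y = 0" using R assms(3) by force+
    then show ?thesis using \<open>0 < e\<close> by simp
  qed
  then show ?thesis using that[of "min d 1"] d(1) by auto
qed

lemma frechet_derivative_eq_0_outside_closure:
  fixes f :: "'a::euclidean_space \<Rightarrow> 'b::real_normed_vector"
  assumes "\<And>x. x \<notin> S \<Longrightarrow> f x = 0" "x \<notin> closure S"
  shows "frechet_derivative f (at x) v = 0"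
proof -
  have "(f has_derivative (\<lambda>h. 0)) (at x)"
  proof (rule has_derivative_transform_within_open[OF has_derivative_const[of 0]])
    show "open (- closure S)" by (rule open_Compl[OF closed_closure])
  qed (use assms closure_subset[of S] in auto)
  then show ?thesis using frechet_derivative_at by metis
qed

lemma frechet_derivative_basis_expansion:
  fixes f :: "'a::euclidean_space \<Rightarrow> 'b::real_normed_vector"
  assumes "f differentiable (at x)"
  shows "frechet_derivative f (at x) v = (\<Sum>b\<in>Basis. (v \<bullet> b) *\<^sub>R frechet_derivative f (at x) b)"
proof -
  have "linear (frechet_derivative f (at x))"
    using assms linear_frechet_derivative by blast
  then have "frechet_derivative f (at x) (\<Sum>b\<in>Basis. (v \<bullet> b) *\<^sub>R b) =
      (\<Sum>b\<in>Basis. (v \<bullet> b) *\<^sub>R frechet_derivative f (at x) b)"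
    by (simp add: linear_sum linear_scale)
  then show ?thesis by (simp only: euclidean_representation)
qed

text \<open>
  Mean value theorem along the segment from \<open>z\<close> to \<open>z + h\<close>, together with the uniform continuity of
  the partial derivatives, which are continuous with bounded support.
\<close>
lemma smooth_uniformly_differentiable:
  fixes K :: "'a::euclidean_space \<Rightarrow> real"
  assumes K: "smooth K" and S: "bounded S" "\<And>x. x \<notin> S \<Longrightarrow> K x = 0" and "0 < e"
  obtains d where "0 < d"
    "\<And>z h. norm h < d \<Longrightarrow> \<bar>K (z + h) - K z - frechet_derivative K (at z) h\<bar> \<le> e * norm h"
proof -
  let ?D = "\<lambda>z v. frechet_derivative K (at z) v"
  define e' where "e' = e / DIM('a)"
  have e': "0 < e'" using \<open>0 < e\<close> by (simp add: e'_def)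
  have "\<exists>d>0. \<forall>x y. dist x y < d \<longrightarrow> dist (?D x b) (?D y b) < e'" for b
    by (rule bounded_support_uniformly_continuous[of "\<lambda>x. ?D x b" "closure S" e'])
       (use smooth_continuous[OF smooth_frechet_derivative[OF K]] S e'
          frechet_derivative_eq_0_outside_closure[of S K] in auto)
  then obtain d where d: "\<And>b. 0 < d b"
      "\<And>b x y. dist x y < d b \<Longrightarrow> dist (?D x b) (?D y b) < e'"
    by metis
  define \<delta> where "\<delta> = Min (d ` Basis)"
  have \<delta>: "0 < \<delta>" "\<And>b. b \<in> Basis \<Longrightarrow> \<delta> \<le> d b"
    using d(1) by (auto simp: \<delta>_def)
  have diff: "K differentiable (at x)" for x
    using smooth_has_derivative[OF K] differentiable_def by blast
  have "\<bar>K (z + h) - K z - ?D z h\<bar> \<le> e * norm h" if h: "norm h < \<delta>" for z h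
  proof -
    have "\<exists>t. 0 < t \<and> t < 1 \<and> K (z + 1 *\<^sub>R h) - K (z + 0 *\<^sub>R h) = (1 - 0) * ?D (z + t *\<^sub>R h) h"
    proof (rule MVT2)
      fix t :: real
      have "((\<lambda>t. z + t *\<^sub>R h) has_derivative (\<lambda>s. s *\<^sub>R h)) (at t)"
        by (auto intro!: derivative_eq_intros)
      from has_derivative_compose[OF this smooth_has_derivative[OF K]]
      have "((\<lambda>t. K (z + t *\<^sub>R h)) has_derivative (\<lambda>s. ?D (z + t *\<^sub>R h) (s *\<^sub>R h))) (at t)" .
      moreover have "?D (z + t *\<^sub>R h) (s *\<^sub>R h) = ?D (z + t *\<^sub>R h) h * s" for s
        using linear_scale[OF linear_frechet_derivative[OF diff]] by simp
      ultimately show "((\<lambda>t. K (z + t *\<^sub>R h)) has_real_derivative ?D (z + t *\<^sub>R h) h) (at t)"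
        by (simp add: has_field_derivative_def)
    qed simp
    then obtain t where t: "0 < t" "t < 1" "K (z + h) - K z = ?D (z + t *\<^sub>R h) h" by auto
    have close: "\<bar>?D (z + t *\<^sub>R h) b - ?D z b\<bar> \<le> e'" if "b \<in> Basis" for b
    proof -
      have "t * norm h \<le> norm h" using t by (simp add: mult_left_le_one_le)
      then have "dist (z + t *\<^sub>R h) z < d b"
        using t h \<delta>(2)[OF that] by (simp add: dist_norm)
      then show ?thesis using d(2)[of "z + t *\<^sub>R h" z b] by (simp add: dist_real_def)
    qed
    have "K (z + h) - K z - ?D z h = (\<Sum>b\<in>Basis. (h \<bullet> b) * (?D (z + t *\<^sub>R h) b - ?D z b))"
      unfolding t(3) frechet_derivative_basis_expansion[OF diff, of _ h]
      by (simp add: sum_subtractf algebra_simps)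
    also have "\<bar>\<dots>\<bar> \<le> (\<Sum>b\<in>(Basis::'a set). norm h * e')"
      by (rule order_trans[OF sum_abs sum_mono])
        (auto simp: abs_mult intro!: mult_mono close Basis_le_norm)
    also have "\<dots> = e * norm h" by (simp add: e'_def)
    finally show ?thesis .
  qed
  then show ?thesis using that \<delta>(1) by blast
qed

lemma integrable_mult_bounded:
  fixes f k :: "'a::euclidean_space \<Rightarrow> complex"
  assumes "integrable M f" "k \<in> borel_measurable M" "\<And>z. norm (k z) \<le> B"
  shows "integrable M (\<lambda>z. f z * k z)"
proof (rule Bochner_Integration.integrable_bound)
  show "integrable M (\<lambda>z. B * norm (f z))"
    using assms(1) by simp
  show "AE z in M. norm (f z * k z) \<le> norm (B * norm (f z))"
  proof (intro always_eventually allI)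
    fix z
    have "0 \<le> B" using assms(3)[of z] norm_ge_zero[of "k z"] by linarith
    then show "norm (f z * k z) \<le> norm (B * norm (f z))"
      using mult_right_mono[OF assms(3)[of z] norm_ge_zero[of "f z"]]
      by (simp add: norm_mult abs_mult mult.commute)
  qed
  show "(\<lambda>z. f z * k z) \<in> borel_measurable M"
    using assms(1,2) by measurable
qed

lemma integrable_conv:
  fixes f :: "'a::euclidean_space \<Rightarrow> complex"
  assumes f: "integrable lborel f" and K: "continuous_on UNIV K" "bounded S" "\<And>x. x \<notin> S \<Longrightarrow> K x = 0"
  shows "integrable lborel (\<lambda>z. f z * of_real (K (z - x)))"
proof -
  obtain M where M: "\<And>x. norm (K x) \<le> M"
    using bounded_support_bounded[OF K] by blast
  have [measurable]: "K \<in> borel_measurable borel"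
    using K(1) by (rule borel_measurable_continuous_onI)
  show ?thesis
    by (rule integrable_mult_bounded[OF f, of _ M]) (use M in \<open>auto simp: norm_of_real\<close>)
qed

text \<open>
  The remainder in the first order expansion of \<open>K\<close> is small uniformly in the base point, so it may be
  integrated against the merely integrable function \<open>f\<close>.
\<close>
lemma conv_has_derivative:
  fixes f :: "'a::euclidean_space \<Rightarrow> complex"
  assumes f: "integrable lborel f" and K: "smooth K" and S: "bounded S" "\<And>x. x \<notin> S \<Longrightarrow> K x = 0"
  shows "(conv f K has_derivative (\<lambda>v. conv f (\<lambda>z. - frechet_derivative K (at z) v) x)) (at x)"
proof -
  let ?D = "\<lambda>z v. frechet_derivative K (at z) v"
  have diff: "K differentiable (at x)" for x
    using smooth_has_derivative[OF K] differentiable_def by blast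
  have intK: "integrable lborel (\<lambda>z. f z * of_real (K (z - x)))" for x
    using integrable_conv[OF f smooth_continuous[OF K] S] .
  have intD: "integrable lborel (\<lambda>z. f z * of_real (- ?D (z - x) v))" for x v
    by (rule integrable_conv[OF f, of _ "closure S"])
       (use smooth_continuous[OF smooth_frechet_derivative[OF K]] S
          frechet_derivative_eq_0_outside_closure[of S K] in \<open>auto intro!: continuous_intros\<close>)
  have lin: "linear (\<lambda>v. conv f (\<lambda>z. - ?D z v) x)"
  proof (rule linearI)
    fix v w
    have "(LINT z|lborel. f z * of_real (- ?D (z - x) (v + w))) =
       (LINT z|lborel. f z * of_real (- ?D (z - x) v) + f z * of_real (- ?D (z - x) w))"
      by (rule Bochner_Integration.integral_cong)
         (auto simp: linear_add[OF linear_frechet_derivative[OF diff]] algebra_simps)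
    then show "conv f (\<lambda>z. - ?D z (v + w)) x = conv f (\<lambda>z. - ?D z v) x + conv f (\<lambda>z. - ?D z w) x"
      unfolding conv_def using intD by simp
  next
    fix c v
    have "(LINT z|lborel. f z * of_real (- ?D (z - x) (c *\<^sub>R v))) =
       (LINT z|lborel. c *\<^sub>R (f z * of_real (- ?D (z - x) v)))"
      by (rule Bochner_Integration.integral_cong)
         (auto simp: linear_scale[OF linear_frechet_derivative[OF diff]] scaleR_conv_of_real)
    then show "conv f (\<lambda>z. - ?D z (c *\<^sub>R v)) x = c *\<^sub>R conv f (\<lambda>z. - ?D z v) x"
      unfolding conv_def by simp
  qed
  define N where "N = (LINT z|lborel. norm (f z))"
  have N: "0 \<le> N" unfolding N_def by simp
  have "\<exists>d>0. \<forall>y. norm (y - x) < d \<longrightarrow>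
      norm (conv f K y - conv f K x - conv f (\<lambda>z. - ?D z (y - x)) x) \<le> e * norm (y - x)" if "0 < e" for e
  proof -
    have "0 < e / (N + 1)" using that N by simp
    then obtain d where d: "0 < d"
      "\<And>z h. norm h < d \<Longrightarrow> \<bar>K (z + h) - K z - ?D z h\<bar> \<le> e / (N + 1) * norm h"
      using smooth_uniformly_differentiable[OF K S] by metis
    have "norm (conv f K y - conv f K x - conv f (\<lambda>z. - ?D z (y - x)) x) \<le> e * norm (y - x)"
      if y: "norm (y - x) < d" for y
    proof -
      have eq: "conv f K y - conv f K x - conv f (\<lambda>z. - ?D z (y - x)) x =
          (LINT z|lborel. f z * of_real (K (z - y)) - f z * of_real (K (z - x))
             - f z * of_real (- ?D (z - x) (y - x)))"
        unfolding conv_def using intK intD by simp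
      also have "norm \<dots> \<le> (LINT z|lborel. norm (f z) * (e / (N + 1) * norm (y - x)))"
      proof (rule Bochner_Integration.integral_norm_bound_integral)
        show "integrable lborel (\<lambda>z. norm (f z) * (e / (N + 1) * norm (y - x)))"
          using f by simp
        show "integrable lborel (\<lambda>z. f z * of_real (K (z - y)) - f z * of_real (K (z - x))
             - f z * of_real (- ?D (z - x) (y - x)))"
          using intK intD by simp
        fix z
        have "?D (z - x) (x - y) = - ?D (z - x) (y - x)"
          using linear_neg[OF linear_frechet_derivative[OF diff], of "z - x" "y - x"] by simp
        then have "\<bar>K (z - y) - K (z - x) + ?D (z - x) (y - x)\<bar> \<le> e / (N + 1) * norm (y - x)"
          using d(2)[of "x - y" "z - x"] y by (simp add: norm_minus_commute)
        moreover have "f z * of_real (K (z - y)) - f z * of_real (K (z - x))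
             - f z * of_real (- ?D (z - x) (y - x)) =
             f z * of_real (K (z - y) - K (z - x) + ?D (z - x) (y - x))"
          by (simp add: algebra_simps)
        ultimately show "norm (f z * of_real (K (z - y)) - f z * of_real (K (z - x))
             - f z * of_real (- ?D (z - x) (y - x))) \<le> norm (f z) * (e / (N + 1) * norm (y - x))"
          by (simp only: norm_mult norm_of_real) (intro mult_left_mono norm_ge_zero)
      qed
      also have "\<dots> = N * (e / (N + 1) * norm (y - x))"
        unfolding N_def by simp
      also have "\<dots> = (N / (N + 1)) * (e * norm (y - x))" by simp
      also have "\<dots> \<le> 1 * (e * norm (y - x))"
        by (rule mult_right_mono) (use N \<open>0 < e\<close> in \<open>auto simp: divide_simps\<close>)
      finally show ?thesis by simp
    qed
    with d(1) show ?thesis by blast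
  qed
  with lin show ?thesis
    unfolding has_derivative_at_alt by (simp add: linear_conv_bounded_linear)
qed

lemma smooth_conv:
  fixes f :: "'a::euclidean_space \<Rightarrow> complex"
  assumes f: "integrable lborel f" and K: "smooth K" and S: "bounded S" "\<And>x. x \<notin> S \<Longrightarrow> K x = 0"
  shows "smooth (conv f K)"
proof -
  have "smooth K \<Longrightarrow> bounded S \<Longrightarrow> (\<forall>x. x \<notin> S \<longrightarrow> K x = 0) \<Longrightarrow> k_smooth k (conv f K)"
    for k and K :: "'a \<Rightarrow> real" and S
  proof (induction k arbitrary: K S)
    case 0
    then have "conv f K differentiable at x" for x
      using conv_has_derivative[OF f 0(1,2)] differentiable_def by blast
    then show ?case
      by (auto intro: continuous_at_imp_continuous_on differentiable_imp_continuous_within)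
  next
    case (Suc k)
    have "smooth (\<lambda>z. - frechet_derivative K (at z) v)" for v
      using smooth_linear_image[OF bounded_linear_minus[OF bounded_linear_ident]
          smooth_frechet_derivative[OF Suc.prems(1)]] .
    then show ?case
      using Suc.prems frechet_derivative_eq_0_outside_closure[of S K] conv_has_derivative[OF f Suc.prems(1,2)]
      by (intro k_smooth_SucI[where f' = "\<lambda>x v. conv f (\<lambda>z. - frechet_derivative K (at z) v) x"]
            Suc.IH[of _ "closure S"]) auto
  qed
  then show ?thesis using assms by (auto simp: smooth_def)
qed

lemma frechet_derivative_conv:
  fixes f :: "'a::euclidean_space \<Rightarrow> complex"
  assumes "integrable lborel f" "smooth K" "bounded S" "\<And>x. x \<notin> S \<Longrightarrow> K x = 0"
  shows "frechet_derivative (conv f K) (at x) v = conv f (\<lambda>z. - frechet_derivative K (at z) v) x"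
  using frechet_derivative_at[OF conv_has_derivative[OF assms, of x]] by metis

section \<open>Integration by parts\<close>

lemma integral_lborel_shift:
  fixes f :: "'a::euclidean_space \<Rightarrow> 'b::{banach, second_countable_topology}"
  assumes "f \<in> borel_measurable borel"
  shows "(LINT z|lborel. f (c + z)) = (LINT z|lborel. f z)"
proof -
  have "(LINT z|lborel. f z) = (LINT z|distr lborel borel ((+) c). f z)"
    by (simp add: lborel_distr_plus)
  also have "\<dots> = (LINT z|lborel. f (c + z))"
    using assms by (subst integral_distr) auto
  finally show ?thesis ..
qed

lemma nn_integral_lborel_shift:
  fixes f :: "'a::euclidean_space \<Rightarrow> ennreal"
  assumes "f \<in> borel_measurable borel"
  shows "(\<integral>\<^sup>+z. f (c + z) \<partial>lborel) = (\<integral>\<^sup>+z. f z \<partial>lborel)"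
proof -
  have "(\<integral>\<^sup>+z. f z \<partial>lborel) = (\<integral>\<^sup>+z. f z \<partial>distr lborel borel ((+) c))"
    by (simp add: lborel_distr_plus)
  also have "\<dots> = (\<integral>\<^sup>+z. f (c + z) \<partial>lborel)"
    using assms by (subst nn_integral_distr) auto
  finally show ?thesis ..
qed

text \<open>
  The convolution of \<open>K\<close> with the indicator of a large ball is constant near the origin, since
  translating \<open>K\<close> does not change its integral.  Its derivative at \<open>0\<close> is minus the integral of the
  derivative of \<open>K\<close>.
\<close>
lemma integral_derivative_eq_0_real:
  fixes K :: "'a::euclidean_space \<Rightarrow> real"
  assumes K: "smooth K" and S: "bounded S" "\<And>x. x \<notin> S \<Longrightarrow> K x = 0"
  shows "(LINT z|lborel. frechet_derivative K (at z) v) = 0"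
proof -
  obtain R where R: "\<And>x. x \<in> S \<Longrightarrow> norm x \<le> R" "0 < R"
    using S(1) bounded_pos by metis
  have R': "norm x \<le> R" if "x \<in> closure S" for x
    using that R(1) closure_minimal[of S "cball 0 R"] by (auto simp: subset_iff)
  define f :: "'a \<Rightarrow> complex" where "f z = of_real (indicat_real (ball 0 (R + 1)) z)" for z
  have f: "integrable lborel f"
    unfolding f_def by (intro integrable_of_real) (simp add: integrable_indicator_iff emeasure_bounded_finite[OF bounded_ball, simplified])
  have [measurable]: "K \<in> borel_measurable borel"
    using smooth_continuous[OF K] by (rule borel_measurable_continuous_onI)
  have const: "conv f K x = (LINT z|lborel. of_real (K z))" if "x \<in> ball 0 1" for x
  proof -
    have "f z * of_real (K (z - x)) = of_real (K (- x + z))" for z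
    proof (cases "z \<in> ball 0 (R + 1)")
      case False
      have "norm z \<le> norm (z - x) + norm x"
        by (metis norm_triangle_sub add.commute)
      with False that have "norm (z - x) > R" by auto
      then have "K (z - x) = 0" using S(2) R(1) by force
      then show ?thesis by simp
    qed (simp add: f_def)
    then have "conv f K x = (LINT z|lborel. of_real (K (- x + z)))"
      unfolding conv_def by (rule Bochner_Integration.integral_cong[OF refl])
    also have "\<dots> = (LINT z|lborel. of_real (K z))"
      by (rule integral_lborel_shift) measurable
    finally show ?thesis .
  qed
  have "(conv f K has_derivative (\<lambda>h. 0)) (at 0)"
  proof (rule has_derivative_transform_within_open[OF has_derivative_const open_ball])
    show "0 \<in> ball (0::'a) 1" by simp
    show "(LINT z|lborel. of_real (K z)) = conv f K x" if "x \<in> ball 0 1" for x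
      using const[OF that] by (rule sym)
  qed
  with conv_has_derivative[OF f K S, of 0]
  have "conv f (\<lambda>z. - frechet_derivative K (at z) v) 0 = 0"
    using has_derivative_unique by metis
  moreover have eq: "f z * of_real (- frechet_derivative K (at (z - 0)) v)
      = - of_real (frechet_derivative K (at z) v)" for z
  proof (cases "z \<in> ball 0 (R + 1)")
    case False
    then have "z \<notin> closure S" using R'[of z] by auto
    then have "frechet_derivative K (at z) v = 0"
      using frechet_derivative_eq_0_outside_closure[of S K] S(2) by blast
    then show ?thesis by simp
  qed (simp add: f_def)
  ultimately have "(LINT z|lborel. - complex_of_real (frechet_derivative K (at z) v)) = 0"
    unfolding conv_def Bochner_Integration.integral_cong[OF refl eq] by simp
  then have "complex_of_real (LINT z|lborel. frechet_derivative K (at z) v) = 0"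
    by (simp only: integral_minus integral_complex_of_real neg_equal_0_iff_equal)
  then show ?thesis by simp
qed

lemma integral_derivative_eq_0:
  fixes \<psi> :: "'a::euclidean_space \<Rightarrow> complex"
  assumes \<psi>: "smooth \<psi>" and S: "bounded S" "\<And>x. x \<notin> S \<Longrightarrow> \<psi> x = 0"
  shows "(LINT z|lborel. frechet_derivative \<psi> (at z) v) = 0"
proof -
  let ?D = "\<lambda>z. frechet_derivative \<psi> (at z) v"
  have int: "integrable lborel ?D"
    by (rule integrable_continuous_bounded_support[of _ "closure S"])
       (use smooth_continuous[OF smooth_frechet_derivative[OF \<psi>]] S
          frechet_derivative_eq_0_outside_closure[of S \<psi>] in auto)
  have part: "(LINT z|lborel. L (?D z)) = 0" if L: "bounded_linear L" for L :: "complex \<Rightarrow> real"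
  proof -
    have "((\<lambda>z. L (\<psi> z)) has_derivative (\<lambda>v. L (frechet_derivative \<psi> (at z) v))) (at z)" for z
      by (rule bounded_linear.has_derivative[OF L smooth_has_derivative[OF \<psi>]])
    then have "frechet_derivative (\<lambda>z. L (\<psi> z)) (at z) = (\<lambda>v. L (frechet_derivative \<psi> (at z) v))" for z
      using frechet_derivative_at by metis
    then have eq: "L (?D z) = frechet_derivative (\<lambda>z. L (\<psi> z)) (at z) v" for z by simp
    show ?thesis unfolding eq
      by (rule integral_derivative_eq_0_real[OF smooth_linear_image[OF L \<psi>] S(1)])
         (use S(2) L in \<open>auto simp: linear_0[OF bounded_linear.linear[OF L]]\<close>)
  qed
  show ?thesis
    using part[OF bounded_linear_Re] part[OF bounded_linear_Im] int
    by (intro complex_eqI) (simp_all flip: integral_Re integral_Im)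
qed

lemma frechet_derivative_mult:
  fixes F G :: "'a::real_normed_vector \<Rightarrow> complex"
  assumes "smooth F" "smooth G"
  shows "frechet_derivative (\<lambda>x. F x * G x) (at x) v =
    F x * frechet_derivative G (at x) v + frechet_derivative F (at x) v * G x"
  using frechet_derivative_at[OF has_derivative_mult[OF smooth_has_derivative[OF assms(1), of x]
        smooth_has_derivative[OF assms(2), of x]]] by metis

lemma integration_by_parts:
  fixes F \<phi> :: "'a::euclidean_space \<Rightarrow> complex"
  assumes F: "smooth F" and \<phi>: "smooth \<phi>" and S: "bounded S" "\<And>x. x \<notin> S \<Longrightarrow> \<phi> x = 0"
  shows "(LINT z|lborel. F z * frechet_derivative \<phi> (at z) v) =
    - (LINT z|lborel. frechet_derivative F (at z) v * \<phi> z)"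
proof -
  have cont: "continuous_on UNIV F" "continuous_on UNIV \<phi>"
      "continuous_on UNIV (\<lambda>z. frechet_derivative F (at z) v)"
      "continuous_on UNIV (\<lambda>z. frechet_derivative \<phi> (at z) v)"
    using F \<phi> by (simp_all add: smooth_continuous smooth_frechet_derivative)
  have 1: "integrable lborel (\<lambda>z. F z * frechet_derivative \<phi> (at z) v)"
    by (rule integrable_continuous_bounded_support[of _ "closure S"])
       (use cont S frechet_derivative_eq_0_outside_closure[of S \<phi>] in \<open>auto intro: continuous_intros\<close>)
  have 2: "integrable lborel (\<lambda>z. frechet_derivative F (at z) v * \<phi> z)"
    by (rule integrable_continuous_bounded_support[of _ S])
       (use cont S in \<open>auto intro: continuous_intros\<close>)
  have "(LINT z|lborel. F z * frechet_derivative \<phi> (at z) v + frechet_derivative F (at z) v * \<phi> z) = 0"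
    using integral_derivative_eq_0[OF smooth_mult[OF F \<phi>] S(1), of v] S(2)
    by (simp add: frechet_derivative_mult[OF F \<phi>])
  with 1 2 show ?thesis by (simp add: eq_neg_iff_add_eq_0)
qed


section \<open>Square integrals\<close>

text \<open>
  The square of the \<open>L\<^sup>2\<close> norm, as an extended nonnegative number: it can be estimated and compared
  before finiteness is known.
\<close>
definition sq_int :: "'a::euclidean_space set \<Rightarrow> ('a \<Rightarrow> complex) \<Rightarrow> ennreal" where
  "sq_int A f = (\<integral>\<^sup>+x\<in>A. ennreal ((norm (f x))\<^sup>2) \<partial>lborel)"

text \<open>
  The square integrable functions on \<open>S\<close>, represented by their extension by zero.
\<close>
definition L2_fun :: "'a::euclidean_space set \<Rightarrow> ('a \<Rightarrow> complex) \<Rightarrow> bool" where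
  "L2_fun S f \<longleftrightarrow> f \<in> borel_measurable borel \<and> (\<forall>x. x \<notin> S \<longrightarrow> f x = 0) \<and> sq_int UNIV f < \<infinity>"

lemma sq_int_mono_set: "A \<subseteq> B \<Longrightarrow> sq_int A f \<le> sq_int B f"
  unfolding sq_int_def by (intro nn_integral_mono mult_left_mono) (auto simp: indicator_def)

lemma sq_int_mono:
  "(\<And>x. x \<in> A \<Longrightarrow> norm (f x) \<le> norm (g x)) \<Longrightarrow> sq_int A f \<le> sq_int A g"
  unfolding sq_int_def by (intro nn_integral_mono) (auto simp: indicator_def intro!: ennreal_leI power_mono)

lemma sq_int_cong: "(\<And>x. x \<in> A \<Longrightarrow> norm (f x) = norm (g x)) \<Longrightarrow> sq_int A f = sq_int A g"
  by (intro antisym sq_int_mono) auto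

lemma sq_int_scale:
  assumes "f \<in> borel_measurable borel" "A \<in> sets borel"
  shows "sq_int A (\<lambda>x. c * f x) = ennreal ((norm c)\<^sup>2) * sq_int A f"
  unfolding sq_int_def using assms
  by (subst nn_integral_cmult[symmetric])
     (auto simp: norm_mult power_mult_distrib ennreal_mult mult.assoc)

lemma sum_sq_le: "(x + y)\<^sup>2 \<le> 2 * x\<^sup>2 + 2 * (y::real)\<^sup>2"
  using zero_le_power2[of "x - y"] by (simp add: power2_eq_square algebra_simps)

lemma sq_int_add_le:
  assumes [measurable]: "f \<in> borel_measurable borel" "g \<in> borel_measurable borel" "A \<in> sets borel"
  shows "sq_int A (\<lambda>x. f x + g x) \<le> 2 * sq_int A f + 2 * sq_int A g"
proof -
  have "ennreal ((norm (f x + g x))\<^sup>2) \<le> 2 * ennreal ((norm (f x))\<^sup>2) + 2 * ennreal ((norm (g x))\<^sup>2)" for x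
  proof -
    have "(norm (f x + g x))\<^sup>2 \<le> (norm (f x) + norm (g x))\<^sup>2"
      by (intro power_mono norm_triangle_ineq) simp
    also have "\<dots> \<le> 2 * (norm (f x))\<^sup>2 + 2 * (norm (g x))\<^sup>2" by (rule sum_sq_le)
    finally have "ennreal ((norm (f x + g x))\<^sup>2) \<le> ennreal (2 * (norm (f x))\<^sup>2 + 2 * (norm (g x))\<^sup>2)"
      by (rule ennreal_leI)
    then show ?thesis by (simp add: ennreal_mult)
  qed
  then have "sq_int A (\<lambda>x. f x + g x) \<le> (\<integral>\<^sup>+x. 2 * (ennreal ((norm (f x))\<^sup>2) * indicator A x)
      + 2 * (ennreal ((norm (g x))\<^sup>2) * indicator A x) \<partial>lborel)"
    unfolding sq_int_def by (intro nn_integral_mono) (auto simp: indicator_def)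
  also have "\<dots> = 2 * sq_int A f + 2 * sq_int A g"
    unfolding sq_int_def by (simp add: nn_integral_add nn_integral_cmult)
  finally show ?thesis .
qed

lemma sq_int_triangle:
  assumes "f \<in> borel_measurable borel" "g \<in> borel_measurable borel" "h \<in> borel_measurable borel" "A \<in> sets borel"
  shows "sq_int A (\<lambda>x. f x - h x) \<le> 2 * sq_int A (\<lambda>x. f x - g x) + 2 * sq_int A (\<lambda>x. g x - h x)"
  using sq_int_add_le[of "\<lambda>x. f x - g x" "\<lambda>x. g x - h x" A] assms by simp

lemma sq_int_minus_commute: "sq_int A (\<lambda>x. f x - g x) = sq_int A (\<lambda>x. g x - f x)"
  by (rule sq_int_cong) (rule norm_minus_commute)

lemma L2_fun_subset: "L2_fun S f \<Longrightarrow> S \<subseteq> T \<Longrightarrow> L2_fun T f"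
  by (auto simp: L2_fun_def)

lemma nn_integral_norm_le:
  assumes "L2_fun S f" "S \<subseteq> B" "B \<in> sets borel"
  shows "(\<integral>\<^sup>+x. norm (f x) \<partial>lborel) \<le> emeasure lborel B + sq_int UNIV f"
proof -
  have [measurable]: "f \<in> borel_measurable borel" "B \<in> sets borel" using assms by (auto simp: L2_fun_def)
  have "ennreal (norm (f x)) \<le> indicator B x + ennreal ((norm (f x))\<^sup>2)" for x
  proof (cases "x \<in> B")
    case True
    have "norm (f x) \<le> 1 + (norm (f x))\<^sup>2"
      using zero_le_power2[of "norm (f x) - 1"] by (simp add: power2_eq_square algebra_simps)
         (use norm_ge_zero[of "f x"] in linarith)
    then have "ennreal (norm (f x)) \<le> ennreal (1 + (norm (f x))\<^sup>2)" by (rule ennreal_leI)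
    then show ?thesis using True by simp
  next
    case False
    then show ?thesis using assms by (auto simp: L2_fun_def)
  qed
  then have "(\<integral>\<^sup>+x. norm (f x) \<partial>lborel) \<le> (\<integral>\<^sup>+x. indicator B x + ennreal ((norm (f x))\<^sup>2) \<partial>lborel)"
    by (intro nn_integral_mono)
  also have "\<dots> = emeasure lborel B + sq_int UNIV f"
    by (simp add: nn_integral_add sq_int_def)
  finally show ?thesis .
qed

lemma L2_fun_integrable:
  assumes "L2_fun S f" "bounded S"
  shows "integrable lborel f"
proof -
  obtain R where R: "S \<subseteq> cball 0 R" using bounded_subset_ballD[OF assms(2), of 0] ball_subset_cball by blast
  have "(\<integral>\<^sup>+x. norm (f x) \<partial>lborel) \<le> emeasure lborel (cball (0::'a) R) + sq_int UNIV f"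
    by (rule nn_integral_norm_le[OF assms(1) R]) simp
  also have "\<dots> < \<infinity>"
    using assms(1) emeasure_bounded_finite[of "cball (0::'a) R"] by (simp add: L2_fun_def)
  finally show ?thesis
    using assms(1) by (auto simp: L2_fun_def integrable_iff_bounded)
qed

lemma tendsto_sq_int_0:
  assumes [measurable]: "\<And>n. f n \<in> borel_measurable borel" "w \<in> borel_measurable borel"
    and "AE x in lborel. (\<lambda>n. f n x) \<longlonglongrightarrow> 0"
    and "\<And>n x. norm (f n x) \<le> norm (w x)" "sq_int UNIV w < \<infinity>"
  shows "(\<lambda>n. sq_int UNIV (f n)) \<longlonglongrightarrow> 0"
proof -
  have "(\<lambda>n. \<integral>\<^sup>+x. ennreal ((norm (f n x))\<^sup>2) \<partial>lborel) \<longlonglongrightarrow> (\<integral>\<^sup>+x. 0 \<partial>(lborel :: 'a measure))"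
  proof (rule nn_integral_dominated_convergence[where w="\<lambda>x. ennreal ((norm (w x))\<^sup>2)"])
    show "AE x in lborel. (\<lambda>n. ennreal ((norm (f n x))\<^sup>2)) \<longlonglongrightarrow> 0"
      using assms(3)
    proof eventually_elim
      case (elim x)
      then have "(\<lambda>n. (norm (f n x))\<^sup>2) \<longlonglongrightarrow> (norm (0::complex))\<^sup>2" by (intro tendsto_intros)
      then show ?case using tendsto_ennrealI by fastforce
    qed
    show "AE x in lborel. ennreal ((norm (f n x))\<^sup>2) \<le> ennreal ((norm (w x))\<^sup>2)" for n
      using assms(4) by (auto intro!: ennreal_leI power_mono)
  qed (use assms(5) in \<open>auto simp: sq_int_def\<close>)
  then show ?thesis by (simp add: sq_int_def)
qed

lemma eventually_less_ennreal:
  assumes "(F :: nat \<Rightarrow> ennreal) \<longlonglongrightarrow> 0" "0 < e"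
  obtains n where "F n < e"
  using order_tendstoD(2)[OF assms] by (auto simp: eventually_sequentially)

text \<open>
  The radial retraction onto the disc of radius \<open>M\<close>.
\<close>
definition clip :: "real \<Rightarrow> complex \<Rightarrow> complex" where
  "clip M z = of_real (M / max M (norm z)) * z"

lemma clip_bounds:
  assumes "0 < M"
  shows "norm (clip M z) \<le> M" "norm (clip M z) \<le> norm z" "norm z \<le> M \<Longrightarrow> clip M z = z"
proof -
  have n: "norm (clip M z) = M * norm z / max M (norm z)"
    using assms by (simp add: clip_def norm_mult norm_divide)
  show "norm (clip M z) \<le> M" "norm (clip M z) \<le> norm z"
    using assms unfolding n by (auto simp: divide_simps max_def)
  show "norm z \<le> M \<Longrightarrow> clip M z = z" using assms by (simp add: clip_def)
qed

lemma continuous_on_clip: "0 < M \<Longrightarrow> continuous_on UNIV (clip M)"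
  unfolding clip_def[abs_def] by (intro continuous_intros) (auto simp: max_def)

text \<open>
  A measurable function is the limit almost everywhere of continuous functions.  Clipping their values
  and multiplying by a continuous cutoff makes the convergence dominated when \<open>f\<close> is bounded; the
  reduction to bounded \<open>f\<close> is again a clipping.
\<close>
lemma L2_approx_continuous:
  fixes f :: "'a::euclidean_space \<Rightarrow> complex"
  assumes f: "L2_fun (cball 0 R) f" and e: "0 < e"
  shows "\<exists>g. continuous_on UNIV g \<and> (\<forall>x. x \<notin> cball 0 (R + 1) \<longrightarrow> g x = 0) \<and>
    sq_int UNIV (\<lambda>x. f x - g x) < e"
proof -
  have [measurable]: "f \<in> borel_measurable borel" using f by (simp add: L2_fun_def)
  have [measurable]: "clip M \<in> borel_measurable borel" if "0 < M" for M
    using continuous_on_clip[OF that] by (rule borel_measurable_continuous_onI)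
  obtain e' :: ennreal where e': "0 < e'" "2 * e' + 2 * e' < e"
  proof (cases "e = \<infinity>")
    case True then show ?thesis using that[of 1] by (simp add: ennreal_mult_less_top)
  next
    case False
    then obtain r where r: "e = ennreal r" "0 < r" using e by (cases e) auto
    show ?thesis
      by (rule that[of "ennreal (r / 8)"])
         (use r in \<open>auto simp: ennreal_mult[symmetric] ennreal_less_iff simp flip: ennreal_plus ennreal_numeral\<close>)
  qed
  have "(\<lambda>n. sq_int UNIV (\<lambda>x. f x - clip (real (Suc n)) (f x))) \<longlonglongrightarrow> 0"
  proof (rule tendsto_sq_int_0[where w="\<lambda>x. 2 * f x"])
    show "AE x in lborel. (\<lambda>n. f x - clip (real (Suc n)) (f x)) \<longlonglongrightarrow> 0"
    proof (intro always_eventually allI)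
      fix x
      obtain N where N: "norm (f x) \<le> real N" using real_arch_simple by blast
      have "\<forall>\<^sub>F n in sequentially. f x - clip (real (Suc n)) (f x) = 0"
        using eventually_ge_at_top[of N]
        by eventually_elim (use N in \<open>simp add: clip_bounds(3)\<close>)
      then show "(\<lambda>n. f x - clip (real (Suc n)) (f x)) \<longlonglongrightarrow> 0"
        by (rule tendsto_eventually)
    qed
    show "norm (f x - clip (real (Suc n)) (f x)) \<le> norm (2 * f x)" for n x
      using norm_triangle_ineq4[of "f x" "clip (real (Suc n)) (f x)"] clip_bounds(2)[of "real (Suc n)" "f x"]
      by (simp add: norm_mult)
    show "sq_int UNIV (\<lambda>x. 2 * f x) < \<infinity>"
      using f by (subst sq_int_scale) (auto simp: L2_fun_def ennreal_mult_less_top)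
  qed auto
  then obtain n where n: "sq_int UNIV (\<lambda>x. f x - clip (real (Suc n)) (f x)) < e'"
    using eventually_less_ennreal[OF _ e'(1)] by blast
  define M where "M = real (Suc n)"
  have M: "0 < M" by (simp add: M_def)
  have "f \<in> borel_measurable lebesgue" by (rule measurable_completion) simp
  then have "f measurable_on UNIV"
    by (intro lebesgue_measurable_imp_measurable_on) auto
  then obtain N g where N: "negligible N" and g: "\<And>n. continuous_on UNIV (g n)"
      "\<And>x. x \<notin> N \<Longrightarrow> (\<lambda>n. g n x) \<longlonglongrightarrow> f x"
    unfolding measurable_on_def by auto
  define \<theta> :: "'a \<Rightarrow> real" where "\<theta> x = max 0 (min 1 (R + 1 - norm x))" for x
  define h where "h k x = of_real (\<theta> x) * clip M (g k x)" for k x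
  have \<theta>: "0 \<le> \<theta> x" "\<theta> x \<le> 1" "norm x \<le> R \<Longrightarrow> \<theta> x = 1" "norm x \<ge> R + 1 \<Longrightarrow> \<theta> x = 0" for x
    by (auto simp: \<theta>_def)
  have h_cont: "continuous_on UNIV (h k)" for k
    unfolding h_def \<theta>_def
    by (intro continuous_intros continuous_on_compose2[OF continuous_on_clip[OF M]] g) auto
  have [measurable]: "h k \<in> borel_measurable borel" for k
    using h_cont by (rule borel_measurable_continuous_onI)
  have "(\<lambda>k. sq_int UNIV (\<lambda>x. clip M (f x) - h k x)) \<longlonglongrightarrow> 0"
  proof (rule tendsto_sq_int_0[where w="\<lambda>x. of_real (2 * M * indicator (cball 0 (R + 1)) x)"])
    have "N \<in> null_sets lebesgue" using N negligible_iff_null_sets by blast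
    then have "AE x in lebesgue. x \<notin> N" using AE_not_in by blast
    then have "AE x in lebesgue. (\<lambda>k. clip M (f x) - h k x) \<longlonglongrightarrow> 0"
    proof eventually_elim
      case (elim x)
      have "isCont (clip M) (f x)"
        using continuous_on_clip[OF M] by (simp add: continuous_on_eq_continuous_at)
      then have "(\<lambda>k. clip M (f x) - h k x) \<longlonglongrightarrow> clip M (f x) - of_real (\<theta> x) * clip M (f x)"
        unfolding h_def by (intro tendsto_intros isCont_tendsto_compose[of _ "clip M"] g elim)
      moreover have "clip M (f x) - of_real (\<theta> x) * clip M (f x) = 0"
      proof (cases "norm x \<le> R")
        case False
        then have "f x = 0" using f by (auto simp: L2_fun_def)
        then show ?thesis by (simp add: clip_def)
      qed (simp add: \<theta>)
      ultimately show ?case by simp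
    qed
    then show "AE x in lborel. (\<lambda>k. clip M (f x) - h k x) \<longlonglongrightarrow> 0"
      by (subst (asm) AE_completion_iff)
    show "(\<lambda>x. complex_of_real (2 * M * indicator (cball 0 (R + 1)) x)) \<in> borel_measurable (borel :: 'a measure)"
    proof -
      have [measurable]: "Measurable.pred borel (\<lambda>x::'a. x \<in> cball 0 (R + 1))"
        by (simp add: pred_def)
      show ?thesis by measurable
    qed
    show "norm (clip M (f x) - h k x) \<le> norm (complex_of_real (2 * M * indicator (cball 0 (R + 1)) x))" for k x
    proof (cases "x \<in> cball 0 (R + 1)")
      case True
      have "norm (h k x) \<le> 1 * M"
        unfolding h_def norm_mult by (rule mult_mono) (use \<theta>[of x] clip_bounds(1)[OF M] in auto)
      then show ?thesis
        using True norm_triangle_ineq4[of "clip M (f x)" "h k x"] clip_bounds(1)[OF M, of "f x"] M by auto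
    next
      case False
      then have "f x = 0" "\<theta> x = 0" using f \<theta>(4) by (auto simp: L2_fun_def)
      then show ?thesis using False by (simp add: h_def clip_def)
    qed
    have "sq_int UNIV (\<lambda>x::'a. of_real (2 * M * indicator (cball 0 (R + 1)) x)) =
       (\<integral>\<^sup>+x. ennreal ((2 * M)\<^sup>2) * indicator (cball 0 (R + 1)) (x::'a) \<partial>lborel)"
      unfolding sq_int_def using M by (intro nn_integral_cong) (auto simp: indicator_def norm_mult power_mult_distrib)
    also have "\<dots> = ennreal ((2 * M)\<^sup>2) * emeasure lborel (cball (0::'a) (R + 1))"
      by (rule nn_integral_cmult_indicator) simp
    also have "\<dots> < \<infinity>"
      using emeasure_bounded_finite[of "cball (0::'a) (R + 1)"] by (simp add: ennreal_mult_less_top)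
    finally show "sq_int UNIV (\<lambda>x::'a. of_real (2 * M * indicator (cball 0 (R + 1)) x)) < \<infinity>" .
  qed (use M in measurable)
  then obtain k where k: "sq_int UNIV (\<lambda>x. clip M (f x) - h k x) < e'"
    using eventually_less_ennreal[OF _ e'(1)] by blast
  have "sq_int UNIV (\<lambda>x. f x - h k x) \<le> 2 * sq_int UNIV (\<lambda>x. f x - clip M (f x))
      + 2 * sq_int UNIV (\<lambda>x. clip M (f x) - h k x)"
    by (rule sq_int_triangle) (use M in measurable)
  also have "\<dots> \<le> 2 * e' + 2 * e'"
    using n k unfolding M_def[symmetric]
    by (intro add_mono mult_left_mono) auto
  also have "\<dots> < e" by (rule e')
  finally have "sq_int UNIV (\<lambda>x. f x - h k x) < e" .
  moreover have "h k x = 0" if "x \<notin> cball 0 (R + 1)" for x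
    using that \<theta>(4)[of x] by (simp add: h_def)
  ultimately show ?thesis using h_cont by blast
qed

text \<open>
  Substituting \<open>\<sigma>\<close> enlarges integrals at most by the factor \<open>C\<close>.  This covers both uses below:
  translations, with \<open>C = 1\<close>, and linear contractions that are not too strong.
\<close>
definition distortion :: "real \<Rightarrow> ('a::euclidean_space \<Rightarrow> 'a) \<Rightarrow> bool" where
  "distortion C \<sigma> \<longleftrightarrow> \<sigma> \<in> borel_measurable borel \<and>
    (\<forall>F\<in>borel_measurable borel. (\<integral>\<^sup>+x. F (\<sigma> x) \<partial>lborel) \<le> ennreal C * (\<integral>\<^sup>+x. F x \<partial>lborel))"

lemma distortion_shift: "distortion 1 (\<lambda>x. x + c)"
  unfolding distortion_def
  using nn_integral_lborel_shift[of _ c] by (auto simp: add.commute)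

lemma distortion_add:
  assumes "distortion C \<sigma>"
  shows "distortion C (\<lambda>x. \<sigma> x + c)"
  unfolding distortion_def
proof (intro conjI ballI)
  have [measurable]: "\<sigma> \<in> borel_measurable borel"
    using assms by (simp add: distortion_def)
  show "(\<lambda>x. \<sigma> x + c) \<in> borel_measurable borel" by measurable
  fix F :: "'a \<Rightarrow> ennreal" assume F: "F \<in> borel_measurable borel"
  then have "(\<lambda>x. F (x + c)) \<in> borel_measurable borel" by measurable
  then have "(\<integral>\<^sup>+x. F (\<sigma> x + c) \<partial>lborel) \<le> ennreal C * (\<integral>\<^sup>+x. F (x + c) \<partial>lborel)"
    using assms unfolding distortion_def by fast
  then show "(\<integral>\<^sup>+x. F (\<sigma> x + c) \<partial>lborel) \<le> ennreal C * (\<integral>\<^sup>+x. F x \<partial>lborel)"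
    using nn_integral_lborel_shift[OF F, of c] by (simp add: add.commute)
qed

lemma sq_int_distortion:
  assumes "distortion C \<sigma>" "f \<in> borel_measurable borel"
  shows "sq_int A (\<lambda>x. f (\<sigma> x)) \<le> ennreal C * sq_int UNIV f"
proof -
  have "sq_int A (\<lambda>x. f (\<sigma> x)) \<le> sq_int UNIV (\<lambda>x. f (\<sigma> x))"
    by (rule sq_int_mono_set) simp
  also have "\<dots> \<le> ennreal C * sq_int UNIV f"
    using assms by (auto simp: sq_int_def distortion_def)
  finally show ?thesis .
qed

lemma ennreal_split_pos:
  assumes "0 < (e::ennreal)" "0 \<le> C"
  obtains e' where "0 < e'" "ennreal C * e' \<le> e" "e' < \<infinity>"
proof (cases "e = \<infinity>")
  case True then show ?thesis using that[of 1] by simp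
next
  case False
  then obtain r where r: "e = ennreal r" "0 < r" using assms by (cases e) auto
  have "C * (r / (C + 1)) \<le> r" using r assms(2) by (simp add: field_simps)
  then show ?thesis
    using that[of "ennreal (r / (C + 1))"] r assms(2)
    by (auto simp: ennreal_mult[symmetric] ennreal_le_iff intro!: ennreal_leI)
qed

text \<open>
  Continuity of \<open>\<sigma> \<mapsto> f \<circ> \<sigma>\<close> in \<open>L\<^sup>2\<close> at the identity, uniformly over all \<open>\<sigma>\<close> with a common distortion
  bound: \<open>f\<close> is replaced by a uniformly continuous function, and the distortion bound controls the
  error after composition.
\<close>
lemma L2_perturbation:
  fixes f :: "'a::euclidean_space \<Rightarrow> complex"
  assumes f: "L2_fun S f" and S: "bounded S" and A: "A \<in> sets borel" "bounded A"
    and e: "0 < e" and C: "0 \<le> C"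
  shows "\<exists>d>0. \<forall>\<sigma>. distortion C \<sigma> \<and> (\<forall>x\<in>A. dist (\<sigma> x) x < d) \<longrightarrow>
     sq_int A (\<lambda>x. f (\<sigma> x) - f x) \<le> e"
proof -
  obtain R where R: "S \<subseteq> cball 0 R" using bounded_subset_ballD[OF S, of 0] ball_subset_cball by blast
  have f': "L2_fun (cball 0 R) f" using L2_fun_subset[OF f R] .
  have vol: "emeasure lborel A < \<infinity>" using A(2) emeasure_bounded_finite by blast
  define V where "V = measure lborel A"
  have V: "emeasure lborel A = ennreal V" "0 \<le> V"
    using vol by (auto simp: V_def emeasure_eq_ennreal_measure)
  obtain e' where e': "0 < e'" "ennreal (2 * C + 4 + 4) * e' \<le> e" "e' < \<infinity>"
    using ennreal_split_pos[OF e, of "2 * C + 4 + 4"] C by auto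
  obtain g where g: "continuous_on UNIV g" "\<And>x. x \<notin> cball 0 (R + 1) \<Longrightarrow> g x = 0"
      "sq_int UNIV (\<lambda>x. f x - g x) < e'"
    using L2_approx_continuous[OF f' e'(1)] by blast
  obtain e2' where e2': "0 < e2'" "ennreal V * e2' \<le> e'" "e2' < \<infinity>"
    using ennreal_split_pos[OF e'(1) V(2)] by blast
  then obtain e2 where e2: "e2' = ennreal e2" "0 < e2" by (cases e2') auto
  obtain d where d: "0 < d" "\<And>x y. dist x y < d \<Longrightarrow> dist (g x) (g y) < sqrt e2"
    by (rule bounded_support_uniformly_continuous[of g "cball 0 (R + 1)" "sqrt e2"])
       (use e2 g in auto)
  have [measurable]: "f \<in> borel_measurable borel" "g \<in> borel_measurable borel" "A \<in> sets borel"
    using f g(1) A by (auto simp: L2_fun_def intro: borel_measurable_continuous_onI)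
  have "sq_int A (\<lambda>x. f (\<sigma> x) - f x) \<le> e"
    if \<sigma>: "distortion C \<sigma>" and close: "\<And>x. x \<in> A \<Longrightarrow> dist (\<sigma> x) x < d" for \<sigma>
  proof -
    have [measurable]: "\<sigma> \<in> borel_measurable borel" using \<sigma> by (simp add: distortion_def)
    have "sq_int A (\<lambda>x. g (\<sigma> x) - g x) \<le> sq_int A (\<lambda>x. of_real (sqrt e2))"
      using d(2)[OF close] e2 by (intro sq_int_mono) (auto simp: dist_norm less_imp_le)
    also have "\<dots> = (\<integral>\<^sup>+x\<in>A. ennreal e2 \<partial>lborel)"
      using e2 by (simp add: sq_int_def)
    also have "\<dots> = ennreal e2 * emeasure lborel A"
      by (rule nn_integral_cmult_indicator) simp
    also have "\<dots> \<le> e'" using e2' e2 V by (simp add: mult.commute)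
    finally have 1: "sq_int A (\<lambda>x. g (\<sigma> x) - g x) \<le> e'" .
    have 2: "sq_int A (\<lambda>x. g x - f x) \<le> e'"
      using sq_int_mono_set[of A UNIV "\<lambda>x. f x - g x"] g(3)
      by (auto simp: sq_int_minus_commute[of A g])
    have "sq_int A (\<lambda>x. f (\<sigma> x) - g (\<sigma> x)) \<le> ennreal C * sq_int UNIV (\<lambda>x. f x - g x)"
      using sq_int_distortion[OF \<sigma>, of "\<lambda>x. f x - g x"] by simp
    also have "\<dots> \<le> ennreal C * e'" using g(3) by (intro mult_left_mono) auto
    finally have 3: "sq_int A (\<lambda>x. f (\<sigma> x) - g (\<sigma> x)) \<le> ennreal C * e'" .
    have "sq_int A (\<lambda>x. f (\<sigma> x) - f x) \<le>
        2 * sq_int A (\<lambda>x. f (\<sigma> x) - g (\<sigma> x)) + 2 * sq_int A (\<lambda>x. g (\<sigma> x) - f x)"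
      by (rule sq_int_triangle) measurable
    also have "sq_int A (\<lambda>x. g (\<sigma> x) - f x) \<le>
        2 * sq_int A (\<lambda>x. g (\<sigma> x) - g x) + 2 * sq_int A (\<lambda>x. g x - f x)"
      by (rule sq_int_triangle) measurable
    also have "2 * sq_int A (\<lambda>x. f (\<sigma> x) - g (\<sigma> x)) + 2 * (2 * sq_int A (\<lambda>x. g (\<sigma> x) - g x)
        + 2 * sq_int A (\<lambda>x. g x - f x)) \<le> 2 * (ennreal C * e') + 2 * (2 * e' + 2 * e')"
      using 1 2 3 by (intro add_mono mult_left_mono) auto
    also have "\<dots> = ennreal (2 * C + 4 + 4) * e'"
    proof -
      obtain r where "e' = ennreal r" "0 \<le> r" using e'(3) by (cases e') auto
      then show ?thesis using C
        by (simp add: ennreal_mult[symmetric] ennreal_plus[symmetric] ennreal_numeral[symmetric] algebra_simps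
            del: ennreal_plus ennreal_numeral)
    qed
    also have "\<dots> \<le> e" by (rule e')
    finally show ?thesis by (simp add: add_left_mono mult_left_mono)
  qed
  then show ?thesis using d(1) by blast
qed

section \<open>Averaging against a mollifier\<close>

lemma mollifier_nn_integral:
  assumes "mollifier K S"
  shows "(\<integral>\<^sup>+y. ennreal (K y) \<partial>lborel) = 1"
  using assms nn_integral_eq_integral[of lborel K] by (simp add: mollifier_def)

lemma mollifier_measurable [measurable_dest]: "mollifier K S \<Longrightarrow> K \<in> borel_measurable borel"
  by (auto simp: mollifier_def)

text \<open>
  Jensen's inequality for the square, obtained from the Cauchy-Schwarz inequality with the two factors
  \<open>k sqrt K\<close> and \<open>sqrt K\<close>.
\<close>
lemma norm_average_le:
  assumes K: "mollifier K S" and [measurable]: "k \<in> borel_measurable borel"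
  shows "ennreal ((norm (LINT y|lborel. k y * of_real (K y) :: complex))\<^sup>2) \<le>
    (\<integral>\<^sup>+y. ennreal ((norm (k y))\<^sup>2) * ennreal (K y) \<partial>lborel)"
proof (cases "integrable lborel (\<lambda>y. k y * of_real (K y) :: complex)")
  case False
  then show ?thesis by (simp add: not_integrable_integral_eq)
next
  case True
  note [measurable] = mollifier_measurable[OF K]
  have nn: "0 \<le> K y" for y using K by (simp add: mollifier_def)
  have "ennreal ((norm (LINT y|lborel. k y * of_real (K y)))\<^sup>2) =
      (ennreal (norm (LINT y|lborel. k y * of_real (K y))))\<^sup>2"
    by (simp add: ennreal_power)
  also have "\<dots> \<le> (\<integral>\<^sup>+y. ennreal (norm (k y * of_real (K y))) \<partial>lborel)\<^sup>2"
    by (intro power_mono integral_norm_bound_ennreal True) simp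
  also have "(\<integral>\<^sup>+y. ennreal (norm (k y * of_real (K y))) \<partial>lborel) =
      (\<integral>\<^sup>+y. ennreal (norm (k y) * sqrt (K y)) * ennreal (sqrt (K y)) \<partial>lborel)"
    using nn by (intro nn_integral_cong) (simp add: norm_mult ennreal_mult[symmetric] mult.assoc)
  also have "\<dots>\<^sup>2 \<le> (\<integral>\<^sup>+y. (ennreal (norm (k y) * sqrt (K y)))\<^sup>2 \<partial>lborel) *
      (\<integral>\<^sup>+y. (ennreal (sqrt (K y)))\<^sup>2 \<partial>lborel)"
    by (rule Cauchy_Schwarz_nn_integral) measurable
  also have "(\<integral>\<^sup>+y. (ennreal (sqrt (K y)))\<^sup>2 \<partial>lborel) = (\<integral>\<^sup>+y. ennreal (K y) \<partial>lborel)"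
    using nn by (intro nn_integral_cong) (simp add: ennreal_power)
  also have "\<dots> = 1" by (rule mollifier_nn_integral[OF K])
  also have "(\<integral>\<^sup>+y. (ennreal (norm (k y) * sqrt (K y)))\<^sup>2 \<partial>lborel) =
      (\<integral>\<^sup>+y. ennreal ((norm (k y))\<^sup>2) * ennreal (K y) \<partial>lborel)"
    using nn by (intro nn_integral_cong)
      (simp add: ennreal_power power_mult_distrib ennreal_mult[symmetric])
  finally show ?thesis by simp
qed

text \<open>
  An average of functions of \<open>x\<close> is not larger in \<open>L\<^sup>2\<close> than the largest of them.  All the estimates
  for convolutions follow from estimates for single translates by this principle.
\<close>
lemma sq_int_average_le:
  fixes k :: "'a::euclidean_space \<Rightarrow> 'a \<Rightarrow> complex"
  assumes K: "mollifier K S" and k [measurable]: "(\<lambda>(x, y). k x y) \<in> borel_measurable (borel \<Otimes>\<^sub>M borel)"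
    and A [measurable]: "A \<in> sets borel" and c: "\<And>y. y \<in> S \<Longrightarrow> sq_int A (\<lambda>x. k x y) \<le> c"
  shows "sq_int A (\<lambda>x. LINT y|lborel. k x y * of_real (K y)) \<le> c"
proof -
  note [measurable] = mollifier_measurable[OF K]
  let ?G = "\<lambda>x y. ennreal ((norm (k x y))\<^sup>2) * ennreal (K y) * indicator A x"
  have G [measurable]: "case_prod ?G \<in> borel_measurable (lborel \<Otimes>\<^sub>M lborel)"
  proof -
    have "case_prod ?G \<in> borel_measurable (borel \<Otimes>\<^sub>M borel)" by measurable
    then show ?thesis by (simp cong: measurable_cong_sets sets_pair_measure_cong)
  qed
  have "sq_int A (\<lambda>x. LINT y|lborel. k x y * of_real (K y)) \<le> (\<integral>\<^sup>+x. \<integral>\<^sup>+y. ?G x y \<partial>lborel \<partial>lborel)"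
    unfolding sq_int_def
  proof (rule nn_integral_mono)
    fix x
    show "ennreal ((norm (LINT y|lborel. k x y * of_real (K y)))\<^sup>2) * indicator A x \<le> (\<integral>\<^sup>+y. ?G x y \<partial>lborel)"
    proof (cases "x \<in> A")
      case True
      have "k x \<in> borel_measurable borel" by measurable
      from norm_average_le[OF K this] True show ?thesis by simp
    qed simp
  qed
  also have "\<dots> = (\<integral>\<^sup>+y. \<integral>\<^sup>+x. ?G x y \<partial>lborel \<partial>lborel)"
    by (rule lborel_pair.Fubini'[OF G, symmetric])
  also have "\<dots> \<le> (\<integral>\<^sup>+y. c * ennreal (K y) \<partial>lborel)"
  proof (rule nn_integral_mono)
    fix y
    have "(\<lambda>x. k x y) \<in> borel_measurable borel" by measurable
    then have "(\<integral>\<^sup>+x. ?G x y \<partial>lborel) = ennreal (K y) * sq_int A (\<lambda>x. k x y)"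
      unfolding sq_int_def by (subst nn_integral_cmult[symmetric]) (auto simp: mult_ac)
    also have "\<dots> \<le> c * ennreal (K y)"
    proof (cases "y \<in> S")
      case True
      then show ?thesis using mult_right_mono[OF c[OF True], of "ennreal (K y)"] by (simp add: mult.commute)
    next
      case False
      then show ?thesis using K by (simp add: mollifier_def)
    qed
    finally show "(\<integral>\<^sup>+x. ?G x y \<partial>lborel) \<le> c * ennreal (K y)" .
  qed
  also have "\<dots> = c"
    using mollifier_nn_integral[OF K] by (simp add: nn_integral_cmult)
  finally show ?thesis .
qed

lemma conv_eq_average:
  assumes [measurable]: "f \<in> borel_measurable borel" "K \<in> borel_measurable borel"
  shows "conv f K x = (LINT y|lborel. f (x + y) * of_real (K y))"
proof -
  have "(LINT z|lborel. f z * of_real (K (z - x))) =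
     (LINT y|lborel. f (x + y) * of_real (K (x + y - x)))"
    by (rule integral_lborel_shift[symmetric]) measurable
  then show ?thesis by (simp add: conv_def)
qed

lemma mollifier_integrable_conv:
  fixes f :: "'a::euclidean_space \<Rightarrow> complex"
  assumes f: "integrable lborel f" and K: "mollifier K S" "bounded S"
  shows "integrable lborel (\<lambda>y. f (x + y) * of_real (K y))"
proof -
  have f': "integrable lborel (\<lambda>y. f (x + y))"
    using f nn_integral_lborel_shift[of "\<lambda>z. ennreal (norm (f z))" x]
    unfolding integrable_iff_bounded by auto
  show ?thesis
    using integrable_conv[OF f', of K S 0] K smooth_continuous[of K] by (auto simp: mollifier_def)
qed

lemma conv_measurable [measurable]:
  fixes f :: "'a::euclidean_space \<Rightarrow> complex"
  assumes "integrable lborel f" and K: "mollifier K S" "bounded S"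
  shows "conv f K \<in> borel_measurable borel"
  using smooth_continuous[OF smooth_conv[OF assms(1), of K S]] K
  by (intro borel_measurable_continuous_onI) (auto simp: mollifier_def)

lemma conv_L2_difference:
  fixes f :: "'a::euclidean_space \<Rightarrow> complex" and \<sigma> :: "'a \<Rightarrow> 'a"
  assumes f: "integrable lborel f" and K: "mollifier K T" "bounded T"
    and h [measurable]: "h \<in> borel_measurable borel"
    and \<sigma> [measurable]: "\<sigma> \<in> borel_measurable borel"
    and A: "A \<in> sets borel" and c: "\<And>y. y \<in> T \<Longrightarrow> sq_int A (\<lambda>x. f (\<sigma> x + y) - h x) \<le> c"
  shows "sq_int A (\<lambda>x. conv f K (\<sigma> x) - h x) \<le> c"
proof -
  have [measurable]: "f \<in> borel_measurable borel" using f by auto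
  have "conv f K (\<sigma> x) - h x = (LINT y|lborel. (f (\<sigma> x + y) - h x) * of_real (K y))" for x
  proof -
    have "(LINT y|lborel. (f (\<sigma> x + y) - h x) * of_real (K y)) =
        (LINT y|lborel. f (\<sigma> x + y) * of_real (K y) - h x * of_real (K y))"
      by (simp add: algebra_simps)
    also have "\<dots> = conv f K (\<sigma> x) - (LINT y|lborel. h x * of_real (K y))"
      using mollifier_integrable_conv[OF f K, of "\<sigma> x"] K conv_eq_average[of f K "\<sigma> x"]
      by (subst Bochner_Integration.integral_diff) (auto simp: mollifier_def)
    also have "(LINT y|lborel. h x * of_real (K y)) = h x"
      using K by (simp add: mollifier_def)
    finally show ?thesis ..
  qed
  then show ?thesis
    using sq_int_average_le[OF K(1), of "\<lambda>x y. f (\<sigma> x + y) - h x" A c] A c by simp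
qed

lemma conv_L2_bound:
  fixes f :: "'a::euclidean_space \<Rightarrow> complex"
  assumes f: "integrable lborel f" and K: "mollifier K T" "bounded T"
    and \<sigma>: "distortion C \<sigma>" and A: "A \<in> sets borel"
  shows "sq_int A (\<lambda>x. conv f K (\<sigma> x)) \<le> ennreal C * sq_int UNIV f"
proof -
  have [measurable]: "\<sigma> \<in> borel_measurable borel" "f \<in> borel_measurable borel"
    using \<sigma> f by (auto simp: distortion_def)
  have "sq_int A (\<lambda>x. conv f K (\<sigma> x) - 0) \<le> ennreal C * sq_int UNIV f"
    by (rule conv_L2_difference[OF f K _ _ A]) (use sq_int_distortion[OF distortion_add[OF \<sigma>]] in auto)
  then show ?thesis by simp
qed

lemma conv_L2_approximation:
  fixes f :: "'a::euclidean_space \<Rightarrow> complex"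
  assumes f: "L2_fun S f" and S: "bounded S" and A: "A \<in> sets borel" "bounded A"
    and e: "0 < e" and C: "0 \<le> C"
  shows "\<exists>d>0. \<forall>\<sigma> K. distortion C \<sigma> \<and> (\<forall>x\<in>A. dist (\<sigma> x) x < d) \<and> mollifier K (ball 0 d) \<longrightarrow>
     sq_int A (\<lambda>x. conv f K (\<sigma> x) - f x) \<le> e"
proof -
  obtain d where d: "0 < d" "\<And>\<sigma>. distortion C \<sigma> \<Longrightarrow> (\<And>x. x \<in> A \<Longrightarrow> dist (\<sigma> x) x < d) \<Longrightarrow>
     sq_int A (\<lambda>x. f (\<sigma> x) - f x) \<le> e"
    using L2_perturbation[OF f S A e C] by metis
  have int: "integrable lborel f" by (rule L2_fun_integrable[OF f S])
  have "sq_int A (\<lambda>x. conv f K (\<sigma> x) - f x) \<le> e"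
    if \<sigma>: "distortion C \<sigma>" and close: "\<And>x. x \<in> A \<Longrightarrow> dist (\<sigma> x) x < d / 2"
      and K: "mollifier K (ball 0 (d / 2))" for \<sigma> K
  proof (rule conv_L2_difference[OF int K bounded_ball _ _ A(1)])
    show "f \<in> borel_measurable borel" "\<sigma> \<in> borel_measurable borel"
      using f \<sigma> by (auto simp: L2_fun_def distortion_def)
    fix y assume y: "y \<in> ball (0::'a) (d / 2)"
    show "sq_int A (\<lambda>x. f (\<sigma> x + y) - f x) \<le> e"
    proof (rule d(2)[OF distortion_add[OF \<sigma>]])
      fix x assume "x \<in> A"
      have "dist (\<sigma> x + y) x \<le> dist (\<sigma> x + y) (\<sigma> x) + dist (\<sigma> x) x" by (rule dist_triangle)
      also have "\<dots> < d" using close[OF \<open>x \<in> A\<close>] y by (simp add: dist_norm)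
      finally show "dist (\<sigma> x + y) x < d" .
    qed
  qed
  then show ?thesis using d(1) by (intro exI[of _ "d / 2"]) auto
qed


section \<open>Weak derivatives of Borel representatives\<close>

lemma mollifier_subset: "mollifier K S \<Longrightarrow> S \<subseteq> T \<Longrightarrow> mollifier K T"
  by (auto simp: mollifier_def)

lemma test_functionsI:
  fixes \<phi> :: "'a::euclidean_space \<Rightarrow> complex"
  assumes "smooth \<phi>" "compact C" "C \<subseteq> U" "\<And>x. x \<notin> C \<Longrightarrow> \<phi> x = 0"
  shows "\<phi> \<in> test_functions U"
proof -
  have sub: "closure {x. \<phi> x \<noteq> 0} \<subseteq> C"
    using assms(2,4) by (intro closure_minimal compact_imp_closed) auto
  moreover from sub have "closure {x. \<phi> x \<noteq> 0} = C \<inter> closure {x. \<phi> x \<noteq> 0}" by blast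
  then have "compact (closure {x. \<phi> x \<noteq> 0})"
    using compact_Int_closed[OF assms(2), of "closure {x. \<phi> x \<noteq> 0}"] by simp
  ultimately show ?thesis
    using assms by (auto simp: test_functions_def)
qed

lemma test_functions_support:
  assumes "\<phi> \<in> test_functions U"
  shows "smooth \<phi>" "bounded {x. \<phi> x \<noteq> 0}"
    "x \<notin> U \<Longrightarrow> \<phi> x = 0" "x \<notin> U \<Longrightarrow> frechet_derivative \<phi> (at x) d = 0"
proof -
  have c: "compact (closure {x. \<phi> x \<noteq> 0})" "closure {x. \<phi> x \<noteq> 0} \<subseteq> U" and s: "smooth \<phi>"
    using assms by (auto simp: test_functions_def)
  show "smooth \<phi>" by (rule s)
  show "bounded {x. \<phi> x \<noteq> 0}"
    by (rule bounded_subset[OF compact_imp_bounded[OF c(1)] closure_subset])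
  show "\<phi> x = 0" if "x \<notin> U" using that c(2) closure_subset[of "{x. \<phi> x \<noteq> 0}"] by auto
  show "frechet_derivative \<phi> (at x) d = 0" if "x \<notin> U"
    using that c(2) frechet_derivative_eq_0_outside_closure[of "{x. \<phi> x \<noteq> 0}" \<phi> x d] by blast
qed

lemma test_functions_bounded:
  assumes "\<phi> \<in> test_functions U"
  obtains M where "\<And>x. norm (\<phi> x) \<le> M" "\<And>x. norm (frechet_derivative \<phi> (at x) d) \<le> M"
proof -
  note t = test_functions_support[OF assms]
  obtain M1 where M1: "\<And>x. norm (\<phi> x) \<le> M1"
    using bounded_support_bounded[OF smooth_continuous[OF t(1)] t(2)] by auto
  have "bounded (closure {x. \<phi> x \<noteq> 0})" by (rule bounded_closure[OF t(2)])
  moreover have "frechet_derivative \<phi> (at x) d = 0" if "x \<notin> closure {x. \<phi> x \<noteq> 0}" for x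
    by (rule frechet_derivative_eq_0_outside_closure[OF _ that]) simp
  ultimately obtain M2 where M2: "\<And>x. norm (frechet_derivative \<phi> (at x) d) \<le> M2"
    using bounded_support_bounded[OF smooth_continuous[OF smooth_frechet_derivative[OF t(1)]]] by metis
  show ?thesis
    by (rule that[of "max M1 M2"]) (use M1 M2 in \<open>auto simp: le_max_iff_disj\<close>)
qed

text \<open>
  The integral identity behind weak derivatives, for an arbitrary direction and for functions defined
  everywhere and integrated over the whole space.
\<close>
definition weak_deriv ::
  "'a::euclidean_space set \<Rightarrow> 'a \<Rightarrow> ('a \<Rightarrow> complex) \<Rightarrow> ('a \<Rightarrow> complex) \<Rightarrow> bool" where
  "weak_deriv U d u g \<longleftrightarrow> (\<forall>\<phi>\<in>test_functions U.
     (LINT x|lborel. u x * frechet_derivative \<phi> (at x) d) = - (LINT x|lborel. g x * \<phi> x))"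

text \<open>
  Differentiating the kernel \<open>K(z - x)\<close> in \<open>x\<close> or in \<open>z\<close> differs by a sign, and as a function of \<open>z\<close> the
  kernel is a test function as soon as \<open>x + C\<close> lies in \<open>U\<close>.  Only this local condition at \<open>x\<close> matters,
  although \<open>u\<close> is extended by zero and has no weak derivative across the boundary of \<open>U\<close>.
\<close>
lemma frechet_derivative_conv_weak_deriv:
  fixes u :: "'a::euclidean_space \<Rightarrow> complex"
  assumes u: "integrable lborel u" and K: "mollifier K C" "compact C"
    and sub: "\<And>y. y \<in> C \<Longrightarrow> x + y \<in> U" and w: "weak_deriv U d u g"
  shows "frechet_derivative (conv u K) (at x) d = conv g K x"
proof -
  have sK: "smooth K" and K0: "\<And>x. x \<notin> C \<Longrightarrow> K x = 0" using K by (auto simp: mollifier_def)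
  define \<phi> where "\<phi> z = complex_of_real (K (z - x))" for z
  have \<phi>: "\<phi> \<in> test_functions U"
  proof (rule test_functionsI)
    show "smooth \<phi>" unfolding \<phi>_def by (intro smooth_of_real smooth_translate sK)
    show "compact ((+) x ` C)" by (rule compact_translation[OF K(2)])
    show "(+) x ` C \<subseteq> U" using sub by auto
    show "\<phi> z = 0" if "z \<notin> (+) x ` C" for z
    proof -
      have "z - x \<notin> C" using that by (metis add.commute diff_add_cancel image_eqI)
      then show ?thesis by (simp add: \<phi>_def K0)
    qed
  qed
  have D: "frechet_derivative \<phi> (at z) d = of_real (frechet_derivative K (at (z - x)) d)" for z
  proof -
    have "((\<lambda>z. z - x) has_derivative (\<lambda>h. h)) (at z)"
      by (auto intro!: derivative_eq_intros)
    from has_derivative_compose[OF this smooth_has_derivative[OF sK]]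
    have "((\<lambda>z. K (z - x)) has_derivative frechet_derivative K (at (z - x))) (at z)" .
    from bounded_linear.has_derivative[OF bounded_linear_of_real this]
    have "(\<phi> has_derivative (\<lambda>h. of_real (frechet_derivative K (at (z - x)) h))) (at z)"
      unfolding \<phi>_def .
    from frechet_derivative_at[OF this] show ?thesis by metis
  qed
  have "frechet_derivative (conv u K) (at x) d = conv u (\<lambda>z. - frechet_derivative K (at z) d) x"
    by (rule frechet_derivative_conv[OF u sK compact_imp_bounded[OF K(2)] K0])
  also have "\<dots> = - (LINT z|lborel. u z * frechet_derivative \<phi> (at z) d)"
    unfolding conv_def D by simp
  also have "\<dots> = (LINT z|lborel. g z * \<phi> z)"
    using w \<phi> by (simp add: weak_deriv_def)
  finally show ?thesis by (simp add: conv_def \<phi>_def)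
qed

lemma test_function_integrable:
  assumes "integrable lborel u" "\<phi> \<in> test_functions U"
  shows "integrable lborel (\<lambda>x. u x * \<phi> x)" "integrable lborel (\<lambda>x. u x * frechet_derivative \<phi> (at x) d)"
proof -
  obtain M where M: "\<And>x. norm (\<phi> x) \<le> M" "\<And>x. norm (frechet_derivative \<phi> (at x) d) \<le> M"
    using test_functions_bounded[OF assms(2)] by blast
  note s = test_functions_support(1)[OF assms(2)]
  have "\<phi> \<in> borel_measurable lborel" "(\<lambda>x. frechet_derivative \<phi> (at x) d) \<in> borel_measurable lborel"
    using s smooth_frechet_derivative[OF s] by (auto intro!: borel_measurable_continuous_onI smooth_continuous)
  then show "integrable lborel (\<lambda>x. u x * \<phi> x)" "integrable lborel (\<lambda>x. u x * frechet_derivative \<phi> (at x) d)"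
    using integrable_mult_bounded[OF assms(1)] M by blast+
qed

lemma weak_deriv_diff:
  assumes "weak_deriv U d u g" "weak_deriv U d v h"
    "integrable lborel u" "integrable lborel v" "integrable lborel g" "integrable lborel h"
  shows "weak_deriv U d (\<lambda>x. u x - v x) (\<lambda>x. g x - h x)"
  unfolding weak_deriv_def
proof
  fix \<phi> assume \<phi>: "\<phi> \<in> test_functions U"
  note i = test_function_integrable[OF _ \<phi>]
  show "(LINT x|lborel. (u x - v x) * frechet_derivative \<phi> (at x) d) = - (LINT x|lborel. (g x - h x) * \<phi> x)"
    using assms \<phi> i unfolding weak_deriv_def left_diff_distrib by simp
qed

lemma weak_deriv_scale:
  assumes "weak_deriv U d u g"
  shows "weak_deriv U d (\<lambda>x. c * u x) (\<lambda>x. c * g x)"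
  using assms unfolding weak_deriv_def by (simp add: mult.assoc)

lemma weak_deriv_direction:
  fixes v :: "'a::euclidean_space"
  assumes u: "integrable lborel u" and g: "\<And>b. b \<in> Basis \<Longrightarrow> integrable lborel (g b)"
    and w: "\<And>b. b \<in> Basis \<Longrightarrow> weak_deriv U b u (g b)"
  shows "weak_deriv U v u (\<lambda>x. \<Sum>b\<in>Basis. of_real (v \<bullet> b) * g b x)"
  unfolding weak_deriv_def
proof
  fix \<phi> assume \<phi>: "\<phi> \<in> test_functions U"
  have "\<phi> differentiable (at x)" for x
    using smooth_has_derivative[OF test_functions_support(1)[OF \<phi>]] differentiable_def by blast
  note D = frechet_derivative_basis_expansion[OF this, of _ v]
  have "(LINT x|lborel. u x * frechet_derivative \<phi> (at x) v) =
     (LINT x|lborel. (\<Sum>b\<in>Basis. of_real (v \<bullet> b) * (u x * frechet_derivative \<phi> (at x) b)))"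
    unfolding D by (simp add: sum_distrib_left scaleR_conv_of_real mult_ac)
  also have "\<dots> = (\<Sum>b\<in>Basis. of_real (v \<bullet> b) * (LINT x|lborel. u x * frechet_derivative \<phi> (at x) b))"
    using test_function_integrable[OF u \<phi>] by (subst Bochner_Integration.integral_sum) auto
  also have "\<dots> = (\<Sum>b\<in>Basis. - of_real (v \<bullet> b) * (LINT x|lborel. g b x * \<phi> x))"
    using w \<phi> by (intro sum.cong) (auto simp: weak_deriv_def)
  also have "\<dots> = - (LINT x|lborel. (\<Sum>b\<in>Basis. of_real (v \<bullet> b) * (g b x * \<phi> x)))"
    using test_function_integrable[OF g \<phi>]
    by (subst Bochner_Integration.integral_sum) (auto simp: sum_negf)
  finally show "(LINT x|lborel. u x * frechet_derivative \<phi> (at x) v) =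
     - (LINT x|lborel. (\<Sum>b\<in>Basis. of_real (v \<bullet> b) * g b x) * \<phi> x)"
    by (simp add: sum_distrib_right mult.assoc)
qed

lemma weak_deriv_smooth:
  fixes F :: "'a::euclidean_space \<Rightarrow> complex"
  assumes F: "smooth F"
  shows "weak_deriv U d (\<lambda>x. indicator U x * F x) (\<lambda>x. indicator U x * frechet_derivative F (at x) d)"
  unfolding weak_deriv_def
proof
  fix \<phi> :: "'a \<Rightarrow> complex" assume \<phi>: "\<phi> \<in> test_functions U"
  note t = test_functions_support[OF \<phi>]
  have 1: "indicator U x * F x * frechet_derivative \<phi> (at x) d = F x * frechet_derivative \<phi> (at x) d" for x
    using t(4)[of x d] by (cases "x \<in> U") auto
  have 2: "indicator U x * frechet_derivative F (at x) d * \<phi> x = frechet_derivative F (at x) d * \<phi> x" for x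
    using t(3)[of x] by (cases "x \<in> U") auto
  show "(LINT x|lborel. indicator U x * F x * frechet_derivative \<phi> (at x) d) =
       - (LINT x|lborel. indicator U x * frechet_derivative F (at x) d * \<phi> x)"
    unfolding 1 2 by (rule integration_by_parts[OF F t(1,2)]) simp
qed

section \<open>The fundamental lemma of the calculus of variations\<close>

lemma lebesgue_borel_representative:
  fixes f :: "'a::euclidean_space \<Rightarrow> complex"
  assumes [measurable]: "f \<in> borel_measurable lebesgue"
  obtains f' where "f' \<in> borel_measurable borel" "AE x in lborel. f x = f' x"
proof -
  obtain a where a: "a \<in> borel_measurable lborel" "AE x in lborel. Re (f x) = a x"
    using completion_ex_borel_measurable_real[of "\<lambda>x. Re (f x)" lborel] by auto
  obtain b where b: "b \<in> borel_measurable lborel" "AE x in lborel. Im (f x) = b x"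
    using completion_ex_borel_measurable_real[of "\<lambda>x. Im (f x)" lborel] by auto
  show ?thesis
  proof (rule that[of "\<lambda>x. of_real (a x) + \<i> * of_real (b x)"])
    show "(\<lambda>x. of_real (a x) + \<i> * of_real (b x)) \<in> borel_measurable borel"
      using a(1) b(1) by measurable
    show "AE x in lborel. f x = of_real (a x) + \<i> * of_real (b x)"
      using a(2) b(2) by eventually_elim (auto simp: complex_eq_iff)
  qed
qed

lemma norm_conv_le:
  fixes f :: "'a::euclidean_space \<Rightarrow> complex"
  assumes K: "mollifier K S" and B: "\<And>x. norm (f x) \<le> B" and f: "f \<in> borel_measurable borel"
  shows "norm (conv f K x) \<le> B"
proof -
  have nn: "0 \<le> K y" for y using K by (simp add: mollifier_def)
  have "norm (LINT y|lborel. f (x + y) * of_real (K y)) \<le> (LINT y|lborel. B * K y)"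
  proof (cases "integrable lborel (\<lambda>y. f (x + y) * of_real (K y))")
    case True
    show ?thesis
      by (rule Bochner_Integration.integral_norm_bound_integral[OF True])
         (use K nn B in \<open>auto simp: mollifier_def norm_mult intro!: mult_right_mono\<close>)
  next
    case False
    have "0 \<le> B" using B[of x] norm_ge_zero order_trans by blast
    with False show ?thesis using nn by (simp add: not_integrable_integral_eq)
  qed
  also have "\<dots> = B" using K by (simp add: mollifier_def)
  finally show ?thesis
    using conv_eq_average[OF f mollifier_measurable[OF K]] by simp
qed

lemma conv_eq_0:
  assumes "mollifier K T" "\<And>y. y \<in> T \<Longrightarrow> f (x + y) = 0" "f \<in> borel_measurable borel"
  shows "conv f K x = 0"
proof -
  have z: "f (x + y) * complex_of_real (K y) = 0" for y
    using assms(1,2) by (cases "y \<in> T") (auto simp: mollifier_def)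
  show ?thesis
    by (simp only: conv_eq_average[OF assms(3) mollifier_measurable[OF assms(1)]] z Bochner_Integration.integral_zero)
qed

text \<open>
  The function \<open>s = clip 1 (cnj h)\<close> on \<open>C\<close>, extended by zero, makes \<open>h s\<close> nonnegative, with zeros on
  \<open>C\<close> only where \<open>h\<close> vanishes.  Mollifying \<open>s\<close> gives test functions that are bounded by \<open>1\<close>, supported
  in a fixed compact neighbourhood \<open>D\<close> of \<open>C\<close>, and convergent to \<open>s\<close> almost everywhere along a
  subsequence; dominated convergence yields \<open>\<integral> h s = 0\<close>.
\<close>
lemma orthogonal_to_test_functions_imp_0_on_compact:
  fixes h :: "'a::euclidean_space \<Rightarrow> complex"
  assumes "open U" and h: "\<And>K. compact K \<Longrightarrow> K \<subseteq> U \<Longrightarrow> set_integrable lebesgue K h"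
    and orth: "\<And>\<phi>. \<phi> \<in> test_functions U \<Longrightarrow> (LINT x|lebesgue_on U. h x * \<phi> x) = 0"
    and C: "compact C" "C \<subseteq> U"
  shows "AE x in lebesgue. x \<in> C \<longrightarrow> h x = 0"
proof -
  obtain \<epsilon> where \<epsilon>: "\<epsilon> > 0" "(\<Union>x\<in>C. cball x \<epsilon>) \<subseteq> U"
    using compact_subset_open_imp_cball_epsilon_subset[OF C(1) \<open>open U\<close> C(2)] by blast
  define D where "D = {x + y |x y. x \<in> C \<and> y \<in> cball 0 \<epsilon>}"
  have D: "compact D" "D \<subseteq> U" "C \<subseteq> D"
  proof -
    show "compact D" unfolding D_def by (rule compact_sums[OF C(1) compact_cball])
    show "D \<subseteq> U" using \<epsilon>(2) by (force simp: D_def dist_norm)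
    show "C \<subseteq> D" using \<epsilon>(1) by (force simp: D_def)
  qed
  have Dm [measurable]: "D \<in> sets borel" "C \<in> sets borel"
    using D(1) C(1) by (simp_all add: borel_compact)
  define k where "k x = indicator D x *\<^sub>R h x" for x
  have k: "integrable lebesgue k"
    using h[OF D(1,2)] by (simp add: set_integrable_def k_def[abs_def])
  then have [measurable]: "k \<in> borel_measurable lebesgue" by auto
  have clipm [measurable]: "clip 1 \<in> borel_measurable borel"
    using continuous_on_clip[of 1] by (intro borel_measurable_continuous_onI) simp
  have "(\<lambda>x. clip 1 (cnj (k x))) \<in> borel_measurable lebesgue"
    by (intro measurable_compose[OF _ clipm] measurable_compose[OF _ borel_measurable_continuous_onI[of cnj]])
       (auto intro: continuous_intros)
  then obtain s1 where s1 [measurable]: "s1 \<in> borel_measurable borel"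
    and s1_eq: "AE x in lborel. clip 1 (cnj (k x)) = s1 x"
    using lebesgue_borel_representative by blast
  define s where "s x = indicator C x * clip 1 (s1 x)" for x
  have [measurable]: "s \<in> borel_measurable borel" unfolding s_def by measurable
  have s_le: "norm (s x) \<le> 1" for x
    using clip_bounds(1)[of 1 "s1 x"] by (simp add: s_def norm_mult indicator_def)
  have s_out: "x \<notin> C \<Longrightarrow> s x = 0" for x by (simp add: s_def)
  have L2s: "L2_fun C s"
  proof -
    have "sq_int UNIV s \<le> (\<integral>\<^sup>+x. indicator C x \<partial>lborel)"
      unfolding sq_int_def
    proof (intro nn_integral_mono)
      fix x
      have "(norm (s x))\<^sup>2 \<le> 1" using s_le[of x] by (simp add: abs_square_le_1)
      then show "ennreal ((norm (s x))\<^sup>2) * indicator UNIV x \<le> indicator C x"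
        using s_out[of x] by (cases "x \<in> C") auto
    qed
    also have "\<dots> < \<infinity>" using emeasure_bounded_finite[OF compact_imp_bounded[OF C(1)]] by simp
    finally show ?thesis using s_out by (auto simp: L2_fun_def)
  qed
  have int_s: "integrable lborel s" by (rule L2_fun_integrable[OF L2s compact_imp_bounded[OF C(1)]])
  have "\<exists>K. mollifier K (ball (0::'a) \<epsilon>) \<and> sq_int D (\<lambda>x. conv s K x - s x) \<le> ennreal (1 / (Suc n))" for n
  proof -
    have "0 < ennreal (1 / (Suc n))" by simp
    from conv_L2_approximation[OF L2s compact_imp_bounded[OF C(1)] Dm(1) compact_imp_bounded[OF D(1)] this, of 1]
    obtain d where d: "d > 0" "\<And>\<sigma> K. distortion 1 \<sigma> \<Longrightarrow> (\<And>x. x \<in> D \<Longrightarrow> dist (\<sigma> x) x < d) \<Longrightarrow>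
        mollifier K (ball 0 d) \<Longrightarrow> sq_int D (\<lambda>x. conv s K (\<sigma> x) - s x) \<le> ennreal (1 / (Suc n))"
      by auto
    obtain K where K: "mollifier K (ball (0::'a) (min d \<epsilon>))"
      using mollifier_exists[of "min d \<epsilon>"] d(1) \<epsilon>(1) by auto
    have "mollifier K (ball 0 d)" "mollifier K (ball 0 \<epsilon>)"
      by (auto intro: mollifier_subset[OF K])
    then show ?thesis using d(2)[of "\<lambda>x. x + 0" K] distortion_shift[of 0] d(1) by auto
  qed
  then obtain K where K: "\<And>n. mollifier (K n) (ball (0::'a) \<epsilon>)"
      "\<And>n. sq_int D (\<lambda>x. conv s (K n) x - s x) \<le> ennreal (1 / (Suc n))" by metis
  define \<phi> where "\<phi> n = conv s (K n)" for n
  have \<phi>_out: "\<phi> n x = 0" if "x \<notin> D" for n x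
    unfolding \<phi>_def
  proof (rule conv_eq_0[OF K(1)])
    fix y :: 'a assume y: "y \<in> ball 0 \<epsilon>"
    have "x + y \<notin> C"
    proof
      assume "x + y \<in> C"
      then have "(x + y) + (- y) \<in> D" unfolding D_def mem_Collect_eq using y
        by (intro exI[of _ "x + y"] exI[of _ "- y"]) simp
      with that show False by simp
    qed
    then show "s (x + y) = 0" by (rule s_out)
  qed simp
  have \<phi>_le: "norm (\<phi> n x) \<le> 1" for n x
    unfolding \<phi>_def by (rule norm_conv_le[OF K(1) s_le]) simp
  have sm: "smooth (\<phi> n)" for n
    unfolding \<phi>_def by (rule smooth_conv[OF int_s _ bounded_ball[of 0 \<epsilon>]]) (use K(1)[of n] in \<open>auto simp: mollifier_def\<close>)
  then have [measurable]: "\<phi> n \<in> borel_measurable borel" for n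
    using smooth_continuous borel_measurable_continuous_onI by blast
  have test: "\<phi> n \<in> test_functions U" for n
    by (rule test_functionsI[OF sm D(1,2) \<phi>_out])
  have zero: "(LINT x|lebesgue. k x * \<phi> n x) = 0" for n
  proof -
    have "U \<in> sets lebesgue" using \<open>open U\<close> by simp
    then have "(LINT x|lebesgue_on U. h x * \<phi> n x) = (LINT x|lebesgue. indicator U x *\<^sub>R (h x * \<phi> n x))"
      by (intro integral_restrict_space) simp
    also have "\<dots> = (LINT x|lebesgue. k x * \<phi> n x)"
    proof (rule Bochner_Integration.integral_cong[OF refl])
      fix x
      show "indicator U x *\<^sub>R (h x * \<phi> n x) = k x * \<phi> n x"
        using \<phi>_out[of x n] D(2) by (cases "x \<in> D") (auto simp: k_def)
    qed
    finally show ?thesis using orth[OF test] by simp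
  qed
  define q where "q n x = indicat_real D x * (norm (\<phi> n x - s x))\<^sup>2" for n x
  have q_nn: "0 \<le> q n x" for n x by (simp add: q_def)
  have [measurable]: "q n \<in> borel_measurable borel" for n unfolding q_def by measurable
  have q_int: "(\<integral>\<^sup>+x. ennreal (q n x) \<partial>lborel) \<le> ennreal (1 / (Suc n))" for n
  proof -
    have "(\<integral>\<^sup>+x. ennreal (q n x) \<partial>lborel) = sq_int D (\<lambda>x. conv s (K n) x - s x)"
      unfolding sq_int_def by (intro nn_integral_cong) (auto simp: q_def \<phi>_def indicator_def)
    then show ?thesis using K(2) by simp
  qed
  have q_integrable: "integrable lborel (q n)" for n
    using q_int[of n] q_nn by (auto simp: integrable_iff_bounded intro: order_le_less_trans)
  have "(\<lambda>n. LINT x|lborel. norm (q n x)) \<longlonglongrightarrow> 0"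
  proof (rule tendsto_sandwich[OF _ _ tendsto_const LIMSEQ_inverse_real_of_nat])
    show "\<forall>\<^sub>F n in sequentially. (LINT x|lborel. norm (q n x)) \<le> inverse (real (Suc n))"
    proof (intro always_eventually allI)
      fix n
      have "(LINT x|lborel. norm (q n x)) = enn2real (\<integral>\<^sup>+x. ennreal (q n x) \<partial>lborel)"
        using q_nn by (subst integral_eq_nn_integral) auto
      also have "\<dots> \<le> 1 / Suc n"
        using q_int[of n] by (intro enn2real_leI) auto
      finally show "(LINT x|lborel. norm (q n x)) \<le> inverse (real (Suc n))" by (simp add: inverse_eq_divide)
    qed
  qed auto
  from tendsto_L1_AE_subseq[OF q_integrable this]
  obtain r where r: "strict_mono r" "AE x in lborel. (\<lambda>n. q (r n) x) \<longlonglongrightarrow> 0" by blast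
  have lim: "AE x in lebesgue. (\<lambda>n. k x * \<phi> (r n) x) \<longlonglongrightarrow> k x * s x"
  proof (rule AE_completion)
    show "AE x in lborel. (\<lambda>n. k x * \<phi> (r n) x) \<longlonglongrightarrow> k x * s x"
      using r(2)
    proof eventually_elim
      case (elim x)
      show ?case
      proof (cases "x \<in> D")
        case True
        then have "(\<lambda>n. (norm (\<phi> (r n) x - s x))\<^sup>2) \<longlonglongrightarrow> 0"
          using elim by (simp add: q_def)
        then have "(\<lambda>n. sqrt ((norm (\<phi> (r n) x - s x))\<^sup>2)) \<longlonglongrightarrow> sqrt 0"
          by (intro tendsto_intros)
        then have "(\<lambda>n. \<phi> (r n) x - s x) \<longlonglongrightarrow> 0"
          by (simp add: tendsto_norm_zero_iff)
        then have "(\<lambda>n. \<phi> (r n) x) \<longlonglongrightarrow> s x" by (simp add: LIM_zero_iff)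
        then show ?thesis by (intro tendsto_intros)
      qed (simp add: k_def)
    qed
  qed
  have km: "k \<in> borel_measurable lebesgue" using k by auto
  have ks: "(\<lambda>x. k x * s x) \<in> borel_measurable lebesgue"
    by (rule borel_measurable_times[OF km measurable_completion]) simp
  have k\<phi>: "(\<lambda>x. k x * \<phi> (r n) x) \<in> borel_measurable lebesgue" for n
    by (rule borel_measurable_times[OF km measurable_completion]) simp
  have "(\<lambda>n. LINT x|lebesgue. k x * \<phi> (r n) x) \<longlonglongrightarrow> (LINT x|lebesgue. k x * s x)"
  proof (rule integral_dominated_convergence[OF ks k\<phi> integrable_norm[OF k] lim])
    show "AE x in lebesgue. norm (k x * \<phi> (r n) x) \<le> norm (k x)" for n
      using \<phi>_le by (auto simp: norm_mult intro!: mult_left_le)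
  qed
  then have int0: "(LINT x|lebesgue. k x * s x) = 0"
    unfolding zero using LIMSEQ_unique tendsto_const by blast
  define p where "p x = indicat_real C x * ((norm (k x))\<^sup>2 / max 1 (norm (k x)))" for x
  have eq: "AE x in lebesgue. k x * s x = of_real (p x)"
  proof (rule AE_completion)
    show "AE x in lborel. k x * s x = of_real (p x)"
      using s1_eq
    proof eventually_elim
      case (elim x)
      have "clip 1 (s1 x) = s1 x"
        using clip_bounds(1)[of 1 "cnj (k x)"] clip_bounds(3)[of 1 "s1 x"] elim by simp
      then have "k x * s x = indicator C x * (k x * clip 1 (cnj (k x)))"
        by (simp add: s_def elim)
      also have "k x * clip 1 (cnj (k x)) = of_real ((norm (k x))\<^sup>2 / max 1 (norm (k x)))"
        by (simp add: clip_def complex_norm_square[symmetric] del: of_real_power)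
      finally show ?case by (simp add: p_def indicator_def)
    qed
  qed
  have p_nn: "0 \<le> p x" for x by (simp add: p_def)
  have "integrable lebesgue (\<lambda>x. k x * s x)"
    by (rule integrable_mult_bounded[OF k measurable_completion s_le]) simp
  moreover have pm: "p \<in> borel_measurable lebesgue"
  proof -
    have "indicat_real C \<in> borel_measurable lebesgue"
      by (rule measurable_completion) simp
    with km show ?thesis unfolding p_def by simp
  qed
  ultimately have ip: "integrable lebesgue (\<lambda>x. complex_of_real (p x))"
    by (subst (asm) integrable_cong_AE[OF ks _ eq]) auto
  have "(LINT x|lebesgue. complex_of_real (p x)) = 0"
    using int0 integral_cong_AE[OF ks _ eq] pm by auto
  then have "(LINT x|lebesgue. p x) = 0" by simp
  moreover have "integrable lebesgue p" using ip by (simp add: complex_of_real_integrable_eq)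
  ultimately have "AE x in lebesgue. p x = 0"
    using integral_nonneg_eq_0_iff_AE[of lebesgue p] p_nn by auto
  then show ?thesis
  proof eventually_elim
    case (elim x)
    show ?case
    proof
      assume "x \<in> C"
      then have "(norm (k x))\<^sup>2 / max 1 (norm (k x)) = 0" using elim by (simp add: p_def)
      then have "k x = 0" by (auto simp: max_def split: if_splits)
      then show "h x = 0" using \<open>x \<in> C\<close> D(3) by (auto simp: k_def)
    qed
  qed
qed

lemma orthogonal_to_test_functions_imp_0:
  fixes h :: "'a::euclidean_space \<Rightarrow> complex"
  assumes "open U" and h: "\<And>K. compact K \<Longrightarrow> K \<subseteq> U \<Longrightarrow> set_integrable lebesgue K h"
    and orth: "\<And>\<phi>. \<phi> \<in> test_functions U \<Longrightarrow> (LINT x|lebesgue_on U. h x * \<phi> x) = 0"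
  shows "AE x in lborel. x \<in> U \<longrightarrow> h x = 0"
proof -
  obtain C where C: "\<And>n::nat. compact (C n)" "\<And>n. C n \<subseteq> U" "\<Union>(range C) = U"
    using open_Union_compact_subsets[OF \<open>open U\<close>] by metis
  have "AE x in lebesgue. \<forall>n. x \<in> C n \<longrightarrow> h x = 0"
    unfolding AE_all_countable
    using orthogonal_to_test_functions_imp_0_on_compact[OF assms C(1,2)] by blast
  then have "AE x in lborel. \<forall>n. x \<in> C n \<longrightarrow> h x = 0" by (simp add: AE_completion_iff)
  then show ?thesis
    by eventually_elim (use C(3) in blast)
qed


section \<open>Sobolev functions through Borel representatives\<close>

text \<open>
  Functions on \<open>U\<close> that are only Lebesgue measurable are handled through a Borel function with which
  they agree almost everywhere on \<open>U\<close>; the theorems on product measures then apply to the latter.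
\<close>
lemma lebesgue_on_representative:
  fixes f u :: "'a::euclidean_space \<Rightarrow> 'b::euclidean_space"
  assumes U: "U \<in> sets borel" and u [measurable]: "u \<in> borel_measurable borel"
    and eq: "AE x in lborel. x \<in> U \<longrightarrow> f x = u x"
  shows "f \<in> borel_measurable (lebesgue_on U)"
    and "(LINT x|lebesgue_on U. f x) = (LINT x|lborel. indicator U x *\<^sub>R u x)"
    and "integrable (lebesgue_on U) f \<longleftrightarrow> integrable lborel (\<lambda>x. indicator U x *\<^sub>R u x)"
proof -
  have [measurable]: "U \<in> sets borel" by (rule U)
  have vm: "(\<lambda>x. indicator U x *\<^sub>R u x) \<in> borel_measurable lborel" by measurable
  then have vm': "(\<lambda>x. indicator U x *\<^sub>R u x) \<in> borel_measurable lebesgue" by (rule measurable_completion)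
  have ae: "AE x in lebesgue. indicator U x *\<^sub>R u x = indicator U x *\<^sub>R f x"
    by (rule AE_completion) (use eq in \<open>eventually_elim, auto simp: indicator_def\<close>)
  have wm: "(\<lambda>x. indicator U x *\<^sub>R f x) \<in> borel_measurable lebesgue"
    by (rule borel_measurable_AE[OF vm' ae])
  have Ul: "U \<inter> space lebesgue \<in> sets lebesgue" using U by simp
  show "f \<in> borel_measurable (lebesgue_on U)"
    using borel_measurable_restrict_space_iff[OF Ul, of f] wm by (simp add: mult.commute)
  have "(LINT x|lebesgue_on U. f x) = (LINT x|lebesgue. indicator U x *\<^sub>R f x)"
    by (rule integral_restrict_space[OF Ul])
  also have "\<dots> = (LINT x|lebesgue. indicator U x *\<^sub>R u x)"
    by (rule integral_cong_AE[OF wm vm']) (use ae in \<open>eventually_elim, auto\<close>)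
  finally show "(LINT x|lebesgue_on U. f x) = (LINT x|lborel. indicator U x *\<^sub>R u x)"
    using integral_completion[OF vm] by simp
  have "integrable (lebesgue_on U) f \<longleftrightarrow> integrable lebesgue (\<lambda>x. indicator U x *\<^sub>R f x)"
    by (rule integrable_restrict_space[OF Ul])
  also have "\<dots> \<longleftrightarrow> integrable lebesgue (\<lambda>x. indicator U x *\<^sub>R u x)"
    by (rule integrable_cong_AE[OF wm vm']) (use ae in \<open>eventually_elim, auto\<close>)
  finally show "integrable (lebesgue_on U) f \<longleftrightarrow> integrable lborel (\<lambda>x. indicator U x *\<^sub>R u x)"
    using integrable_completion[OF vm] by simp
qed

lemma Lp_representative:
  fixes f u :: "'a::euclidean_space \<Rightarrow> complex"
  assumes U: "U \<in> sets borel" and u [measurable]: "u \<in> borel_measurable borel"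
    and eq: "AE x in lborel. x \<in> U \<longrightarrow> f x = u x" and p: "0 < p"
  defines "I \<equiv> (\<integral>\<^sup>+x\<in>U. ennreal (norm (u x) powr p) \<partial>lborel)"
  shows "f \<in> Lp p U \<longleftrightarrow> I < \<infinity>" and "Lp_norm p U f = enn2real I powr (1 / p)"
proof -
  have [measurable]: "U \<in> sets borel" by (rule U)
  have eq': "AE x in lborel. x \<in> U \<longrightarrow> norm (f x) powr p = norm (u x) powr p"
    using eq by eventually_elim simp
  have um: "(\<lambda>x. norm (u x) powr p) \<in> borel_measurable borel" by measurable
  note r = lebesgue_on_representative[OF U um eq']
  have I: "(\<integral>\<^sup>+x. ennreal (indicator U x *\<^sub>R (norm (u x) powr p)) \<partial>lborel) = I"
    unfolding I_def by (intro nn_integral_cong) (auto simp: indicator_def)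
  have "integrable lborel (\<lambda>x. indicator U x *\<^sub>R (norm (u x) powr p)) \<longleftrightarrow> I < \<infinity>"
    unfolding I[symmetric] by (subst integrable_iff_bounded) (auto simp: indicator_def intro!: arg_cong[of _ _ "\<lambda>x. x < top"] nn_integral_cong)
  with r(3) show "f \<in> Lp p U \<longleftrightarrow> I < \<infinity>"
    using lebesgue_on_representative(1)[OF U u eq] by (simp add: Lp_def)
  have "(LINT x|lborel. indicator U x *\<^sub>R (norm (u x) powr p)) = enn2real I"
    unfolding I[symmetric] by (rule integral_eq_nn_integral) auto
  with r(2) show "Lp_norm p U f = enn2real I powr (1 / p)"
    by (simp add: Lp_norm_def)
qed

lemma sq_int_powr: "(\<integral>\<^sup>+x\<in>U. ennreal (norm (u x) powr 2) \<partial>lborel) = sq_int U u"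
  unfolding sq_int_def by (intro nn_integral_cong) simp

lemma sq_int_support: "(\<And>x. x \<notin> U \<Longrightarrow> u x = 0) \<Longrightarrow> sq_int U u = sq_int UNIV u"
  unfolding sq_int_def by (intro nn_integral_cong) (auto simp: indicator_def)

lemma L2_representative:
  fixes f u :: "'a::euclidean_space \<Rightarrow> complex"
  assumes U: "U \<in> sets borel" and u: "L2_fun U u"
    and eq: "AE x in lborel. x \<in> U \<longrightarrow> f x = u x"
  shows "f \<in> Lp 2 U" and "(Lp_norm 2 U f)\<^sup>2 = enn2real (sq_int UNIV u)"
proof -
  have um: "u \<in> borel_measurable borel" using u by (simp add: L2_fun_def)
  have s: "sq_int U u = sq_int UNIV u" using u by (intro sq_int_support) (auto simp: L2_fun_def)
  note r = Lp_representative[OF U um eq, of 2, unfolded sq_int_powr s]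
  show "f \<in> Lp 2 U" using r(1) u by (simp add: L2_fun_def)
  show "(Lp_norm 2 U f)\<^sup>2 = enn2real (sq_int UNIV u)"
    using r(2) by (simp add: powr_half_sqrt)
qed

lemma Lp_2_has_representative:
  fixes f :: "'a::euclidean_space \<Rightarrow> complex"
  assumes f: "f \<in> Lp 2 U" and U: "U \<in> sets borel"
  obtains u where "L2_fun U u" "AE x in lborel. x \<in> U \<longrightarrow> f x = u x"
proof -
  have [measurable]: "U \<in> sets borel" by (rule U)
  have "f \<in> borel_measurable (lebesgue_on U)" using f by (simp add: Lp_def)
  then have "(\<lambda>x. if x \<in> U then f x else 0) \<in> borel_measurable lebesgue"
    using U by (intro borel_measurable_if_I) auto
  then obtain v where [measurable]: "v \<in> borel_measurable borel"
      and v: "AE x in lborel. (if x \<in> U then f x else 0) = v x"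
    using lebesgue_borel_representative by blast
  define u where "u x = indicator U x * v x" for x
  have um [measurable]: "u \<in> borel_measurable borel" unfolding u_def by measurable
  have eq: "AE x in lborel. x \<in> U \<longrightarrow> f x = u x"
    using v by eventually_elim (auto simp: u_def)
  have s: "sq_int U u = sq_int UNIV u" by (rule sq_int_support) (simp add: u_def)
  have "L2_fun U u"
    using Lp_representative(1)[OF U um eq, of 2, unfolded sq_int_powr s] f um
    by (auto simp: L2_fun_def u_def)
  then show ?thesis using that eq by blast
qed

text \<open>
  \<open>u\<close> and \<open>g b\<close> are Borel representatives, extended by zero, of \<open>f\<close> and of its weak derivatives.
\<close>
definition sobolev_rep ::
  "'a::euclidean_space set \<Rightarrow> ('a \<Rightarrow> complex) \<Rightarrow> ('a \<Rightarrow> complex) \<Rightarrow> ('a \<Rightarrow> 'a \<Rightarrow> complex) \<Rightarrow> bool" where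
  "sobolev_rep U f u g \<longleftrightarrow> (AE x in lborel. x \<in> U \<longrightarrow> f x = u x) \<and> L2_fun U u \<and>
     (\<forall>b\<in>Basis. L2_fun U (g b) \<and> weak_deriv U b u (g b))"

text \<open>
  The square of the Sobolev norm.
\<close>
definition sobolev_energy ::
  "('a::euclidean_space \<Rightarrow> complex) \<Rightarrow> ('a \<Rightarrow> 'a \<Rightarrow> complex) \<Rightarrow> ennreal" where
  "sobolev_energy u g = sq_int UNIV u + (\<Sum>b\<in>Basis. sq_int UNIV (g b))"

lemma weak_integral_representative:
  fixes f u \<psi> :: "'a::euclidean_space \<Rightarrow> complex"
  assumes U: "U \<in> sets borel" and u [measurable]: "u \<in> borel_measurable borel"
    and eq: "AE x in lborel. x \<in> U \<longrightarrow> f x = u x" and \<psi> [measurable]: "\<psi> \<in> borel_measurable borel"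
    and out: "\<And>x. x \<notin> U \<Longrightarrow> u x = 0"
  shows "(LINT x|lebesgue_on U. f x * \<psi> x) = (LINT x|lborel. u x * \<psi> x)"
proof -
  have "(LINT x|lebesgue_on U. f x * \<psi> x) = (LINT x|lborel. indicator U x *\<^sub>R (u x * \<psi> x))"
  proof (rule lebesgue_on_representative(2)[OF U])
    show "(\<lambda>x. u x * \<psi> x) \<in> borel_measurable borel" by measurable
    show "AE x in lborel. x \<in> U \<longrightarrow> f x * \<psi> x = u x * \<psi> x"
      using eq by eventually_elim simp
  qed
  also have "\<dots> = (LINT x|lborel. u x * \<psi> x)"
    by (rule Bochner_Integration.integral_cong) (auto simp: indicator_def out)
  finally show ?thesis .
qed

lemma L2_rep_locally_integrable:
  fixes f u :: "'a::euclidean_space \<Rightarrow> complex"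
  assumes u: "L2_fun U u" and U: "bounded U"
    and eq: "AE x in lborel. x \<in> U \<longrightarrow> f x = u x"
  shows "locally_integrable U f"
  unfolding locally_integrable_def
proof (intro allI impI)
  fix K assume K: "compact K" "K \<subseteq> U"
  have Km: "K \<in> sets borel" using K(1) by (rule borel_compact)
  have "AE x in lborel. x \<in> K \<longrightarrow> f x = u x"
    using eq by eventually_elim (use K in auto)
  then have "integrable (lebesgue_on K) f \<longleftrightarrow> integrable lborel (\<lambda>x. indicator K x *\<^sub>R u x)"
    using lebesgue_on_representative(3)[OF Km, of u f] u by (auto simp: L2_fun_def)
  moreover have "integrable lborel (\<lambda>x. indicator K x *\<^sub>R u x)"
    using integrable_mult_indicator[of K lborel u] Km L2_fun_integrable[OF u U] by simp
  ultimately show "set_integrable lebesgue K f"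
    unfolding set_integrable_def using Km by (simp add: integrable_restrict_space)
qed

lemma has_weak_derivative_iff_weak_deriv:
  fixes f u :: "'a::euclidean_space \<Rightarrow> complex"
  assumes U: "open U" "bounded U" and u: "L2_fun U u" "AE x in lborel. x \<in> U \<longrightarrow> f x = u x"
    and g: "L2_fun U g" "AE x in lborel. x \<in> U \<longrightarrow> h x = g x"
  shows "has_weak_derivative U b f h \<longleftrightarrow> weak_deriv U b u g"
proof -
  have Um: "U \<in> sets borel" using U by simp
  have eq: "(LINT x|lebesgue_on U. f x * frechet_derivative \<phi> (at x) b) =
        (LINT x|lborel. u x * frechet_derivative \<phi> (at x) b)"
       "(LINT x|lebesgue_on U. h x * \<phi> x) = (LINT x|lborel. g x * \<phi> x)"
    if "\<phi> \<in> test_functions U" for \<phi>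
  proof -
    note s = test_functions_support(1)[OF that]
    have "\<phi> \<in> borel_measurable borel" "(\<lambda>x. frechet_derivative \<phi> (at x) b) \<in> borel_measurable borel"
      using s smooth_frechet_derivative[OF s] by (auto intro!: borel_measurable_continuous_onI smooth_continuous)
    then show "(LINT x|lebesgue_on U. f x * frechet_derivative \<phi> (at x) b) =
        (LINT x|lborel. u x * frechet_derivative \<phi> (at x) b)"
       "(LINT x|lebesgue_on U. h x * \<phi> x) = (LINT x|lborel. g x * \<phi> x)"
      using u g by (auto intro!: weak_integral_representative[OF Um] simp: L2_fun_def)
  qed
  show ?thesis
    unfolding has_weak_derivative_def weak_deriv_def
    using L2_rep_locally_integrable[OF u(1) U(2) u(2)] L2_rep_locally_integrable[OF g(1) U(2) g(2)] eq
    by auto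
qed

lemma W1_has_sobolev_rep:
  fixes f :: "'a::euclidean_space \<Rightarrow> complex"
  assumes U: "open U" "bounded U" and f: "f \<in> W1 U"
  obtains u g where "sobolev_rep U f u g"
proof -
  have Um: "U \<in> sets borel" using U by simp
  obtain u where u: "L2_fun U u" "AE x in lborel. x \<in> U \<longrightarrow> f x = u x"
    using Lp_2_has_representative[OF _ Um, of f] f by (auto simp: W1_def)
  have "\<exists>g. L2_fun U g \<and> weak_deriv U b u g" if "b \<in> Basis" for b
  proof -
    obtain h where h: "h \<in> Lp 2 U" "has_weak_derivative U b f h"
      using f \<open>b \<in> Basis\<close> by (auto simp: W1_def)
    obtain g where g: "L2_fun U g" "AE x in lborel. x \<in> U \<longrightarrow> h x = g x"
      using Lp_2_has_representative[OF h(1) Um] by blast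
    then show ?thesis
      using has_weak_derivative_iff_weak_deriv[OF U u g] h(2) by blast
  qed
  then obtain g where "\<And>b. b \<in> Basis \<Longrightarrow> L2_fun U (g b) \<and> weak_deriv U b u (g b)" by metis
  then show ?thesis using that[of u g] u by (auto simp: sobolev_rep_def)
qed

text \<open>
  The difference of two weak derivatives annihilates all test functions.
\<close>
lemma has_weak_derivative_unique:
  fixes f :: "'a::euclidean_space \<Rightarrow> complex"
  assumes U: "open U" and g: "has_weak_derivative U b f g" and h: "has_weak_derivative U b f h"
  shows "AE x in lborel. x \<in> U \<longrightarrow> g x = h x"
proof -
  have li: "locally_integrable U g" "locally_integrable U h"
    using g h by (auto simp: has_weak_derivative_def)
  have "AE x in lborel. x \<in> U \<longrightarrow> g x - h x = 0"
  proof (rule orthogonal_to_test_functions_imp_0[OF U])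
    show "set_integrable lebesgue K (\<lambda>x. g x - h x)" if "compact K" "K \<subseteq> U" for K
      using li that by (auto simp: locally_integrable_def intro!: set_integral_diff(1))
    fix \<phi> :: "'a \<Rightarrow> complex" assume \<phi>: "\<phi> \<in> test_functions U"
    define K where "K = closure {x. \<phi> x \<noteq> 0}"
    have K: "compact K" "K \<subseteq> U" using \<phi> by (auto simp: test_functions_def K_def)
    note t = test_functions_support[OF \<phi>]
    obtain M where M: "\<And>x. norm (\<phi> x) \<le> M" using test_functions_bounded[OF \<phi>] by blast
    have \<phi>m: "\<phi> \<in> borel_measurable lebesgue"
      by (rule measurable_completion) (use borel_measurable_continuous_onI[OF smooth_continuous[OF t(1)]] in simp)
    have int: "integrable (lebesgue_on U) (\<lambda>x. k x * \<phi> x)" if "locally_integrable U k" for k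
    proof -
      have "integrable lebesgue (\<lambda>x. indicator K x *\<^sub>R k x)"
        using that K by (simp add: locally_integrable_def set_integrable_def)
      then have "integrable lebesgue (\<lambda>x. (indicator K x *\<^sub>R k x) * \<phi> x)"
        by (rule integrable_mult_bounded[OF _ \<phi>m M])
      also have "(\<lambda>x. (indicator K x *\<^sub>R k x) * \<phi> x) = (\<lambda>x. indicator U x *\<^sub>R (k x * \<phi> x))"
      proof
        fix x
        show "(indicator K x *\<^sub>R k x) * \<phi> x = indicator U x *\<^sub>R (k x * \<phi> x)"
        proof (cases "x \<in> K")
          case False
          then have "\<phi> x = 0" using closure_subset[of "{x. \<phi> x \<noteq> 0}"] by (auto simp: K_def)
          then show ?thesis by simp
        qed (use K(2) in auto)
      qed
      finally show ?thesis
        using U by (subst integrable_restrict_space) auto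
    qed
    have "(LINT x|lebesgue_on U. (g x - h x) * \<phi> x) =
        (LINT x|lebesgue_on U. g x * \<phi> x) - (LINT x|lebesgue_on U. h x * \<phi> x)"
      unfolding left_diff_distrib by (rule Bochner_Integration.integral_diff[OF int[OF li(1)] int[OF li(2)]])
    also have "\<dots> = 0" using g h \<phi> by (auto simp: has_weak_derivative_def)
    finally show "(LINT x|lebesgue_on U. (g x - h x) * \<phi> x) = 0" .
  qed
  then show ?thesis by eventually_elim simp
qed

text \<open>
  By uniqueness, the weak derivatives selected in the definition of the Sobolev norm agree with the
  functions \<open>g b\<close> almost everywhere.
\<close>
lemma sobolev_rep_W1:
  fixes f :: "'a::euclidean_space \<Rightarrow> complex"
  assumes U: "open U" "bounded U" and r: "sobolev_rep U f u g"
  shows "f \<in> W1 U" and "W1_norm U f = sqrt (enn2real (sobolev_energy u g))"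
    and "sobolev_energy u g < \<infinity>"
proof -
  have Um: "U \<in> sets borel" using U by simp
  have u: "L2_fun U u" "AE x in lborel. x \<in> U \<longrightarrow> f x = u x"
    and g: "\<And>b. b \<in> Basis \<Longrightarrow> L2_fun U (g b)" "\<And>b. b \<in> Basis \<Longrightarrow> weak_deriv U b u (g b)"
    using r by (auto simp: sobolev_rep_def)
  have wd: "has_weak_derivative U b f (g b)" if "b \<in> Basis" for b
    using has_weak_derivative_iff_weak_deriv[OF U u g(1)[OF that], of "g b"] g(2)[OF that] by simp
  have g2: "g b \<in> Lp 2 U" if "b \<in> Basis" for b
    by (rule L2_representative(1)[OF Um g(1)[OF that]]) simp
  show "f \<in> W1 U"
    using L2_representative(1)[OF Um u] wd g2 by (auto simp: W1_def)
  have n: "(Lp_norm 2 U (weak_derivative U b f))\<^sup>2 = enn2real (sq_int UNIV (g b))" if b: "b \<in> Basis" for b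
  proof (rule L2_representative(2)[OF Um g(1)[OF b]])
    have "has_weak_derivative U b f (weak_derivative U b f)"
      unfolding weak_derivative_def by (rule someI[of "has_weak_derivative U b f"]) (rule wd[OF b])
    then show "AE x in lborel. x \<in> U \<longrightarrow> weak_derivative U b f x = g b x"
      using has_weak_derivative_unique[OF U(1)] wd[OF b] by blast
  qed
  have fin: "sq_int UNIV u < \<infinity>" "\<And>b. b \<in> Basis \<Longrightarrow> sq_int UNIV (g b) < \<infinity>"
    using u g by (auto simp: L2_fun_def)
  then show "sobolev_energy u g < \<infinity>" by (auto simp: sobolev_energy_def)
  have "enn2real (sobolev_energy u g) = enn2real (sq_int UNIV u) + (\<Sum>b\<in>Basis. enn2real (sq_int UNIV (g b)))"
    unfolding sobolev_energy_def using fin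
    by (subst enn2real_plus) (auto simp: enn2real_sum)
  then show "W1_norm U f = sqrt (enn2real (sobolev_energy u g))"
    using L2_representative(2)[OF Um u] n by (simp add: W1_norm_def)
qed

lemma L2_fun_diff:
  assumes f: "L2_fun U f" and g: "L2_fun U g"
  shows "L2_fun U (\<lambda>x. f x - g x)"
proof -
  have [measurable]: "f \<in> borel_measurable borel" "g \<in> borel_measurable borel"
    using f g by (auto simp: L2_fun_def)
  have "sq_int UNIV (\<lambda>x. f x - g x) \<le> 2 * sq_int UNIV f + 2 * sq_int UNIV (\<lambda>x. - g x)"
    using sq_int_add_le[of f "\<lambda>x. - g x" UNIV] by simp
  also have "sq_int UNIV (\<lambda>x. - g x) = sq_int UNIV g" by (rule sq_int_cong) simp
  also have "2 * sq_int UNIV f + 2 * sq_int UNIV g < \<infinity>"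
    using f g by (auto simp: L2_fun_def ennreal_mult_less_top)
  finally show ?thesis using f g by (auto simp: L2_fun_def)
qed

lemma L2_fun_scale: "L2_fun U f \<Longrightarrow> L2_fun U (\<lambda>x. c * f x)"
  unfolding L2_fun_def by (auto simp: sq_int_scale ennreal_mult_less_top)

lemma sobolev_rep_diff:
  assumes U: "bounded U" and f: "sobolev_rep U f u g" and h: "sobolev_rep U h v k"
  shows "sobolev_rep U (\<lambda>x. f x - h x) (\<lambda>x. u x - v x) (\<lambda>b x. g b x - k b x)"
  unfolding sobolev_rep_def
proof (intro conjI ballI)
  show "AE x in lborel. x \<in> U \<longrightarrow> f x - h x = u x - v x"
  proof -
    have "AE x in lborel. x \<in> U \<longrightarrow> f x = u x" "AE x in lborel. x \<in> U \<longrightarrow> h x = v x"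
      using f h by (auto simp: sobolev_rep_def)
    then show ?thesis by eventually_elim simp
  qed
  show "L2_fun U (\<lambda>x. u x - v x)" using f h by (auto simp: sobolev_rep_def intro: L2_fun_diff)
  fix b :: 'a assume b: "b \<in> Basis"
  show "L2_fun U (\<lambda>x. g b x - k b x)" using f h b by (auto simp: sobolev_rep_def intro: L2_fun_diff)
  show "weak_deriv U b (\<lambda>x. u x - v x) (\<lambda>x. g b x - k b x)"
    by (rule weak_deriv_diff) (use f h b U in \<open>auto simp: sobolev_rep_def intro: L2_fun_integrable\<close>)
qed

lemma L2_fun_continuous:
  assumes U: "U \<in> sets borel" "bounded U" and F: "continuous_on UNIV F"
  shows "L2_fun U (\<lambda>x. indicator U x * F x)"
proof -
  have [measurable]: "F \<in> borel_measurable borel" "U \<in> sets borel"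
    using F U by (auto intro: borel_measurable_continuous_onI)
  have "compact (F ` closure U)"
    using U(2) continuous_on_subset[OF F] by (intro compact_continuous_image) (auto simp: compact_closure)
  then obtain M where M: "\<And>y. y \<in> F ` closure U \<Longrightarrow> norm y \<le> M"
    using compact_imp_bounded bounded_iff by metis
  have "sq_int UNIV (\<lambda>x. indicator U x * F x) \<le> (\<integral>\<^sup>+x. ennreal (M\<^sup>2) * indicator U x \<partial>lborel)"
    unfolding sq_int_def
  proof (intro nn_integral_mono)
    fix x
    show "ennreal ((norm (indicator U x * F x))\<^sup>2) * indicator UNIV x \<le> ennreal (M\<^sup>2) * indicator U x"
    proof (cases "x \<in> U")
      case True
      then have "norm (F x) \<le> M" using M closure_subset by blast
      then show ?thesis using True by (auto intro!: ennreal_leI power_mono)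
    qed simp
  qed
  also have "\<dots> = ennreal (M\<^sup>2) * emeasure lborel U"
    by (rule nn_integral_cmult_indicator) simp
  also have "\<dots> < \<infinity>" using emeasure_bounded_finite[OF U(2)] by (simp add: ennreal_mult_less_top)
  finally show ?thesis by (auto simp: L2_fun_def)
qed

lemma sobolev_rep_smooth:
  fixes F :: "'a::euclidean_space \<Rightarrow> complex"
  assumes U: "U \<in> sets borel" "bounded U" and F: "smooth F" and f: "\<And>x. x \<in> U \<Longrightarrow> f x = F x"
  shows "sobolev_rep U f (\<lambda>x. indicator U x * F x) (\<lambda>b x. indicator U x * frechet_derivative F (at x) b)"
  unfolding sobolev_rep_def
  using L2_fun_continuous[OF U smooth_continuous[OF F]] weak_deriv_smooth[OF F]
    L2_fun_continuous[OF U smooth_continuous[OF smooth_frechet_derivative[OF F]]] f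
  by auto


section \<open>Domains with an interior cone condition\<close>

text \<open>
  The truncated cone of height \<open>h\<close> with vertex \<open>0\<close> over the ball of radius \<open>r\<close> around \<open>v\<close>.
\<close>
definition finite_cone :: "'a::euclidean_space \<Rightarrow> real \<Rightarrow> real \<Rightarrow> 'a set" where
  "finite_cone v r h = (\<lambda>(t, y). t *\<^sub>R y) ` ({0..h} \<times> cball v r)"

text \<open>
  The points \<open>x\<close> such that the translate of \<open>C\<close> with vertex \<open>x\<close> lies in \<open>U\<close>.  The interior cone
  condition says that \<open>U\<close> is a finite union of such sets, with \<open>C\<close> ranging over finite cones.
\<close>
definition inner_part :: "'a::euclidean_space set \<Rightarrow> 'a set \<Rightarrow> 'a set" where
  "inner_part U C = {x. \<forall>y\<in>C. x + y \<in> U}"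

lemma compact_finite_cone: "compact (finite_cone v r h)"
  unfolding finite_cone_def
  by (intro compact_continuous_image compact_Times compact_Icc compact_cball)
     (auto simp: case_prod_beta intro!: continuous_intros)

lemma zero_in_finite_cone: "0 \<le> r \<Longrightarrow> 0 \<le> h \<Longrightarrow> 0 \<in> finite_cone v r h"
  unfolding finite_cone_def by (rule image_eqI[of _ _ "(0, v)"]) auto

lemma open_inner_part:
  assumes "open U" "compact C"
  shows "open (inner_part U C)"
proof -
  have "compact (uminus ` C)" by (rule compact_negations[OF assms(2)])
  then have "closed (\<Union>x\<in>uminus ` C. \<Union>y\<in>- U. {x + y})"
    using assms(1) by (intro compact_closed_sums) auto
  also have "(\<Union>x\<in>uminus ` C. \<Union>y\<in>- U. {x + y}) = {x + y |x y. x \<in> uminus ` C \<and> y \<in> - U}"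
    by blast
  finally have "closed {x + y |x y. x \<in> uminus ` C \<and> y \<in> - U}" .
  moreover have "- inner_part U C = {x + y |x y. x \<in> uminus ` C \<and> y \<in> - U}"
  proof (intro set_eqI iffI)
    fix z assume "z \<in> - inner_part U C"
    then obtain y where "y \<in> C" "z + y \<notin> U" by (auto simp: inner_part_def)
    then show "z \<in> {x + y |x y. x \<in> uminus ` C \<and> y \<in> - U}"
      by (intro CollectI exI[of _ "- y"] exI[of _ "z + y"]) auto
  next
    fix z assume "z \<in> {x + y |x y. x \<in> uminus ` C \<and> y \<in> - U}"
    then obtain c y where "c \<in> C" "y \<notin> U" "z = - c + y" by auto
    then show "z \<in> - inner_part U C"
      unfolding inner_part_def by (auto intro!: bexI[of _ c])
  qed
  ultimately have "closed (- inner_part U C)" by simp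
  then show ?thesis by (simp add: closed_def)
qed

lemma inner_part_subset: "0 \<in> C \<Longrightarrow> inner_part U C \<subseteq> U"
  by (force simp: inner_part_def)

text \<open>
  By convexity of the ball around \<open>v\<close>, the heights of two points of the cone add up.
\<close>
lemma finite_cone_add:
  assumes "0 \<le> s" "0 \<le> \<delta>" "s + \<delta> \<le> h" "y \<in> cball v r" "z \<in> cball (\<delta> *\<^sub>R v) (\<delta> * r)"
  shows "s *\<^sub>R y + z \<in> finite_cone v r h"
proof (cases "s + \<delta> = 0")
  case True
  then have "s = 0" "\<delta> = 0" using assms by auto
  then have "z = 0" using assms by auto
  moreover have "0 \<le> r" using assms(4) by (metis mem_cball dist_not_less_zero order_trans zero_le_dist)
  ultimately show ?thesis using zero_in_finite_cone[of r h v] assms \<open>s = 0\<close> by auto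
next
  case False
  then have p: "0 < s + \<delta>" using assms by auto
  let ?w = "(1 / (s + \<delta>)) *\<^sub>R (s *\<^sub>R y + z)"
  have "s *\<^sub>R y + z - (s + \<delta>) *\<^sub>R v = s *\<^sub>R (y - v) + (z - \<delta> *\<^sub>R v)"
    by (simp add: algebra_simps)
  then have "norm (s *\<^sub>R y + z - (s + \<delta>) *\<^sub>R v) \<le> norm (s *\<^sub>R (y - v)) + norm (z - \<delta> *\<^sub>R v)"
    by (simp only: norm_triangle_ineq)
  also have "\<dots> \<le> s * r + \<delta> * r"
    using assms by (intro add_mono) (auto simp: dist_norm norm_minus_commute intro!: mult_left_mono)
  finally have le: "norm (s *\<^sub>R y + z - (s + \<delta>) *\<^sub>R v) \<le> (s + \<delta>) * r" by (simp add: algebra_simps)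
  have "?w - v = (1 / (s + \<delta>)) *\<^sub>R (s *\<^sub>R y + z - (s + \<delta>) *\<^sub>R v)"
    using p by (simp add: scaleR_diff_right)
  then have "norm (?w - v) = norm (s *\<^sub>R y + z - (s + \<delta>) *\<^sub>R v) / (s + \<delta>)"
    using p by simp
  also have "\<dots> \<le> r" using le p by (simp add: divide_le_eq mult.commute)
  finally have "?w \<in> cball v r" by (simp add: dist_norm norm_minus_commute)
  moreover have "s *\<^sub>R y + z = (s + \<delta>) *\<^sub>R ?w" using p by simp
  ultimately show ?thesis unfolding finite_cone_def
    using p assms(3) by (intro image_eqI[of _ _ "(s + \<delta>, ?w)"]) auto
qed

text \<open>
  The derivative in direction \<open>w\<close> that belongs to the partial derivatives \<open>g b\<close>.
\<close>
definition directional :: "('a::euclidean_space \<Rightarrow> 'a \<Rightarrow> complex) \<Rightarrow> 'a \<Rightarrow> 'a \<Rightarrow> complex" where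
  "directional g w x = (\<Sum>b\<in>Basis. of_real (w \<bullet> b) * g b x)"

lemma directional_measurable:
  assumes "\<And>b. b \<in> Basis \<Longrightarrow> g b \<in> borel_measurable borel"
  shows "directional g w \<in> borel_measurable borel"
  unfolding directional_def using assms by measurable

lemma sq_int_directional:
  assumes m: "\<And>b. b \<in> Basis \<Longrightarrow> g b \<in> borel_measurable borel"
  shows "sq_int UNIV (directional g w) \<le> ennreal ((norm w)\<^sup>2) * (\<Sum>b\<in>Basis. sq_int UNIV (g b))"
proof -
  have "(norm (directional g w x))\<^sup>2 \<le> (norm w)\<^sup>2 * (\<Sum>b\<in>Basis. (norm (g b x))\<^sup>2)" for x
  proof -
    have "norm (directional g w x) \<le> (\<Sum>b\<in>Basis. \<bar>w \<bullet> b\<bar> * norm (g b x))"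
      unfolding directional_def by (rule order_trans[OF norm_sum]) (simp add: norm_mult)
    then have "(norm (directional g w x))\<^sup>2 \<le> (\<Sum>b\<in>Basis. \<bar>w \<bullet> b\<bar> * norm (g b x))\<^sup>2"
      by (intro power_mono) auto
    also have "\<dots> \<le> (\<Sum>b\<in>Basis. \<bar>w \<bullet> b\<bar>\<^sup>2) * (\<Sum>b\<in>Basis. (norm (g b x))\<^sup>2)"
      by (rule Cauchy_Schwarz_ineq_sum)
    also have "(\<Sum>b\<in>Basis. \<bar>w \<bullet> b\<bar>\<^sup>2) = (norm w)\<^sup>2"
      unfolding power2_norm_eq_inner euclidean_inner[of w w] by (simp add: power2_eq_square)
    finally show ?thesis .
  qed
  then have "sq_int UNIV (directional g w) \<le>
      (\<integral>\<^sup>+x. ennreal ((norm w)\<^sup>2 * (\<Sum>b\<in>Basis. (norm (g b x))\<^sup>2)) \<partial>lborel)"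
    unfolding sq_int_def by (intro nn_integral_mono) (auto intro: ennreal_leI)
  also have "\<dots> = (\<integral>\<^sup>+x. ennreal ((norm w)\<^sup>2) * (\<Sum>b\<in>Basis. ennreal ((norm (g b x))\<^sup>2)) \<partial>lborel)"
    by (intro nn_integral_cong) (simp add: ennreal_mult sum_nonneg sum_ennreal)
  also have "\<dots> = ennreal ((norm w)\<^sup>2) * (\<Sum>b\<in>Basis. \<integral>\<^sup>+x. ennreal ((norm (g b x))\<^sup>2) \<partial>lborel)"
    using m by (subst nn_integral_cmult) (auto simp: nn_integral_sum simp del: sum_ennreal)
  finally show ?thesis by (simp add: sq_int_def)
qed

lemma L2_fun_directional:
  assumes g: "\<And>b. b \<in> Basis \<Longrightarrow> L2_fun U (g b)"
  shows "L2_fun U (directional g w)"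
  unfolding L2_fun_def
proof (intro conjI allI impI)
  have m: "g b \<in> borel_measurable borel" if "b \<in> Basis" for b using g[OF that] by (simp add: L2_fun_def)
  show "directional g w \<in> borel_measurable borel" by (rule directional_measurable[OF m])
  show "directional g w x = 0" if "x \<notin> U" for x
    using g that by (auto simp: directional_def L2_fun_def)
  have "(\<Sum>b\<in>Basis. sq_int UNIV (g b)) < \<infinity>" using g by (auto simp: L2_fun_def)
  then show "sq_int UNIV (directional g w) < \<infinity>"
    using sq_int_directional[of g w, OF m] by (auto simp: ennreal_mult_less_top intro: order_le_less_trans)
qed

text \<open>
  An element of the Sobolev space of \<open>U\<close>, given by Borel representatives extended by zero.
\<close>
locale sobolev_fun =
  fixes U :: "'a::euclidean_space set" and u :: "'a \<Rightarrow> complex" and g :: "'a \<Rightarrow> 'a \<Rightarrow> complex"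
  assumes open_U: "open U" and bounded_U: "bounded U"
    and u: "L2_fun U u" and g: "\<And>b. b \<in> Basis \<Longrightarrow> L2_fun U (g b)"
    and weak: "\<And>b. b \<in> Basis \<Longrightarrow> weak_deriv U b u (g b)"
begin

lemma U_sets [measurable]: "U \<in> sets borel" using open_U by simp

lemma u_measurable [measurable]: "u \<in> borel_measurable borel" using u by (simp add: L2_fun_def)

lemma u_integrable: "integrable lborel u" by (rule L2_fun_integrable[OF u bounded_U])

lemma directional_L2: "L2_fun U (directional g w)" by (rule L2_fun_directional[OF g])

lemma directional_integrable: "integrable lborel (directional g w)"
  by (rule L2_fun_integrable[OF directional_L2 bounded_U])

lemma weak_directional: "weak_deriv U w u (directional g w)"
  unfolding directional_def
  by (rule weak_deriv_direction[OF u_integrable _ weak]) (use g bounded_U L2_fun_integrable in auto)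

lemma sq_int_directional_energy: "sq_int UNIV (directional g w) \<le> ennreal ((norm w)\<^sup>2) * sobolev_energy u g"
proof -
  have "sq_int UNIV (directional g w) \<le> ennreal ((norm w)\<^sup>2) * (\<Sum>b\<in>Basis. sq_int UNIV (g b))"
    by (rule sq_int_directional) (use g in \<open>auto simp: L2_fun_def\<close>)
  also have "\<dots> \<le> ennreal ((norm w)\<^sup>2) * sobolev_energy u g"
    unfolding sobolev_energy_def by (intro mult_left_mono) auto
  finally show ?thesis .
qed

text \<open>
  On the segments that start in the inner part and point into the cone, the support of the kernel stays
  inside \<open>U\<close> after translation: the cone has height \<open>h\<close>, the segment uses up to \<open>h/2\<close> of it and the
  kernel the rest.
\<close>
lemma conv_derivative_along_cone:
  assumes K: "mollifier K (ball (\<delta> *\<^sub>R v) (\<delta> * r))" and \<delta>: "0 < \<delta>" "\<delta> \<le> h / 2"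
    and x: "x \<in> inner_part U (finite_cone v r h)" and s: "0 \<le> s" "s \<le> h / 2" and y: "y \<in> cball v r"
  shows "((\<lambda>t. conv u K (x + t *\<^sub>R y)) has_vector_derivative conv (directional g y) K (x + s *\<^sub>R y)) (at s within T)"
proof -
  have K': "mollifier K (cball (\<delta> *\<^sub>R v) (\<delta> * r))" using mollifier_subset[OF K] by auto
  have D: "frechet_derivative (conv u K) (at (x + s *\<^sub>R y)) y = conv (directional g y) K (x + s *\<^sub>R y)"
  proof (rule frechet_derivative_conv_weak_deriv[OF u_integrable K' compact_cball _ weak_directional])
    fix z assume "z \<in> cball (\<delta> *\<^sub>R v) (\<delta> * r)"
    then have "s *\<^sub>R y + z \<in> finite_cone v r h" using \<delta> s y by (intro finite_cone_add[of s \<delta>]) auto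
    then have "x + (s *\<^sub>R y + z) \<in> U" using x unfolding inner_part_def by blast
    then show "x + s *\<^sub>R y + z \<in> U" by (simp add: add.assoc)
  qed
  have sm: "smooth (conv u K)"
    by (rule smooth_conv[OF u_integrable _ bounded_cball]) (use K' in \<open>auto simp: mollifier_def\<close>)
  have lin: "linear (frechet_derivative (conv u K) (at z))" for z
    using has_derivative_linear[OF smooth_has_derivative[OF sm]] .
  have "((\<lambda>t. x + t *\<^sub>R y) has_derivative (\<lambda>t. t *\<^sub>R y)) (at s within T)"
    by (auto intro!: derivative_eq_intros)
  from has_derivative_compose[OF this smooth_has_derivative[OF sm]]
  have "((\<lambda>t. conv u K (x + t *\<^sub>R y)) has_derivative
      (\<lambda>t. frechet_derivative (conv u K) (at (x + s *\<^sub>R y)) (t *\<^sub>R y))) (at s within T)" .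
  then show ?thesis
    unfolding has_vector_derivative_def linear_scale[OF lin] D .
qed

lemma conv_directional_continuous:
  assumes "mollifier K S" "bounded S"
  shows "continuous_on UNIV (conv (directional g w) K)"
  by (rule smooth_continuous[OF smooth_conv[OF directional_integrable _ assms(2)]])
     (use assms(1) in \<open>auto simp: mollifier_def\<close>)

lemma conv_increment:
  assumes K: "mollifier K (ball (\<delta> *\<^sub>R v) (\<delta> * r))" and \<delta>: "0 < \<delta>" "\<delta> \<le> h / 2"
    and x: "x \<in> inner_part U (finite_cone v r h)" and t: "0 \<le> t" "t \<le> h / 2" and y: "y \<in> cball v r"
  shows "ennreal ((norm (conv u K (x + t *\<^sub>R y) - conv u K x))\<^sup>2) \<le>
    ennreal t * (\<integral>\<^sup>+s\<in>{0..t}. ennreal ((norm (conv (directional g y) K (x + s *\<^sub>R y)))\<^sup>2) \<partial>lborel)"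
proof -
  let ?G = "\<lambda>s. conv (directional g y) K (x + s *\<^sub>R y)"
  have G: "continuous_on UNIV ?G"
    by (intro continuous_on_compose2[OF conv_directional_continuous[OF K bounded_ball]] continuous_intros) auto
  then have [measurable]: "?G \<in> borel_measurable borel" by (rule borel_measurable_continuous_onI)
  have "has_bochner_integral lborel (\<lambda>s. indicator {0..t} s *\<^sub>R ?G s)
      (conv u K (x + t *\<^sub>R y) - conv u K (x + 0 *\<^sub>R y))"
    by (rule has_bochner_integral_FTC_Icc[OF t(1)])
       (use t conv_derivative_along_cone[OF K \<delta> x _ _ y] continuous_on_subset[OF G] in auto)
  then have I: "integrable lborel (\<lambda>s. indicator {0..t} s *\<^sub>R ?G s)"
      "conv u K (x + t *\<^sub>R y) - conv u K x = (LINT s|lborel. indicator {0..t} s *\<^sub>R ?G s)"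
    by (auto simp: has_bochner_integral_iff)
  have "ennreal ((norm (conv u K (x + t *\<^sub>R y) - conv u K x))\<^sup>2) =
      (ennreal (norm (LINT s|lborel. indicator {0..t} s *\<^sub>R ?G s)))\<^sup>2"
    unfolding I(2) by (simp add: ennreal_power)
  also have "\<dots> \<le> (\<integral>\<^sup>+s. ennreal (norm (indicator {0..t} s *\<^sub>R ?G s)) \<partial>lborel)\<^sup>2"
    by (intro power_mono integral_norm_bound_ennreal I) simp
  also have "(\<integral>\<^sup>+s. ennreal (norm (indicator {0..t} s *\<^sub>R ?G s)) \<partial>lborel) =
      (\<integral>\<^sup>+s. indicator {0..t} s * (ennreal (norm (?G s)) * indicator {0..t} s) \<partial>lborel)"
    by (intro nn_integral_cong) (auto simp: indicator_def)
  also have "\<dots>\<^sup>2 \<le> (\<integral>\<^sup>+s. (indicator {0..t} s)\<^sup>2 \<partial>lborel) *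
      (\<integral>\<^sup>+s. (ennreal (norm (?G s)) * indicator {0..t} s)\<^sup>2 \<partial>lborel)"
    by (rule Cauchy_Schwarz_nn_integral) measurable
  also have "(\<integral>\<^sup>+s. (indicator {0..t} s)\<^sup>2 \<partial>lborel) = (\<integral>\<^sup>+s. indicator {0..t} s \<partial>lborel)"
    by (intro nn_integral_cong) (auto simp: indicator_def)
  also have "\<dots> = ennreal t" using t by simp
  also have "(\<integral>\<^sup>+s. (ennreal (norm (?G s)) * indicator {0..t} s)\<^sup>2 \<partial>lborel) =
      (\<integral>\<^sup>+s\<in>{0..t}. ennreal ((norm (?G s))\<^sup>2) \<partial>lborel)"
    by (intro nn_integral_cong) (auto simp: indicator_def ennreal_power)
  finally show ?thesis .
qed

text \<open>
  Fundamental theorem of calculus and the Cauchy-Schwarz inequality on each segment, followed by an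
  exchange of the integrations over the segment and over its initial point.
\<close>
lemma conv_translation_estimate:
  assumes K: "mollifier K (ball (\<delta> *\<^sub>R v) (\<delta> * r))" and \<delta>: "0 < \<delta>" "\<delta> \<le> h / 2"
    and t: "0 \<le> t" "t \<le> h / 2" and y: "y \<in> cball v r"
  shows "sq_int (inner_part U (finite_cone v r h)) (\<lambda>x. conv u K (x + t *\<^sub>R y) - conv u K x)
    \<le> ennreal (t\<^sup>2) * sq_int UNIV (directional g y)"
proof -
  let ?A = "inner_part U (finite_cone v r h)"
  have [measurable]: "?A \<in> sets borel" using open_inner_part[OF open_U compact_finite_cone] by simp
  define G where "G = conv (directional g y) K"
  have "continuous_on UNIV G" unfolding G_def by (rule conv_directional_continuous[OF K bounded_ball])
  then have [measurable]: "G \<in> borel_measurable borel" by (rule borel_measurable_continuous_onI)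
  let ?H = "\<lambda>x s. ennreal ((norm (G (x + s *\<^sub>R y)))\<^sup>2) * indicator {0..t} s"
  have H [measurable]: "case_prod ?H \<in> borel_measurable (lborel \<Otimes>\<^sub>M lborel)"
  proof -
    have "case_prod ?H \<in> borel_measurable (borel \<Otimes>\<^sub>M borel)" by measurable
    then show ?thesis by (simp cong: measurable_cong_sets sets_pair_measure_cong)
  qed
  have "sq_int ?A (\<lambda>x. conv u K (x + t *\<^sub>R y) - conv u K x) \<le>
      (\<integral>\<^sup>+x. ennreal t * (\<integral>\<^sup>+s. ?H x s \<partial>lborel) \<partial>lborel)"
    unfolding sq_int_def
  proof (intro nn_integral_mono)
    fix x
    show "ennreal ((norm (conv u K (x + t *\<^sub>R y) - conv u K x))\<^sup>2) * indicator ?A x \<le>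
        ennreal t * (\<integral>\<^sup>+s. ?H x s \<partial>lborel)"
      using conv_increment[OF K \<delta> _ t y, of x] by (cases "x \<in> ?A") (auto simp: G_def)
  qed
  also have "\<dots> = ennreal t * (\<integral>\<^sup>+x. \<integral>\<^sup>+s. ?H x s \<partial>lborel \<partial>lborel)"
    by (rule nn_integral_cmult) measurable
  also have "(\<integral>\<^sup>+x. \<integral>\<^sup>+s. ?H x s \<partial>lborel \<partial>lborel) = (\<integral>\<^sup>+s. \<integral>\<^sup>+x. ?H x s \<partial>lborel \<partial>lborel)"
    by (rule lborel_pair.Fubini'[OF H, symmetric])
  also have "\<dots> = (\<integral>\<^sup>+s. sq_int UNIV G * indicator {0..t} s \<partial>lborel)"
  proof (intro nn_integral_cong)
    fix s
    have "(\<integral>\<^sup>+x. ?H x s \<partial>lborel) = (\<integral>\<^sup>+x. ennreal ((norm (G (x + s *\<^sub>R y)))\<^sup>2) \<partial>lborel) * indicator {0..t} s"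
      by (rule nn_integral_multc) measurable
    also have "(\<integral>\<^sup>+x. ennreal ((norm (G (x + s *\<^sub>R y)))\<^sup>2) \<partial>lborel) = sq_int UNIV G"
      using nn_integral_lborel_shift[of "\<lambda>x. ennreal ((norm (G x))\<^sup>2)" "s *\<^sub>R y"]
      by (simp add: sq_int_def add.commute)
    finally show "(\<integral>\<^sup>+x. ?H x s \<partial>lborel) = sq_int UNIV G * indicator {0..t} s" .
  qed
  also have "\<dots> = sq_int UNIV G * ennreal t"
    using t by (subst nn_integral_cmult_indicator) auto
  also have "ennreal t * (sq_int UNIV G * ennreal t) = ennreal (t\<^sup>2) * sq_int UNIV G"
    using t by (simp add: power2_eq_square ennreal_mult mult_ac)
  also have "sq_int UNIV G \<le> ennreal 1 * sq_int UNIV (directional g y)"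
    unfolding G_def using conv_L2_bound[OF directional_integrable K bounded_ball distortion_shift[of 0], of UNIV] by simp
  finally show ?thesis by (simp add: mult_left_mono)
qed

text \<open>
  Kernels supported around \<open>\<delta> v\<close> approximate the identity as \<open>\<delta>\<close> tends to \<open>0\<close>, just like kernels
  centred at the origin.
\<close>
lemma fine_mollifier_exists:
  assumes "0 < e" "finite F" "\<And>f. f \<in> F \<Longrightarrow> L2_fun U f" "bounded B" "B \<in> sets borel" "0 < r" "0 < h"
  obtains \<delta> K where "0 < \<delta>" "\<delta> \<le> h / 2" "mollifier K (ball (\<delta> *\<^sub>R v) (\<delta> * r))"
    "\<And>f. f \<in> F \<Longrightarrow> sq_int B (\<lambda>x. conv f K x - f x) \<le> e"
proof -
  have "\<exists>d>0. \<forall>K. mollifier K (ball 0 d) \<longrightarrow> sq_int B (\<lambda>x. conv f K x - f x) \<le> e" if f: "f \<in> F" for f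
  proof -
    obtain d where d: "d > 0" "\<And>\<sigma> K. distortion 1 \<sigma> \<Longrightarrow> (\<And>x. x \<in> B \<Longrightarrow> dist (\<sigma> x) x < d) \<Longrightarrow>
        mollifier K (ball 0 d) \<Longrightarrow> sq_int B (\<lambda>x. conv f K (\<sigma> x) - f x) \<le> e"
      using conv_L2_approximation[OF assms(3)[OF f] bounded_U assms(5,4,1) zero_le_one] by metis
    have "sq_int B (\<lambda>x. conv f K x - f x) \<le> e" if "mollifier K (ball 0 d)" for K
      using d(2)[OF distortion_shift[of 0] _ that] d(1) by simp
    with d(1) show ?thesis by blast
  qed
  then obtain d where d: "\<And>f. f \<in> F \<Longrightarrow> d f > 0"
     "\<And>f K. f \<in> F \<Longrightarrow> mollifier K (ball 0 (d f)) \<Longrightarrow> sq_int B (\<lambda>x. conv f K x - f x) \<le> e" by metis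
  define D where "D = Min (insert 1 (d ` F))"
  have D: "0 < D" "\<And>f. f \<in> F \<Longrightarrow> D \<le> d f" using d(1) assms(2) by (auto simp: D_def)
  define \<delta> where "\<delta> = min (h / 2) (D / (norm v + r))"
  have p: "0 < norm v + r" using assms(6) norm_ge_zero[of v] by linarith
  have "0 < \<delta>" unfolding \<delta>_def using D p assms(7) by simp
  moreover have "\<delta> \<le> h / 2" unfolding \<delta>_def by (rule min.cobounded1)
  ultimately have \<delta>: "0 < \<delta>" "\<delta> \<le> h / 2" by blast+
  have "\<delta> * (norm v + r) \<le> D"
    using p mult_right_mono[of \<delta> "D / (norm v + r)" "norm v + r"] by (simp add: \<delta>_def)
  then have sub: "ball (\<delta> *\<^sub>R v) (\<delta> * r) \<subseteq> ball 0 (d f)" if "f \<in> F" for f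
    using D(2)[OF that] \<delta> by (subst ball_subset_ball_iff) (auto simp: dist_norm algebra_simps)
  obtain K where K: "mollifier K (ball (\<delta> *\<^sub>R v) (\<delta> * r))"
    using mollifier_exists[of "\<delta> * r" "\<delta> *\<^sub>R v"] \<delta> assms(6) by auto
  show ?thesis
    by (rule that[OF \<delta> K]) (use d(2) mollifier_subset[OF K sub] in blast)
qed

text \<open>
  The estimate for the mollified function passes to the limit; the factor \<open>4\<close> comes from splitting off
  the mollification error with \<open>|a + b|\<^sup>2 \<le> 2 |a|\<^sup>2 + 2 |b|\<^sup>2\<close> twice.
\<close>
lemma translation_estimate:
  assumes rh: "0 < r" "0 < h" and t: "0 \<le> t" "t \<le> h / 2" and y: "y \<in> cball v r"
  shows "sq_int (inner_part U (finite_cone v r h)) (\<lambda>x. u (x + t *\<^sub>R y) - u x)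
    \<le> ennreal (4 * t\<^sup>2) * sq_int UNIV (directional g y)"
proof (rule ennreal_le_epsilon)
  fix e :: real assume e: "0 < e"
  let ?A = "inner_part U (finite_cone v r h)"
  have A [measurable]: "?A \<in> sets borel" using open_inner_part[OF open_U compact_finite_cone] by simp
  have AU: "?A \<subseteq> U" by (rule inner_part_subset, rule zero_in_finite_cone) (use rh in auto)
  have e6: "0 < ennreal (e / 6)" using e by simp
  from fine_mollifier_exists[OF e6, of "{u}" U r h v] obtain \<delta> K where K: "0 < \<delta>" "\<delta> \<le> h / 2"
      "mollifier K (ball (\<delta> *\<^sub>R v) (\<delta> * r))" "sq_int U (\<lambda>x. conv u K x - u x) \<le> ennreal (e / 6)"
    using u bounded_U rh by auto
  have [measurable]: "conv u K \<in> borel_measurable borel"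
    by (rule conv_measurable[OF u_integrable K(3) bounded_ball])
  have "sq_int ?A (\<lambda>x. u (x + t *\<^sub>R y) - conv u K (x + t *\<^sub>R y)) \<le> sq_int U (\<lambda>x. conv u K x - u x)"
  proof -
    let ?f = "\<lambda>x. ennreal ((norm (u x - conv u K x))\<^sup>2) * indicator U x"
    have "sq_int ?A (\<lambda>x. u (x + t *\<^sub>R y) - conv u K (x + t *\<^sub>R y)) \<le> (\<integral>\<^sup>+x. ?f (t *\<^sub>R y + x) \<partial>lborel)"
      unfolding sq_int_def
    proof (intro nn_integral_mono)
      fix x
      have "t *\<^sub>R y + 0 \<in> finite_cone v r h" if "x \<in> ?A" by (rule finite_cone_add[where \<delta>=0]) (use t rh y in auto)
      then have "t *\<^sub>R y + x \<in> U" if "x \<in> ?A" using that by (auto simp: inner_part_def add.commute)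
      then show "ennreal ((norm (u (x + t *\<^sub>R y) - conv u K (x + t *\<^sub>R y)))\<^sup>2) * indicator ?A x \<le> ?f (t *\<^sub>R y + x)"
        by (auto simp: indicator_def add.commute)
    qed
    also have "\<dots> = (\<integral>\<^sup>+x. ?f x \<partial>lborel)" by (rule nn_integral_lborel_shift) measurable
    also have "\<dots> = sq_int U (\<lambda>x. u x - conv u K x)" by (simp add: sq_int_def)
    also have "\<dots> = sq_int U (\<lambda>x. conv u K x - u x)" by (rule sq_int_minus_commute)
    finally show ?thesis .
  qed
  with K(4) have 1: "sq_int ?A (\<lambda>x. u (x + t *\<^sub>R y) - conv u K (x + t *\<^sub>R y)) \<le> ennreal (e / 6)" by simp
  have 2: "sq_int ?A (\<lambda>x. conv u K x - u x) \<le> ennreal (e / 6)"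
    using sq_int_mono_set[OF AU] K(4) order_trans by blast
  note 3 = conv_translation_estimate[OF K(3) K(1,2) t y]
  have "sq_int ?A (\<lambda>x. u (x + t *\<^sub>R y) - u x) \<le>
      2 * sq_int ?A (\<lambda>x. u (x + t *\<^sub>R y) - conv u K (x + t *\<^sub>R y))
      + 2 * sq_int ?A (\<lambda>x. conv u K (x + t *\<^sub>R y) - u x)"
    by (rule sq_int_triangle) measurable
  also have "sq_int ?A (\<lambda>x. conv u K (x + t *\<^sub>R y) - u x) \<le>
      2 * sq_int ?A (\<lambda>x. conv u K (x + t *\<^sub>R y) - conv u K x) + 2 * sq_int ?A (\<lambda>x. conv u K x - u x)"
    by (rule sq_int_triangle) measurable
  also have "2 * sq_int ?A (\<lambda>x. u (x + t *\<^sub>R y) - conv u K (x + t *\<^sub>R y))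
      + 2 * (2 * sq_int ?A (\<lambda>x. conv u K (x + t *\<^sub>R y) - conv u K x) + 2 * sq_int ?A (\<lambda>x. conv u K x - u x))
    \<le> 2 * ennreal (e / 6) + 2 * (2 * (ennreal (t\<^sup>2) * sq_int UNIV (directional g y)) + 2 * ennreal (e / 6))"
    using 1 2 3 by (intro add_mono mult_left_mono) auto
  also have "\<dots> = ennreal (4 * t\<^sup>2) * sq_int UNIV (directional g y) + ennreal e"
  proof -
    have "sq_int UNIV (directional g y) < \<infinity>" using directional_L2 by (simp add: L2_fun_def)
    then obtain q where "sq_int UNIV (directional g y) = ennreal q" "0 \<le> q"
      by (cases "sq_int UNIV (directional g y)") auto
    then show ?thesis using e
      by (simp add: ennreal_mult[symmetric] ennreal_plus[symmetric] ennreal_numeral[symmetric] algebra_simps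
            del: ennreal_plus ennreal_numeral)
  qed
  finally show "sq_int ?A (\<lambda>x. u (x + t *\<^sub>R y) - u x) \<le>
      ennreal (4 * t\<^sup>2) * sq_int UNIV (directional g y) + ennreal e"
    by (simp add: add_left_mono mult_left_mono)
qed

text \<open>
  A kernel supported around \<open>t v\<close> averages over translates by \<open>t y\<close> with \<open>y\<close> in the ball around \<open>v\<close>, so
  mollifying at scale \<open>t\<close> costs at most \<open>t\<close> times the Sobolev norm.
\<close>
lemma average_estimate:
  assumes rh: "0 < r" "0 < h" and t: "0 < t" "t \<le> h / 2" and K: "mollifier K (ball (t *\<^sub>R v) (t * r))"
  shows "sq_int (inner_part U (finite_cone v r h)) (\<lambda>x. conv u K x - u x)
    \<le> ennreal (4 * t\<^sup>2 * (norm v + r)\<^sup>2) * sobolev_energy u g"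
proof -
  have A: "inner_part U (finite_cone v r h) \<in> sets borel" using open_inner_part[OF open_U compact_finite_cone] by simp
  show ?thesis
  proof (rule conv_L2_difference[OF u_integrable K bounded_ball u_measurable _ A, of "\<lambda>x. x"])
    fix y assume y: "y \<in> ball (t *\<^sub>R v) (t * r)"
    define w where "w = (1 / t) *\<^sub>R y"
    have yw: "y = t *\<^sub>R w" using t by (simp add: w_def)
    have "t *\<^sub>R v - y = t *\<^sub>R (v - w)" by (simp add: yw algebra_simps)
    then have "t * norm (v - w) < t * r" using y t by (simp add: dist_norm)
    then have w: "w \<in> cball v r" using t by (simp add: dist_norm)
    have "norm w \<le> norm v + r"
      using w norm_triangle_sub[of w v] by (simp add: dist_norm norm_minus_commute)
    then have nw: "(norm w)\<^sup>2 \<le> (norm v + r)\<^sup>2" by (intro power_mono) auto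
    have "sq_int (inner_part U (finite_cone v r h)) (\<lambda>x. u (x + y) - u x)
        \<le> ennreal (4 * t\<^sup>2) * sq_int UNIV (directional g w)"
      unfolding yw by (rule translation_estimate[OF rh _ _ w]) (use t in auto)
    also have "\<dots> \<le> ennreal (4 * t\<^sup>2) * (ennreal ((norm w)\<^sup>2) * sobolev_energy u g)"
      by (intro mult_left_mono sq_int_directional_energy) simp
    also have "\<dots> \<le> ennreal (4 * t\<^sup>2) * (ennreal ((norm v + r)\<^sup>2) * sobolev_energy u g)"
      using nw by (intro mult_left_mono mult_right_mono ennreal_leI) auto
    also have "\<dots> = ennreal (4 * t\<^sup>2 * (norm v + r)\<^sup>2) * sobolev_energy u g"
      by (simp add: ennreal_mult mult.assoc)
    finally show "sq_int (inner_part U (finite_cone v r h)) (\<lambda>x. u (x + y) - u x) \<le>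
        ennreal (4 * t\<^sup>2 * (norm v + r)\<^sup>2) * sobolev_energy u g" .
  qed simp
qed

end


section \<open>Rellich compactness\<close>

lemma conv_equibounded:
  fixes f :: "'a::euclidean_space \<Rightarrow> complex"
  assumes f: "integrable lborel f" "(LINT x|lborel. norm (f x)) \<le> L" and B: "\<And>z. \<bar>k z\<bar> \<le> B" "0 \<le> B"
    and k: "k \<in> borel_measurable borel"
  shows "norm (LINT z|lborel. f z * of_real (k z)) \<le> B * L"
proof -
  have "norm (LINT z|lborel. f z * of_real (k z)) \<le> (LINT z|lborel. B * norm (f z))"
  proof (rule Bochner_Integration.integral_norm_bound_integral)
    show "integrable lborel (\<lambda>z. f z * of_real (k z))"
      by (rule integrable_mult_bounded[OF f(1), of _ B]) (use k B(1) in auto)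
    show "integrable lborel (\<lambda>z. B * norm (f z))" using f by simp
    show "norm (f z * of_real (k z)) \<le> B * norm (f z)" for z
      using mult_right_mono[OF B(1)[of z] norm_ge_zero[of "f z"]] by (simp add: norm_mult mult.commute)
  qed
  also have "\<dots> = B * (LINT z|lborel. norm (f z))" by simp
  also have "\<dots> \<le> B * L" by (rule mult_left_mono[OF f(2) B(2)])
  finally show ?thesis .
qed

text \<open>
  Convolution with a fixed kernel turns a sequence bounded in \<open>L\<^sup>1\<close> into a bounded and equicontinuous
  one.
\<close>
lemma conv_compactness:
  fixes u :: "nat \<Rightarrow> 'a::euclidean_space \<Rightarrow> complex"
  assumes u: "\<And>n. integrable lborel (u n)" "\<And>n. (LINT x|lborel. norm (u n x)) \<le> L"
    and K: "mollifier K S" "bounded S" and D: "compact D" and \<epsilon>: "0 < \<epsilon>"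
  obtains s :: "nat \<Rightarrow> nat" where "strict_mono s" "\<And>i j x. x \<in> D \<Longrightarrow> norm (conv (u (s i)) K x - conv (u (s j)) K x) \<le> \<epsilon>"
proof -
  have Kc: "continuous_on UNIV K" and K0: "\<And>x. x \<notin> S \<Longrightarrow> K x = 0"
    using K smooth_continuous by (auto simp: mollifier_def)
  have [measurable]: "K \<in> borel_measurable borel" using K by (auto simp: mollifier_def)
  have L: "0 \<le> L" using order_trans[OF _ u(2)[of 0]] by simp
  obtain B where B: "\<And>x. norm (K x) \<le> B" "0 \<le> B"
    using bounded_support_bounded[OF Kc K(2) K0] by blast
  have equi: "\<exists>d>0. \<forall>n y. y \<in> D \<and> norm (x - y) < d \<longrightarrow> norm (conv (u n) K x - conv (u n) K y) < e"
    if e: "0 < e" for x :: 'a and e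
  proof -
    have "0 < e / (L + 1) / 2" using e L by simp
    from bounded_support_uniformly_continuous[OF Kc K(2) K0 this]
    obtain d where d: "0 < d" "\<And>x y. dist x y < d \<Longrightarrow> dist (K x) (K y) < e / (L + 1) / 2" by blast
    have "norm (conv (u n) K x - conv (u n) K y) < e" if xy: "norm (x - y) < d" for n y
    proof -
      have "conv (u n) K x - conv (u n) K y =
          (LINT z|lborel. u n z * of_real (K (z - x)) - u n z * of_real (K (z - y)))"
        unfolding conv_def using integrable_conv[OF u(1) Kc K(2) K0] by simp
      also have "\<dots> = (LINT z|lborel. u n z * of_real (K (z - x) - K (z - y)))"
        by (simp add: algebra_simps)
      also have "norm \<dots> \<le> e / (L + 1) / 2 * L"
      proof (rule conv_equibounded[OF u(1,2)])
        show "\<bar>K (z - x) - K (z - y)\<bar> \<le> e / (L + 1) / 2" for z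
          using d(2)[of "z - x" "z - y"] xy by (simp add: dist_norm norm_minus_commute)
      qed (use e L in auto)
      also have "\<dots> = e * (L / (2 * (L + 1)))" by simp
      also have "\<dots> < e * 1" using e L by (intro mult_strict_left_mono) (auto simp: divide_simps)
      finally show ?thesis by simp
    qed
    with d(1) show ?thesis by blast
  qed
  have bd: "norm (conv (u n) K x) \<le> B * L" for n x
    unfolding conv_def using B by (intro conv_equibounded[OF u(1,2)]) auto
  obtain g k where k: "strict_mono (k :: nat \<Rightarrow> nat)"
    "\<And>e. 0 < e \<Longrightarrow> \<exists>N. \<forall>n x. n \<ge> N \<and> x \<in> D \<longrightarrow> norm (conv (u (k n)) K x - g x) < e"
    using Arzela_Ascoli[OF D, of "\<lambda>n. conv (u n) K" "B * L"] bd equi by (metis (no_types, lifting))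
  obtain N where N: "\<And>n x. n \<ge> N \<Longrightarrow> x \<in> D \<Longrightarrow> norm (conv (u (k n)) K x - g x) < \<epsilon> / 2"
    using k(2)[of "\<epsilon> / 2"] \<epsilon> by auto
  show ?thesis
  proof (rule that[of "\<lambda>n. k (n + N)"])
    show "strict_mono (\<lambda>n. k (n + N))" using k(1) by (simp add: strict_mono_def)
    show "norm (conv (u (k (i + N))) K x - conv (u (k (j + N))) K x) \<le> \<epsilon>" if "x \<in> D" for i j x
      using N[of "i + N" x] N[of "j + N" x] that
        norm_triangle_ineq4[of "conv (u (k (i + N))) K x - g x" "conv (u (k (j + N))) K x - g x"] by simp
  qed
qed

text \<open>
  The mollification scale \<open>t\<close> is chosen first, so that all members of the sequence are close to their
  mollifications; only then is a subsequence with uniformly close mollifications extracted.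
\<close>
lemma rellich_piece:
  fixes u :: "nat \<Rightarrow> 'a::euclidean_space \<Rightarrow> complex"
  assumes s: "\<And>n. sobolev_fun U (u n) (g n)" and M: "\<And>n. sobolev_energy (u n) (g n) \<le> ennreal M" "0 \<le> M"
    and rh: "0 < r" "0 < h" and e: "0 < e"
  shows "\<exists>s::nat \<Rightarrow> nat. strict_mono s \<and> (\<forall>i j. sq_int (inner_part U (finite_cone v r h)) (\<lambda>x. u (s i) x - u (s j) x) \<le> ennreal e)"
proof -
  let ?A = "inner_part U (finite_cone v r h)"
  interpret s0: sobolev_fun U "u 0" "g 0" by (rule s)
  note U = s0.open_U s0.bounded_U
  have A [measurable]: "?A \<in> sets borel" using open_inner_part[OF U(1) compact_finite_cone] by simp
  have AU: "?A \<subseteq> U" by (rule inner_part_subset, rule zero_in_finite_cone) (use rh in auto)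
  have um [measurable]: "u n \<in> borel_measurable borel" for n by (rule sobolev_fun.u_measurable[OF s])
  define Q where "Q = 4 * (norm v + r)\<^sup>2 * M + 1"
  have Q: "0 < Q" using M by (auto simp: Q_def add_nonneg_pos)
  define t where "t = min (h / 2) (sqrt (e / (12 * Q)))"
  have t: "0 < t" "t \<le> h / 2" using rh e Q by (simp_all add: t_def)
  have t2: "t\<^sup>2 \<le> e / (12 * Q)"
  proof -
    have "t \<le> sqrt (e / (12 * Q))" by (simp add: t_def)
    then have "t\<^sup>2 \<le> (sqrt (e / (12 * Q)))\<^sup>2" using t by (intro power_mono) auto
    then show ?thesis using e Q by simp
  qed
  obtain K where K: "mollifier K (ball (t *\<^sub>R v) (t * r))"
    using mollifier_exists[of "t * r" "t *\<^sub>R v"] t rh by auto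
  have close: "sq_int ?A (\<lambda>x. conv (u n) K x - u n x) \<le> ennreal (e / 12)" for n
  proof -
    have "sq_int ?A (\<lambda>x. conv (u n) K x - u n x) \<le>
        ennreal (4 * t\<^sup>2 * (norm v + r)\<^sup>2) * sobolev_energy (u n) (g n)"
      by (rule sobolev_fun.average_estimate[OF s rh t K])
    also have "\<dots> \<le> ennreal (4 * t\<^sup>2 * (norm v + r)\<^sup>2) * ennreal M"
      by (intro mult_left_mono M) simp
    also have "\<dots> = ennreal (t\<^sup>2 * (4 * (norm v + r)\<^sup>2 * M))"
      using M by (simp add: ennreal_mult[symmetric] mult_ac)
    also have "\<dots> \<le> ennreal (e / 12)"
    proof (rule ennreal_leI)
      have "t\<^sup>2 * (4 * (norm v + r)\<^sup>2 * M) \<le> e / (12 * Q) * Q"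
        by (rule mult_mono) (use t2 M e Q in \<open>auto simp: Q_def\<close>)
      then show "t\<^sup>2 * (4 * (norm v + r)\<^sup>2 * M) \<le> e / 12" using Q by simp
    qed
    finally show ?thesis .
  qed
  define V where "V = measure lborel U"
  have V: "emeasure lborel U = ennreal V" "0 \<le> V"
    using emeasure_bounded_finite[OF U(2)] by (auto simp: V_def emeasure_eq_ennreal_measure)
  have L: "(LINT x|lborel. norm (u n x)) \<le> V + M" for n
  proof -
    have "(\<integral>\<^sup>+x. norm (u n x) \<partial>lborel) \<le> emeasure lborel U + sq_int UNIV (u n)"
      by (rule nn_integral_norm_le[OF sobolev_fun.u[OF s] subset_refl]) (use U in simp)
    also have "\<dots> \<le> emeasure lborel U + sobolev_energy (u n) (g n)"
      unfolding sobolev_energy_def by (intro add_left_mono) simp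
    also have "\<dots> \<le> ennreal (V + M)"
      using M V by (auto simp: add_left_mono)
    finally have "(\<integral>\<^sup>+x. ennreal (norm (u n x)) \<partial>lborel) \<le> ennreal (V + M)" .
    then have "enn2real (\<integral>\<^sup>+x. ennreal (norm (u n x)) \<partial>lborel) \<le> V + M"
      using V M by (intro enn2real_leI) auto
    then show ?thesis by (subst integral_eq_nn_integral) auto
  qed
  define \<epsilon> where "\<epsilon> = sqrt (e / (12 * (V + 1)))"
  have \<epsilon>: "0 < \<epsilon>" "\<epsilon>\<^sup>2 = e / (12 * (V + 1))" using e V by (simp_all add: \<epsilon>_def)
  have D: "compact (closure U)" using U by (simp add: compact_closure)
  obtain s :: "nat \<Rightarrow> nat" where s': "strict_mono s"
      "\<And>i j x. x \<in> closure U \<Longrightarrow> norm (conv (u (s i)) K x - conv (u (s j)) K x) \<le> \<epsilon>"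
  proof (rule conv_compactness[of u "V + M" K "ball (t *\<^sub>R v) (t * r)" "closure U" \<epsilon>])
    show "integrable lborel (u n)" for n by (rule sobolev_fun.u_integrable[OF s])
  qed (use L K D \<epsilon>(1) in auto)
  have [measurable]: "conv (u n) K \<in> borel_measurable borel" for n
    by (rule conv_measurable[OF sobolev_fun.u_integrable[OF s] K bounded_ball])
  have "sq_int ?A (\<lambda>x. u (s i) x - u (s j) x) \<le> ennreal e" for i j
  proof -
    have "sq_int ?A (\<lambda>x. conv (u (s i)) K x - conv (u (s j)) K x)
        \<le> sq_int U (\<lambda>x. conv (u (s i)) K x - conv (u (s j)) K x)"
      by (rule sq_int_mono_set[OF AU])
    also have "\<dots> \<le> sq_int U (\<lambda>x. of_real \<epsilon>)"
    proof (rule sq_int_mono)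
      fix x assume "x \<in> U"
      then have "x \<in> closure U" using closure_subset[of U] by (rule rev_subsetD)
      then show "norm (conv (u (s i)) K x - conv (u (s j)) K x) \<le> norm (complex_of_real \<epsilon>)"
        using s'(2)[of x i j] \<epsilon>(1) by simp
    qed
    also have "\<dots> = ennreal (\<epsilon>\<^sup>2) * emeasure lborel U"
      unfolding sq_int_def using U by (subst nn_integral_cmult_indicator) auto
    also have "\<dots> = ennreal (\<epsilon>\<^sup>2 * V)" using V by (simp add: ennreal_mult)
    also have "\<dots> \<le> ennreal (e / 12)"
      using e V unfolding \<epsilon>(2) by (intro ennreal_leI) (simp add: divide_simps)
    finally have 1: "sq_int ?A (\<lambda>x. conv (u (s i)) K x - conv (u (s j)) K x) \<le> ennreal (e / 12)" .
    have "sq_int ?A (\<lambda>x. u (s i) x - u (s j) x) \<le> 2 * sq_int ?A (\<lambda>x. u (s i) x - conv (u (s i)) K x)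
        + 2 * sq_int ?A (\<lambda>x. conv (u (s i)) K x - u (s j) x)"
      by (rule sq_int_triangle) measurable
    also have "sq_int ?A (\<lambda>x. conv (u (s i)) K x - u (s j) x) \<le>
        2 * sq_int ?A (\<lambda>x. conv (u (s i)) K x - conv (u (s j)) K x)
        + 2 * sq_int ?A (\<lambda>x. conv (u (s j)) K x - u (s j) x)"
      by (rule sq_int_triangle) measurable
    also have "2 * sq_int ?A (\<lambda>x. u (s i) x - conv (u (s i)) K x) + 2 * (
        2 * sq_int ?A (\<lambda>x. conv (u (s i)) K x - conv (u (s j)) K x)
        + 2 * sq_int ?A (\<lambda>x. conv (u (s j)) K x - u (s j) x)) \<le>
        2 * ennreal (e / 12) + 2 * (2 * ennreal (e / 12) + 2 * ennreal (e / 12))"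
      using 1 close[of "s i"] close[of "s j"]
      by (intro add_mono mult_left_mono) (auto simp: sq_int_minus_commute[of _ "u (s i)"])
    also have "\<dots> \<le> ennreal e"
      using e by (simp add: ennreal_mult[symmetric] ennreal_plus[symmetric] ennreal_numeral[symmetric]
            ennreal_le_iff del: ennreal_plus ennreal_numeral)
    finally show ?thesis by (simp add: add_left_mono mult_left_mono)
  qed
  with s'(1) show ?thesis by blast
qed

lemma rellich_pieces:
  fixes u :: "nat \<Rightarrow> 'a::euclidean_space \<Rightarrow> complex"
  assumes s: "\<And>n. sobolev_fun U (u n) (g n)" and M: "\<And>n. sobolev_energy (u n) (g n) \<le> ennreal M" "0 \<le> M"
    and rh: "0 < r" "0 < h" and e: "0 < e" and V: "finite V"
  shows "\<exists>s::nat \<Rightarrow> nat. strict_mono s \<and> (\<forall>v\<in>V. \<forall>i j. sq_int (inner_part U (finite_cone v r h)) (\<lambda>x. u (s i) x - u (s j) x) \<le> ennreal e)"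
  using V
proof induction
  case empty
  show ?case by (rule exI[of _ id]) (auto simp: strict_mono_def)
next
  case (insert v V)
  then obtain s :: "nat \<Rightarrow> nat" where s1: "strict_mono s"
    "\<And>w i j. w \<in> V \<Longrightarrow> sq_int (inner_part U (finite_cone w r h)) (\<lambda>x. u (s i) x - u (s j) x) \<le> ennreal e" by blast
  obtain s' :: "nat \<Rightarrow> nat" where s2: "strict_mono s'" "\<And>i j. sq_int (inner_part U (finite_cone v r h))
      (\<lambda>x. u (s (s' i)) x - u (s (s' j)) x) \<le> ennreal e"
    using rellich_piece[of U "\<lambda>n. u (s n)" "\<lambda>n. g (s n)" M r h e v] s M rh e by blast
  show ?case
    by (rule exI[of _ "s \<circ> s'"]) (use s1(2) s2(2) strict_mono_o[OF s1(1) s2(1)] in \<open>auto simp: o_def\<close>)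
qed

lemma sq_int_UN_le:
  assumes "finite V" "U \<subseteq> (\<Union>v\<in>V. A v)" "f \<in> borel_measurable borel" "\<And>v. A v \<in> sets borel"
    "\<And>x. x \<notin> U \<Longrightarrow> f x = 0"
  shows "sq_int UNIV f \<le> (\<Sum>v\<in>V. sq_int (A v) f)"
proof -
  have "sq_int UNIV f \<le> (\<integral>\<^sup>+x. (\<Sum>v\<in>V. ennreal ((norm (f x))\<^sup>2) * indicator (A v) x) \<partial>lborel)"
    unfolding sq_int_def
  proof (intro nn_integral_mono)
    fix x
    show "ennreal ((norm (f x))\<^sup>2) * indicator UNIV x \<le> (\<Sum>v\<in>V. ennreal ((norm (f x))\<^sup>2) * indicator (A v) x)"
    proof (cases "x \<in> U")
      case True
      then obtain v where v: "v \<in> V" "x \<in> A v" using assms(2) by blast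
      have "ennreal ((norm (f x))\<^sup>2) * indicator (A v) x \<le> (\<Sum>v\<in>V. ennreal ((norm (f x))\<^sup>2) * indicator (A v) x)"
        by (rule member_le_sum[OF v(1)]) (use assms(1) in auto)
      then show ?thesis using v by simp
    qed (use assms(5) in auto)
  qed
  also have "\<dots> = (\<Sum>v\<in>V. sq_int (A v) f)"
    unfolding sq_int_def using assms by (intro nn_integral_sum) auto
  finally show ?thesis .
qed

text \<open>
  Along a subsequence with increments \<open>d\<^sub>k\<close> of squared norm at most \<open>4\<^sup>-\<^sup>k\<close>, the series of
  \<open>2\<^sup>k |d\<^sub>k|\<^sup>2\<close> has finite integral.  Hence \<open>|d\<^sub>k|\<close> is dominated by a geometric sequence almost everywhere,
  and the subsequence converges pointwise.  Fatou's lemma identifies the limit.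
\<close>
lemma L2_complete:
  fixes f :: "nat \<Rightarrow> 'a::euclidean_space \<Rightarrow> complex"
  assumes f: "\<And>n. L2_fun U (f n)" and U: "U \<in> sets borel"
    and cauchy: "\<And>e. 0 < e \<Longrightarrow> \<exists>N. \<forall>i\<ge>N. \<forall>j\<ge>N. sq_int UNIV (\<lambda>x. f i x - f j x) \<le> ennreal e"
  shows "\<exists>w. L2_fun U w \<and> (\<lambda>n. sq_int UNIV (\<lambda>x. f n x - w x)) \<longlonglongrightarrow> 0"
proof -
  have [measurable]: "U \<in> sets borel" by (rule U)
  have [measurable]: "f n \<in> borel_measurable borel" for n using f[of n] by (simp add: L2_fun_def)
  have "\<exists>N. \<forall>i\<ge>N. \<forall>j\<ge>N. sq_int UNIV (\<lambda>x. f i x - f j x) \<le> ennreal ((1/4) ^ k)" for k :: nat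
    by (rule cauchy) simp
  then obtain N where N: "\<And>k i j. i \<ge> N k \<Longrightarrow> j \<ge> N k \<Longrightarrow>
      sq_int UNIV (\<lambda>x. f i x - f j x) \<le> ennreal ((1/4) ^ k)" by metis
  define m where "m k = (\<Sum>i\<le>k. N i) + k" for k
  have m: "m k \<ge> N k" "m k \<ge> k" "m (Suc k) \<ge> N k" for k
  proof -
    have "N k \<le> (\<Sum>i\<le>k. N i)" by (rule member_le_sum) auto
    then show "m k \<ge> N k" "m k \<ge> k" "m (Suc k) \<ge> N k" by (simp_all add: m_def)
  qed
  define d where "d k x = f (m (Suc k)) x - f (m k) x" for k x
  have dm [measurable]: "d k \<in> borel_measurable borel" for k unfolding d_def by measurable
  have dk: "sq_int UNIV (d k) \<le> ennreal ((1/4) ^ k)" for k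
    unfolding d_def using N m by blast
  define S where "S x = (\<Sum>k. ennreal (2 ^ k * (norm (d k x))\<^sup>2))" for x
  have Sm [measurable]: "S \<in> borel_measurable borel" unfolding S_def by measurable
  have "(\<integral>\<^sup>+x. S x \<partial>lborel) = (\<Sum>k. \<integral>\<^sup>+x. ennreal (2 ^ k * (norm (d k x))\<^sup>2) \<partial>lborel)"
    unfolding S_def by (rule nn_integral_suminf) measurable
  also have "\<dots> \<le> (\<Sum>k. ennreal ((1/2) ^ k))"
  proof (rule suminf_le)
    fix k
    have "(\<integral>\<^sup>+x. ennreal (2 ^ k * (norm (d k x))\<^sup>2) \<partial>lborel) = ennreal (2 ^ k) * sq_int UNIV (d k)"
      unfolding sq_int_def by (subst nn_integral_cmult[symmetric]) (auto simp: ennreal_mult)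
    also have "\<dots> \<le> ennreal (2 ^ k) * ennreal ((1/4) ^ k)" by (intro mult_left_mono dk) simp
    also have "\<dots> = ennreal ((1/2) ^ k)"
      by (simp add: ennreal_mult[symmetric] power_mult_distrib[symmetric])
    finally show "(\<integral>\<^sup>+x. ennreal (2 ^ k * (norm (d k x))\<^sup>2) \<partial>lborel) \<le> ennreal ((1/2) ^ k)" .
  qed auto
  also have "\<dots> = ennreal (\<Sum>k. (1/2) ^ k)"
    by (rule suminf_ennreal2) (auto intro: summable_geometric)
  finally have "(\<integral>\<^sup>+x. S x \<partial>lborel) \<noteq> \<infinity>" by (auto simp: top_unique)
  then have "AE x in lborel. S x \<noteq> \<infinity>"
    by (intro nn_integral_noteq_infinite) auto
  then have conv: "AE x in lborel. convergent (\<lambda>k. f (m k) x)"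
  proof eventually_elim
    case (elim x)
    then obtain c where c: "S x = ennreal c" "0 \<le> c" by (cases "S x") auto
    have "norm (d k x) \<le> sqrt c * (sqrt (1/2)) ^ k" for k
    proof -
      have "sum F {k} \<le> suminf F" for F :: "nat \<Rightarrow> ennreal" by (rule sum_le_suminf) auto
      then have "F k \<le> suminf F" for F :: "nat \<Rightarrow> ennreal" by simp
      then have "ennreal (2 ^ k * (norm (d k x))\<^sup>2) \<le> ennreal c"
        unfolding c(1)[symmetric] S_def by fast
      then have "2 ^ k * (norm (d k x))\<^sup>2 \<le> c" using c(2) by (simp only: ennreal_le_iff)
      then have "(norm (d k x))\<^sup>2 \<le> c * (1/2) ^ k" by (simp add: field_simps)
      also have "\<dots> = (sqrt c * (sqrt (1/2)) ^ k)\<^sup>2"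
      proof -
        have "((sqrt (1/2)) ^ k)\<^sup>2 = ((sqrt (1/2))\<^sup>2) ^ k"
          by (metis power_mult mult.commute)
        also have "\<dots> = (1/2) ^ k" by simp
        finally have "((sqrt (1/2)) ^ k)\<^sup>2 = (1/2) ^ k" .
        then show ?thesis using c(2) by (simp only: power_mult_distrib real_sqrt_pow2)
      qed
      finally show ?thesis using c by (intro power2_le_imp_le[of "norm (d k x)"]) auto
    qed
    note bound = this
    have "summable (\<lambda>k. sqrt c * (sqrt (1/2)) ^ k)"
      by (intro summable_mult summable_geometric) (simp add: real_sqrt_less_iff)
    then have "summable (\<lambda>k. d k x)"
      by (rule summable_comparison_test'[where N=0]) (rule bound)
    then have "convergent (\<lambda>n. \<Sum>k<n. d k x)" by (simp add: summable_iff_convergent)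
    moreover have "(\<Sum>k<n. d k x) = f (m n) x - f (m 0) x" for n
      unfolding d_def by (rule sum_lessThan_telescope)
    ultimately have "convergent (\<lambda>n. f (m n) x - f (m 0) x)" by simp
    then have "convergent (\<lambda>n. (f (m n) x - f (m 0) x) + f (m 0) x)"
      by (intro convergent_add convergent_const)
    then show ?case by simp
  qed
  define w where "w x = indicator U x * lim (\<lambda>k. f (m k) x)" for x
  have wm [measurable]: "w \<in> borel_measurable borel"
    unfolding w_def by measurable
  have w_lim: "AE x in lborel. (\<lambda>k. f (m k) x) \<longlonglongrightarrow> w x"
    using conv
  proof eventually_elim
    case (elim x)
    show ?case
    proof (cases "x \<in> U")
      case True
      then show ?thesis using elim by (simp add: w_def convergent_LIMSEQ_iff)
    next
      case False
      then have "f n x = 0" for n using f[of n] by (auto simp: L2_fun_def)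
      with False show ?thesis by (simp add: w_def)
    qed
  qed
  have lim: "sq_int UNIV (\<lambda>x. f n x - w x) \<le> ennreal ((1/4) ^ k)" if n: "n \<ge> N k" for n k
  proof -
    have "sq_int UNIV (\<lambda>x. f n x - w x) =
        (\<integral>\<^sup>+x. liminf (\<lambda>l. ennreal ((norm (f n x - f (m l) x))\<^sup>2)) \<partial>lborel)"
      unfolding sq_int_def
    proof (rule nn_integral_cong_AE)
      show "AE x in lborel. ennreal ((norm (f n x - w x))\<^sup>2) * indicator UNIV x =
          liminf (\<lambda>l. ennreal ((norm (f n x - f (m l) x))\<^sup>2))"
        using w_lim
      proof eventually_elim
        case (elim x)
        then have "(\<lambda>l. ennreal ((norm (f n x - f (m l) x))\<^sup>2)) \<longlonglongrightarrow> ennreal ((norm (f n x - w x))\<^sup>2)"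
          by (intro tendsto_intros)
        then show ?case using lim_imp_Liminf[OF sequentially_bot] by fastforce
      qed
    qed
    also have "\<dots> \<le> liminf (\<lambda>l. \<integral>\<^sup>+x. ennreal ((norm (f n x - f (m l) x))\<^sup>2) \<partial>lborel)"
      by (rule nn_integral_liminf) measurable
    also have "\<dots> \<le> ennreal ((1/4) ^ k)"
    proof (rule Liminf_le)
      show "\<forall>\<^sub>F l in sequentially. (\<integral>\<^sup>+x. ennreal ((norm (f n x - f (m l) x))\<^sup>2) \<partial>lborel) \<le> ennreal ((1/4) ^ k)"
        using eventually_ge_at_top[of "N k"]
      proof eventually_elim
        case (elim l)
        then have "N k \<le> m l" using m(2)[of l] by linarith
        then show ?case using N[OF n, of "m l"] by (simp add: sq_int_def)
      qed
    qed simp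
    finally show ?thesis .
  qed
  have L2w: "L2_fun U w"
  proof -
    have "sq_int UNIV (\<lambda>x. f (N 0) x - w x) < \<infinity>"
      using lim[of 0 "N 0"] by (auto intro: order_le_less_trans)
    then have "L2_fun U (\<lambda>x. f (N 0) x - w x)"
      using f[of "N 0"] by (auto simp: L2_fun_def w_def)
    from L2_fun_diff[OF f[of "N 0"] this] show ?thesis by simp
  qed
  have "(\<lambda>n. sq_int UNIV (\<lambda>x. f n x - w x)) \<longlonglongrightarrow> 0"
  proof (rule order_tendstoI)
    show "\<forall>\<^sub>F n in sequentially. sq_int UNIV (\<lambda>x. f n x - w x) < e" if "0 < e" for e
    proof -
      obtain q where q: "0 < q" "q < e" using dense[OF \<open>0 < e\<close>] by blast
      then obtain e' where e': "0 < e'" "ennreal e' < e" by (cases q) auto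
      obtain k where k: "(1/4::real) ^ k < e'" using real_arch_pow_inv[of e' "1/4"] e' by auto
      show ?thesis
        using eventually_ge_at_top[of "N k"]
      proof eventually_elim
        case (elim n)
        have "sq_int UNIV (\<lambda>x. f n x - w x) \<le> ennreal ((1/4) ^ k)" by (rule lim[OF elim])
        also have "\<dots> \<le> ennreal e'" using k by (intro ennreal_leI) simp
        finally show ?case using e'(2) by simp
      qed
    qed
  qed simp
  with L2w show ?thesis by blast
qed

text \<open>
  For every tolerance there is a subsequence whose members are pairwise closer than the tolerance on
  all pieces; a diagonal subsequence is a Cauchy sequence.
\<close>
theorem rellich:
  fixes u :: "nat \<Rightarrow> 'a::euclidean_space \<Rightarrow> complex"
  assumes s: "\<And>n. sobolev_fun U (u n) (g n)" and M: "\<And>n. sobolev_energy (u n) (g n) \<le> ennreal M" "0 \<le> M"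
    and rh: "0 < r" "0 < h" and V: "finite V" "U \<subseteq> (\<Union>v\<in>V. inner_part U (finite_cone v r h))"
  shows "\<exists>w (s::nat \<Rightarrow> nat). strict_mono s \<and> L2_fun U w \<and> (\<lambda>n. sq_int UNIV (\<lambda>x. u (s n) x - w x)) \<longlonglongrightarrow> 0"
proof -
  interpret s0: sobolev_fun U "u 0" "g 0" by (rule s)
  have L2: "L2_fun U (u n)" for n by (rule sobolev_fun.u[OF s])
  have A: "inner_part U (finite_cone v r h) \<in> sets borel" for v
    using open_inner_part[OF s0.open_U compact_finite_cone] by simp
  define P where "P m s \<longleftrightarrow> (\<forall>i j. sq_int UNIV (\<lambda>x. u (s i) x - u (s j) x) \<le> ennreal (1 / Suc m))"
    for m and s :: "nat \<Rightarrow> nat"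
  interpret subseqs P
  proof
    fix m and s0 :: "nat \<Rightarrow> nat"
    define e where "e = 1 / (real (card V) + 1) / Suc m"
    have e: "0 < e" by (simp add: e_def)
    obtain s' :: "nat \<Rightarrow> nat" where s': "strict_mono s'" "\<And>v i j. v \<in> V \<Longrightarrow>
        sq_int (inner_part U (finite_cone v r h)) (\<lambda>x. u (s0 (s' i)) x - u (s0 (s' j)) x) \<le> ennreal e"
      using rellich_pieces[of U "\<lambda>n. u (s0 n)" "\<lambda>n. g (s0 n)" M r h e V] s M rh e V by blast
    have "sq_int UNIV (\<lambda>x. u (s0 (s' i)) x - u (s0 (s' j)) x) \<le> ennreal (1 / Suc m)" for i j
    proof -
      have "sq_int UNIV (\<lambda>x. u (s0 (s' i)) x - u (s0 (s' j)) x) \<le>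
         (\<Sum>v\<in>V. sq_int (inner_part U (finite_cone v r h)) (\<lambda>x. u (s0 (s' i)) x - u (s0 (s' j)) x))"
        by (rule sq_int_UN_le[OF V _ A]) (use L2 L2_fun_diff[OF L2 L2] in \<open>auto simp: L2_fun_def\<close>)
      also have "\<dots> \<le> (\<Sum>v\<in>V. ennreal e)" by (intro sum_mono s')
      also have "\<dots> = ennreal (real (card V) * e)"
        using e by (simp add: ennreal_mult ennreal_of_nat_eq_real_of_nat)
      also have "\<dots> \<le> ennreal (1 / Suc m)"
      proof (rule ennreal_leI)
        have "real (card V) * e = (real (card V) / (real (card V) + 1)) * (1 / Suc m)"
          by (simp add: e_def)
        also have "\<dots> \<le> 1 * (1 / Suc m)" by (rule mult_right_mono) auto
        finally show "real (card V) * e \<le> 1 / Suc m" by simp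
      qed
      finally show ?thesis .
    qed
    with s'(1) show "\<exists>r'. strict_mono r' \<and> P m (s0 \<circ> r')" by (auto simp: P_def)
  qed
  have hold: "P k (diagseq \<circ> ((+) (Suc k)))" for k
    by (rule diagseq_holds) (auto simp: P_def)
  have "\<exists>w. L2_fun U w \<and> (\<lambda>n. sq_int UNIV (\<lambda>x. u (diagseq n) x - w x)) \<longlonglongrightarrow> 0"
  proof (rule L2_complete)
    fix e :: real assume "0 < e"
    then obtain k where k: "1 / Suc k < e" using nat_approx_posE by blast
    have "sq_int UNIV (\<lambda>x. u (diagseq i) x - u (diagseq j) x) \<le> ennreal e" if "i \<ge> Suc k" "j \<ge> Suc k" for i j
    proof -
      have "sq_int UNIV (\<lambda>x. u (diagseq (Suc k + (i - Suc k))) x - u (diagseq (Suc k + (j - Suc k))) x)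
          \<le> ennreal (1 / Suc k)"
        using hold[of k] unfolding P_def o_def by blast
      also have "\<dots> \<le> ennreal e" using k by (intro ennreal_leI) simp
      finally show ?thesis using that by simp
    qed
    then show "\<exists>N. \<forall>i\<ge>N. \<forall>j\<ge>N. sq_int UNIV (\<lambda>x. u (diagseq i) x - u (diagseq j) x) \<le> ennreal e" by blast
  qed (use L2 s0.open_U in auto)
  with subseq_diagseq show ?thesis by blast
qed


section \<open>The Loomis-Whitney inequality in dimension four\<close>

lemma am_gm_3:
  fixes p q s :: real
  assumes "0 \<le> p" "0 \<le> q" "0 \<le> s"
  shows "p * q * s \<le> ((p + q + s) / 3) ^ 3"
proof -
  have "(p + q + s) ^ 3 - 27 * (p * q * s) =
      (p + q + s) * ((p - q)\<^sup>2 + (q - s)\<^sup>2 + (s - p)\<^sup>2) / 2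
      + 3 * (p * (q - s)\<^sup>2 + q * (s - p)\<^sup>2 + s * (p - q)\<^sup>2)"
    by (simp add: power2_eq_square power3_eq_cube field_simps)
  also have "\<dots> \<ge> 0" using assms by (intro add_nonneg_nonneg mult_nonneg_nonneg divide_nonneg_nonneg) auto
  finally show ?thesis by (simp add: power_divide)
qed

text \<open>
  Hoelder's inequality with three exponents \<open>3\<close>, written without cube roots so that it makes sense for
  extended nonnegative numbers.  It follows from the inequality between the arithmetic and the geometric
  mean after normalising the three integrals.
\<close>
lemma Holder_3:
  fixes h a b c :: "'a \<Rightarrow> ennreal"
  assumes [measurable]: "h \<in> borel_measurable M" "a \<in> borel_measurable M" "b \<in> borel_measurable M" "c \<in> borel_measurable M"
    and le: "\<And>x. h x ^ 3 \<le> a x * b x * c x"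
  shows "(\<integral>\<^sup>+x. h x \<partial>M) ^ 3 \<le> (\<integral>\<^sup>+x. a x \<partial>M) * (\<integral>\<^sup>+x. b x \<partial>M) * (\<integral>\<^sup>+x. c x \<partial>M)"
proof -
  define A B C where "A = (\<integral>\<^sup>+x. a x \<partial>M)" "B = (\<integral>\<^sup>+x. b x \<partial>M)" "C = (\<integral>\<^sup>+x. c x \<partial>M)"
  note ABC = this
  consider "A = 0 \<or> B = 0 \<or> C = 0" | "A \<noteq> 0" "B \<noteq> 0" "C \<noteq> 0" "A = \<infinity> \<or> B = \<infinity> \<or> C = \<infinity>"
    | "A \<noteq> 0" "B \<noteq> 0" "C \<noteq> 0" "A \<noteq> \<infinity>" "B \<noteq> \<infinity>" "C \<noteq> \<infinity>" by blast
  then show ?thesis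
  proof cases
    case 1
    have "AE x in M. a x * b x * c x = 0"
    proof -
      have "AE x in M. a x = 0" if "A = 0" using that unfolding ABC by (subst (asm) nn_integral_0_iff_AE) auto
      moreover have "AE x in M. b x = 0" if "B = 0" using that unfolding ABC by (subst (asm) nn_integral_0_iff_AE) auto
      moreover have "AE x in M. c x = 0" if "C = 0" using that unfolding ABC by (subst (asm) nn_integral_0_iff_AE) auto
      ultimately show ?thesis using 1 by (auto elim: eventually_mono)
    qed
    then have "AE x in M. h x = 0"
    proof eventually_elim
      case (elim x)
      have "h x ^ 3 \<le> 0" using le[of x] unfolding elim .
      then show ?case by simp
    qed
    then have "(\<integral>\<^sup>+x. h x \<partial>M) = 0" by (subst nn_integral_0_iff_AE) auto
    then show ?thesis by simp
  next
    case 2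
    then have "A * B * C = \<infinity>" by (auto simp: ennreal_mult_eq_top_iff)
    then show ?thesis by (simp add: ABC)
  next
    case 3
    obtain A' B' C' where r: "A = ennreal A'" "B = ennreal B'" "C = ennreal C'"
        "0 < A'" "0 < B'" "0 < C'"
      using 3 by (cases A; cases B; cases C) (auto simp: less_le)
    define D where "D = root 3 (A' * B' * C')"
    have D: "0 < D" "D ^ 3 = A' * B' * C'"
      using r by (auto simp: D_def)
    have pt: "h x \<le> ennreal (D / (3 * A')) * a x + ennreal (D / (3 * B')) * b x + ennreal (D / (3 * C')) * c x" for x
    proof (cases "a x = \<infinity> \<or> b x = \<infinity> \<or> c x = \<infinity>")
      case True
      then show ?thesis using r D by (auto simp: ennreal_mult_top)
    next
      case False
      then obtain p q s where p: "a x = ennreal p" "b x = ennreal q" "c x = ennreal s" "0 \<le> p" "0 \<le> q" "0 \<le> s"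
        by (cases "a x"; cases "b x"; cases "c x") auto
      have le': "h x ^ 3 \<le> ennreal (p * q * s)" using le[of x] p by (simp add: ennreal_mult)
      then have "h x \<noteq> \<infinity>" by (auto simp: top_power_ennreal top_unique)
      then obtain t where t: "h x = ennreal t" "0 \<le> t" by (cases "h x") auto
      have "t ^ 3 \<le> p * q * s" using le' t p by (simp add: ennreal_power)
      also have "\<dots> = D ^ 3 * ((p / A') * (q / B') * (s / C'))" using r unfolding D(2) by simp
      also have "\<dots> \<le> D ^ 3 * ((p / A' + q / B' + s / C') / 3) ^ 3"
        using am_gm_3[of "p / A'" "q / B'" "s / C'"] p r D by (intro mult_left_mono) auto
      also have "\<dots> = (D * ((p / A' + q / B' + s / C') / 3)) ^ 3" by (simp add: power_mult_distrib power_divide)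
      finally have "t ^ 3 \<le> (D * ((p / A' + q / B' + s / C') / 3)) ^ 3" .
      moreover have "0 \<le> D * ((p / A' + q / B' + s / C') / 3)" using p r D by simp
      moreover have "t \<le> Y" if "t ^ 3 \<le> Y ^ 3" "0 \<le> Y" for Y :: real
        using that power_mono_iff[of t Y 3] t(2) by simp
      ultimately have "t \<le> D * ((p / A' + q / B' + s / C') / 3)" by fast
      also have "\<dots> = D / (3 * A') * p + D / (3 * B') * q + D / (3 * C') * s" by (simp add: algebra_simps)
      finally show ?thesis
        unfolding t p using p r D by (simp add: ennreal_mult[symmetric] ennreal_plus[symmetric] del: ennreal_plus)
    qed
    have "(\<integral>\<^sup>+x. h x \<partial>M) \<le> (\<integral>\<^sup>+x. ennreal (D / (3 * A')) * a x + ennreal (D / (3 * B')) * b x + ennreal (D / (3 * C')) * c x \<partial>M)"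
      by (intro nn_integral_mono pt)
    also have "\<dots> = ennreal (D / (3 * A')) * A + ennreal (D / (3 * B')) * B + ennreal (D / (3 * C')) * C"
      unfolding ABC by (simp add: nn_integral_add nn_integral_cmult)
    also have "\<dots> = ennreal D"
      unfolding r using r D by (simp add: ennreal_mult[symmetric] ennreal_plus[symmetric] del: ennreal_plus)
    finally have "(\<integral>\<^sup>+x. h x \<partial>M) ^ 3 \<le> (ennreal D) ^ 3" by (intro power_mono) auto
    also have "\<dots> = A * B * C" using r D by (simp add: ennreal_power ennreal_mult)
    finally show ?thesis by (simp add: ABC)
  qed
qed

text \<open>
  One variable is integrated at a time.  Of the four factors, one does not depend on the current variable
  and is absorbed into one of the others, so that \<open>Holder_3\<close> applies in each of the four steps.
\<close>
lemma loomis_whitney_4: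
  fixes h :: "real \<times> real \<times> real \<times> real \<Rightarrow> ennreal" and f1 f2 f3 f4 :: "real \<times> real \<times> real \<Rightarrow> ennreal"
  assumes [measurable]: "h \<in> borel_measurable borel" "f1 \<in> borel_measurable borel" "f2 \<in> borel_measurable borel"
      "f3 \<in> borel_measurable borel" "f4 \<in> borel_measurable borel"
    and le: "\<And>a b c d. h (a, b, c, d) ^ 3 \<le> f1 (b, c, d) * f2 (a, c, d) * f3 (a, b, d) * f4 (a, b, c)"
  shows "(\<integral>\<^sup>+d. \<integral>\<^sup>+c. \<integral>\<^sup>+b. \<integral>\<^sup>+a. h (a, b, c, d) \<partial>lborel \<partial>lborel \<partial>lborel \<partial>lborel) ^ 3 \<le>
    (\<integral>\<^sup>+d. \<integral>\<^sup>+c. \<integral>\<^sup>+b. f1 (b, c, d) \<partial>lborel \<partial>lborel \<partial>lborel) *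
    (\<integral>\<^sup>+d. \<integral>\<^sup>+c. \<integral>\<^sup>+a. f2 (a, c, d) \<partial>lborel \<partial>lborel \<partial>lborel) *
    (\<integral>\<^sup>+d. \<integral>\<^sup>+b. \<integral>\<^sup>+a. f3 (a, b, d) \<partial>lborel \<partial>lborel \<partial>lborel) *
    (\<integral>\<^sup>+c. \<integral>\<^sup>+b. \<integral>\<^sup>+a. f4 (a, b, c) \<partial>lborel \<partial>lborel \<partial>lborel)"
proof -
  define H1 where "H1 b c d = (\<integral>\<^sup>+a. h (a, b, c, d) \<partial>lborel)" for b c d
  define H2 where "H2 c d = (\<integral>\<^sup>+b. H1 b c d \<partial>lborel)" for c d
  define H3 where "H3 d = (\<integral>\<^sup>+c. H2 c d \<partial>lborel)" for d
  define F2 where "F2 c d = (\<integral>\<^sup>+a. f2 (a, c, d) \<partial>lborel)" for c d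
  define F3 where "F3 b d = (\<integral>\<^sup>+a. f3 (a, b, d) \<partial>lborel)" for b d
  define F4 where "F4 b c = (\<integral>\<^sup>+a. f4 (a, b, c) \<partial>lborel)" for b c
  define G1 where "G1 c d = (\<integral>\<^sup>+b. f1 (b, c, d) \<partial>lborel)" for c d
  define G3 where "G3 d = (\<integral>\<^sup>+b. F3 b d \<partial>lborel)" for d
  define G4 where "G4 c = (\<integral>\<^sup>+b. F4 b c \<partial>lborel)" for c
  define P1 where "P1 d = (\<integral>\<^sup>+c. G1 c d \<partial>lborel)" for d
  define P2 where "P2 d = (\<integral>\<^sup>+c. F2 c d \<partial>lborel)" for d
  define P4 where "P4 = (\<integral>\<^sup>+c. G4 c \<partial>lborel)"
  have 1: "H1 b c d ^ 3 \<le> f1 (b, c, d) * F2 c d * F3 b d * F4 b c" for b c d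
  proof -
    have "H1 b c d ^ 3 \<le> (\<integral>\<^sup>+a. f1 (b, c, d) * f2 (a, c, d) \<partial>lborel) * F3 b d * F4 b c"
      unfolding H1_def F3_def F4_def by (rule Holder_3) (use le in measurable)
    then show ?thesis by (simp add: F2_def nn_integral_cmult)
  qed
  have [measurable]: "(\<lambda>(b, c, d). H1 b c d) \<in> borel_measurable (borel \<Otimes>\<^sub>M borel \<Otimes>\<^sub>M borel)"
    unfolding H1_def by measurable
  have [measurable]: "case_prod F2 \<in> borel_measurable (borel \<Otimes>\<^sub>M borel)"
     "case_prod F3 \<in> borel_measurable (borel \<Otimes>\<^sub>M borel)" "case_prod F4 \<in> borel_measurable (borel \<Otimes>\<^sub>M borel)"
     "case_prod G1 \<in> borel_measurable (borel \<Otimes>\<^sub>M borel)"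
    unfolding F2_def F3_def F4_def G1_def by measurable
  have [measurable]: "(\<lambda>b. H1 b c d) \<in> borel_measurable borel" for c d
    unfolding H1_def by measurable
  have 2: "H2 c d ^ 3 \<le> F2 c d * G1 c d * G3 d * G4 c" for c d
  proof -
    have "H2 c d ^ 3 \<le> (\<integral>\<^sup>+b. F2 c d * f1 (b, c, d) \<partial>lborel) * G3 d * G4 c"
      unfolding H2_def G3_def G4_def
      by (rule Holder_3) (use 1[of _ c d] in \<open>measurable, simp add: mult_ac\<close>)
    then show ?thesis by (simp add: G1_def nn_integral_cmult)
  qed
  have [measurable]: "case_prod H2 \<in> borel_measurable (borel \<Otimes>\<^sub>M borel)"
    unfolding H2_def H1_def by measurable
  have [measurable]: "G3 \<in> borel_measurable borel" "G4 \<in> borel_measurable borel"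
    "P1 \<in> borel_measurable borel" "P2 \<in> borel_measurable borel" "H3 \<in> borel_measurable borel"
    unfolding G3_def G4_def P1_def P2_def H3_def by measurable
  have 3: "H3 d ^ 3 \<le> G3 d * P2 d * P1 d * P4" for d
  proof -
    have "H3 d ^ 3 \<le> (\<integral>\<^sup>+c. G3 d * F2 c d \<partial>lborel) * P1 d * P4"
      unfolding H3_def P1_def P4_def
      by (rule Holder_3) (use 2[of _ d] in \<open>measurable, simp add: mult_ac\<close>)
    then show ?thesis by (simp add: P2_def nn_integral_cmult)
  qed
  have "(\<integral>\<^sup>+d. H3 d \<partial>lborel) ^ 3 \<le> (\<integral>\<^sup>+d. P4 * G3 d \<partial>lborel) * (\<integral>\<^sup>+d. P2 d \<partial>lborel) * (\<integral>\<^sup>+d. P1 d \<partial>lborel)"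
    by (rule Holder_3) (use 3 in \<open>measurable, simp add: mult_ac\<close>)
  then have "(\<integral>\<^sup>+d. H3 d \<partial>lborel) ^ 3 \<le> (\<integral>\<^sup>+d. P1 d \<partial>lborel) * (\<integral>\<^sup>+d. P2 d \<partial>lborel) * (\<integral>\<^sup>+d. G3 d \<partial>lborel) * P4"
    by (simp add: nn_integral_cmult mult_ac)
  then show ?thesis
    unfolding H3_def H2_def H1_def P1_def P2_def P4_def G1_def G3_def G4_def F2_def F3_def F4_def .
qed

section \<open>Oblique coordinates\<close>

lemma nn_integral_euclidean_affine:
  fixes f :: "'a::euclidean_space \<Rightarrow> ennreal"
  assumes [measurable]: "f \<in> borel_measurable borel" and "c \<noteq> 0"
  shows "(\<integral>\<^sup>+x. f x \<partial>lborel) = ennreal (\<bar>c\<bar> ^ DIM('a)) * (\<integral>\<^sup>+x. f (t + c *\<^sub>R x) \<partial>lborel)"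
  by (subst lborel_affine[OF assms(2), of t])
     (simp add: nn_integral_density nn_integral_distr nn_integral_cmult)

lemma nn_integral_prod:
  fixes f :: "'a::euclidean_space \<times> 'b::euclidean_space \<Rightarrow> ennreal"
  assumes "f \<in> borel_measurable borel"
  shows "(\<integral>\<^sup>+x. f x \<partial>lborel) = (\<integral>\<^sup>+y. \<integral>\<^sup>+x. f (x, y) \<partial>lborel \<partial>lborel)"
proof -
  have "f \<in> borel_measurable (lborel \<Otimes>\<^sub>M lborel)" using assms by (simp add: lborel_prod)
  from lborel_pair.nn_integral_snd[OF this] show ?thesis by (simp add: lborel_prod)
qed

lemma nn_integral_swap:
  fixes f :: "'a::euclidean_space \<Rightarrow> 'b::euclidean_space \<Rightarrow> ennreal"
  assumes "case_prod f \<in> borel_measurable borel"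
  shows "(\<integral>\<^sup>+y. \<integral>\<^sup>+x. f x y \<partial>lborel \<partial>lborel) = (\<integral>\<^sup>+x. \<integral>\<^sup>+y. f x y \<partial>lborel \<partial>lborel)"
  by (rule lborel_pair.Fubini') (use assms in \<open>simp add: lborel_prod\<close>)

lemma lborel_complex: "(lborel :: complex measure) = distr lborel borel (\<lambda>(a, b). Complex a b)"
proof (rule lborel_eqI)
  have [measurable]: "(\<lambda>(a, b). Complex a b) \<in> borel_measurable borel"
    unfolding case_prod_beta Complex_eq by (intro borel_measurable_continuous_onI continuous_intros)
  fix l u :: complex
  assume le: "\<And>b. b \<in> Basis \<Longrightarrow> l \<bullet> b \<le> u \<bullet> b"
  have le': "Re l \<le> Re u" "Im l \<le> Im u" using le[of 1] le[of \<i>] by (auto simp: Basis_complex_def)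
  have "(\<lambda>(a, b). Complex a b) -` box l u = box (Re l, Im l) (Re u, Im u)"
    by (auto simp: box_def Basis_complex_def Basis_prod_def)
  then have "emeasure (distr lborel borel (\<lambda>(a, b). Complex a b)) (box l u) =
      emeasure lborel (box (Re l, Im l) (Re u, Im u))"
    by (subst emeasure_distr) auto
  also have "\<dots> = (\<Prod>b\<in>Basis. (u - l) \<bullet> b)"
    using le' by (subst emeasure_lborel_box_eq) (auto simp: Basis_prod_def Basis_complex_def prod.union_disjoint prod.insert_if complex_eq_iff)
  finally show "emeasure (distr lborel borel (\<lambda>(a, b). Complex a b)) (box l u) = (\<Prod>b\<in>Basis. (u - l) \<bullet> b)" .
qed simp

lemma nn_integral_complex:
  fixes f :: "complex \<Rightarrow> ennreal"
  assumes [measurable]: "f \<in> borel_measurable borel"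
  shows "(\<integral>\<^sup>+z. f z \<partial>lborel) = (\<integral>\<^sup>+b. \<integral>\<^sup>+a. f (Complex a b) \<partial>lborel \<partial>lborel)"
proof -
  have m [measurable]: "(\<lambda>(a, b). Complex a b) \<in> borel_measurable borel"
    unfolding case_prod_beta Complex_eq by (intro borel_measurable_continuous_onI continuous_intros)
  have "(\<integral>\<^sup>+z. f z \<partial>lborel) = (\<integral>\<^sup>+x. f (case x of (a, b) \<Rightarrow> Complex a b) \<partial>lborel)"
    by (subst lborel_complex) (simp add: nn_integral_distr)
  also have "\<dots> = (\<integral>\<^sup>+b. \<integral>\<^sup>+a. f (case (a, b) of (a, b) \<Rightarrow> Complex a b) \<partial>lborel \<partial>lborel)"
    by (rule nn_integral_prod) measurable
  finally show ?thesis by simp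
qed

lemma nn_integral_C2:
  fixes F :: "complex \<times> complex \<Rightarrow> ennreal"
  assumes [measurable]: "F \<in> borel_measurable borel"
  shows "(\<integral>\<^sup>+x. F x \<partial>lborel) =
    (\<integral>\<^sup>+y. \<integral>\<^sup>+a. (case y of (b, c, d) \<Rightarrow> F (Complex a b, Complex c d)) \<partial>lborel \<partial>lborel)"
proof -
  have [measurable]: "(\<lambda>(y :: real \<times> real \<times> real, a). (Complex a (fst y), Complex (fst (snd y)) (snd (snd y))))
      \<in> borel_measurable borel"
    unfolding case_prod_beta Complex_eq by (intro borel_measurable_continuous_onI continuous_intros)
  have [measurable]: "(\<lambda>z. (z, Complex c d)) \<in> borel_measurable borel" for c d
    by (intro borel_measurable_continuous_onI continuous_intros)
  have [measurable]: "(\<lambda>(a, b). Complex a b) \<in> borel_measurable borel"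
    unfolding case_prod_beta Complex_eq by (intro borel_measurable_continuous_onI continuous_intros)
  define k where "k y = (\<integral>\<^sup>+a. (case y of (b, c, d) \<Rightarrow> F (Complex a b, Complex c d)) \<partial>lborel)" for y :: "real \<times> real \<times> real"
  have "(\<lambda>p. F (case p of (y :: real \<times> real \<times> real, a) \<Rightarrow> (Complex a (fst y), Complex (fst (snd y)) (snd (snd y))))) \<in> borel_measurable borel"
    by measurable
  then have "(\<lambda>(y :: real \<times> real \<times> real, a). case y of (b, c, d) \<Rightarrow> F (Complex a b, Complex c d))
      \<in> borel_measurable (lborel \<Otimes>\<^sub>M lborel)"
    by (simp add: lborel_prod case_prod_beta)
  then have "k \<in> borel_measurable lborel"
    unfolding k_def by (rule lborel.borel_measurable_nn_integral)
  then have k [measurable]: "k \<in> borel_measurable borel" by simp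
  have "(\<integral>\<^sup>+x. F x \<partial>lborel) = (\<integral>\<^sup>+w. \<integral>\<^sup>+z. F (z, w) \<partial>lborel \<partial>lborel)"
    by (rule nn_integral_prod) measurable
  also have "\<dots> = (\<integral>\<^sup>+d. \<integral>\<^sup>+c. \<integral>\<^sup>+z. F (z, Complex c d) \<partial>lborel \<partial>lborel \<partial>lborel)"
  proof (rule nn_integral_complex)
    have "F \<in> borel_measurable (lborel \<Otimes>\<^sub>M lborel)" by (simp add: lborel_prod)
    then show "(\<lambda>w. \<integral>\<^sup>+z. F (z, w) \<partial>lborel) \<in> borel_measurable borel" by measurable
  qed
  also have "\<dots> = (\<integral>\<^sup>+d. \<integral>\<^sup>+c. \<integral>\<^sup>+b. \<integral>\<^sup>+a. F (Complex a b, Complex c d) \<partial>lborel \<partial>lborel \<partial>lborel \<partial>lborel)"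
    by (intro nn_integral_cong nn_integral_complex) measurable
  also have "\<dots> = (\<integral>\<^sup>+d. \<integral>\<^sup>+c. \<integral>\<^sup>+b. k (b, c, d) \<partial>lborel \<partial>lborel \<partial>lborel)"
    by (simp add: k_def)
  also have "\<dots> = (\<integral>\<^sup>+y. \<integral>\<^sup>+b. k (b, y) \<partial>lborel \<partial>lborel)"
  proof (rule nn_integral_prod[symmetric])
    have "k \<in> borel_measurable (lborel \<Otimes>\<^sub>M lborel)" by (simp add: lborel_prod)
    then show "(\<lambda>y. \<integral>\<^sup>+b. k (b, y) \<partial>lborel) \<in> borel_measurable borel" by measurable
  qed
  also have "\<dots> = (\<integral>\<^sup>+y. k y \<partial>lborel)"
    by (rule nn_integral_prod[symmetric]) measurable
  finally show ?thesis by (simp add: k_def)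
qed

text \<open>
  The linear coordinates with respect to the four vectors \<open>v + \<rho> b\<close>, where \<open>b\<close> runs through the standard
  basis.  For small \<open>\<rho>\<close> these vectors are all close to \<open>v\<close>.
\<close>
definition oblique :: "complex \<times> complex \<Rightarrow> real \<Rightarrow> real \<times> real \<times> real \<times> real \<Rightarrow> complex \<times> complex" where
  "oblique v \<rho> = (\<lambda>(a, b, c, d). \<rho> *\<^sub>R (Complex a b, Complex c d) + (a + b + c + d) *\<^sub>R v)"

lemma oblique_continuous: "continuous_on UNIV (oblique v \<rho>)"
  unfolding oblique_def case_prod_beta Complex_eq by (intro continuous_intros)

text \<open>
  The matrix is \<open>\<rho>\<close> times the identity plus a matrix of rank one, with determinant
  \<open>\<rho>\<^sup>3 (\<rho> + \<Sum> v\<^sub>i)\<close>.  The change of variables is carried out with one-dimensional substitutions: with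
  the sum \<open>S\<close> of the coordinates as a new first variable, the other three are shifted by multiples of
  \<open>S\<close>, and at last \<open>S\<close> itself is rescaled.
\<close>
lemma nn_integral_oblique:
  fixes F :: "complex \<times> complex \<Rightarrow> ennreal"
  assumes F [measurable]: "F \<in> borel_measurable borel" and \<rho>: "0 < \<rho>" "\<rho> + v \<bullet> One \<noteq> 0"
  shows "(\<integral>\<^sup>+x. F x \<partial>lborel) =
    ennreal (\<bar>\<rho> + v \<bullet> One\<bar> * \<rho> ^ 3) * (\<integral>\<^sup>+y. \<integral>\<^sup>+a. F (oblique v \<rho> (a, y)) \<partial>lborel \<partial>lborel)"
proof -
  define \<alpha> where "\<alpha> = (Im (fst v), Re (snd v), Im (snd v))"
  define \<alpha>1 where "\<alpha>1 = Re (fst v)"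
  define t where "t y = fst y + fst (snd y) + snd (snd y)" for y :: "real \<times> real \<times> real"
  define F' where "F' p y = F (Complex p (fst y), Complex (fst (snd y)) (snd (snd y)))"
    for p and y :: "real \<times> real \<times> real"
  have One: "v \<bullet> One = \<alpha>1 + t \<alpha>"
    by (simp add: \<alpha>1_def \<alpha>_def t_def inner_sum_right[symmetric] sum.union_disjoint Basis_prod_def Basis_complex_def
        prod_eq_iff inner_prod_def inner_complex_def sum.insert_if complex_eq_iff)
  have Fm: "(\<lambda>x. F (\<phi> x)) \<in> borel_measurable borel" if "continuous_on UNIV \<phi>" for \<phi> :: "'b::euclidean_space \<Rightarrow> _"
    using borel_measurable_continuous_onI[OF that] by measurable
  have ob: "F (oblique v \<rho> (a, y)) = F' (\<rho> * a + (a + t y) * \<alpha>1) (\<rho> *\<^sub>R y + (a + t y) *\<^sub>R \<alpha>)" for a y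
    unfolding oblique_def F'_def \<alpha>_def \<alpha>1_def t_def
    by (intro arg_cong[of _ _ F]) (auto simp: case_prod_beta prod_eq_iff complex_eq_iff algebra_simps)
  define \<Phi> where "\<Phi> S y = F' ((\<rho> + v \<bullet> One) * S - t y) y" for S and y :: "real \<times> real \<times> real"
  have \<Phi>_eq: "F' (\<rho> * (S - t y) + S * \<alpha>1) (\<rho> *\<^sub>R y + S *\<^sub>R \<alpha>) = \<Phi> S (S *\<^sub>R \<alpha> + \<rho> *\<^sub>R y)" for S y
    unfolding \<Phi>_def One by (simp add: t_def algebra_simps)
  have "(\<integral>\<^sup>+a. F (oblique v \<rho> (a, y)) \<partial>lborel) = (\<integral>\<^sup>+S. \<Phi> S (S *\<^sub>R \<alpha> + \<rho> *\<^sub>R y) \<partial>lborel)" for y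
  proof -
    have "(\<lambda>S. \<Phi> S (S *\<^sub>R \<alpha> + \<rho> *\<^sub>R y)) \<in> borel_measurable borel"
      unfolding \<Phi>_def F'_def t_def by (rule Fm) (auto simp: Complex_eq intro!: continuous_intros)
    from nn_integral_lborel_shift[OF this, of "t y"]
    have "(\<integral>\<^sup>+S. \<Phi> S (S *\<^sub>R \<alpha> + \<rho> *\<^sub>R y) \<partial>lborel) =
        (\<integral>\<^sup>+a. \<Phi> (t y + a) ((t y + a) *\<^sub>R \<alpha> + \<rho> *\<^sub>R y) \<partial>lborel)" ..
    also have "\<dots> = (\<integral>\<^sup>+a. F (oblique v \<rho> (a, y)) \<partial>lborel)"
      unfolding ob \<Phi>_eq[symmetric] by (simp add: add.commute)
    finally show ?thesis ..
  qed
  then have "(\<integral>\<^sup>+y. \<integral>\<^sup>+a. F (oblique v \<rho> (a, y)) \<partial>lborel \<partial>lborel) =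
      (\<integral>\<^sup>+y. \<integral>\<^sup>+S. \<Phi> S (S *\<^sub>R \<alpha> + \<rho> *\<^sub>R y) \<partial>lborel \<partial>lborel)" by simp
  also have "\<dots> = (\<integral>\<^sup>+S. \<integral>\<^sup>+y. \<Phi> S (S *\<^sub>R \<alpha> + \<rho> *\<^sub>R y) \<partial>lborel \<partial>lborel)"
    by (rule nn_integral_swap)
       (unfold \<Phi>_def F'_def t_def case_prod_beta, rule Fm, auto simp: Complex_eq intro!: continuous_intros)
  also have "ennreal (\<rho> ^ 3) * \<dots> = (\<integral>\<^sup>+S. ennreal (\<rho> ^ 3) * (\<integral>\<^sup>+y. \<Phi> S (S *\<^sub>R \<alpha> + \<rho> *\<^sub>R y) \<partial>lborel) \<partial>lborel)"
  proof (rule nn_integral_cmult[symmetric])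
    have "(\<lambda>p. \<Phi> (fst p) (fst p *\<^sub>R \<alpha> + \<rho> *\<^sub>R snd p)) \<in> borel_measurable borel"
      unfolding \<Phi>_def F'_def t_def by (rule Fm) (auto simp: Complex_eq intro!: continuous_intros)
    then have "(\<lambda>(S, y). \<Phi> S (S *\<^sub>R \<alpha> + \<rho> *\<^sub>R y)) \<in> borel_measurable (lborel \<Otimes>\<^sub>M lborel)"
      by (simp add: lborel_prod case_prod_beta)
    then show "(\<lambda>S. \<integral>\<^sup>+y. \<Phi> S (S *\<^sub>R \<alpha> + \<rho> *\<^sub>R y) \<partial>lborel) \<in> borel_measurable lborel"
      by (rule lborel.borel_measurable_nn_integral)
  qed
  also have "\<dots> = (\<integral>\<^sup>+S. \<integral>\<^sup>+y. \<Phi> S y \<partial>lborel \<partial>lborel)"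
  proof (rule nn_integral_cong)
    fix S
    have "\<Phi> S \<in> borel_measurable borel"
      unfolding \<Phi>_def F'_def t_def by (rule Fm) (auto simp: Complex_eq intro!: continuous_intros)
    from nn_integral_euclidean_affine[OF this, of \<rho> "S *\<^sub>R \<alpha>"] \<rho>
    show "ennreal (\<rho> ^ 3) * (\<integral>\<^sup>+y. \<Phi> S (S *\<^sub>R \<alpha> + \<rho> *\<^sub>R y) \<partial>lborel) = (\<integral>\<^sup>+y. \<Phi> S y \<partial>lborel)"
      by (simp add: power3_eq_cube mult.assoc)
  qed
  also have "\<dots> = (\<integral>\<^sup>+y. \<integral>\<^sup>+S. \<Phi> S y \<partial>lborel \<partial>lborel)"
    by (rule nn_integral_swap[symmetric])
       (unfold \<Phi>_def F'_def t_def case_prod_beta, rule Fm, auto simp: Complex_eq intro!: continuous_intros)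
  finally have eq: "ennreal (\<rho> ^ 3) * (\<integral>\<^sup>+y. \<integral>\<^sup>+a. F (oblique v \<rho> (a, y)) \<partial>lborel \<partial>lborel) =
      (\<integral>\<^sup>+y. \<integral>\<^sup>+S. \<Phi> S y \<partial>lborel \<partial>lborel)" .
  have "(\<integral>\<^sup>+x. F x \<partial>lborel) = (\<integral>\<^sup>+y. \<integral>\<^sup>+a. F' a y \<partial>lborel \<partial>lborel)"
    unfolding nn_integral_C2[OF F] F'_def by (simp add: case_prod_beta)
  also have "\<dots> = (\<integral>\<^sup>+y. ennreal \<bar>\<rho> + v \<bullet> One\<bar> * (\<integral>\<^sup>+S. \<Phi> S y \<partial>lborel) \<partial>lborel)"
  proof (rule nn_integral_cong)
    fix y :: "real \<times> real \<times> real"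
    have "(\<lambda>a. F' a y) \<in> borel_measurable borel"
      unfolding F'_def by (rule Fm) (auto simp: Complex_eq intro!: continuous_intros)
    from nn_integral_real_affine[OF this \<rho>(2), of "- t y"]
    show "(\<integral>\<^sup>+a. F' a y \<partial>lborel) = ennreal \<bar>\<rho> + v \<bullet> One\<bar> * (\<integral>\<^sup>+S. \<Phi> S y \<partial>lborel)"
      by (simp add: \<Phi>_def)
  qed
  also have "\<dots> = ennreal \<bar>\<rho> + v \<bullet> One\<bar> * (\<integral>\<^sup>+y. \<integral>\<^sup>+S. \<Phi> S y \<partial>lborel \<partial>lborel)"
  proof (rule nn_integral_cmult)
    have "(\<lambda>p. \<Phi> (snd p) (fst p)) \<in> borel_measurable borel"
      unfolding \<Phi>_def F'_def t_def by (rule Fm) (auto simp: Complex_eq intro!: continuous_intros)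
    then have "(\<lambda>(y, S). \<Phi> S y) \<in> borel_measurable (lborel \<Otimes>\<^sub>M lborel)"
      by (simp add: lborel_prod case_prod_beta)
    then show "(\<lambda>y. \<integral>\<^sup>+S. \<Phi> S y \<partial>lborel) \<in> borel_measurable lborel"
      by (rule lborel.borel_measurable_nn_integral)
  qed
  finally show ?thesis
    using \<rho>(1) unfolding eq[symmetric] by (simp add: ennreal_mult mult.assoc)
qed

lemma nn_integral_real3:
  fixes k :: "real \<times> real \<times> real \<Rightarrow> ennreal"
  assumes [measurable]: "k \<in> borel_measurable borel"
  shows "(\<integral>\<^sup>+y. k y \<partial>lborel) = (\<integral>\<^sup>+d. \<integral>\<^sup>+c. \<integral>\<^sup>+b. k (b, c, d) \<partial>lborel \<partial>lborel \<partial>lborel)"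
proof -
  have "(\<integral>\<^sup>+y. k y \<partial>lborel) = (\<integral>\<^sup>+y. \<integral>\<^sup>+b. k (b, y) \<partial>lborel \<partial>lborel)"
    by (rule nn_integral_prod) measurable
  also have "\<dots> = (\<integral>\<^sup>+d. \<integral>\<^sup>+c. \<integral>\<^sup>+b. k (b, c, d) \<partial>lborel \<partial>lborel \<partial>lborel)"
  proof (rule nn_integral_prod)
    have "k \<in> borel_measurable (lborel \<Otimes>\<^sub>M lborel)" by (simp add: lborel_prod)
    then show "(\<lambda>y. \<integral>\<^sup>+b. k (b, y) \<partial>lborel) \<in> borel_measurable borel" by measurable
  qed
  finally show ?thesis .
qed

lemma Basis_C2: "(Basis :: (complex \<times> complex) set) = {(1, 0), (\<i>, 0), (0, 1), (0, \<i>)}"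
  by (auto simp: Basis_prod_def Basis_complex_def)

lemma prod_Basis_C2:
  fixes f :: "complex \<times> complex \<Rightarrow> ennreal"
  shows "(\<Prod>b\<in>Basis. f b) = f (1, 0) * f (\<i>, 0) * f (0, 1) * f (0, \<i>)"
  by (simp add: Basis_C2 prod.insert_if complex_eq_iff mult.assoc)

text \<open>
  The Loomis-Whitney inequality in oblique coordinates.  The integral of \<open>G b\<close> along the line through \<open>x\<close>
  in direction \<open>v + \<rho> b\<close> depends on the other three oblique coordinates of \<open>x\<close> only.
\<close>
lemma frame_loomis_whitney:
  fixes h :: "complex \<times> complex \<Rightarrow> ennreal" and G :: "complex \<times> complex \<Rightarrow> complex \<times> complex \<Rightarrow> ennreal"
  assumes h [measurable]: "h \<in> borel_measurable borel" and G: "\<And>b. b \<in> Basis \<Longrightarrow> G b \<in> borel_measurable borel"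
    and \<rho>: "0 < \<rho>" "\<rho> + v \<bullet> One \<noteq> 0"
    and le: "\<And>x. h x ^ 3 \<le> (\<Prod>b\<in>Basis. \<integral>\<^sup>+t. G b (x + t *\<^sub>R (v + \<rho> *\<^sub>R b)) \<partial>lborel)"
  shows "(\<integral>\<^sup>+x. h x \<partial>lborel) ^ 3 \<le>
    ennreal (1 / (\<bar>\<rho> + v \<bullet> One\<bar> * \<rho> ^ 3)) * (\<Prod>b\<in>Basis. \<integral>\<^sup>+x. G b x \<partial>lborel)"
proof -
  define \<kappa> where "\<kappa> = \<bar>\<rho> + v \<bullet> One\<bar> * \<rho> ^ 3"
  have \<kappa>: "0 < \<kappa>" using \<rho> by (simp add: \<kappa>_def)
  let ?b1 = "(1, 0) :: complex \<times> complex" and ?b2 = "(\<i>, 0) :: complex \<times> complex"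
  let ?b3 = "(0, 1) :: complex \<times> complex" and ?b4 = "(0, \<i>) :: complex \<times> complex"
  define L where "L = oblique v \<rho>"
  have Lm [measurable]: "L \<in> borel_measurable borel"
    unfolding L_def by (rule borel_measurable_continuous_onI[OF oblique_continuous])
  have Gm [measurable]: "G ?b1 \<in> borel_measurable borel" "G ?b2 \<in> borel_measurable borel"
      "G ?b3 \<in> borel_measurable borel" "G ?b4 \<in> borel_measurable borel"
    using G by (auto simp: Basis_C2)
  have L_shift: "L (a, b, c, d) + t *\<^sub>R (v + \<rho> *\<^sub>R ?b1) = L (a + t, b, c, d)"
       "L (a, b, c, d) + t *\<^sub>R (v + \<rho> *\<^sub>R ?b2) = L (a, b + t, c, d)"
       "L (a, b, c, d) + t *\<^sub>R (v + \<rho> *\<^sub>R ?b3) = L (a, b, c + t, d)"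
       "L (a, b, c, d) + t *\<^sub>R (v + \<rho> *\<^sub>R ?b4) = L (a, b, c, d + t)" for a b c d t
    by (auto simp: L_def oblique_def prod_eq_iff complex_eq_iff algebra_simps)
  define f1 where "f1 = (\<lambda>(b, c, d). \<integral>\<^sup>+a. G ?b1 (L (a, b, c, d)) \<partial>lborel)"
  define f2 where "f2 = (\<lambda>(a, c, d). \<integral>\<^sup>+b. G ?b2 (L (a, b, c, d)) \<partial>lborel)"
  define f3 where "f3 = (\<lambda>(a, b, d). \<integral>\<^sup>+c. G ?b3 (L (a, b, c, d)) \<partial>lborel)"
  define f4 where "f4 = (\<lambda>(a, b, c). \<integral>\<^sup>+d. G ?b4 (L (a, b, c, d)) \<partial>lborel)"
  have Gcont: "(\<lambda>x. F (L (\<phi> x))) \<in> borel_measurable borel"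
    if "F \<in> borel_measurable borel" "continuous_on UNIV \<phi>"
    for \<phi> :: "'b::euclidean_space \<Rightarrow> _" and F :: "_ \<Rightarrow> ennreal"
    using borel_measurable_continuous_onI[OF that(2)] that(1) by measurable
  have fm_aux: "(\<lambda>y. \<integral>\<^sup>+s. F (L (\<phi> y s)) \<partial>lborel) \<in> borel_measurable borel"
    if "F \<in> borel_measurable borel" "continuous_on UNIV (\<lambda>p. \<phi> (fst p) (snd p))"
    for F :: "_ \<Rightarrow> ennreal" and \<phi> :: "'b::euclidean_space \<Rightarrow> 'c::euclidean_space \<Rightarrow> _"
  proof -
    have "(\<lambda>(y, s). F (L (\<phi> y s))) \<in> borel_measurable (lborel \<Otimes>\<^sub>M lborel)"
      using Gcont[OF that] by (simp add: lborel_prod case_prod_beta)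
    then have "(\<lambda>y. \<integral>\<^sup>+s. F (L (\<phi> y s)) \<partial>lborel) \<in> borel_measurable lborel"
      by (rule lborel.borel_measurable_nn_integral)
    then show ?thesis by simp
  qed
  have fm: "f1 \<in> borel_measurable borel" "f2 \<in> borel_measurable borel" "f3 \<in> borel_measurable borel" "f4 \<in> borel_measurable borel"
    unfolding f1_def f2_def f3_def f4_def case_prod_beta
    by (rule fm_aux, use Gm in simp, intro continuous_intros)+
  have shift: "(\<integral>\<^sup>+t. F (s + t) \<partial>lborel) = (\<integral>\<^sup>+t. F t \<partial>lborel)" if "F \<in> borel_measurable borel" for F :: "real \<Rightarrow> ennreal" and s
    by (rule nn_integral_lborel_shift[OF that])
  have line: "(\<integral>\<^sup>+t. G ?b1 (L (a, b, c, d) + t *\<^sub>R (v + \<rho> *\<^sub>R ?b1)) \<partial>lborel) = f1 (b, c, d)"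
    "(\<integral>\<^sup>+t. G ?b2 (L (a, b, c, d) + t *\<^sub>R (v + \<rho> *\<^sub>R ?b2)) \<partial>lborel) = f2 (a, c, d)"
    "(\<integral>\<^sup>+t. G ?b3 (L (a, b, c, d) + t *\<^sub>R (v + \<rho> *\<^sub>R ?b3)) \<partial>lborel) = f3 (a, b, d)"
    "(\<integral>\<^sup>+t. G ?b4 (L (a, b, c, d) + t *\<^sub>R (v + \<rho> *\<^sub>R ?b4)) \<partial>lborel) = f4 (a, b, c)" for a b c d
    unfolding L_shift f1_def f2_def f3_def f4_def prod.case
    by (rule shift[of "\<lambda>a. G ?b1 (L (a, b, c, d))"] shift[of "\<lambda>b. G ?b2 (L (a, b, c, d))"]
          shift[of "\<lambda>c. G ?b3 (L (a, b, c, d))"] shift[of "\<lambda>d. G ?b4 (L (a, b, c, d))"],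
        rule Gcont, use Gm in simp, intro continuous_intros)+
  have I: "(\<integral>\<^sup>+x. F x \<partial>lborel) =
      ennreal \<kappa> * (\<integral>\<^sup>+d. \<integral>\<^sup>+c. \<integral>\<^sup>+b. \<integral>\<^sup>+a. F (L (a, b, c, d)) \<partial>lborel \<partial>lborel \<partial>lborel \<partial>lborel)"
    if F: "F \<in> borel_measurable borel" for F
  proof -
    have "(\<lambda>y. \<integral>\<^sup>+a. F (L (a, y)) \<partial>lborel) \<in> borel_measurable borel"
      by (rule fm_aux[OF F]) (intro continuous_intros)
    from nn_integral_real3[OF this] nn_integral_oblique[OF F \<rho>] show ?thesis
      by (simp add: \<kappa>_def L_def)
  qed
  have swap_aux: "(\<integral>\<^sup>+y. \<integral>\<^sup>+x. k x y \<partial>lborel \<partial>lborel) = (\<integral>\<^sup>+x. \<integral>\<^sup>+y. k x y \<partial>lborel \<partial>lborel)"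
    if "(\<lambda>p. k (fst p) (snd p)) \<in> borel_measurable borel" for k :: "real \<Rightarrow> real \<Rightarrow> ennreal"
    by (rule nn_integral_swap) (use that in \<open>simp add: case_prod_beta\<close>)
  have J1: "ennreal \<kappa> * (\<integral>\<^sup>+d. \<integral>\<^sup>+c. \<integral>\<^sup>+b. f1 (b, c, d) \<partial>lborel \<partial>lborel \<partial>lborel) = (\<integral>\<^sup>+x. G ?b1 x \<partial>lborel)"
    unfolding I[OF Gm(1)] f1_def by simp
  have "(\<integral>\<^sup>+a. f2 (a, c, d) \<partial>lborel) = (\<integral>\<^sup>+b. \<integral>\<^sup>+a. G ?b2 (L (a, b, c, d)) \<partial>lborel \<partial>lborel)" for c d
    unfolding f2_def prod.case by (rule swap_aux, rule Gcont[OF Gm(2)]) (intro continuous_intros)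
  then have J2: "ennreal \<kappa> * (\<integral>\<^sup>+d. \<integral>\<^sup>+c. \<integral>\<^sup>+a. f2 (a, c, d) \<partial>lborel \<partial>lborel \<partial>lborel) = (\<integral>\<^sup>+x. G ?b2 x \<partial>lborel)"
    unfolding I[OF Gm(2)] by simp
  have "(\<integral>\<^sup>+b. \<integral>\<^sup>+a. f3 (a, b, d) \<partial>lborel \<partial>lborel) =
      (\<integral>\<^sup>+c. \<integral>\<^sup>+b. \<integral>\<^sup>+a. G ?b3 (L (a, b, c, d)) \<partial>lborel \<partial>lborel \<partial>lborel)" for d
  proof -
    have "(\<integral>\<^sup>+a. f3 (a, b, d) \<partial>lborel) = (\<integral>\<^sup>+c. \<integral>\<^sup>+a. G ?b3 (L (a, b, c, d)) \<partial>lborel \<partial>lborel)" for b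
      unfolding f3_def prod.case by (rule swap_aux, rule Gcont[OF Gm(3)]) (intro continuous_intros)
    then have "(\<integral>\<^sup>+b. \<integral>\<^sup>+a. f3 (a, b, d) \<partial>lborel \<partial>lborel) =
        (\<integral>\<^sup>+b. \<integral>\<^sup>+c. \<integral>\<^sup>+a. G ?b3 (L (a, b, c, d)) \<partial>lborel \<partial>lborel \<partial>lborel)" by simp
    also have "\<dots> = (\<integral>\<^sup>+c. \<integral>\<^sup>+b. \<integral>\<^sup>+a. G ?b3 (L (a, b, c, d)) \<partial>lborel \<partial>lborel \<partial>lborel)"
      by (rule swap_aux, rule fm_aux[OF Gm(3)]) (intro continuous_intros)
    finally show ?thesis .
  qed
  then have J3: "ennreal \<kappa> * (\<integral>\<^sup>+d. \<integral>\<^sup>+b. \<integral>\<^sup>+a. f3 (a, b, d) \<partial>lborel \<partial>lborel \<partial>lborel) = (\<integral>\<^sup>+x. G ?b3 x \<partial>lborel)"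
    unfolding I[OF Gm(3)] by simp
  have "(\<integral>\<^sup>+c. \<integral>\<^sup>+b. \<integral>\<^sup>+a. f4 (a, b, c) \<partial>lborel \<partial>lborel \<partial>lborel) =
      (\<integral>\<^sup>+d. \<integral>\<^sup>+c. \<integral>\<^sup>+b. \<integral>\<^sup>+a. G ?b4 (L (a, b, c, d)) \<partial>lborel \<partial>lborel \<partial>lborel \<partial>lborel)"
  proof -
    have "(\<integral>\<^sup>+c. \<integral>\<^sup>+b. \<integral>\<^sup>+a. f4 (a, b, c) \<partial>lborel \<partial>lborel \<partial>lborel) = (\<integral>\<^sup>+y. f4 y \<partial>lborel)"
      by (rule nn_integral_real3[symmetric, OF fm(4)])
    also have "\<dots> = (\<integral>\<^sup>+y. \<integral>\<^sup>+d. G ?b4 (L (fst y, fst (snd y), snd (snd y), d)) \<partial>lborel \<partial>lborel)"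
      unfolding f4_def by (simp add: case_prod_beta)
    also have "\<dots> = (\<integral>\<^sup>+d. \<integral>\<^sup>+y. G ?b4 (L (fst y, fst (snd y), snd (snd y), d)) \<partial>lborel \<partial>lborel)"
      by (rule nn_integral_swap, unfold case_prod_beta, rule Gcont[OF Gm(4)]) (intro continuous_intros)
    also have "\<dots> = (\<integral>\<^sup>+d. \<integral>\<^sup>+c. \<integral>\<^sup>+b. \<integral>\<^sup>+a. G ?b4 (L (a, b, c, d)) \<partial>lborel \<partial>lborel \<partial>lborel \<partial>lborel)"
      by (intro nn_integral_cong, subst nn_integral_real3, rule Gcont[OF Gm(4)]) (auto intro!: continuous_intros)
    finally show ?thesis .
  qed
  then have J4: "ennreal \<kappa> * (\<integral>\<^sup>+c. \<integral>\<^sup>+b. \<integral>\<^sup>+a. f4 (a, b, c) \<partial>lborel \<partial>lborel \<partial>lborel) = (\<integral>\<^sup>+x. G ?b4 x \<partial>lborel)"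
    unfolding I[OF Gm(4)] by simp
  define X where "X = (\<integral>\<^sup>+d. \<integral>\<^sup>+c. \<integral>\<^sup>+b. \<integral>\<^sup>+a. h (L (a, b, c, d)) \<partial>lborel \<partial>lborel \<partial>lborel \<partial>lborel)"
  define X1 where "X1 = (\<integral>\<^sup>+d. \<integral>\<^sup>+c. \<integral>\<^sup>+b. f1 (b, c, d) \<partial>lborel \<partial>lborel \<partial>lborel)"
  define X2 where "X2 = (\<integral>\<^sup>+d. \<integral>\<^sup>+c. \<integral>\<^sup>+a. f2 (a, c, d) \<partial>lborel \<partial>lborel \<partial>lborel)"
  define X3 where "X3 = (\<integral>\<^sup>+d. \<integral>\<^sup>+b. \<integral>\<^sup>+a. f3 (a, b, d) \<partial>lborel \<partial>lborel \<partial>lborel)"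
  define X4 where "X4 = (\<integral>\<^sup>+c. \<integral>\<^sup>+b. \<integral>\<^sup>+a. f4 (a, b, c) \<partial>lborel \<partial>lborel \<partial>lborel)"
  have "X ^ 3 \<le> X1 * X2 * X3 * X4"
    unfolding X_def X1_def X2_def X3_def X4_def
  proof (rule loomis_whitney_4)
    show "(\<lambda>p. h (L p)) \<in> borel_measurable borel" by measurable
    show "h (L (a, b, c, d)) ^ 3 \<le> f1 (b, c, d) * f2 (a, c, d) * f3 (a, b, d) * f4 (a, b, c)" for a b c d
      using le[of "L (a, b, c, d)"] unfolding prod_Basis_C2 line .
  qed (rule fm)+
  then have "(ennreal \<kappa> * X) ^ 3 \<le> ennreal (\<kappa> ^ 3) * (X1 * X2 * X3 * X4)"
    using \<kappa> by (simp add: power_mult_distrib ennreal_power mult_left_mono)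
  also have "\<dots> = ennreal (1 / \<kappa>) * ((ennreal \<kappa> * X1) * (ennreal \<kappa> * X2) * (ennreal \<kappa> * X3) * (ennreal \<kappa> * X4))"
  proof -
    have "ennreal (\<kappa> ^ 3) = ennreal (1 / \<kappa>) * ennreal \<kappa> * ennreal \<kappa> * ennreal \<kappa> * ennreal \<kappa>"
      using \<kappa> by (simp add: ennreal_mult[symmetric] power3_eq_cube)
    then show ?thesis by (simp add: mult_ac)
  qed
  also have "\<dots> = ennreal (1 / \<kappa>) * (\<Prod>b\<in>Basis. \<integral>\<^sup>+x. G b x \<partial>lborel)"
    unfolding X1_def X2_def X3_def X4_def J1 J2 J3 J4 prod_Basis_C2 ..
  finally show ?thesis
    unfolding I[OF h] X_def \<kappa>_def .
qed


section \<open>The Sobolev inequality\<close>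

lemma prod_mono_ennreal:
  fixes f g :: "'a \<Rightarrow> ennreal"
  shows "(\<And>i. i \<in> A \<Longrightarrow> f i \<le> g i) \<Longrightarrow> prod f A \<le> prod g A"
  by (induction A rule: infinite_finite_induct) (auto intro: mult_mono)

text \<open>
  A bounded and smooth substitute for \<open>|z|\<close>: with \<open>r = sqrt (1 + |z|\<^sup>2)\<close> it is \<open>r/(1 + \<delta> r)\<close>, which has
  Lipschitz constant \<open>1\<close> and increases to \<open>r\<close> as \<open>\<delta>\<close> decreases to \<open>0\<close>.
\<close>
definition trunc :: "real \<Rightarrow> complex \<Rightarrow> real" where
  "trunc \<delta> z = sqrt (1 + (norm z)\<^sup>2) / (1 + \<delta> * sqrt (1 + (norm z)\<^sup>2))"

lemma trunc_bounds:
  assumes "0 < \<delta>"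
  shows "0 < trunc \<delta> z" "trunc \<delta> z \<le> 1 / \<delta>" "(trunc \<delta> z)\<^sup>2 \<le> 1 + (norm z)\<^sup>2"
proof -
  define r where "r = sqrt (1 + (norm z)\<^sup>2)"
  have r: "0 < r" "r\<^sup>2 = 1 + (norm z)\<^sup>2" by (auto simp: r_def add_pos_nonneg)
  have p: "0 < 1 + \<delta> * r" using assms r by (simp add: add_pos_pos)
  show "0 < trunc \<delta> z" using r p by (simp add: trunc_def r_def[symmetric])
  show "trunc \<delta> z \<le> 1 / \<delta>"
    using r p assms by (simp add: trunc_def r_def[symmetric] divide_simps mult.commute)
  have "trunc \<delta> z \<le> r"
    using r p assms by (simp add: trunc_def r_def[symmetric] divide_le_eq)
  then have "(trunc \<delta> z)\<^sup>2 \<le> r\<^sup>2" using \<open>0 < trunc \<delta> z\<close> by (intro power_mono) auto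
  then show "(trunc \<delta> z)\<^sup>2 \<le> 1 + (norm z)\<^sup>2" by (simp add: r)
qed

lemma trunc_lipschitz:
  assumes "0 < \<delta>"
  shows "\<bar>trunc \<delta> z - trunc \<delta> w\<bar> \<le> norm (z - w)"
proof -
  define r s where "r = sqrt (1 + (norm z)\<^sup>2)" "s = sqrt (1 + (norm w)\<^sup>2)"
  have rs: "0 < r" "0 < s" by (auto simp: r_s_def add_pos_nonneg)
  have p: "1 \<le> 1 + \<delta> * r" "1 \<le> 1 + \<delta> * s" using assms rs by auto
  have "trunc \<delta> z - trunc \<delta> w = (r - s) / ((1 + \<delta> * r) * (1 + \<delta> * s))"
    unfolding trunc_def r_s_def[symmetric] using p by (simp add: field_simps)
  then have "\<bar>trunc \<delta> z - trunc \<delta> w\<bar> = \<bar>r - s\<bar> / ((1 + \<delta> * r) * (1 + \<delta> * s))"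
    using p by (simp add: abs_divide abs_mult)
  also have "\<dots> \<le> \<bar>r - s\<bar> / 1"
  proof (rule divide_left_mono)
    have "0 \<le> 1 + \<delta> * r" using p by linarith
    then show "1 \<le> (1 + \<delta> * r) * (1 + \<delta> * s)" using mult_mono[OF p] by simp
  qed (use p in auto)
  also have "\<bar>r - s\<bar> = \<bar>norm (1::real, norm z) - norm (1::real, norm w)\<bar>"
    by (simp add: r_s_def norm_Pair)
  also have "\<dots> \<le> norm ((1::real, norm z) - (1::real, norm w))" by (rule norm_triangle_ineq3)
  also have "\<dots> = \<bar>norm z - norm w\<bar>" by (simp add: norm_Pair)
  also have "\<dots> \<le> norm (z - w)" by (rule norm_triangle_ineq3)
  finally show ?thesis by simp
qed

lemma trunc_power4_lipschitz:
  assumes "0 < \<delta>"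
  shows "trunc \<delta> z ^ 4 \<le> trunc \<delta> w ^ 4 + 4 / \<delta> ^ 3 * norm (z - w)"
proof -
  define a b M where "a = trunc \<delta> z" "b = trunc \<delta> w" "M = 1 / \<delta>"
  have ab: "0 \<le> a" "a \<le> M" "0 \<le> b" "b \<le> M"
    using trunc_bounds[OF assms] by (auto simp: a_b_M_def less_imp_le)
  have "a ^ 4 - b ^ 4 = (a - b) * (a ^ 3 + a\<^sup>2 * b + a * b\<^sup>2 + b ^ 3)"
    by (simp add: power2_eq_square power3_eq_cube power4_eq_xxxx algebra_simps)
  also have "\<dots> \<le> norm (z - w) * (M ^ 3 + M\<^sup>2 * M + M * M\<^sup>2 + M ^ 3)"
  proof (rule mult_mono)
    show "a - b \<le> norm (z - w)" using trunc_lipschitz[OF assms, of z w] by (simp add: a_b_M_def)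
    show "a ^ 3 + a\<^sup>2 * b + a * b\<^sup>2 + b ^ 3 \<le> M ^ 3 + M\<^sup>2 * M + M * M\<^sup>2 + M ^ 3"
      using ab by (intro add_mono mult_mono power_mono) auto
  qed (use ab in auto)
  also have "\<dots> = 4 / \<delta> ^ 3 * norm (z - w)"
    by (simp add: a_b_M_def power2_eq_square power3_eq_cube mult.assoc)
  finally show ?thesis by (simp add: a_b_M_def)
qed

lemma continuous_on_trunc: "0 < \<delta> \<Longrightarrow> continuous_on UNIV (trunc \<delta>)"
proof -
  assume \<delta>: "0 < \<delta>"
  have "1 + \<delta> * sqrt (1 + (norm z)\<^sup>2) \<noteq> 0" for z :: complex
  proof -
    have "0 \<le> \<delta> * sqrt (1 + (norm z)\<^sup>2)" using \<delta> by simp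
    then show ?thesis by linarith
  qed
  then show ?thesis
    unfolding trunc_def[abs_def] by (intro continuous_intros) auto
qed

text \<open>
  The fundamental theorem of calculus for \<open>(1 - t/\<tau>) m(t)\<^sup>3\<close>, where \<open>m\<close> is the truncated modulus along the
  curve; the linear weight removes the boundary term at \<open>t = \<tau>\<close>.
\<close>
lemma trunc_cube_along_curve:
  fixes z z' :: "real \<Rightarrow> complex"
  assumes \<delta>: "0 < \<delta>" and \<tau>: "0 < \<tau>"
    and z: "\<And>t. 0 \<le> t \<Longrightarrow> t \<le> \<tau> \<Longrightarrow> (z has_vector_derivative z' t) (at t within {0..\<tau>})"
    and z': "continuous_on {0..\<tau>} z'"
  shows "ennreal (trunc \<delta> (z 0) ^ 3) \<le>
    (\<integral>\<^sup>+t\<in>{0..\<tau>}. ennreal (trunc \<delta> (z t) ^ 3 / \<tau> + 3 * (trunc \<delta> (z t))\<^sup>2 * norm (z' t)) \<partial>lborel)"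
proof -
  define r where "r t = sqrt (1 + z t \<bullet> z t)" for t
  define r' where "r' t = (z t \<bullet> z' t) / r t" for t
  define m where "m t = r t / (1 + \<delta> * r t)" for t
  define m' where "m' t = r' t / (1 + \<delta> * r t)\<^sup>2" for t
  have m_eq: "trunc \<delta> (z t) = m t" for t
    by (simp add: trunc_def m_def r_def power2_norm_eq_inner)
  have rpos: "0 < r t" for t by (auto simp: r_def add_pos_nonneg)
  have ppos: "1 \<le> 1 + \<delta> * r t" for t using \<delta> rpos[of t] by auto
  have nz: "1 + \<delta> * r t \<noteq> 0" for t using ppos[of t] by linarith
  have mpos: "0 < m t" for t using trunc_bounds(1)[OF \<delta>, of "z t"] by (simp add: m_eq)
  have r_deriv: "(r has_real_derivative r' t) (at t within {0..\<tau>})" if "0 \<le> t" "t \<le> \<tau>" for t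
  proof -
    have "((\<lambda>t. z t \<bullet> z t) has_derivative (\<lambda>s. z t \<bullet> (s *\<^sub>R z' t) + (s *\<^sub>R z' t) \<bullet> z t)) (at t within {0..\<tau>})"
      using z[OF that] unfolding has_vector_derivative_def by (intro has_derivative_inner)
    then have "((\<lambda>t. z t \<bullet> z t) has_real_derivative 2 * (z t \<bullet> z' t)) (at t within {0..\<tau>})"
      unfolding has_field_derivative_def by (rule has_derivative_eq_rhs) (auto simp: inner_commute)
    from DERIV_add[OF DERIV_const[of 1] this]
    have "((\<lambda>t. 1 + z t \<bullet> z t) has_real_derivative 2 * (z t \<bullet> z' t)) (at t within {0..\<tau>})" by simp
    from DERIV_chain2[OF DERIV_real_sqrt this]
    have "((\<lambda>t. sqrt (1 + z t \<bullet> z t)) has_real_derivative inverse (sqrt (1 + z t \<bullet> z t)) / 2 * (2 * (z t \<bullet> z' t)))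
        (at t within {0..\<tau>})"
      using rpos[of t] by (auto simp: r_def)
    then show ?thesis unfolding r_def[abs_def] r'_def by (simp add: field_simps)
  qed
  have m_deriv: "(m has_real_derivative m' t) (at t within {0..\<tau>})" if "0 \<le> t" "t \<le> \<tau>" for t
    unfolding m_def[abs_def] m'_def using nz[of t]
    by (auto intro!: derivative_eq_intros r_deriv that simp: power2_eq_square divide_simps algebra_simps)
  define q where "q t = (1 - t / \<tau>) * m t ^ 3" for t
  define q' where "q' t = (1 - t / \<tau>) * (3 * (m t)\<^sup>2 * m' t) - m t ^ 3 / \<tau>" for t
  have q_deriv: "(q has_vector_derivative q' t) (at t within {0..\<tau>})" if "0 \<le> t" "t \<le> \<tau>" for t
    unfolding has_real_derivative_iff_has_vector_derivative[symmetric] q_def[abs_def] q'_def using \<tau>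
    by (auto intro!: derivative_eq_intros m_deriv that simp: field_simps)
  have zc: "continuous_on {0..\<tau>} z"
    using z has_vector_derivative_continuous by (fastforce simp: continuous_on_eq_continuous_within)
  have rc: "continuous_on {0..\<tau>} r" unfolding r_def by (intro continuous_intros zc)
  have mc: "continuous_on {0..\<tau>} m" unfolding m_def using nz by (intro continuous_intros rc) auto
  have r'c: "continuous_on {0..\<tau>} r'" unfolding r'_def using rpos
    by (intro continuous_intros rc zc z') (auto simp: less_imp_neq[symmetric])
  have m'c: "continuous_on {0..\<tau>} m'" unfolding m'_def using nz by (intro continuous_intros rc r'c) auto
  have q'c: "continuous_on {0..\<tau>} q'" unfolding q'_def using \<tau> by (intro continuous_intros mc m'c) auto
  have "has_bochner_integral lborel (\<lambda>t. indicator {0..\<tau>} t *\<^sub>R q' t) (q \<tau> - q 0)"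
    by (rule has_bochner_integral_FTC_Icc) (use \<tau> q_deriv q'c in auto)
  then have I: "integrable lborel (\<lambda>t. indicator {0..\<tau>} t *\<^sub>R q' t)"
      "(LINT t|lborel. indicator {0..\<tau>} t *\<^sub>R q' t) = - (m 0 ^ 3)"
    using \<tau> by (auto simp: has_bochner_integral_iff q_def)
  have m'_le: "\<bar>m' t\<bar> \<le> norm (z' t)" for t
  proof -
    have "norm (z t) \<le> r t" unfolding r_def by (rule real_le_rsqrt) (simp add: power2_norm_eq_inner)
    then have "\<bar>z t \<bullet> z' t\<bar> \<le> r t * norm (z' t)"
      using Cauchy_Schwarz_ineq2[of "z t" "z' t"] mult_right_mono[OF _ norm_ge_zero[of "z' t"]] order_trans by blast
    then have r'_le: "\<bar>r' t\<bar> \<le> norm (z' t)"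
      using rpos[of t] by (simp add: r'_def abs_divide divide_le_eq mult.commute)
    have "\<bar>m' t\<bar> = \<bar>r' t\<bar> / (1 + \<delta> * r t)\<^sup>2" by (simp add: m'_def abs_divide)
    also have "\<dots> \<le> \<bar>r' t\<bar> / 1"
      using ppos[of t] by (intro divide_left_mono) (auto simp: one_le_power)
    finally show ?thesis using r'_le by simp
  qed
  have q'_le: "\<bar>q' t\<bar> \<le> m t ^ 3 / \<tau> + 3 * (m t)\<^sup>2 * norm (z' t)" if "t \<in> {0..\<tau>}" for t
  proof -
    have t: "0 \<le> 1 - t / \<tau>" "1 - t / \<tau> \<le> 1" using that \<tau> by (auto simp: divide_simps)
    have "\<bar>q' t\<bar> \<le> \<bar>(1 - t / \<tau>) * (3 * (m t)\<^sup>2 * m' t)\<bar> + \<bar>m t ^ 3 / \<tau>\<bar>"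
      unfolding q'_def by (rule abs_triangle_ineq4)
    also have "\<bar>(1 - t / \<tau>) * (3 * (m t)\<^sup>2 * m' t)\<bar> \<le> 1 * (3 * (m t)\<^sup>2 * norm (z' t))"
      unfolding abs_mult using t m'_le[of t] by (intro mult_mono) auto
    also have "\<bar>m t ^ 3 / \<tau>\<bar> = m t ^ 3 / \<tau>" using mpos[of t] \<tau> by simp
    finally show ?thesis by simp
  qed
  have "ennreal (m 0 ^ 3) = ennreal (norm (LINT t|lborel. indicator {0..\<tau>} t *\<^sub>R q' t))"
    unfolding I(2) using mpos[of 0] by simp
  also have "\<dots> \<le> (\<integral>\<^sup>+t. ennreal (norm (indicator {0..\<tau>} t *\<^sub>R q' t)) \<partial>lborel)"
    by (rule integral_norm_bound_ennreal[OF I(1)])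
  also have "\<dots> \<le> (\<integral>\<^sup>+t\<in>{0..\<tau>}. ennreal (m t ^ 3 / \<tau> + 3 * (m t)\<^sup>2 * norm (z' t)) \<partial>lborel)"
  proof (rule nn_integral_mono)
    fix t
    show "ennreal (norm (indicator {0..\<tau>} t *\<^sub>R q' t)) \<le>
        ennreal (m t ^ 3 / \<tau> + 3 * (m t)\<^sup>2 * norm (z' t)) * indicator {0..\<tau>} t"
      using q'_le[of t] by (auto simp: indicator_def intro!: ennreal_leI)
  qed
  finally show ?thesis by (simp add: m_eq)
qed

definition trunc_int :: "real \<Rightarrow> 'a::euclidean_space set \<Rightarrow> ('a \<Rightarrow> complex) \<Rightarrow> ennreal" where
  "trunc_int \<delta> A f = (\<integral>\<^sup>+x\<in>A. ennreal (trunc \<delta> (f x) ^ 4) \<partial>lborel)"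

lemma trunc_int_finite:
  assumes "0 < \<delta>" "A \<in> sets borel" "bounded A"
  shows "trunc_int \<delta> A f < \<infinity>"
proof -
  have "trunc_int \<delta> A f \<le> (\<integral>\<^sup>+x. ennreal ((1 / \<delta>) ^ 4) * indicator A x \<partial>lborel)"
    unfolding trunc_int_def using trunc_bounds[OF assms(1)]
    by (intro nn_integral_mono mult_right_mono ennreal_leI power_mono) (auto simp: less_imp_le)
  also have "\<dots> = ennreal ((1 / \<delta>) ^ 4) * emeasure lborel A"
    using assms by (intro nn_integral_cmult_indicator) simp
  also have "\<dots> < \<infinity>" using emeasure_bounded_finite[OF assms(3)] by (simp add: ennreal_mult_less_top)
  finally show ?thesis .
qed

lemma trunc_int_diff_le:
  assumes \<delta>: "0 < \<delta>" and [measurable]: "f \<in> borel_measurable borel" "g \<in> borel_measurable borel"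
    "A \<in> sets borel" "U \<in> sets borel" and "A \<subseteq> U"
  shows "trunc_int \<delta> A f \<le> trunc_int \<delta> A g + ennreal (4 / \<delta> ^ 3) * (\<integral>\<^sup>+x\<in>U. ennreal (norm (f x - g x)) \<partial>lborel)"
proof -
  have [measurable]: "trunc \<delta> \<in> borel_measurable borel"
    by (rule borel_measurable_continuous_onI[OF continuous_on_trunc[OF \<delta>]])
  have "trunc_int \<delta> A f \<le> (\<integral>\<^sup>+x. ennreal (trunc \<delta> (g x) ^ 4) * indicator A x
      + ennreal (4 / \<delta> ^ 3) * (ennreal (norm (f x - g x)) * indicator U x) \<partial>lborel)"
    unfolding trunc_int_def
  proof (rule nn_integral_mono)
    fix x
    have "ennreal (trunc \<delta> (f x) ^ 4) \<le> ennreal (trunc \<delta> (g x) ^ 4 + 4 / \<delta> ^ 3 * norm (f x - g x))"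
      by (rule ennreal_leI[OF trunc_power4_lipschitz[OF \<delta>]])
    also have "\<dots> = ennreal (trunc \<delta> (g x) ^ 4) + ennreal (4 / \<delta> ^ 3) * ennreal (norm (f x - g x))"
      using \<delta> trunc_bounds(1)[OF \<delta>, of "g x"]
      by (subst ennreal_plus) (auto simp: ennreal_mult[symmetric] less_imp_le)
    finally show "ennreal (trunc \<delta> (f x) ^ 4) * indicator A x \<le> ennreal (trunc \<delta> (g x) ^ 4) * indicator A x
      + ennreal (4 / \<delta> ^ 3) * (ennreal (norm (f x - g x)) * indicator U x)"
      using assms(6) by (auto simp: indicator_def)
  qed
  also have "\<dots> = trunc_int \<delta> A g + ennreal (4 / \<delta> ^ 3) * (\<integral>\<^sup>+x\<in>U. ennreal (norm (f x - g x)) \<partial>lborel)"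
    unfolding trunc_int_def by (subst nn_integral_add) (auto simp: nn_integral_cmult)
  finally show ?thesis .
qed

lemma nn_integral_norm_sq_le:
  assumes [measurable]: "f \<in> borel_measurable borel" "U \<in> sets borel"
  shows "(\<integral>\<^sup>+x\<in>U. ennreal (norm (f x)) \<partial>lborel)\<^sup>2 \<le> emeasure lborel U * sq_int U f"
proof -
  have "(\<integral>\<^sup>+x. indicator U x * (ennreal (norm (f x)) * indicator U x) \<partial>lborel)\<^sup>2 \<le>
     (\<integral>\<^sup>+x. (indicator U x)\<^sup>2 \<partial>lborel) * (\<integral>\<^sup>+x. (ennreal (norm (f x)) * indicator U x)\<^sup>2 \<partial>lborel)"
    by (rule Cauchy_Schwarz_nn_integral) measurable
  moreover have "indicator U x * (ennreal (norm (f x)) * indicator U x) = ennreal (norm (f x)) * indicator U x"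
     "(indicator U x :: ennreal)\<^sup>2 = indicator U x"
     "(ennreal (norm (f x)) * indicator U x)\<^sup>2 = ennreal ((norm (f x))\<^sup>2) * indicator U x" for x
    by (auto simp: indicator_def ennreal_power)
  ultimately show ?thesis unfolding sq_int_def by simp
qed

text \<open>
  On a piece, \<open>|u|\<^sup>3\<close> (truncated) is bounded by four line integrals over the parts of the lines in
  \<open>U\<close>, and these are combined by the Loomis-Whitney inequality.  Each of the four integrals over \<open>U\<close> is
  bounded by the Cauchy-Schwarz inequality with \<open>m\<^sup>2\<close> and \<open>m/\<tau> + 3 |Du|\<close> as factors.  The bound \<open>E\<close> depends
  neither on the mollifier nor on the truncation.
\<close>
lemma sobolev_piece_mollified:
  fixes U :: "(complex \<times> complex) set"
  assumes s: "sobolev_fun U u g" and rh: "0 < r" "0 < h" and \<rho>: "0 < \<rho>" "\<rho> \<le> r" "\<rho> + v \<bullet> One \<noteq> 0"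
    and K: "mollifier K (ball (\<eta> *\<^sub>R v) (\<eta> * r))" and \<eta>: "0 < \<eta>" "\<eta> \<le> h / 2" and \<delta>: "0 < \<delta>"
  defines "E \<equiv> ennreal (16 / h\<^sup>2) * emeasure lborel U
      + ennreal (16 / h\<^sup>2 + 18 * (norm v + r)\<^sup>2) * sobolev_energy u g"
  shows "trunc_int \<delta> (inner_part U (finite_cone v r h)) (conv u K) ^ 6 \<le>
    (ennreal (1 / (\<bar>\<rho> + v \<bullet> One\<bar> * \<rho> ^ 3)))\<^sup>2 * (trunc_int \<delta> U (conv u K) ^ 4 * E ^ 4)"
proof -
  interpret sobolev_fun U u g by (rule s)
  let ?A = "inner_part U (finite_cone v r h)"
  have [measurable]: "?A \<in> sets borel" using open_inner_part[OF open_U compact_finite_cone] by simp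
  define \<tau> where "\<tau> = h / 2"
  have \<tau>: "0 < \<tau>" using rh by (simp add: \<tau>_def)
  define V where "V = conv u K"
  define W where "W b = conv (directional g (v + \<rho> *\<^sub>R b)) K" for b
  have Vm [measurable]: "V \<in> borel_measurable borel"
    unfolding V_def by (rule conv_measurable[OF u_integrable K bounded_ball])
  have Wm [measurable]: "W b \<in> borel_measurable borel" for b
    unfolding W_def by (rule conv_measurable[OF directional_integrable K bounded_ball])
  have [measurable]: "trunc \<delta> \<in> borel_measurable borel"
    by (rule borel_measurable_continuous_onI[OF continuous_on_trunc[OF \<delta>]])
  define hh where "hh x = ennreal (trunc \<delta> (V x) ^ 4) * indicator ?A x" for x
  define G where "G b x = ennreal (trunc \<delta> (V x) ^ 3 / \<tau> + 3 * (trunc \<delta> (V x))\<^sup>2 * norm (W b x)) * indicator U x" for b x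
  have le: "hh x ^ 3 \<le> (\<Prod>b\<in>Basis. \<integral>\<^sup>+t. G b (x + t *\<^sub>R (v + \<rho> *\<^sub>R b)) \<partial>lborel)" for x
  proof (cases "x \<in> ?A")
    case True
    have seg: "ennreal (trunc \<delta> (V x) ^ 3) \<le> (\<integral>\<^sup>+t. G b (x + t *\<^sub>R (v + \<rho> *\<^sub>R b)) \<partial>lborel)" if b: "b \<in> Basis" for b
    proof -
      let ?e = "v + \<rho> *\<^sub>R b"
      have e: "?e \<in> cball v r" using b \<rho> by (simp add: dist_norm)
      have "ennreal (trunc \<delta> (V (x + 0 *\<^sub>R ?e)) ^ 3) \<le>
         (\<integral>\<^sup>+t\<in>{0..\<tau>}. ennreal (trunc \<delta> (V (x + t *\<^sub>R ?e)) ^ 3 / \<tau> +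
             3 * (trunc \<delta> (V (x + t *\<^sub>R ?e)))\<^sup>2 * norm (W b (x + t *\<^sub>R ?e))) \<partial>lborel)"
      proof (rule trunc_cube_along_curve[OF \<delta> \<tau>])
        show "((\<lambda>t. V (x + t *\<^sub>R ?e)) has_vector_derivative W b (x + t *\<^sub>R ?e)) (at t within {0..\<tau>})"
          if "0 \<le> t" "t \<le> \<tau>" for t
          unfolding V_def W_def by (rule conv_derivative_along_cone[OF K \<eta> True _ _ e]) (use that in \<open>auto simp: \<tau>_def\<close>)
        show "continuous_on {0..\<tau>} (\<lambda>t. W b (x + t *\<^sub>R ?e))"
          unfolding W_def
          by (intro continuous_on_compose2[OF conv_directional_continuous[OF K bounded_ball]] continuous_intros) auto
      qed
      also have "\<dots> \<le> (\<integral>\<^sup>+t. G b (x + t *\<^sub>R ?e) \<partial>lborel)"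
      proof (rule nn_integral_mono)
        fix t
        have "x + t *\<^sub>R ?e \<in> U" if "t \<in> {0..\<tau>}"
        proof -
          have "t *\<^sub>R ?e + 0 \<in> finite_cone v r h"
            by (rule finite_cone_add[where \<delta>=0]) (use that e rh in \<open>auto simp: \<tau>_def\<close>)
          then show ?thesis using True by (auto simp: inner_part_def)
        qed
        then show "ennreal (trunc \<delta> (V (x + t *\<^sub>R ?e)) ^ 3 / \<tau> +
             3 * (trunc \<delta> (V (x + t *\<^sub>R ?e)))\<^sup>2 * norm (W b (x + t *\<^sub>R ?e))) * indicator {0..\<tau>} t
             \<le> G b (x + t *\<^sub>R ?e)"
          by (auto simp: G_def indicator_def)
      qed
      finally show ?thesis by simp
    qed
    have "hh x ^ 3 = (\<Prod>b\<in>(Basis :: (complex \<times> complex) set). ennreal (trunc \<delta> (V x) ^ 3))"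
      using True trunc_bounds(1)[OF \<delta>, of "V x"]
      by (simp add: hh_def ennreal_power power_mult[symmetric] less_imp_le)
    also have "\<dots> \<le> (\<Prod>b\<in>Basis. \<integral>\<^sup>+t. G b (x + t *\<^sub>R (v + \<rho> *\<^sub>R b)) \<partial>lborel)"
      by (rule prod_mono_ennreal[OF seg])
    finally show ?thesis .
  qed (simp add: hh_def)
  define C where "C = ennreal (1 / (\<bar>\<rho> + v \<bullet> One\<bar> * \<rho> ^ 3))"
  define X where "X = trunc_int \<delta> ?A V"
  define Y where "Y = trunc_int \<delta> U V"
  have X_eq: "(\<integral>\<^sup>+x. hh x \<partial>lborel) = X" by (simp add: hh_def X_def trunc_int_def)
  have LW: "X ^ 3 \<le> C * (\<Prod>b\<in>Basis. \<integral>\<^sup>+x. G b x \<partial>lborel)"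
    unfolding X_eq[symmetric] C_def
  proof (rule frame_loomis_whitney[OF _ _ \<rho>(1,3) le])
    show "hh \<in> borel_measurable borel" unfolding hh_def by measurable
    show "G b \<in> borel_measurable borel" for b unfolding G_def by measurable
  qed
  have GE: "(\<integral>\<^sup>+x. G b x \<partial>lborel)\<^sup>2 \<le> Y * E" if b: "b \<in> Basis" for b
  proof -
    let ?m = "\<lambda>x. trunc \<delta> (V x)"
    have pos: "0 < ?m x" for x by (rule trunc_bounds(1)[OF \<delta>])
    have "(\<integral>\<^sup>+x. G b x \<partial>lborel) =
       (\<integral>\<^sup>+x. (ennreal ((?m x)\<^sup>2) * indicator U x) * (ennreal (?m x / \<tau> + 3 * norm (W b x)) * indicator U x) \<partial>lborel)"
    proof (rule nn_integral_cong)
      fix x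
      have "?m x ^ 3 / \<tau> + 3 * (?m x)\<^sup>2 * norm (W b x) = (?m x)\<^sup>2 * (?m x / \<tau> + 3 * norm (W b x))"
        by (simp add: power2_eq_square power3_eq_cube algebra_simps)
      then show "G b x = (ennreal ((?m x)\<^sup>2) * indicator U x) * (ennreal (?m x / \<tau> + 3 * norm (W b x)) * indicator U x)"
        using pos[of x] \<tau> by (auto simp: G_def indicator_def ennreal_mult)
    qed
    also have "\<dots>\<^sup>2 \<le> (\<integral>\<^sup>+x. (ennreal ((?m x)\<^sup>2) * indicator U x)\<^sup>2 \<partial>lborel) *
        (\<integral>\<^sup>+x. (ennreal (?m x / \<tau> + 3 * norm (W b x)) * indicator U x)\<^sup>2 \<partial>lborel)"
      by (rule Cauchy_Schwarz_nn_integral) measurable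
    also have "(\<integral>\<^sup>+x. (ennreal ((?m x)\<^sup>2) * indicator U x)\<^sup>2 \<partial>lborel) = Y"
      unfolding Y_def trunc_int_def
      by (intro nn_integral_cong) (auto simp: indicator_def ennreal_power power_mult[symmetric])
    also have "(\<integral>\<^sup>+x. (ennreal (?m x / \<tau> + 3 * norm (W b x)) * indicator U x)\<^sup>2 \<partial>lborel) \<le> E"
    proof -
      have "(\<integral>\<^sup>+x. (ennreal (?m x / \<tau> + 3 * norm (W b x)) * indicator U x)\<^sup>2 \<partial>lborel) \<le>
         (\<integral>\<^sup>+x. ennreal (2 / \<tau>\<^sup>2) * indicator U x + (ennreal (2 / \<tau>\<^sup>2) * (ennreal ((norm (V x))\<^sup>2) * indicator U x)
             + ennreal 18 * (ennreal ((norm (W b x))\<^sup>2) * indicator U x)) \<partial>lborel)"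
      proof (rule nn_integral_mono)
        fix x
        have "(?m x / \<tau> + 3 * norm (W b x))\<^sup>2 \<le> 2 * (?m x / \<tau>)\<^sup>2 + 2 * (3 * norm (W b x))\<^sup>2" by (rule sum_sq_le)
        also have "\<dots> = 2 / \<tau>\<^sup>2 * (?m x)\<^sup>2 + 18 * (norm (W b x))\<^sup>2"
          by (simp add: power_divide power_mult_distrib)
        also have "\<dots> \<le> 2 / \<tau>\<^sup>2 * (1 + (norm (V x))\<^sup>2) + 18 * (norm (W b x))\<^sup>2"
          using trunc_bounds(3)[OF \<delta>, of "V x"] by (intro add_right_mono mult_left_mono) auto
        finally have "(?m x / \<tau> + 3 * norm (W b x))\<^sup>2 \<le> 2 / \<tau>\<^sup>2 + (2 / \<tau>\<^sup>2 * (norm (V x))\<^sup>2 + 18 * (norm (W b x))\<^sup>2)"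
          by (simp add: algebra_simps add_divide_distrib)
        then have "ennreal ((?m x / \<tau> + 3 * norm (W b x))\<^sup>2) \<le>
            ennreal (2 / \<tau>\<^sup>2 + (2 / \<tau>\<^sup>2 * (norm (V x))\<^sup>2 + 18 * (norm (W b x))\<^sup>2))" by (rule ennreal_leI)
        also have "\<dots> = ennreal (2 / \<tau>\<^sup>2) + (ennreal (2 / \<tau>\<^sup>2) * ennreal ((norm (V x))\<^sup>2) + ennreal 18 * ennreal ((norm (W b x))\<^sup>2))"
          using \<tau> by (simp only: ennreal_plus[symmetric] ennreal_mult[symmetric] zero_le_power2 zero_le_divide_iff
             zero_le_numeral mult_nonneg_nonneg add_nonneg_nonneg simp_thms)
        finally have *: "ennreal ((?m x / \<tau> + 3 * norm (W b x))\<^sup>2) \<le>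
            ennreal (2 / \<tau>\<^sup>2) + (ennreal (2 / \<tau>\<^sup>2) * ennreal ((norm (V x))\<^sup>2) + ennreal 18 * ennreal ((norm (W b x))\<^sup>2))" .
        show "(ennreal (?m x / \<tau> + 3 * norm (W b x)) * indicator U x)\<^sup>2 \<le>
            ennreal (2 / \<tau>\<^sup>2) * indicator U x + (ennreal (2 / \<tau>\<^sup>2) * (ennreal ((norm (V x))\<^sup>2) * indicator U x)
             + ennreal 18 * (ennreal ((norm (W b x))\<^sup>2) * indicator U x))"
        proof -
          have "0 \<le> ?m x / \<tau> + 3 * norm (W b x)" using pos[of x] \<tau> by simp
          then have "(ennreal (?m x / \<tau> + 3 * norm (W b x)))\<^sup>2 = ennreal ((?m x / \<tau> + 3 * norm (W b x))\<^sup>2)"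
            by (rule ennreal_power)
          with * show ?thesis by (cases "x \<in> U") (simp_all del: ennreal_plus)
        qed
      qed
      also have "\<dots> = ennreal (2 / \<tau>\<^sup>2) * emeasure lborel U + (ennreal (2 / \<tau>\<^sup>2) * sq_int U V + ennreal 18 * sq_int U (W b))"
        unfolding sq_int_def by (simp add: nn_integral_add nn_integral_cmult nn_integral_cmult_indicator del: ennreal_numeral)
      also have "\<dots> \<le> ennreal (16 / h\<^sup>2) * emeasure lborel U + (ennreal (16 / h\<^sup>2) * sobolev_energy u g
          + ennreal 18 * (ennreal ((norm v + r)\<^sup>2) * sobolev_energy u g))"
      proof (intro add_mono mult_mono)
        have "2 / \<tau>\<^sup>2 \<le> 16 / h\<^sup>2" by (simp add: \<tau>_def power_divide divide_right_mono)
        then show "ennreal (2 / \<tau>\<^sup>2) \<le> ennreal (16 / h\<^sup>2)" "ennreal (2 / \<tau>\<^sup>2) \<le> ennreal (16 / h\<^sup>2)" by (simp_all add: ennreal_leI)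
        have "sq_int U V \<le> ennreal 1 * sq_int UNIV u"
          unfolding V_def using conv_L2_bound[OF u_integrable K bounded_ball distortion_shift[of 0] U_sets] by simp
        also have "\<dots> \<le> sobolev_energy u g" by (simp add: sobolev_energy_def)
        finally show "sq_int U V \<le> sobolev_energy u g" .
        have "sq_int U (W b) \<le> ennreal 1 * sq_int UNIV (directional g (v + \<rho> *\<^sub>R b))"
          unfolding W_def using conv_L2_bound[OF directional_integrable K bounded_ball distortion_shift[of 0] U_sets] by simp
        also have "\<dots> \<le> ennreal ((norm (v + \<rho> *\<^sub>R b))\<^sup>2) * sobolev_energy u g"
          using sq_int_directional_energy by simp
        also have "\<dots> \<le> ennreal ((norm v + r)\<^sup>2) * sobolev_energy u g"
        proof (intro mult_right_mono ennreal_leI power_mono)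
          have "norm (v + \<rho> *\<^sub>R b) \<le> norm v + norm (\<rho> *\<^sub>R b)" by (rule norm_triangle_ineq)
          then show "norm (v + \<rho> *\<^sub>R b) \<le> norm v + r" using b \<rho> by simp
        qed auto
        finally show "sq_int U (W b) \<le> ennreal ((norm v + r)\<^sup>2) * sobolev_energy u g" .
      qed auto
      also have "\<dots> = E"
      proof -
        have "ennreal (16 / h\<^sup>2 + 18 * (norm v + r)\<^sup>2) = ennreal (16 / h\<^sup>2) + ennreal 18 * ennreal ((norm v + r)\<^sup>2)"
          by (subst ennreal_plus) (auto simp: ennreal_mult[symmetric] simp del: ennreal_numeral)
        then show ?thesis unfolding E_def by (simp add: distrib_right mult.assoc del: ennreal_numeral)
      qed
      finally show ?thesis .
    qed
    finally show ?thesis by (simp add: mult_left_mono)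
  qed
  have "X ^ 6 = (X ^ 3)\<^sup>2" by (simp add: power_mult[symmetric])
  also have "\<dots> \<le> (C * (\<Prod>b\<in>Basis. \<integral>\<^sup>+x. G b x \<partial>lborel))\<^sup>2" by (intro power_mono LW) simp
  also have "\<dots> = C\<^sup>2 * (\<Prod>b\<in>Basis. (\<integral>\<^sup>+x. G b x \<partial>lborel)\<^sup>2)" by (simp add: power_mult_distrib prod_power_distrib)
  also have "\<dots> \<le> C\<^sup>2 * (\<Prod>b\<in>(Basis :: (complex \<times> complex) set). Y * E)"
    by (intro mult_left_mono prod_mono_ennreal GE) auto
  also have "\<dots> = C\<^sup>2 * (Y ^ 4 * E ^ 4)" by (simp add: power_mult_distrib)
  finally show ?thesis unfolding X_def Y_def C_def V_def .
qed

lemma ennreal_le_of_sq_le: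
  assumes "x\<^sup>2 \<le> ennreal (\<epsilon>\<^sup>2)" "0 \<le> \<epsilon>"
  shows "x \<le> ennreal \<epsilon>"
proof (cases x)
  case (real y)
  then have "y\<^sup>2 \<le> \<epsilon>\<^sup>2" using assms by (simp add: ennreal_power)
  then have "y \<le> \<epsilon>" using assms(2) by (rule power2_le_imp_le)
  then show ?thesis unfolding real by (rule ennreal_leI)
next
  case top
  then show ?thesis using assms by (simp add: power2_eq_square top_unique)
qed

text \<open>
  The truncated modulus is bounded and Lipschitz, so its fourth power passes to the limit when \<open>u\<close> is
  approximated by its mollifications.
\<close>
lemma sobolev_piece:
  fixes U :: "(complex \<times> complex) set"
  assumes s: "sobolev_fun U u g" and rh: "0 < r" "0 < h" and \<rho>: "0 < \<rho>" "\<rho> \<le> r" "\<rho> + v \<bullet> One \<noteq> 0"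
    and \<delta>: "0 < \<delta>"
  defines "E \<equiv> ennreal (16 / h\<^sup>2) * emeasure lborel U
      + ennreal (16 / h\<^sup>2 + 18 * (norm v + r)\<^sup>2) * sobolev_energy u g"
  shows "trunc_int \<delta> (inner_part U (finite_cone v r h)) u ^ 6 \<le>
    (ennreal (1 / (\<bar>\<rho> + v \<bullet> One\<bar> * \<rho> ^ 3)))\<^sup>2 * (trunc_int \<delta> U u ^ 4 * E ^ 4)"
proof -
  interpret sobolev_fun U u g by (rule s)
  let ?A = "inner_part U (finite_cone v r h)"
  have Am [measurable]: "?A \<in> sets borel" using open_inner_part[OF open_U compact_finite_cone] by simp
  have AU: "?A \<subseteq> U" by (rule inner_part_subset, rule zero_in_finite_cone) (use rh in auto)
  define c where "c = 1 / (\<bar>\<rho> + v \<bullet> One\<bar> * \<rho> ^ 3)"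
  have c: "0 \<le> c" using \<rho> by (simp add: c_def)
  have vol: "emeasure lborel U < \<infinity>" using emeasure_bounded_finite[OF bounded_U] by simp
  have en: "sobolev_energy u g < \<infinity>"
    using u g by (auto simp: sobolev_energy_def L2_fun_def)
  have "E < \<infinity>" unfolding E_def using vol en by (simp add: ennreal_mult_less_top)
  then obtain e where e: "E = ennreal e" "0 \<le> e" by (cases E) auto
  obtain x where x: "trunc_int \<delta> ?A u = ennreal x" "0 \<le> x"
    using trunc_int_finite[OF \<delta> Am bounded_subset[OF bounded_U AU], of u] by (cases "trunc_int \<delta> ?A u") auto
  obtain y where y: "trunc_int \<delta> U u = ennreal y" "0 \<le> y"
    using trunc_int_finite[OF \<delta> U_sets bounded_U, of u] by (cases "trunc_int \<delta> U u") auto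
  obtain w where w: "emeasure lborel U = ennreal w" "0 \<le> w" using vol by (cases "emeasure lborel U") auto
  have step: "max 0 (x - \<epsilon>) ^ 6 \<le> c\<^sup>2 * ((y + \<epsilon>) ^ 4 * e ^ 4)" if \<epsilon>: "0 < \<epsilon>" for \<epsilon>
  proof -
    have "0 < ennreal (\<epsilon>\<^sup>2)" "0 \<le> (4 / \<delta> ^ 3)\<^sup>2 * w" using \<epsilon> w by auto
    then obtain e1 where e1: "0 < e1" "ennreal ((4 / \<delta> ^ 3)\<^sup>2 * w) * e1 \<le> ennreal (\<epsilon>\<^sup>2)"
      by (rule ennreal_split_pos)
    obtain \<eta> K where K: "0 < \<eta>" "\<eta> \<le> h / 2" "mollifier K (ball (\<eta> *\<^sub>R v) (\<eta> * r))"
        "sq_int U (\<lambda>x. conv u K x - u x) \<le> e1"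
      using fine_mollifier_exists[OF e1(1), of "{u}" U r h v] u bounded_U rh by auto
    have Vm: "conv u K \<in> borel_measurable borel"
      by (rule conv_measurable[OF u_integrable K(3) bounded_ball])
    let ?I = "\<integral>\<^sup>+x\<in>U. ennreal (norm (conv u K x - u x)) \<partial>lborel"
    have "(ennreal (4 / \<delta> ^ 3) * ?I)\<^sup>2 = ennreal ((4 / \<delta> ^ 3)\<^sup>2) * ?I\<^sup>2"
      using \<delta> by (simp add: power_mult_distrib ennreal_power)
    also have "\<dots> \<le> ennreal ((4 / \<delta> ^ 3)\<^sup>2) * (emeasure lborel U * sq_int U (\<lambda>x. conv u K x - u x))"
      by (intro mult_left_mono nn_integral_norm_sq_le) (use Vm in measurable)
    also have "\<dots> \<le> ennreal ((4 / \<delta> ^ 3)\<^sup>2) * (emeasure lborel U * e1)"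
      by (intro mult_left_mono K) auto
    also have "\<dots> = ennreal ((4 / \<delta> ^ 3)\<^sup>2 * w) * e1"
      unfolding w using w by (simp add: ennreal_mult mult.assoc)
    also have "\<dots> \<le> ennreal (\<epsilon>\<^sup>2)" by (rule e1)
    finally have I: "ennreal (4 / \<delta> ^ 3) * ?I \<le> ennreal \<epsilon>"
      by (rule ennreal_le_of_sq_le) (rule less_imp_le[OF \<epsilon>])
    have I': "(\<integral>\<^sup>+x\<in>U. ennreal (norm (u x - conv u K x)) \<partial>lborel) = ?I" by (simp add: norm_minus_commute)
    obtain x' where x': "trunc_int \<delta> ?A (conv u K) = ennreal x'" "0 \<le> x'"
      using trunc_int_finite[OF \<delta> Am bounded_subset[OF bounded_U AU], of "conv u K"]
      by (cases "trunc_int \<delta> ?A (conv u K)") auto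
    obtain y' where y': "trunc_int \<delta> U (conv u K) = ennreal y'" "0 \<le> y'"
      using trunc_int_finite[OF \<delta> U_sets bounded_U, of "conv u K"] by (cases "trunc_int \<delta> U (conv u K)") auto
    have "ennreal x \<le> ennreal x' + ennreal \<epsilon>"
      using order_trans[OF trunc_int_diff_le[OF \<delta> u_measurable Vm Am U_sets AU] add_left_mono[OF I[folded I']]]
      unfolding x x' .
    then have xx: "x \<le> x' + \<epsilon>" using x' \<epsilon> by (simp add: ennreal_plus[symmetric] del: ennreal_plus)
    have "ennreal y' \<le> ennreal y + ennreal \<epsilon>"
      using order_trans[OF trunc_int_diff_le[OF \<delta> Vm u_measurable U_sets U_sets subset_refl] add_left_mono[OF I]]
      unfolding y y' .
    then have yy: "y' \<le> y + \<epsilon>" using y \<epsilon> by (simp add: ennreal_plus[symmetric] del: ennreal_plus)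
    have "ennreal x' ^ 6 \<le> (ennreal c)\<^sup>2 * (ennreal y' ^ 4 * ennreal e ^ 4)"
      using sobolev_piece_mollified[OF s rh \<rho> K(3,1,2) \<delta>] unfolding E_def[symmetric] e(1) x' y' c_def .
    then have "x' ^ 6 \<le> c\<^sup>2 * (y' ^ 4 * e ^ 4)"
      using x' y' e c by (simp add: ennreal_power ennreal_mult[symmetric])
    have "max 0 (x - \<epsilon>) ^ 6 \<le> x' ^ 6" using xx x' by (intro power_mono) auto
    also have "\<dots> \<le> c\<^sup>2 * (y' ^ 4 * e ^ 4)" by fact
    also have "\<dots> \<le> c\<^sup>2 * ((y + \<epsilon>) ^ 4 * e ^ 4)"
      using yy y' e by (intro mult_left_mono mult_right_mono power_mono) auto
    finally show ?thesis .
  qed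
  have "max 0 (x - 0) ^ 6 \<le> c\<^sup>2 * ((y + 0) ^ 4 * e ^ 4)"
  proof (rule tendsto_le[of "at_right (0::real)"])
    show "((\<lambda>\<epsilon>. max 0 (x - \<epsilon>) ^ 6) \<longlongrightarrow> max 0 (x - 0) ^ 6) (at_right 0)"
      by (intro tendsto_power tendsto_max tendsto_diff tendsto_const tendsto_ident_at)
    show "((\<lambda>\<epsilon>. c\<^sup>2 * ((y + \<epsilon>) ^ 4 * e ^ 4)) \<longlongrightarrow> c\<^sup>2 * ((y + 0) ^ 4 * e ^ 4)) (at_right 0)"
      by (intro tendsto_mult tendsto_power tendsto_add tendsto_const tendsto_ident_at)
    show "\<forall>\<^sub>F \<epsilon> in at_right 0. max 0 (x - \<epsilon>) ^ 6 \<le> c\<^sup>2 * ((y + \<epsilon>) ^ 4 * e ^ 4)"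
      using eventually_at_right_less[of 0] by eventually_elim (rule step)
  qed simp
  then have "ennreal (x ^ 6) \<le> ennreal (c\<^sup>2 * (y ^ 4 * e ^ 4))" using x by (intro ennreal_leI) simp
  then show ?thesis
    unfolding x y e c_def[symmetric] using x y e c by (simp add: ennreal_power ennreal_mult)
qed

text \<open>
  Some piece carries at least the fraction \<open>1/N\<close> of the integral over \<open>U\<close>, where \<open>N\<close> is the number of pieces.
  On this piece the estimate bounds the sixth power of the integral by its fourth power, and since the
  truncated integral is finite the common factor may be cancelled.
\<close>
lemma sobolev_trunc:
  fixes U :: "(complex \<times> complex) set"
  assumes U: "open U" "bounded U" and rh: "0 < r" "0 < h"
    and V: "finite V" "U \<subseteq> (\<Union>v\<in>V. inner_part U (finite_cone v r h))"
  shows "\<exists>C\<ge>0. \<forall>u g \<delta>. sobolev_fun U u g \<longrightarrow> 0 < \<delta> \<longrightarrow>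
    trunc_int \<delta> U u \<le> ennreal C * (1 + sobolev_energy u g)\<^sup>2"
proof -
  have Um: "U \<in> sets borel" using U by simp
  define w where "w = measure lborel U"
  have w: "emeasure lborel U = ennreal w" "0 \<le> w"
    using emeasure_bounded_finite[OF U(2)] by (auto simp: w_def emeasure_eq_ennreal_measure)
  define \<rho> where "\<rho> v = (if r / 2 + v \<bullet> One \<noteq> 0 then r / 2 else r / 3)" for v :: "complex \<times> complex"
  have \<rho>: "0 < \<rho> v" "\<rho> v \<le> r" "\<rho> v + v \<bullet> One \<noteq> 0" for v using rh by (auto simp: \<rho>_def)
  define c where "c v = 1 / (\<bar>\<rho> v + v \<bullet> One\<bar> * \<rho> v ^ 3)" for v
  define d where "d v = 16 / h\<^sup>2 * w + (16 / h\<^sup>2 + 18 * (norm v + r)\<^sup>2)" for v :: "complex \<times> complex"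
  have d: "0 \<le> d v" for v using w by (simp add: d_def)
  define B where "B = (\<Sum>v\<in>V. (c v)\<^sup>2 * d v ^ 4)"
  have B: "0 \<le> B" unfolding B_def by (intro sum_nonneg) auto
  define N where "N = real (card V)"
  have "trunc_int \<delta> U u \<le> ennreal (sqrt (N ^ 6 * B)) * (1 + sobolev_energy u g)\<^sup>2"
    if s: "sobolev_fun U u g" and \<delta>: "0 < \<delta>" for u g \<delta>
  proof -
    interpret sobolev_fun U u g by (rule s)
    have [measurable]: "trunc \<delta> \<in> borel_measurable borel"
      by (rule borel_measurable_continuous_onI[OF continuous_on_trunc[OF \<delta>]])
    have Am: "inner_part U (finite_cone v r h) \<in> sets borel" for v
      using open_inner_part[OF open_U compact_finite_cone] by simp
    have AU: "inner_part U (finite_cone v r h) \<subseteq> U" for v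
      by (rule inner_part_subset, rule zero_in_finite_cone) (use rh in auto)
    have en: "sobolev_energy u g < \<infinity>" using u g by (auto simp: sobolev_energy_def L2_fun_def)
    then obtain q where q: "sobolev_energy u g = ennreal q" "0 \<le> q" by (cases "sobolev_energy u g") auto
    obtain y where y: "trunc_int \<delta> U u = ennreal y" "0 \<le> y"
      using trunc_int_finite[OF \<delta> Um U(2), of u] by (cases "trunc_int \<delta> U u") auto
    define X where "X v = enn2real (trunc_int \<delta> (inner_part U (finite_cone v r h)) u)" for v
    have X: "trunc_int \<delta> (inner_part U (finite_cone v r h)) u = ennreal (X v)" "0 \<le> X v" for v
      using trunc_int_finite[OF \<delta> Am bounded_subset[OF U(2) AU], of v u] by (simp_all add: X_def)
    have piece: "X v ^ 6 \<le> B * (y ^ 4 * (1 + q) ^ 4)" if v: "v \<in> V" for v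
    proof -
      have "ennreal (16 / h\<^sup>2) * emeasure lborel U
          + ennreal (16 / h\<^sup>2 + 18 * (norm v + r)\<^sup>2) * sobolev_energy u g =
          ennreal (16 / h\<^sup>2 * w + (16 / h\<^sup>2 + 18 * (norm v + r)\<^sup>2) * q)"
      proof -
        have "ennreal a * ennreal w + ennreal b * ennreal q = ennreal (a * w + b * q)" if "0 \<le> a" "0 \<le> b" for a b
          using that w q by (simp add: ennreal_mult)
        from this[of "16 / h\<^sup>2" "16 / h\<^sup>2 + 18 * (norm v + r)\<^sup>2"] show ?thesis
          unfolding w q by (simp del: ennreal_plus)
      qed
      from sobolev_piece[OF s rh \<rho>[of v] \<delta>, unfolded this X y c_def[symmetric]]
      have *: "ennreal (X v) ^ 6 \<le> (ennreal (c v))\<^sup>2 * (ennreal y ^ 4 *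
          ennreal (16 / h\<^sup>2 * w + (16 / h\<^sup>2 + 18 * (norm v + r)\<^sup>2) * q) ^ 4)" .
      have nn: "0 \<le> c v" "0 \<le> 16 / h\<^sup>2 * w + (16 / h\<^sup>2 + 18 * (norm v + r)\<^sup>2) * q"
        using w q \<rho>[of v] by (auto simp: c_def)
      have "X v ^ 6 \<le> (c v)\<^sup>2 * (y ^ 4 * (16 / h\<^sup>2 * w + (16 / h\<^sup>2 + 18 * (norm v + r)\<^sup>2) * q) ^ 4)"
        using * nn X(2)[of v] y(2) by (simp add: ennreal_power ennreal_mult[symmetric] del: ennreal_plus)
      also have "\<dots> \<le> (c v)\<^sup>2 * (y ^ 4 * (d v * (1 + q)) ^ 4)"
      proof (intro mult_left_mono power_mono)
        have "a * w + b * q \<le> (a * w + b) * (1 + q)" if "0 \<le> a" "0 \<le> b" for a b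
        proof -
          have "0 \<le> a * w * q + b" using that w q by simp
          then show ?thesis by (simp add: algebra_simps)
        qed
        then show "16 / h\<^sup>2 * w + (16 / h\<^sup>2 + 18 * (norm v + r)\<^sup>2) * q \<le> d v * (1 + q)"
          unfolding d_def by this auto
      qed (use w q y in auto)
      also have "\<dots> = ((c v)\<^sup>2 * d v ^ 4) * (y ^ 4 * (1 + q) ^ 4)" by (simp add: power_mult_distrib)
      also have "\<dots> \<le> B * (y ^ 4 * (1 + q) ^ 4)"
        unfolding B_def using V v by (intro mult_right_mono member_le_sum) auto
      finally show ?thesis .
    qed
    have "trunc_int \<delta> U u \<le> (\<integral>\<^sup>+x. (\<Sum>v\<in>V. ennreal (trunc \<delta> (u x) ^ 4) * indicator (inner_part U (finite_cone v r h)) x) \<partial>lborel)"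
      unfolding trunc_int_def
    proof (rule nn_integral_mono)
      fix x
      show "ennreal (trunc \<delta> (u x) ^ 4) * indicator U x \<le>
          (\<Sum>v\<in>V. ennreal (trunc \<delta> (u x) ^ 4) * indicator (inner_part U (finite_cone v r h)) x)"
      proof (cases "x \<in> U")
        case True
        then obtain v where v: "v \<in> V" "x \<in> inner_part U (finite_cone v r h)" using V by blast
        have "ennreal (trunc \<delta> (u x) ^ 4) * indicator (inner_part U (finite_cone v r h)) x \<le>
           (\<Sum>v\<in>V. ennreal (trunc \<delta> (u x) ^ 4) * indicator (inner_part U (finite_cone v r h)) x)"
          by (rule member_le_sum[OF v(1)]) (use V in auto)
        then show ?thesis using v True by simp
      qed simp
    qed
    also have "\<dots> = (\<Sum>v\<in>V. trunc_int \<delta> (inner_part U (finite_cone v r h)) u)"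
      unfolding trunc_int_def using Am by (intro nn_integral_sum) auto
    also have "\<dots> = ennreal (\<Sum>v\<in>V. X v)" using X by simp
    finally have sum: "y \<le> (\<Sum>v\<in>V. X v)" unfolding y using X(2) by (simp add: sum_nonneg)
    have "y\<^sup>2 \<le> N ^ 6 * B * (1 + q) ^ 4"
    proof (cases "y = 0")
      case True
      then show ?thesis using B q by (simp add: N_def)
    next
      case False
      then have ypos: "0 < y" using y by simp
      then have "V \<noteq> {}" using sum by auto
      then have N: "0 < N" using V by (simp add: N_def card_gt_0_iff)
      have "\<exists>v\<in>V. y / N \<le> X v"
      proof (rule ccontr)
        assume "\<not> ?thesis"
        then have "(\<Sum>v\<in>V. X v) < (\<Sum>v\<in>V. y / N)"
          using V \<open>V \<noteq> {}\<close> by (intro sum_strict_mono) auto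
        also have "\<dots> = y" using N by (simp add: N_def)
        finally show False using sum by simp
      qed
      then obtain v where v: "v \<in> V" "y / N \<le> X v" by blast
      have "(y / N) ^ 6 \<le> X v ^ 6" using v ypos N by (intro power_mono) auto
      also have "\<dots> \<le> B * (y ^ 4 * (1 + q) ^ 4)" by (rule piece[OF v(1)])
      finally have le6: "y ^ 6 \<le> N ^ 6 * (B * (y ^ 4 * (1 + q) ^ 4))"
        using N by (simp add: power_divide divide_le_eq mult.commute)
      have "y\<^sup>2 * y ^ 4 = y ^ 6" by (simp add: power_add[symmetric])
      also note le6
      also have "N ^ 6 * (B * (y ^ 4 * (1 + q) ^ 4)) = (N ^ 6 * B * (1 + q) ^ 4) * y ^ 4"
        by (simp only: mult_ac)
      finally have "y\<^sup>2 * y ^ 4 \<le> (N ^ 6 * B * (1 + q) ^ 4) * y ^ 4" .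
      then show ?thesis using ypos by (simp only: mult_le_cancel_right_pos zero_less_power)
    qed
    also have "\<dots> = (sqrt (N ^ 6 * B) * (1 + q)\<^sup>2)\<^sup>2"
      using B by (simp add: power_mult_distrib power_mult[symmetric] N_def)
    finally have "y \<le> sqrt (N ^ 6 * B) * (1 + q)\<^sup>2"
      by (rule power2_le_imp_le) (use B q in \<open>auto simp: N_def\<close>)
    then have "ennreal y \<le> ennreal (sqrt (N ^ 6 * B) * (1 + q)\<^sup>2)" by (rule ennreal_leI)
    also have "\<dots> = ennreal (sqrt (N ^ 6 * B)) * (1 + ennreal q)\<^sup>2"
    proof -
      have "1 + ennreal q = ennreal (1 + q)" using q by simp
      moreover have "0 \<le> 1 + q" "0 \<le> sqrt (N ^ 6 * B)" using q B by (auto simp: N_def)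
      ultimately show ?thesis by (simp add: ennreal_mult ennreal_power del: ennreal_plus)
    qed
    finally show ?thesis unfolding y q .
  qed
  moreover have "0 \<le> sqrt (N ^ 6 * B)" using B by (simp add: N_def)
  ultimately show ?thesis by blast
qed

lemma sobolev_fun_scale:
  assumes "sobolev_fun U u g"
  shows "sobolev_fun U (\<lambda>x. c * u x) (\<lambda>b x. c * g b x)"
    and "sobolev_energy (\<lambda>x. c * u x) (\<lambda>b x. c * g b x) = ennreal ((norm c)\<^sup>2) * sobolev_energy u g"
proof -
  interpret sobolev_fun U u g by fact
  show "sobolev_fun U (\<lambda>x. c * u x) (\<lambda>b x. c * g b x)"
    by unfold_locales (use open_U bounded_U u g weak in \<open>auto intro: L2_fun_scale weak_deriv_scale\<close>)
  have gm: "g b \<in> borel_measurable borel" if "b \<in> Basis" for b using g[OF that] by (simp add: L2_fun_def)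
  show "sobolev_energy (\<lambda>x. c * u x) (\<lambda>b x. c * g b x) = ennreal ((norm c)\<^sup>2) * sobolev_energy u g"
    unfolding sobolev_energy_def using gm
    by (simp add: sq_int_scale distrib_left sum_distrib_left)
qed

text \<open>
  Letting \<open>\<delta>\<close> tend to \<open>0\<close> gives a bound by \<open>(1 + energy)\<^sup>2\<close>.  Applied to a multiple of \<open>u\<close> whose energy is
  at most \<open>1\<close>, it becomes homogeneous.
\<close>
theorem sobolev_inequality:
  fixes U :: "(complex \<times> complex) set"
  assumes U: "open U" "bounded U" and rh: "0 < r" "0 < h"
    and V: "finite V" "U \<subseteq> (\<Union>v\<in>V. inner_part U (finite_cone v r h))"
  shows "\<exists>C\<ge>0. \<forall>u g. sobolev_fun U u g \<longrightarrow>
    (\<integral>\<^sup>+x. ennreal (norm (u x) ^ 4) \<partial>lborel) \<le> ennreal C * (sobolev_energy u g)\<^sup>2"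
proof -
  obtain C where C: "0 \<le> C" "\<And>u g \<delta>. sobolev_fun U u g \<Longrightarrow> 0 < \<delta> \<Longrightarrow>
    trunc_int \<delta> U u \<le> ennreal C * (1 + sobolev_energy u g)\<^sup>2"
    using sobolev_trunc[OF U rh V] by blast
  have bound: "(\<integral>\<^sup>+x. ennreal (norm (u x) ^ 4) \<partial>lborel) \<le> ennreal C * (1 + sobolev_energy u g)\<^sup>2"
    if s: "sobolev_fun U u g" for u g
  proof -
    interpret sobolev_fun U u g by (rule s)
    define \<delta> where "\<delta> n = 1 / real (Suc n)" for n
    have \<delta>: "0 < \<delta> n" for n by (simp add: \<delta>_def)
    have \<delta>0: "\<delta> \<longlonglongrightarrow> 0" unfolding \<delta>_def by (rule LIMSEQ_Suc[OF lim_1_over_n])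
    have tm [measurable]: "trunc (\<delta> n) \<in> borel_measurable borel" for n
      by (rule borel_measurable_continuous_onI[OF continuous_on_trunc[OF \<delta>]])
    have "(\<integral>\<^sup>+x. ennreal (norm (u x) ^ 4) \<partial>lborel) \<le>
        (\<integral>\<^sup>+x. liminf (\<lambda>n. ennreal (trunc (\<delta> n) (u x) ^ 4) * indicator U x) \<partial>lborel)"
    proof (rule nn_integral_mono)
      fix x
      show "ennreal (norm (u x) ^ 4) \<le> liminf (\<lambda>n. ennreal (trunc (\<delta> n) (u x) ^ 4) * indicator U x)"
      proof (cases "x \<in> U")
        case True
        let ?r = "sqrt (1 + (norm (u x))\<^sup>2)"
        have "(\<lambda>n. trunc (\<delta> n) (u x)) \<longlonglongrightarrow> ?r / (1 + 0 * ?r)"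
          unfolding trunc_def by (intro tendsto_intros \<delta>0) simp
        then have "(\<lambda>n. ennreal (trunc (\<delta> n) (u x) ^ 4)) \<longlonglongrightarrow> ennreal ((?r / (1 + 0 * ?r)) ^ 4)"
          by (intro tendsto_intros)
        then have "liminf (\<lambda>n. ennreal (trunc (\<delta> n) (u x) ^ 4)) = ennreal ((?r / (1 + 0 * ?r)) ^ 4)"
          by (rule lim_imp_Liminf[OF sequentially_bot])
        moreover have "norm (u x) \<le> ?r" by (rule real_le_rsqrt) simp
        then have "ennreal (norm (u x) ^ 4) \<le> ennreal ((?r / (1 + 0 * ?r)) ^ 4)"
          by (intro ennreal_leI power_mono) auto
        ultimately show ?thesis using True by simp
      next
        case False
        then have "u x = 0" using u unfolding L2_fun_def by blast
        then show ?thesis by simp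
      qed
    qed
    also have "\<dots> \<le> liminf (\<lambda>n. trunc_int (\<delta> n) U u)"
      unfolding trunc_int_def by (rule nn_integral_liminf) measurable
    also have "\<dots> \<le> ennreal C * (1 + sobolev_energy u g)\<^sup>2"
      by (rule Liminf_le) (use C(2)[OF s \<delta>] in auto)
    finally show ?thesis .
  qed
  have "(\<integral>\<^sup>+x. ennreal (norm (u x) ^ 4) \<partial>lborel) \<le> ennreal (4 * C) * (sobolev_energy u g)\<^sup>2"
    if s: "sobolev_fun U u g" for u g
  proof -
    interpret sobolev_fun U u g by (rule s)
    have en: "sobolev_energy u g < \<infinity>" using u g by (auto simp: sobolev_energy_def L2_fun_def)
    then obtain q where q: "sobolev_energy u g = ennreal q" "0 \<le> q" by (cases "sobolev_energy u g") auto
    have "(\<integral>\<^sup>+x. ennreal (norm (u x) ^ 4) \<partial>lborel) < \<infinity>"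
      using bound[OF s] q by (auto simp: ennreal_mult_less_top power2_eq_square intro: order_le_less_trans)
    then obtain I where I: "(\<integral>\<^sup>+x. ennreal (norm (u x) ^ 4) \<partial>lborel) = ennreal I" "0 \<le> I"
      by (cases "\<integral>\<^sup>+x. ennreal (norm (u x) ^ 4) \<partial>lborel") auto
    have step: "I \<le> C * (q + \<epsilon> + q)\<^sup>2" if \<epsilon>: "0 < \<epsilon>" for \<epsilon>
    proof -
      define t where "t = 1 / (q + \<epsilon>)"
      have t: "0 < t" using q \<epsilon> by (simp add: t_def)
      define c where "c = complex_of_real (sqrt t)"
      have c: "(norm c)\<^sup>2 = t" "norm c ^ 4 = t\<^sup>2"
      proof -
        show "(norm c)\<^sup>2 = t" using t by (simp add: c_def)
        then show "norm c ^ 4 = t\<^sup>2" using power_mult[of "norm c" 2 2] by simp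
      qed
      have "ennreal (t\<^sup>2 * I) = (\<integral>\<^sup>+x. ennreal (norm (c * u x) ^ 4) \<partial>lborel)"
      proof -
        have "(\<integral>\<^sup>+x. ennreal (norm (c * u x) ^ 4) \<partial>lborel) = (\<integral>\<^sup>+x. ennreal (t\<^sup>2) * ennreal (norm (u x) ^ 4) \<partial>lborel)"
          by (simp add: norm_mult power_mult_distrib c ennreal_mult)
        also have "\<dots> = ennreal (t\<^sup>2) * ennreal I" unfolding I(1)[symmetric] by (rule nn_integral_cmult) measurable
        finally show ?thesis using I by (simp add: ennreal_mult)
      qed
      also have "\<dots> \<le> ennreal C * (1 + sobolev_energy (\<lambda>x. c * u x) (\<lambda>b x. c * g b x))\<^sup>2"
        by (rule bound[OF sobolev_fun_scale(1)[OF s]])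
      also have "\<dots> = ennreal (C * (1 + t * q)\<^sup>2)"
      proof -
        have "1 + sobolev_energy (\<lambda>x. c * u x) (\<lambda>b x. c * g b x) = ennreal (1 + t * q)"
          unfolding sobolev_fun_scale(2)[OF s] c q using t q by (simp add: ennreal_mult)
        moreover have "0 \<le> 1 + t * q" using t q by simp
        ultimately show ?thesis using C by (simp add: ennreal_power ennreal_mult del: ennreal_plus)
      qed
      finally have "t\<^sup>2 * I \<le> C * (1 + t * q)\<^sup>2" using C by (subst (asm) ennreal_le_iff) auto
      then have "(q + \<epsilon>)\<^sup>2 * (t\<^sup>2 * I) \<le> (q + \<epsilon>)\<^sup>2 * (C * (1 + t * q)\<^sup>2)" by (rule mult_left_mono) simp
      also have "(q + \<epsilon>)\<^sup>2 * (t\<^sup>2 * I) = ((q + \<epsilon>) * t)\<^sup>2 * I" by (simp add: power_mult_distrib)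
      also have "(q + \<epsilon>) * t = 1" using q \<epsilon> by (simp add: t_def)
      also have "(q + \<epsilon>)\<^sup>2 * (C * (1 + t * q)\<^sup>2) = C * ((q + \<epsilon>) + (q + \<epsilon>) * t * q)\<^sup>2"
        by (simp add: power_mult_distrib[symmetric] algebra_simps)
      also have "(q + \<epsilon>) * t * q = q" using q \<epsilon> by (simp add: t_def)
      finally show ?thesis by simp
    qed
    have "I \<le> C * (q + 0 + q)\<^sup>2"
    proof (rule tendsto_le[of "at_right (0::real)"])
      show "((\<lambda>\<epsilon>. C * (q + \<epsilon> + q)\<^sup>2) \<longlongrightarrow> C * (q + 0 + q)\<^sup>2) (at_right 0)"
        by (intro tendsto_mult tendsto_power tendsto_add tendsto_const tendsto_ident_at)
      show "\<forall>\<^sub>F \<epsilon> in at_right 0. I \<le> C * (q + \<epsilon> + q)\<^sup>2"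
        using eventually_at_right_less[of 0] by eventually_elim (rule step)
    qed auto
    also have "\<dots> = 4 * C * q\<^sup>2" by (simp add: power2_eq_square)
    finally show ?thesis unfolding I q using C q by (simp add: ennreal_power ennreal_mult[symmetric] ennreal_leI)
  qed
  then show ?thesis using C(1) by (intro exI[of _ "4 * C"]) auto
qed


section \<open>The cone condition on the Hartogs triangle\<close>

text \<open>
  Total boundedness of the set of axes: an axis is replaced by a nearby one from a finite set at the
  price of halving the aperture.
\<close>
lemma finite_cone_cover:
  fixes U :: "'a::euclidean_space set"
  assumes B: "\<And>x. x \<in> U \<Longrightarrow> norm (a x) \<le> B" and r: "0 < r"
    and cone: "\<And>x y t. x \<in> U \<Longrightarrow> y \<in> cball (a x) (2 * r) \<Longrightarrow> 0 \<le> t \<Longrightarrow> t \<le> h \<Longrightarrow> x + t *\<^sub>R y \<in> U"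
  obtains V where "finite V" "U \<subseteq> (\<Union>v\<in>V. inner_part U (finite_cone v r h))"
proof -
  have "compact (cball (0::'a) B)" by simp
  then have "\<exists>V. finite V \<and> cball (0::'a) B \<subseteq> (\<Union>v\<in>V. ball v r)"
    using r unfolding compact_eq_totally_bounded by blast
  then obtain V where V: "finite V" "cball (0::'a) B \<subseteq> (\<Union>v\<in>V. ball v r)"
    by blast
  have "U \<subseteq> (\<Union>v\<in>V. inner_part U (finite_cone v r h))"
  proof
    fix x assume x: "x \<in> U"
    then have "a x \<in> cball 0 B" using B by simp
    then obtain v where v: "v \<in> V" "a x \<in> ball v r" using V(2) by blast
    have "x + t *\<^sub>R y \<in> U" if "0 \<le> t" "t \<le> h" "y \<in> cball v r" for t y
    proof (rule cone[OF x _ that(1,2)])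
      have "dist (a x) y \<le> dist (a x) v + dist v y" by (rule dist_triangle)
      then show "y \<in> cball (a x) (2 * r)" using v(2) that(3) by (simp add: dist_commute)
    qed
    then have "x \<in> inner_part U (finite_cone v r h)"
      unfolding inner_part_def finite_cone_def by auto
    then show "x \<in> (\<Union>v\<in>V. inner_part U (finite_cone v r h))" using v(1) by blast
  qed
  with V(1) show ?thesis using that by blast
qed

lemma open_hartogs_triangle: "open hartogs_triangle"
proof -
  have eq: "hartogs_triangle = {x. norm (fst x) < norm (snd x)} \<inter> {x. norm (snd x) < 1}"
    by (auto simp: hartogs_triangle_def)
  show ?thesis
    unfolding eq by (intro open_Int open_Collect_less continuous_intros)
qed

lemma bounded_hartogs_triangle: "bounded hartogs_triangle"
proof -
  have "norm x \<le> 2" if "x \<in> hartogs_triangle" for x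
    using that norm_Pair_le[of "fst x" "snd x"] by (auto simp: hartogs_triangle_def)
  then show ?thesis unfolding bounded_iff by blast
qed

text \<open>
  Near the origin the axis increases \<open>|w|\<close> at unit speed and keeps \<open>z\<close> fixed.  Away from the origin it is
  the direction of the flow \<open>(exp(-2t) z, exp(-t) w)\<close>, which contracts \<open>z\<close> faster than \<open>w\<close> and so
  moves away from both boundary parts \<open>|z| = |w|\<close> and \<open>|w| = 1\<close>.
\<close>
definition hartogs_axis :: "complex \<times> complex \<Rightarrow> complex \<times> complex" where
  "hartogs_axis = (\<lambda>(z, w). if norm w < 1/2 then (0, w /\<^sub>R norm w) else (- 2 * z, - w))"

lemma hartogs_triangle_cone:
  assumes x: "x \<in> hartogs_triangle" and y: "y \<in> cball (hartogs_axis x) (1/4)" and t: "0 \<le> t" "t \<le> 1/4"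
  shows "x + t *\<^sub>R y \<in> hartogs_triangle"
proof -
  obtain z w where zw: "x = (z, w)" "norm z < norm w" "norm w < 1"
    using x by (auto simp: hartogs_triangle_def)
  obtain a b where ab: "y = (a, b)" by (cases y)
  show ?thesis
  proof (cases "norm w < 1/2")
    case True
    have "norm (y - (0, w /\<^sub>R norm w)) \<le> 1/4"
      using y True by (simp add: hartogs_axis_def zw dist_norm norm_minus_commute)
    then have a: "norm a \<le> 1/4" and b: "norm (b - w /\<^sub>R norm w) \<le> 1/4"
      using norm_fst_le[of a "b - w /\<^sub>R norm w"] norm_snd_le[of "b - w /\<^sub>R norm w" a]
      by (auto simp: ab)
    have w0: "0 < norm w" using zw(2) norm_ge_zero[of z] by linarith
    have "w + t *\<^sub>R (w /\<^sub>R norm w) = (1 + t / norm w) *\<^sub>R w" by (simp add: algebra_simps divide_inverse)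
    then have "norm (w + t *\<^sub>R (w /\<^sub>R norm w)) = (1 + t / norm w) * norm w" using t w0 by simp
    also have "\<dots> = norm w + t" using w0 by (simp add: algebra_simps)
    finally have n: "norm (w + t *\<^sub>R (w /\<^sub>R norm w)) = norm w + t" .
    have eq: "w + t *\<^sub>R b = (w + t *\<^sub>R (w /\<^sub>R norm w)) + t *\<^sub>R (b - w /\<^sub>R norm w)" by (simp add: algebra_simps)
    have "norm (t *\<^sub>R (b - w /\<^sub>R norm w)) \<le> t / 4" using mult_left_mono[OF b t(1)] t by simp
    then have "norm (w + t *\<^sub>R b) \<le> norm w + t + t / 4" "norm (w + t *\<^sub>R b) \<ge> norm w + t - t / 4"
      using norm_triangle_ineq[of "w + t *\<^sub>R (w /\<^sub>R norm w)" "t *\<^sub>R (b - w /\<^sub>R norm w)"]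
        norm_diff_ineq[of "w + t *\<^sub>R (w /\<^sub>R norm w)" "t *\<^sub>R (b - w /\<^sub>R norm w)"] n
      unfolding eq by linarith+
    moreover have "norm (z + t *\<^sub>R a) \<le> norm z + t * (1/4)"
      using norm_triangle_ineq[of z "t *\<^sub>R a"] mult_left_mono[OF a t(1)] t by simp
    ultimately show ?thesis using True zw t by (auto simp: ab hartogs_triangle_def)
  next
    case False
    have "norm (y - (- 2 * z, - w)) \<le> 1/4"
      using y False by (simp add: hartogs_axis_def zw dist_norm norm_minus_commute)
    then have a: "norm (a + 2 * z) \<le> 1/4" and b: "norm (b + w) \<le> 1/4"
      using norm_fst_le[of "a + 2 * z" "b + w"] norm_snd_le[of "b + w" "a + 2 * z"] by (auto simp: ab)
    have "z + t *\<^sub>R a = (1 - 2 * t) *\<^sub>R z + t *\<^sub>R (a + 2 * z)" by (simp add: algebra_simps scaleR_conv_of_real)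
    then have "norm (z + t *\<^sub>R a) \<le> (1 - 2 * t) * norm z + t * norm (a + 2 * z)"
      using norm_triangle_ineq[of "(1 - 2 * t) *\<^sub>R z" "t *\<^sub>R (a + 2 * z)"] t by simp
    also have "t * norm (a + 2 * z) \<le> t * (1/4)" using a t by (intro mult_left_mono) auto
    finally have 1: "norm (z + t *\<^sub>R a) \<le> (1 - 2 * t) * norm z + t / 4" by simp
    have eq: "w + t *\<^sub>R b = (1 - t) *\<^sub>R w + t *\<^sub>R (b + w)" by (simp add: algebra_simps)
    have tb: "norm (t *\<^sub>R (b + w)) \<le> t / 4" using mult_left_mono[OF b t(1)] t by simp
    have 2: "norm (w + t *\<^sub>R b) \<le> (1 - t) * norm w + t / 4" "norm (w + t *\<^sub>R b) \<ge> (1 - t) * norm w - t / 4"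
      using norm_triangle_ineq[of "(1 - t) *\<^sub>R w" "t *\<^sub>R (b + w)"]
        norm_diff_ineq[of "(1 - t) *\<^sub>R w" "t *\<^sub>R (b + w)"] tb t unfolding eq by auto
    have 3: "t * norm w \<ge> t * (1/2)" using False t by (intro mult_left_mono) auto
    have "(1 - 2 * t) * norm z < (1 - 2 * t) * norm w" using t zw by (intro mult_strict_left_mono) auto
    also have "\<dots> \<le> (1 - t) * norm w - t / 2" using 3 by (simp add: algebra_simps)
    finally have "norm (z + t *\<^sub>R a) < norm (w + t *\<^sub>R b)" using 1 2 by linarith
    moreover have "norm (w + t *\<^sub>R b) < 1"
    proof -
      have "(1 - t) * norm w + t / 4 \<le> norm w" using 3 t by (simp add: algebra_simps)
      then show ?thesis using 2 zw by linarith
    qed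
    ultimately show ?thesis by (auto simp: zw ab hartogs_triangle_def)
  qed
qed

lemma hartogs_triangle_cone_cover:
  obtains V where "finite V" "hartogs_triangle \<subseteq> (\<Union>v\<in>V. inner_part hartogs_triangle (finite_cone v (1/8) (1/4)))"
proof (rule finite_cone_cover[of hartogs_triangle hartogs_axis 3 "1/8" "1/4"])
  fix x assume "x \<in> hartogs_triangle"
  then obtain z w where zw: "x = (z, w)" "norm z < norm w" "norm w < 1" by (auto simp: hartogs_triangle_def)
  show "norm (hartogs_axis x) \<le> 3"
  proof (cases "norm w < 1/2")
    case True
    have "norm (0::complex, w /\<^sub>R norm w) \<le> 1" by (cases "w = 0") (auto simp: norm_Pair)
    then show ?thesis using True by (simp add: hartogs_axis_def zw)
  next
    case False
    have "norm (- 2 * z, - w) \<le> 3"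
      using norm_Pair_le[of "- 2 * z" "- w"] zw by (simp add: norm_mult)
    then show ?thesis using False by (simp add: hartogs_axis_def zw)
  qed
qed (use hartogs_triangle_cone that in auto)

section \<open>Smooth approximation on the Hartogs triangle\<close>

text \<open>
  Shrinking \<open>z\<close> more strongly than \<open>w\<close> moves the boundary of the Hartogs triangle, except for the origin,
  into its interior.
\<close>
definition anisotropic :: "real \<Rightarrow> complex \<times> complex \<Rightarrow> complex \<times> complex" where
  "anisotropic \<mu> = (\<lambda>(z, w). (\<mu>\<^sup>2 *\<^sub>R z, \<mu> *\<^sub>R w))"

lemma bounded_linear_anisotropic: "bounded_linear (anisotropic \<mu>)"
  unfolding anisotropic_def case_prod_beta
  by (intro bounded_linear_Pair bounded_linear_const_scaleR bounded_linear_fst bounded_linear_snd)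

lemma distortion_anisotropic:
  assumes \<mu>: "1/2 \<le> \<mu>" "\<mu> \<le> 1"
  shows "distortion 64 (anisotropic \<mu>)"
  unfolding distortion_def
proof (intro conjI ballI)
  have c: "continuous_on UNIV (anisotropic \<mu>)" by (rule linear_continuous_on[OF bounded_linear_anisotropic])
  then show m [measurable]: "anisotropic \<mu> \<in> borel_measurable borel" by (rule borel_measurable_continuous_onI)
  fix F :: "complex \<times> complex \<Rightarrow> ennreal" assume F [measurable]: "F \<in> borel_measurable borel"
  have l: "0 < \<mu>" using \<mu> by simp
  have pair: "(\<lambda>z. (z, w)) \<in> borel_measurable borel" for w :: complex
    by (intro borel_measurable_continuous_onI continuous_intros)
  have Fs: "(\<lambda>z. F (z, w)) \<in> borel_measurable borel" for w
    using measurable_compose[OF pair F] .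
  have inner: "(\<integral>\<^sup>+z. F (z, w) \<partial>lborel) = ennreal (\<mu> ^ 4) * (\<integral>\<^sup>+z. F (\<mu>\<^sup>2 *\<^sub>R z, w) \<partial>lborel)" for w
    using nn_integral_euclidean_affine[OF Fs, of "\<mu>\<^sup>2" w 0] l by (simp add: power_mult[symmetric])
  have Fl: "F \<in> borel_measurable (lborel \<Otimes>\<^sub>M lborel)" by (simp add: lborel_prod)
  have "(\<integral>\<^sup>+x. F x \<partial>lborel) = (\<integral>\<^sup>+w. \<integral>\<^sup>+z. F (z, w) \<partial>lborel \<partial>lborel)"
    by (rule nn_integral_prod[OF F])
  also have "\<dots> = ennreal (\<mu>\<^sup>2) * (\<integral>\<^sup>+w. \<integral>\<^sup>+z. F (z, \<mu> *\<^sub>R w) \<partial>lborel \<partial>lborel)"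
  proof -
    have "(\<lambda>w. \<integral>\<^sup>+z. F (z, w) \<partial>lborel) \<in> borel_measurable borel" using Fl by measurable
    from nn_integral_euclidean_affine[OF this, of \<mu> 0] l show ?thesis by simp
  qed
  also have "\<dots> = ennreal (\<mu>\<^sup>2) * (\<integral>\<^sup>+w. ennreal (\<mu> ^ 4) * (\<integral>\<^sup>+z. F (anisotropic \<mu> (z, w)) \<partial>lborel) \<partial>lborel)"
    unfolding inner by (simp add: anisotropic_def)
  also have "\<dots> = ennreal (\<mu>\<^sup>2) * (ennreal (\<mu> ^ 4) * (\<integral>\<^sup>+w. \<integral>\<^sup>+z. F (anisotropic \<mu> (z, w)) \<partial>lborel \<partial>lborel))"
  proof -
    have "(\<lambda>x. F (anisotropic \<mu> x)) \<in> borel_measurable (lborel \<Otimes>\<^sub>M lborel)"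
      using measurable_compose[OF m F] by (simp add: lborel_prod)
    then have "(\<lambda>w. \<integral>\<^sup>+z. F (anisotropic \<mu> (z, w)) \<partial>lborel) \<in> borel_measurable lborel" by measurable
    then show ?thesis by (subst nn_integral_cmult) auto
  qed
  also have "(\<integral>\<^sup>+w. \<integral>\<^sup>+z. F (anisotropic \<mu> (z, w)) \<partial>lborel \<partial>lborel) = (\<integral>\<^sup>+x. F (anisotropic \<mu> x) \<partial>lborel)"
    by (rule nn_integral_prod[symmetric]) measurable
  finally have eq: "(\<integral>\<^sup>+x. F x \<partial>lborel) = ennreal (\<mu> ^ 6) * (\<integral>\<^sup>+x. F (anisotropic \<mu> x) \<partial>lborel)"
    using l by (simp add: mult.assoc[symmetric] ennreal_mult[symmetric] power_add[symmetric])
  have "(1/2) ^ 6 \<le> \<mu> ^ 6" using \<mu> by (intro power_mono) auto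
  then have "1 \<le> 64 * \<mu> ^ 6" by (simp add: power_divide)
  then have "ennreal 1 \<le> ennreal 64 * ennreal (\<mu> ^ 6)" using l by (subst ennreal_mult[symmetric]) (auto simp del: ennreal_numeral ennreal_1 intro!: ennreal_leI)
  then have "1 * (\<integral>\<^sup>+x. F (anisotropic \<mu> x) \<partial>lborel) \<le> (ennreal 64 * ennreal (\<mu> ^ 6)) * (\<integral>\<^sup>+x. F (anisotropic \<mu> x) \<partial>lborel)"
    by (intro mult_right_mono) simp_all
  then show "(\<integral>\<^sup>+x. F (anisotropic \<mu> x) \<partial>lborel) \<le> ennreal 64 * (\<integral>\<^sup>+x. F x \<partial>lborel)"
    unfolding eq by (simp add: mult.assoc)
qed

text \<open>
  One minus the mollified indicator of a ball of radius \<open>3\<close>, rescaled.  The constant \<open>M\<close> does not depend on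
  the scale \<open>s\<close>.
\<close>
lemma cutoff_exists:
  "\<exists>M\<ge>0. \<forall>s>0. \<exists>\<psi> :: 'a::euclidean_space \<Rightarrow> complex. smooth \<psi> \<and> (\<forall>x. norm (\<psi> x) \<le> 2) \<and>
     (\<forall>x. norm x < 2 * s \<longrightarrow> \<psi> x = 0) \<and> (\<forall>x. 4 * s < norm x \<longrightarrow> \<psi> x = 1) \<and>
     (\<forall>x. \<forall>b\<in>Basis. norm (frechet_derivative \<psi> (at x) b) \<le> M / s) \<and>
     (\<forall>x. \<forall>b\<in>Basis. 4 * s < norm x \<longrightarrow> frechet_derivative \<psi> (at x) b = 0)"
proof -
  obtain K where K: "mollifier K (ball (0::'a) 1)" using mollifier_exists[of 1 0] by auto
  define f :: "'a \<Rightarrow> complex" where "f x = of_real (indicat_real (ball 0 3) x)" for x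
  have f: "integrable lborel f"
    unfolding f_def by (intro integrable_of_real)
      (simp add: integrable_indicator_iff emeasure_bounded_finite[OF bounded_ball, simplified])
  have [measurable]: "Measurable.pred borel (\<lambda>x::'a. x \<in> ball 0 3)"
    by (simp add: pred_def)
  have fm: "f \<in> borel_measurable borel" unfolding f_def by measurable
  have f_le: "norm (f x) \<le> 1" for x by (simp add: f_def indicator_def)
  define \<psi>0 where "\<psi>0 x = 1 + - conv f K x" for x
  have sc: "smooth (conv f K)"
    by (rule smooth_conv[OF f _ bounded_ball[of 0 1]]) (use K in \<open>auto simp: mollifier_def\<close>)
  have s0: "smooth \<psi>0" unfolding \<psi>0_def
    by (intro smooth_add smooth_const smooth_linear_image[OF _ sc] bounded_linear_minus bounded_linear_ident)
  have le2: "norm (\<psi>0 x) \<le> 2" for x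
    using norm_triangle_ineq[of 1 "- conv f K x"] norm_conv_le[OF K f_le fm, of x] by (simp add: \<psi>0_def)
  have in0: "\<psi>0 x = 0" if "norm x < 2" for x
  proof -
    have eq: "f (x + y) * of_real (K y) = of_real (K y)" for y
    proof (cases "y \<in> ball 0 1")
      case True
      then have "norm (x + y) < 3" using norm_triangle_ineq[of x y] that by simp
      then show ?thesis by (simp add: f_def)
    qed (use K in \<open>simp add: mollifier_def\<close>)
    have "conv f K x = (LINT y|lborel. complex_of_real (K y))"
      by (simp only: conv_eq_average[OF fm mollifier_measurable[OF K]] eq)
    then show ?thesis using K by (simp add: \<psi>0_def mollifier_def)
  qed
  have out1: "\<psi>0 x = 1" if "4 < norm x" for x
  proof -
    have "conv f K x = 0"
    proof (rule conv_eq_0[OF K _ fm])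
      fix y :: 'a assume "y \<in> ball 0 1"
      then have "norm (x + y) > 3" using norm_diff_ineq[of x y] that by simp
      then show "f (x + y) = 0" by (simp add: f_def)
    qed
    then show ?thesis by (simp add: \<psi>0_def)
  qed
  have D0: "frechet_derivative \<psi>0 (at x) b = 0" if "4 < norm x" for x b
  proof -
    have "(\<psi>0 has_derivative (\<lambda>h. 0)) (at x)"
    proof (rule has_derivative_transform_within_open[OF has_derivative_const[of 1]])
      show "open (- cball (0::'a) 4)" by (rule open_Compl[OF closed_cball])
    qed (use that out1 in auto)
    then show ?thesis using frechet_derivative_at by metis
  qed
  have "\<exists>M. \<forall>x. norm (frechet_derivative \<psi>0 (at x) b) \<le> M" for b
  proof (rule bounded_support_bounded[of "\<lambda>x. frechet_derivative \<psi>0 (at x) b" "cball 0 4"])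
    show "continuous_on UNIV (\<lambda>x. frechet_derivative \<psi>0 (at x) b)"
      by (rule smooth_continuous[OF smooth_frechet_derivative[OF s0]])
  qed (use D0 in auto)
  then obtain M where M: "\<And>b x. norm (frechet_derivative \<psi>0 (at x) b) \<le> M b" by metis
  define M0 where "M0 = (\<Sum>b\<in>(Basis :: 'a set). \<bar>M b\<bar>)"
  have M0: "norm (frechet_derivative \<psi>0 (at x) b) \<le> M0" if "b \<in> Basis" for x b
  proof -
    have "norm (frechet_derivative \<psi>0 (at x) b) \<le> \<bar>M b\<bar>" using M[of x b] by linarith
    also have "\<dots> \<le> M0" unfolding M0_def using that by (intro member_le_sum) auto
    finally show ?thesis .
  qed
  show ?thesis
  proof (intro exI[of _ M0] conjI allI impI)
    show "0 \<le> M0" by (simp add: M0_def sum_nonneg)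
    fix s :: real assume s: "0 < s"
    define \<psi> where "\<psi> x = \<psi>0 ((1 / s) *\<^sub>R x + 0)" for x
    have bl: "bounded_linear (\<lambda>x::'a. (1 / s) *\<^sub>R x)" by (rule bounded_linear_scaleR_right)
    have D: "frechet_derivative \<psi> (at x) b = (1 / s) *\<^sub>R frechet_derivative \<psi>0 (at ((1 / s) *\<^sub>R x)) b" for x b
    proof -
      have "((\<lambda>x. (1 / s) *\<^sub>R x) has_derivative (\<lambda>h. (1 / s) *\<^sub>R h)) (at x)"
        by (rule bounded_linear_imp_has_derivative[OF bl])
      from has_derivative_compose[OF this smooth_has_derivative[OF s0]]
      have "(\<psi> has_derivative (\<lambda>h. frechet_derivative \<psi>0 (at ((1 / s) *\<^sub>R x)) ((1 / s) *\<^sub>R h))) (at x)"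
        by (simp add: \<psi>_def[abs_def])
      then have "frechet_derivative \<psi> (at x) b = frechet_derivative \<psi>0 (at ((1 / s) *\<^sub>R x)) ((1 / s) *\<^sub>R b)"
        using frechet_derivative_at by metis
      also have "\<dots> = (1 / s) *\<^sub>R frechet_derivative \<psi>0 (at ((1 / s) *\<^sub>R x)) b"
        using linear_scale[OF has_derivative_linear[OF smooth_has_derivative[OF s0]]] .
      finally show ?thesis .
    qed
    have n1: "norm ((1 / s) *\<^sub>R x) = norm x / s" for x :: 'a using s by simp
    show "\<exists>\<psi> :: 'a \<Rightarrow> complex. smooth \<psi> \<and> (\<forall>x. norm (\<psi> x) \<le> 2) \<and>
       (\<forall>x. norm x < 2 * s \<longrightarrow> \<psi> x = 0) \<and> (\<forall>x. 4 * s < norm x \<longrightarrow> \<psi> x = 1) \<and>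
       (\<forall>x. \<forall>b\<in>Basis. norm (frechet_derivative \<psi> (at x) b) \<le> M0 / s) \<and>
       (\<forall>x. \<forall>b\<in>Basis. 4 * s < norm x \<longrightarrow> frechet_derivative \<psi> (at x) b = 0)"
    proof (intro exI[of _ \<psi>] conjI allI ballI impI)
      show "smooth \<psi>" unfolding \<psi>_def by (rule smooth_affine[OF bl s0])
      show "norm (\<psi> x) \<le> 2" for x by (simp only: \<psi>_def le2)
      show "\<psi> x = 0" if "norm x < 2 * s" for x
        unfolding \<psi>_def by (rule in0) (use that s n1[of x] in \<open>simp add: divide_less_eq\<close>)
      show "\<psi> x = 1" if "4 * s < norm x" for x
        unfolding \<psi>_def by (rule out1) (use that s n1[of x] in \<open>simp add: less_divide_eq\<close>)
      show "norm (frechet_derivative \<psi> (at x) b) \<le> M0 / s" if "b \<in> Basis" for x b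
        unfolding D norm_scaleR using M0[OF that, of "(1 / s) *\<^sub>R x"] s by (simp add: divide_right_mono)
      show "frechet_derivative \<psi> (at x) b = 0" if "4 * s < norm x" for x b
        unfolding D using D0[of "(1 / s) *\<^sub>R x" b] that s n1[of x] by (simp add: less_divide_eq)
    qed
  qed
qed

lemma small_ball_integral:
  fixes F :: "'a::euclidean_space \<Rightarrow> ennreal"
  assumes [measurable]: "F \<in> borel_measurable borel" and fin: "(\<integral>\<^sup>+x. F x \<partial>lborel) < \<infinity>" and e: "0 < e"
  shows "\<exists>s0>0. \<forall>s. s \<le> s0 \<longrightarrow> (\<integral>\<^sup>+x\<in>cball 0 s. F x \<partial>lborel) < e"
proof -
  have "(\<lambda>n. \<integral>\<^sup>+x. F x * indicator (cball 0 (1 / real (Suc n))) x \<partial>lborel) \<longlonglongrightarrow> (\<integral>\<^sup>+x. 0 \<partial>(lborel :: 'a measure))"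
  proof (rule nn_integral_dominated_convergence[where w = F])
    have "AE x in lborel. x \<noteq> (0::'a)" by (rule AE_lborel_singleton)
    then show "AE x in lborel. (\<lambda>n. F x * indicator (cball 0 (1 / real (Suc n))) x) \<longlonglongrightarrow> 0"
    proof eventually_elim
      case (elim x)
      then obtain N where N: "1 / real (Suc N) < norm x" using nat_approx_posE[of "norm x"] by auto
      have "F x * indicator (cball 0 (1 / real (Suc n))) x = 0" if "n \<ge> N" for n
      proof -
        have "1 / real (Suc n) \<le> 1 / real (Suc N)" using that by (simp add: frac_le)
        then have "x \<notin> cball 0 (1 / real (Suc n))" using N by simp
        then show ?thesis by simp
      qed
      then have "\<forall>\<^sub>F n in sequentially. F x * indicator (cball 0 (1 / real (Suc n))) x = 0"
        by (auto simp: eventually_sequentially)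
      then show ?case by (rule tendsto_eventually)
    qed
  qed (use fin in \<open>auto simp: indicator_def\<close>)
  then have lim: "(\<lambda>n. \<integral>\<^sup>+x. F x * indicator (cball 0 (1 / real (Suc n))) x \<partial>lborel) \<longlonglongrightarrow> 0" by simp
  obtain n where n: "(\<integral>\<^sup>+x. F x * indicator (cball 0 (1 / real (Suc n))) x \<partial>lborel) < e"
    by (rule eventually_less_ennreal[OF lim e])
  have "(\<integral>\<^sup>+x\<in>cball 0 s. F x \<partial>lborel) < e" if "s \<le> 1 / real (Suc n)" for s
  proof (rule order_le_less_trans[OF _ n])
    show "(\<integral>\<^sup>+x\<in>cball 0 s. F x \<partial>lborel) \<le> (\<integral>\<^sup>+x. F x * indicator (cball 0 (1 / real (Suc n))) x \<partial>lborel)"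
      using that by (intro nn_integral_mono mult_left_mono) (auto simp: indicator_def)
  qed
  then show ?thesis by (intro exI[of _ "1 / real (Suc n)"]) auto
qed

lemma emeasure_cball_scale:
  assumes "0 < s"
  shows "emeasure lborel (cball (0 :: 'a::euclidean_space) s) = ennreal (s ^ DIM('a)) * emeasure lborel (cball (0 :: 'a) 1)"
proof -
  have "emeasure lborel (cball (0 :: 'a) s) = (\<integral>\<^sup>+x. indicator (cball (0 :: 'a) s) x \<partial>lborel)" by simp
  also have "\<dots> = ennreal (s ^ DIM('a)) * (\<integral>\<^sup>+x. indicator (cball (0 :: 'a) s) (0 + s *\<^sub>R x) \<partial>lborel)"
    using assms by (subst nn_integral_euclidean_affine[where c = s and t = 0]) (auto intro: borel_measurable_indicator)
  also have "(\<lambda>x. indicator (cball (0 :: 'a) s) (0 + s *\<^sub>R x) :: ennreal) = indicator (cball 0 1)"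
    using assms by (auto simp: indicator_def fun_eq_iff)
  finally show ?thesis by simp
qed

text \<open>
  In dimension four the volume of the ball contributes exactly the factor \<open>s\<^sup>2\<close> that compensates the
  square of a cutoff derivative of size \<open>1/s\<close>.
\<close>
lemma sq_int_ball_L4:
  fixes u :: "complex \<times> complex \<Rightarrow> complex"
  assumes [measurable]: "u \<in> borel_measurable borel" and s: "0 < s"
  shows "(sq_int (cball 0 s) u)\<^sup>2 \<le>
    ennreal (s ^ 4) * emeasure lborel (cball (0 :: complex \<times> complex) 1) * (\<integral>\<^sup>+x\<in>cball 0 s. ennreal (norm (u x) ^ 4) \<partial>lborel)"
proof -
  have [measurable]: "Measurable.pred borel (\<lambda>x::complex \<times> complex. x \<in> cball 0 s)"
    by (simp add: pred_def)
  let ?B = "cball (0 :: complex \<times> complex) s"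
  have "(\<integral>\<^sup>+x. indicator ?B x * (ennreal ((norm (u x))\<^sup>2) * indicator ?B x) \<partial>lborel)\<^sup>2 \<le>
     (\<integral>\<^sup>+x. (indicator ?B x)\<^sup>2 \<partial>lborel) * (\<integral>\<^sup>+x. (ennreal ((norm (u x))\<^sup>2) * indicator ?B x)\<^sup>2 \<partial>lborel)"
    by (rule Cauchy_Schwarz_nn_integral) measurable
  moreover have "indicator ?B x * (ennreal ((norm (u x))\<^sup>2) * indicator ?B x) = ennreal ((norm (u x))\<^sup>2) * indicator ?B x"
     "(indicator ?B x :: ennreal)\<^sup>2 = indicator ?B x"
     "(ennreal ((norm (u x))\<^sup>2) * indicator ?B x)\<^sup>2 = ennreal (norm (u x) ^ 4) * indicator ?B x" for x
    by (auto simp: indicator_def ennreal_power power_mult[symmetric])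
  ultimately show ?thesis unfolding sq_int_def emeasure_cball_scale[OF s, symmetric] using emeasure_cball_scale[OF s, where 'a="complex \<times> complex"] by simp
qed


lemma sobolev_rep_sobolev_fun:
  assumes "open U" "bounded U" "sobolev_rep U f u g"
  shows "sobolev_fun U u g"
  by unfold_locales (use assms in \<open>auto simp: sobolev_rep_def\<close>)

lemma sq_int_add5_le:
  assumes [measurable]: "f1 \<in> borel_measurable borel" "f2 \<in> borel_measurable borel" "f3 \<in> borel_measurable borel"
    "f4 \<in> borel_measurable borel" "f5 \<in> borel_measurable borel" "A \<in> sets borel"
    and le: "sq_int A f1 \<le> ennreal e1" "sq_int A f2 \<le> ennreal e2" "sq_int A f3 \<le> ennreal e3"
      "sq_int A f4 \<le> ennreal e4" "sq_int A f5 \<le> ennreal e5"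
    and nn: "0 \<le> e1" "0 \<le> e2" "0 \<le> e3" "0 \<le> e4" "0 \<le> e5"
  shows "sq_int A (\<lambda>x. f1 x + (f2 x + (f3 x + (f4 x + f5 x)))) \<le> ennreal (16 * (e1 + e2 + e3 + e4 + e5))"
proof -
  have two: "2 * ennreal a + 2 * ennreal b = ennreal (2 * a + 2 * b)" if "0 \<le> a" "0 \<le> b" for a b
    using that by (simp add: ennreal_mult)
  have 1: "sq_int A (\<lambda>x. f x + g x) \<le> ennreal (2 * a + 2 * b)"
    if "f \<in> borel_measurable borel" "g \<in> borel_measurable borel" "sq_int A f \<le> ennreal a" "sq_int A g \<le> ennreal b" "0 \<le> a" "0 \<le> b"
    for f g a b
  proof -
    have "sq_int A (\<lambda>x. f x + g x) \<le> 2 * sq_int A f + 2 * sq_int A g" by (rule sq_int_add_le[OF that(1,2) assms(6)])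
    also have "\<dots> \<le> 2 * ennreal a + 2 * ennreal b" by (intro add_mono mult_left_mono that) auto
    finally show ?thesis unfolding two[OF that(5,6)] .
  qed
  have m: "(\<lambda>x. f4 x + f5 x) \<in> borel_measurable borel" "(\<lambda>x. f3 x + (f4 x + f5 x)) \<in> borel_measurable borel"
      "(\<lambda>x. f2 x + (f3 x + (f4 x + f5 x))) \<in> borel_measurable borel" by measurable
  have "sq_int A (\<lambda>x. f4 x + f5 x) \<le> ennreal (2 * e4 + 2 * e5)"
    by (rule 1) (use le nn in auto)
  from 1[OF assms(3) m(1) le(3) this nn(3)]
  have "sq_int A (\<lambda>x. f3 x + (f4 x + f5 x)) \<le> ennreal (2 * e3 + 2 * (2 * e4 + 2 * e5))" using nn by simp
  from 1[OF assms(2) m(2) le(2) this nn(2)]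
  have "sq_int A (\<lambda>x. f2 x + (f3 x + (f4 x + f5 x))) \<le> ennreal (2 * e2 + 2 * (2 * e3 + 2 * (2 * e4 + 2 * e5)))"
    using nn by simp
  from 1[OF assms(1) m(3) le(1) this nn(1)]
  have "sq_int A (\<lambda>x. f1 x + (f2 x + (f3 x + (f4 x + f5 x)))) \<le>
      ennreal (2 * e1 + 2 * (2 * e2 + 2 * (2 * e3 + 2 * (2 * e4 + 2 * e5))))" using nn by simp
  also have "\<dots> \<le> ennreal (16 * (e1 + e2 + e3 + e4 + e5))" using nn by (intro ennreal_leI) simp
  finally show ?thesis .
qed

lemma sq_int_mult_bound:
  assumes [measurable]: "f \<in> borel_measurable borel" "A \<in> sets borel" "B \<in> sets borel"
    and k: "\<And>x. norm (k x) \<le> c" "\<And>x. x \<in> A \<Longrightarrow> x \<notin> B \<Longrightarrow> k x = 0" and c: "0 \<le> c"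
    and f: "ennreal (c\<^sup>2) * sq_int (A \<inter> B) f \<le> ennreal e"
  shows "sq_int A (\<lambda>x. k x * f x) \<le> ennreal e"
proof -
  have "sq_int A (\<lambda>x. k x * f x) \<le> (\<integral>\<^sup>+x. ennreal (c\<^sup>2) * (ennreal ((norm (f x))\<^sup>2) * indicator (A \<inter> B) x) \<partial>lborel)"
    unfolding sq_int_def
  proof (rule nn_integral_mono)
    fix x
    have "(norm (k x * f x))\<^sup>2 \<le> c\<^sup>2 * (norm (f x))\<^sup>2"
      using k(1)[of x] unfolding norm_mult power_mult_distrib by (intro mult_right_mono power_mono) auto
    then have "ennreal ((norm (k x * f x))\<^sup>2) \<le> ennreal (c\<^sup>2) * ennreal ((norm (f x))\<^sup>2)"
      by (simp add: ennreal_mult[symmetric] ennreal_leI)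
    then show "ennreal ((norm (k x * f x))\<^sup>2) * indicator A x \<le> ennreal (c\<^sup>2) * (ennreal ((norm (f x))\<^sup>2) * indicator (A \<inter> B) x)"
      using k(2)[of x] by (cases "x \<in> A"; cases "x \<in> B") auto
  qed
  also have "\<dots> = ennreal (c\<^sup>2) * sq_int (A \<inter> B) f"
    unfolding sq_int_def by (rule nn_integral_cmult) measurable
  also have "\<dots> \<le> ennreal e" by (rule f)
  finally show ?thesis .
qed

text \<open>
  Away from the origin the dilated point has a distance from the boundary that is bounded below.
\<close>
lemma anisotropic_into_hartogs_triangle:
  assumes x: "x \<in> hartogs_triangle" "2 * s \<le> norm x" and \<mu>: "1/2 \<le> \<mu>" "\<mu> < 1" and s: "0 < s" "s \<le> 1"
    and y: "norm y \<le> \<mu> * (1 - \<mu>) * s / 4"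
  shows "anisotropic \<mu> x + y \<in> hartogs_triangle"
proof -
  obtain z w where zw: "x = (z, w)" "norm z < norm w" "norm w < 1"
    using x by (auto simp: hartogs_triangle_def)
  obtain a b where ab: "y = (a, b)" by (cases y)
  define \<kappa> where "\<kappa> = \<mu> * (1 - \<mu>) * s / 4"
  have a: "norm a \<le> \<kappa>" and b: "norm b \<le> \<kappa>"
    using y norm_fst_le[of a b] norm_snd_le[of b a] by (auto simp: ab \<kappa>_def)
  have "norm x \<le> norm z + norm w" using norm_Pair_le[of z w] by (simp add: zw)
  then have w: "s \<le> norm w" using x(2) zw by linarith
  have p: "0 < \<mu> * (1 - \<mu>)" using \<mu> by simp
  have \<kappa>1: "2 * \<kappa> < \<mu> * (1 - \<mu>) * norm w"
  proof -
    have "2 * \<kappa> < \<mu> * (1 - \<mu>) * s" unfolding \<kappa>_def using mult_pos_pos[OF p s(1)] by linarith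
    also have "\<dots> \<le> \<mu> * (1 - \<mu>) * norm w" using w p by (intro mult_left_mono) auto
    finally show ?thesis .
  qed
  have \<kappa>2: "\<kappa> < 1 - \<mu>"
  proof -
    have "\<mu> * (1 - \<mu>) * s \<le> 1 * (1 - \<mu>) * 1" using \<mu> s by (intro mult_mono) auto
    also have "\<dots> = 1 - \<mu>" by simp
    finally show ?thesis unfolding \<kappa>_def using \<mu> by linarith
  qed
  have "norm (\<mu>\<^sup>2 *\<^sub>R z + a) \<le> \<mu>\<^sup>2 * norm z + \<kappa>"
    using norm_triangle_ineq[of "\<mu>\<^sup>2 *\<^sub>R z" a] a by simp
  also have "\<dots> \<le> \<mu>\<^sup>2 * norm w + \<kappa>" using zw by (intro add_right_mono mult_left_mono) auto
  also have "\<dots> < \<mu> * norm w - \<kappa>" using \<kappa>1 by (simp add: power2_eq_square algebra_simps)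
  also have "\<dots> \<le> norm (\<mu> *\<^sub>R w + b)"
    using norm_diff_ineq[of "\<mu> *\<^sub>R w" b] b \<mu> by simp
  finally have 1: "norm (\<mu>\<^sup>2 *\<^sub>R z + a) < norm (\<mu> *\<^sub>R w + b)" .
  have "norm (\<mu> *\<^sub>R w + b) \<le> \<mu> * norm w + \<kappa>"
    using norm_triangle_ineq[of "\<mu> *\<^sub>R w" b] b \<mu> by simp
  also have "\<dots> \<le> \<mu> * 1 + \<kappa>" using zw \<mu> by (intro add_right_mono mult_left_mono) auto
  also have "\<dots> < 1" using \<kappa>2 by simp
  finally show ?thesis using 1 by (simp add: zw ab anisotropic_def hartogs_triangle_def)
qed

lemma dist_anisotropic:
  assumes x: "x \<in> hartogs_triangle" and \<mu>: "1/2 \<le> \<mu>" "\<mu> < 1"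
  shows "dist (anisotropic \<mu> x) x \<le> 3 * (1 - \<mu>)"
proof -
  obtain z w where zw: "x = (z, w)" "norm z < norm w" "norm w < 1"
    using x by (auto simp: hartogs_triangle_def)
  have l2: "\<mu>\<^sup>2 \<le> 1" using \<mu> by (simp add: abs_square_le_1)
  have "anisotropic \<mu> x - x = ((\<mu>\<^sup>2 - 1) *\<^sub>R z, (\<mu> - 1) *\<^sub>R w)"
    by (simp add: zw anisotropic_def algebra_simps)
  then have "dist (anisotropic \<mu> x) x \<le> norm ((\<mu>\<^sup>2 - 1) *\<^sub>R z) + norm ((\<mu> - 1) *\<^sub>R w)"
    unfolding dist_norm by (simp only: norm_Pair_le)
  also have "\<dots> = (1 - \<mu>\<^sup>2) * norm z + (1 - \<mu>) * norm w" using \<mu> l2 by simp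
  also have "\<dots> \<le> (1 - \<mu>\<^sup>2) * 1 + (1 - \<mu>) * 1" using zw \<mu> l2 by (intro add_mono mult_left_mono) auto
  also have "\<dots> \<le> 3 * (1 - \<mu>)"
  proof -
    have "1 - \<mu>\<^sup>2 = (1 - \<mu>) * (1 + \<mu>)" by (simp add: power2_eq_square algebra_simps)
    also have "\<dots> \<le> (1 - \<mu>) * 2" using \<mu> by (intro mult_left_mono) auto
    finally show ?thesis by simp
  qed
  finally show ?thesis .
qed

lemma anisotropic_Basis:
  assumes "b \<in> Basis" "1/2 \<le> \<mu>" "\<mu> < 1"
  obtains c where "anisotropic \<mu> b = c *\<^sub>R b" "0 \<le> c" "c \<le> 1" "1 - c \<le> 2 * (1 - \<mu>)"
proof -
  have "1 - \<mu>\<^sup>2 = (1 - \<mu>) * (1 + \<mu>)" by (simp add: power2_eq_square algebra_simps)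
  also have "\<dots> \<le> (1 - \<mu>) * 2" using assms by (intro mult_left_mono) auto
  finally have l: "1 - \<mu>\<^sup>2 \<le> 2 * (1 - \<mu>)" by simp
  have l2: "\<mu>\<^sup>2 \<le> 1" using assms by (simp add: abs_square_le_1)
  show ?thesis
    using assms(1) that[of "\<mu>\<^sup>2"] that[of \<mu>] l l2 assms(2,3)
    by (auto simp: Basis_C2 anisotropic_def)
qed

text \<open>
  The approximant is \<open>\<psi> P\<close>, where \<open>\<psi>\<close> is the cutoff at scale \<open>s\<close> and \<open>P\<close> a mollification of \<open>u\<close> composed
  with the dilation.  The parameters are chosen in this order: \<open>s\<close> such that the terms with \<open>1 - \<psi>\<close>
  and with the derivative of \<open>\<psi>\<close> are small, then the dilation factor \<open>\<mu>\<close> and the kernel such that \<open>P\<close>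
  and its derivatives are close to \<open>u\<close> and \<open>g b\<close>; the radius of the kernel is so small compared with
  \<open>1 - \<mu>\<close> and \<open>s\<close> that outside the ball of radius \<open>2s\<close> only values of \<open>u\<close> in the triangle are used.
\<close>
lemma smooth_approximation:
  assumes s: "sobolev_fun hartogs_triangle u g" and L4: "(\<integral>\<^sup>+x. ennreal (norm (u x) ^ 4) \<partial>lborel) < \<infinity>" and e: "0 < e"
  shows "\<exists>F. smooth F \<and> sq_int hartogs_triangle (\<lambda>x. u x - F x) \<le> ennreal (256 * e) \<and>
    (\<forall>b\<in>Basis. sq_int hartogs_triangle (\<lambda>x. g b x - frechet_derivative F (at x) b) \<le> ennreal (256 * e))"
proof -
  let ?T = hartogs_triangle
  interpret sobolev_fun ?T u g by (rule s)
  have gm [measurable]: "g b \<in> borel_measurable borel" if "b \<in> Basis" for b using g[OF that] by (simp add: L2_fun_def)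
  have gint: "integrable lborel (g b)" if "b \<in> Basis" for b by (rule L2_fun_integrable[OF g[OF that] bounded_U])
  obtain M where M: "0 \<le> M" and cut: "\<And>s. 0 < s \<Longrightarrow> \<exists>\<psi> :: complex \<times> complex \<Rightarrow> complex. smooth \<psi> \<and> (\<forall>x. norm (\<psi> x) \<le> 2) \<and>
     (\<forall>x. norm x < 2 * s \<longrightarrow> \<psi> x = 0) \<and> (\<forall>x. 4 * s < norm x \<longrightarrow> \<psi> x = 1) \<and>
     (\<forall>x. \<forall>b\<in>Basis. norm (frechet_derivative \<psi> (at x) b) \<le> M / s) \<and>
     (\<forall>x. \<forall>b\<in>Basis. 4 * s < norm x \<longrightarrow> frechet_derivative \<psi> (at x) b = 0)"
    using cutoff_exists by metis
  define v where "v = measure lborel (cball (0 :: complex \<times> complex) 1)"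
  have v: "emeasure lborel (cball (0 :: complex \<times> complex) 1) = ennreal v" "0 \<le> v"
    using emeasure_bounded_finite[OF bounded_cball[of "0 :: complex \<times> complex" 1]]
    by (auto simp: v_def emeasure_eq_ennreal_measure)
  \<comment> \<open>choice of the scale of the cutoff\<close>
  have "0 < ennreal (e\<^sup>2)" "0 \<le> M ^ 4 * 256 * v" using e v M by auto
  then obtain \<theta> where \<theta>: "0 < \<theta>" "ennreal (M ^ 4 * 256 * v) * \<theta> \<le> ennreal (e\<^sup>2)" by (rule ennreal_split_pos)
  obtain s1 where s1: "0 < s1" "\<And>s. s \<le> s1 \<Longrightarrow> (\<integral>\<^sup>+x\<in>cball 0 s. ennreal (norm (u x) ^ 4) \<partial>lborel) < \<theta>"
    using small_ball_integral[OF _ L4 \<theta>(1)] by auto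
  have e9: "0 < ennreal (e / 9)" using e by simp
  have sq_small: "\<exists>s0>0. \<forall>s. s \<le> s0 \<longrightarrow> sq_int (cball 0 s) f < ennreal (e / 9)" if "L2_fun ?T f" for f
    unfolding sq_int_def
    by (rule small_ball_integral) (use that e9 in \<open>auto simp: L2_fun_def sq_int_def\<close>)
  obtain s2 where s2: "0 < s2" "\<And>s. s \<le> s2 \<Longrightarrow> sq_int (cball 0 s) u < ennreal (e / 9)"
    using sq_small[OF u] by blast
  have "\<exists>s0>0. \<forall>s. s \<le> s0 \<longrightarrow> sq_int (cball 0 s) (g b) < ennreal (e / 9)" if "b \<in> Basis" for b
    by (rule sq_small[OF g[OF that]])
  then obtain s3 where s3: "\<And>b. b \<in> Basis \<Longrightarrow> 0 < s3 b"
      "\<And>b s. b \<in> Basis \<Longrightarrow> s \<le> s3 b \<Longrightarrow> sq_int (cball 0 s) (g b) < ennreal (e / 9)"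
    by metis
  define s where "s = Min (insert 1 (insert s1 (insert s2 (s3 ` Basis)))) / 4"
  have s: "0 < s" "s \<le> 1" "4 * s \<le> s1" "4 * s \<le> s2" "\<And>b. b \<in> Basis \<Longrightarrow> 4 * s \<le> s3 b"
  proof -
    let ?S = "insert 1 (insert s1 (insert s2 (s3 ` Basis)))"
    define m where "m = Min ?S"
    have "m \<in> ?S" unfolding m_def by (rule Min_in) auto
    then have "0 < m" using s1(1) s2(1) s3(1) by auto
    moreover have le: "m \<le> a" if "a \<in> ?S" for a unfolding m_def by (rule Min_le[OF _ that]) auto
    then have "m \<le> 1" "m \<le> s1" "m \<le> s2" by auto
    moreover have sm: "s = m / 4" by (simp add: s_def m_def)
    ultimately show "0 < s" "s \<le> 1" "4 * s \<le> s1" "4 * s \<le> s2" by auto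
    show "4 * s \<le> s3 b" if "b \<in> Basis" for b using le[of "s3 b"] that sm by simp
  qed
  let ?B = "cball (0 :: complex \<times> complex) (4 * s)"
  have Bu: "ennreal (3\<^sup>2) * sq_int (?T \<inter> ?B) u \<le> ennreal e"
  proof -
    have "sq_int (?T \<inter> ?B) u \<le> sq_int ?B u" by (rule sq_int_mono_set) auto
    also have "\<dots> \<le> ennreal (e / 9)" using s2(2)[OF s(4)] by simp
    finally have "ennreal (3\<^sup>2) * sq_int (?T \<inter> ?B) u \<le> ennreal (3\<^sup>2) * ennreal (e / 9)" by (rule mult_left_mono) simp
    also have "\<dots> = ennreal e" using e by (subst ennreal_mult[symmetric]) auto
    finally show ?thesis .
  qed
  have Bg: "ennreal (3\<^sup>2) * sq_int (?T \<inter> ?B) (g b) \<le> ennreal e" if b: "b \<in> Basis" for b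
  proof -
    have "sq_int (?T \<inter> ?B) (g b) \<le> sq_int ?B (g b)" by (rule sq_int_mono_set) auto
    also have "\<dots> \<le> ennreal (e / 9)" using s3(2)[OF b s(5)[OF b]] by simp
    finally have "ennreal (3\<^sup>2) * sq_int (?T \<inter> ?B) (g b) \<le> ennreal (3\<^sup>2) * ennreal (e / 9)" by (rule mult_left_mono) simp
    also have "\<dots> = ennreal e" using e by (subst ennreal_mult[symmetric]) auto
    finally show ?thesis .
  qed
  have Du: "ennreal ((M / s)\<^sup>2) * sq_int (?T \<inter> ?B) u \<le> ennreal e"
  proof -
    have "(ennreal ((M / s)\<^sup>2) * sq_int ?B u)\<^sup>2 = (ennreal ((M / s)\<^sup>2))\<^sup>2 * (sq_int ?B u)\<^sup>2" by (rule power_mult_distrib)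
    also have "\<dots> \<le> (ennreal ((M / s)\<^sup>2))\<^sup>2 * (ennreal ((4 * s) ^ 4) * ennreal v * \<theta>)"
    proof (rule mult_left_mono)
      have "(sq_int ?B u)\<^sup>2 \<le> ennreal ((4 * s) ^ 4) * ennreal v * (\<integral>\<^sup>+x\<in>?B. ennreal (norm (u x) ^ 4) \<partial>lborel)"
        unfolding v(1)[symmetric] by (rule sq_int_ball_L4) (use s in auto)
      also have "\<dots> \<le> ennreal ((4 * s) ^ 4) * ennreal v * \<theta>"
        using s1(2)[OF s(3)] by (intro mult_left_mono) auto
      finally show "(sq_int ?B u)\<^sup>2 \<le> ennreal ((4 * s) ^ 4) * ennreal v * \<theta>" .
    qed simp
    also have "\<dots> = ennreal (M ^ 4 * 256 * v) * \<theta>"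
    proof -
      have "((M / s)\<^sup>2)\<^sup>2 * ((4 * s) ^ 4 * v) = M ^ 4 * 256 * v"
        using s(1) by (simp add: power_mult_distrib power_divide power_mult[symmetric])
      then have "(ennreal ((M / s)\<^sup>2))\<^sup>2 * (ennreal ((4 * s) ^ 4) * ennreal v) = ennreal (M ^ 4 * 256 * v)"
        using v s by (simp add: ennreal_power ennreal_mult[symmetric])
      then show ?thesis by (simp only: mult.assoc[symmetric])
    qed
    also have "\<dots> \<le> ennreal (e\<^sup>2)" by (rule \<theta>(2))
    finally have "ennreal ((M / s)\<^sup>2) * sq_int ?B u \<le> ennreal e"
      by (rule ennreal_le_of_sq_le) (use e in simp)
    moreover have "sq_int (?T \<inter> ?B) u \<le> sq_int ?B u" by (rule sq_int_mono_set) auto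
    ultimately show ?thesis by (meson mult_left_mono order_trans zero_le)
  qed
  obtain \<psi> :: "complex \<times> complex \<Rightarrow> complex" where \<psi>: "smooth \<psi>" "\<And>x. norm (\<psi> x) \<le> 2" "\<And>x. norm x < 2 * s \<Longrightarrow> \<psi> x = 0" "\<And>x. 4 * s < norm x \<Longrightarrow> \<psi> x = 1"
     "\<And>x b. b \<in> Basis \<Longrightarrow> norm (frechet_derivative \<psi> (at x) b) \<le> M / s"
     "\<And>x b. b \<in> Basis \<Longrightarrow> 4 * s < norm x \<Longrightarrow> frechet_derivative \<psi> (at x) b = 0"
    using cut[OF s(1)] by blast
  have \<psi>m [measurable]: "\<psi> \<in> borel_measurable borel"
    by (rule borel_measurable_continuous_onI[OF smooth_continuous[OF \<psi>(1)]])
  have D\<psi>m [measurable]: "(\<lambda>x. frechet_derivative \<psi> (at x) b) \<in> borel_measurable borel" for b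
    by (rule borel_measurable_continuous_onI[OF smooth_continuous[OF smooth_frechet_derivative[OF \<psi>(1)]]])
  \<comment> \<open>choice of the dilation and of the mollifier\<close>
  define c1 where "c1 = 4 + (M / s)\<^sup>2"
  have c1: "0 < c1" by (simp add: c1_def add_pos_nonneg)
  have e1: "0 < ennreal (e / c1)" using e c1 by simp
  define good where "good f d \<longleftrightarrow> 0 < d \<and> (\<forall>\<sigma> K. distortion 64 \<sigma> \<and> (\<forall>x\<in>?T. dist (\<sigma> x) x < d) \<and> mollifier K (ball 0 d) \<longrightarrow>
     sq_int ?T (\<lambda>x. conv f K (\<sigma> x) - f x) \<le> ennreal (e / c1))" for f d
  have good_ex: "\<exists>d. good f d" if "L2_fun ?T f" for f
    unfolding good_def by (rule conv_L2_approximation[OF that bounded_U U_sets bounded_U e1]) simp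
  have good_pos: "0 < d" if "good f d" for f d using that by (simp add: good_def)
  have goodD: "sq_int ?T (\<lambda>x. conv f K (\<sigma> x) - f x) \<le> ennreal (e / c1)"
    if "good f d" "distortion 64 \<sigma>" "\<And>x. x \<in> ?T \<Longrightarrow> dist (\<sigma> x) x < d" "mollifier K (ball 0 d)" for f d \<sigma> K
    using that unfolding good_def by blast
  obtain d1 where d1: "good u d1" using good_ex[OF u] ..
  have "\<exists>d. good (g b) d" if "b \<in> Basis" for b by (rule good_ex[OF g[OF that]])
  then obtain d2 where d2: "\<And>b. b \<in> Basis \<Longrightarrow> good (g b) (d2 b)" by metis
  define d where "d = Min (insert d1 (d2 ` Basis))"
  have d: "0 < d" "d \<le> d1" "\<And>b. b \<in> Basis \<Longrightarrow> d \<le> d2 b"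
    using good_pos[OF d1] good_pos[OF d2] by (auto simp: d_def Min_gr_iff simp del: Min_insert)
  define Q where "Q = enn2real (\<Sum>b\<in>Basis. sq_int UNIV (g b))"
  have Q: "sq_int UNIV (g b) \<le> ennreal Q" "0 \<le> Q" if b: "b \<in> Basis" for b
  proof -
    have "(\<Sum>b\<in>Basis. sq_int UNIV (g b)) < \<infinity>" using g by (auto simp: L2_fun_def)
    then have "ennreal Q = (\<Sum>b\<in>Basis. sq_int UNIV (g b))" by (simp add: Q_def)
    moreover have "sq_int UNIV (g b) \<le> (\<Sum>b\<in>Basis. sq_int UNIV (g b))" using b by (intro member_le_sum) auto
    ultimately show "sq_int UNIV (g b) \<le> ennreal Q" "0 \<le> Q" by (simp_all add: Q_def)
  qed
  have Q0: "0 \<le> Q" by (simp add: Q_def)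
  define \<mu> where "\<mu> = 1 - min (1/2) (min (d / 4) (sqrt (e / (1024 * (Q + 1)))))"
  have \<mu>: "1/2 \<le> \<mu>" "\<mu> < 1" "3 * (1 - \<mu>) < d" "(1 - \<mu>)\<^sup>2 \<le> e / (1024 * (Q + 1))"
  proof -
    have p: "0 < sqrt (e / (1024 * (Q + 1)))" using e Q0 by simp
    then show "1/2 \<le> \<mu>" "\<mu> < 1" "3 * (1 - \<mu>) < d" using d(1) by (auto simp: \<mu>_def)
    have "1 - \<mu> \<le> sqrt (e / (1024 * (Q + 1)))" "0 \<le> 1 - \<mu>" using p d(1) by (auto simp: \<mu>_def)
    then have "(1 - \<mu>)\<^sup>2 \<le> (sqrt (e / (1024 * (Q + 1))))\<^sup>2" by (rule power_mono)
    also have "\<dots> = e / (1024 * (Q + 1))" using e Q0 by simp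
    finally show "(1 - \<mu>)\<^sup>2 \<le> e / (1024 * (Q + 1))" .
  qed
  define \<kappa> where "\<kappa> = min d (\<mu> * (1 - \<mu>) * s / 4)"
  have \<kappa>: "0 < \<kappa>" using d(1) \<mu> s by (simp add: \<kappa>_def)
  obtain K where K: "mollifier K (ball (0 :: complex \<times> complex) \<kappa>)" using mollifier_exists[OF \<kappa>] by blast
  let ?\<sigma> = "anisotropic \<mu>"
  have dis: "distortion 64 ?\<sigma>" by (rule distortion_anisotropic) (use \<mu> in auto)
  have near: "dist (?\<sigma> x) x < d" if "x \<in> ?T" for x using dist_anisotropic[OF that \<mu>(1,2)] \<mu>(3) by simp
  have bl: "bounded_linear ?\<sigma>" by (rule bounded_linear_anisotropic)
  define P where "P x = conv u K (?\<sigma> x)" for x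
  define H where "H b x = conv (g b) K (?\<sigma> x)" for b x
  have sc: "smooth (conv u K)"
    by (rule smooth_conv[OF u_integrable _ bounded_ball[of 0 \<kappa>]]) (use K in \<open>auto simp: mollifier_def\<close>)
  have sP: "smooth P" using smooth_affine[OF bl sc, of 0] by (simp add: P_def[abs_def])
  have \<sigma>m [measurable]: "?\<sigma> \<in> borel_measurable borel" using dis by (simp add: distortion_def)
  have Pm [measurable]: "P \<in> borel_measurable borel"
    by (rule borel_measurable_continuous_onI[OF smooth_continuous[OF sP]])
  have Hm [measurable]: "H b \<in> borel_measurable borel" if "b \<in> Basis" for b
    unfolding H_def using measurable_compose[OF \<sigma>m conv_measurable[OF gint[OF that] K bounded_ball]] .
  have K1: "mollifier K (ball 0 d1)"
    by (rule mollifier_subset[OF K]) (use d(2) in \<open>auto simp: \<kappa>_def\<close>)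
  have K2: "mollifier K (ball 0 (d2 b))" if "b \<in> Basis" for b
    by (rule mollifier_subset[OF K]) (use d(3)[OF that] in \<open>auto simp: \<kappa>_def\<close>)
  have Pu: "sq_int ?T (\<lambda>x. P x - u x) \<le> ennreal (e / c1)"
    unfolding P_def by (rule goodD[OF d1 dis _ K1]) (use near d(2) in force)
  have Hg: "sq_int ?T (\<lambda>x. H b x - g b x) \<le> ennreal (e / c1)" if "b \<in> Basis" for b
    unfolding H_def by (rule goodD[OF d2[OF that] dis _ K2[OF that]]) (use near d(3)[OF that] in force)
  have c1_le: "ennreal (c\<^sup>2) * sq_int A f \<le> ennreal e"
    if "c\<^sup>2 \<le> c1" "sq_int ?T f \<le> ennreal (e / c1)" "A \<subseteq> ?T" for c A and f :: "complex \<times> complex \<Rightarrow> complex"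
  proof -
    have "ennreal (c\<^sup>2) * sq_int A f \<le> ennreal c1 * ennreal (e / c1)"
      using that order_trans[OF sq_int_mono_set[OF that(3)] that(2)] by (intro mult_mono ennreal_leI) auto
    also have "\<dots> = ennreal e" using c1 e by (subst ennreal_mult[symmetric]) auto
    finally show ?thesis .
  qed
  define F where "F x = \<psi> x * P x" for x
  have sF: "smooth F" unfolding F_def by (rule smooth_mult[OF \<psi>(1) sP])
  have chi1: "norm (1 - \<psi> x) \<le> 3" for x using norm_triangle_ineq4[of 1 "\<psi> x"] \<psi>(2)[of x] by simp
  have chi1_out: "1 - \<psi> x = 0" if "x \<notin> ?B" for x using \<psi>(4)[of x] that by simp
  have D\<psi>_out: "frechet_derivative \<psi> (at x) b = 0" if "x \<notin> ?B" "b \<in> Basis" for x b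
    using \<psi>(6)[OF that(2), of x] that(1) by simp
  have M_c1: "(M / s)\<^sup>2 \<le> c1" "2\<^sup>2 \<le> c1" by (auto simp: c1_def)
  have Ms: "0 \<le> M / s" using M s by simp
  have uF: "sq_int ?T (\<lambda>x. u x - F x) \<le> ennreal (256 * e)"
  proof -
    have "sq_int ?T (\<lambda>x. (1 - \<psi> x) * u x + (- \<psi> x * (P x - u x) + (0 + (0 + 0)))) \<le> ennreal (16 * (e + e + 0 + 0 + 0))"
    proof (rule sq_int_add5_le)
      show "sq_int ?T (\<lambda>x. (1 - \<psi> x) * u x) \<le> ennreal e"
        by (rule sq_int_mult_bound[where B = ?B and c = 3]) (use chi1 chi1_out Bu in auto)
      show "sq_int ?T (\<lambda>x. - \<psi> x * (P x - u x)) \<le> ennreal e"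
        by (rule sq_int_mult_bound[where B = UNIV and c = 2]) (use \<psi>(2) c1_le[OF M_c1(2) Pu] in auto)
    qed (use e in \<open>auto simp: sq_int_def\<close>)
    also have "\<dots> \<le> ennreal (256 * e)" using e by (intro ennreal_leI) simp
    also have "(\<lambda>x. (1 - \<psi> x) * u x + (- \<psi> x * (P x - u x) + (0 + (0 + 0)))) = (\<lambda>x. u x - F x)"
      by (simp add: F_def algebra_simps fun_eq_iff)
    finally show ?thesis .
  qed
  have DP: "\<psi> x * frechet_derivative P (at x) b = \<psi> x * (of_real c * H b x)"
    if x: "x \<in> ?T" and b: "b \<in> Basis" and c: "?\<sigma> b = c *\<^sub>R b" for x b c
  proof (cases "norm x < 2 * s")
    case True
    then show ?thesis by (simp add: \<psi>(3))
  next
    case False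
    have "(?\<sigma> has_derivative ?\<sigma>) (at x)" by (rule bounded_linear_imp_has_derivative[OF bl])
    from has_derivative_compose[OF this smooth_has_derivative[OF sc]]
    have "(P has_derivative (\<lambda>h. frechet_derivative (conv u K) (at (?\<sigma> x)) (?\<sigma> h))) (at x)"
      by (simp add: P_def[abs_def])
    then have "frechet_derivative P (at x) b = frechet_derivative (conv u K) (at (?\<sigma> x)) (?\<sigma> b)"
      using frechet_derivative_at by metis
    also have "\<dots> = c *\<^sub>R frechet_derivative (conv u K) (at (?\<sigma> x)) b"
      unfolding c using linear_scale[OF has_derivative_linear[OF smooth_has_derivative[OF sc]]] .
    also have "frechet_derivative (conv u K) (at (?\<sigma> x)) b = H b x"
      unfolding H_def
    proof (rule frechet_derivative_conv_weak_deriv[OF u_integrable _ compact_cball _ weak[OF b]])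
      show "mollifier K (cball 0 \<kappa>)" by (rule mollifier_subset[OF K]) auto
      show "?\<sigma> x + y \<in> ?T" if "y \<in> cball 0 \<kappa>" for y
        by (rule anisotropic_into_hartogs_triangle[OF x _ \<mu>(1,2) s(1,2)]) (use False that in \<open>auto simp: \<kappa>_def\<close>)
    qed
    finally show ?thesis by (simp add: scaleR_conv_of_real)
  qed
  have gF: "sq_int ?T (\<lambda>x. g b x - frechet_derivative F (at x) b) \<le> ennreal (256 * e)" if b: "b \<in> Basis" for b
  proof -
    obtain c where c: "?\<sigma> b = c *\<^sub>R b" "0 \<le> c" "c \<le> 1" "1 - c \<le> 2 * (1 - \<mu>)"
      using anisotropic_Basis[OF b \<mu>(1,2)] by blast
    let ?D = "\<lambda>x. frechet_derivative \<psi> (at x) b"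
    let ?k3 = "\<lambda>x. \<psi> x * of_real (1 - c)"
    note [measurable] = gm[OF b] Hm[OF b]
    have k3: "norm (?k3 x) \<le> 4 * (1 - \<mu>)" for x
    proof -
      have "norm (?k3 x) = norm (\<psi> x) * (1 - c)" using c by (simp add: norm_mult del: of_real_diff)
      also have "\<dots> \<le> 2 * (2 * (1 - \<mu>))" using \<psi>(2)[of x] c by (intro mult_mono) auto
      finally show ?thesis by simp
    qed
    have "sq_int ?T (\<lambda>x. (1 - \<psi> x) * g b x + (- \<psi> x * (H b x - g b x) + (?k3 x * H b x +
        (- ?D x * (P x - u x) + - ?D x * u x)))) \<le> ennreal (16 * (e + e + e + e + e))"
    proof (rule sq_int_add5_le)
      show "sq_int ?T (\<lambda>x. (1 - \<psi> x) * g b x) \<le> ennreal e"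
        by (rule sq_int_mult_bound[where B = ?B and c = 3]) (use chi1 chi1_out Bg[OF b] in auto)
      show "sq_int ?T (\<lambda>x. - \<psi> x * (H b x - g b x)) \<le> ennreal e"
        by (rule sq_int_mult_bound[where B = UNIV and c = 2]) (use \<psi>(2) c1_le[OF M_c1(2) Hg[OF b]] in auto)
      show "sq_int ?T (\<lambda>x. ?k3 x * H b x) \<le> ennreal e"
      proof (rule sq_int_mult_bound[where B = UNIV and c = "4 * (1 - \<mu>)", OF _ _ _ k3])
        have "sq_int (?T \<inter> UNIV) (H b) \<le> ennreal 64 * ennreal Q"
          unfolding H_def
          by (rule order_trans[OF conv_L2_bound[OF gint[OF b] K bounded_ball dis]]) (use Q(1)[OF b] in \<open>auto intro!: mult_left_mono\<close>)
        then have "ennreal ((4 * (1 - \<mu>))\<^sup>2) * sq_int (?T \<inter> UNIV) (H b) \<le> ennreal ((4 * (1 - \<mu>))\<^sup>2) * (ennreal 64 * ennreal Q)"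
          by (rule mult_left_mono) simp
        also have "\<dots> = ennreal ((4 * (1 - \<mu>))\<^sup>2 * (64 * Q))"
          using Q0 by (simp only: ennreal_mult[symmetric] zero_le_power2 zero_le_numeral mult_nonneg_nonneg)
        also have "(4 * (1 - \<mu>))\<^sup>2 * (64 * Q) = 1024 * Q * (1 - \<mu>)\<^sup>2"
          by (simp add: power2_eq_square algebra_simps)
        also have "\<dots> \<le> ennreal e"
        proof (rule ennreal_leI)
          have "1024 * Q * (1 - \<mu>)\<^sup>2 \<le> 1024 * (Q + 1) * (e / (1024 * (Q + 1)))"
            using \<mu>(4) Q0 e by (intro mult_mono) auto
          also have "\<dots> = e" using Q0 by simp
          finally show "1024 * Q * (1 - \<mu>)\<^sup>2 \<le> e" .
        qed
        finally show "ennreal ((4 * (1 - \<mu>))\<^sup>2) * sq_int (?T \<inter> UNIV) (H b) \<le> ennreal e" .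
      qed (use \<mu> in auto)
      show "sq_int ?T (\<lambda>x. - ?D x * (P x - u x)) \<le> ennreal e"
        by (rule sq_int_mult_bound[where B = UNIV and c = "M / s"]) (use \<psi>(5)[OF b] Ms c1_le[OF M_c1(1) Pu] in auto)
      show "sq_int ?T (\<lambda>x. - ?D x * u x) \<le> ennreal e"
        by (rule sq_int_mult_bound[where B = ?B and c = "M / s"]) (use \<psi>(5)[OF b] Ms D\<psi>_out[OF _ b] Du in auto)
    qed (use e in auto)
    also have "\<dots> \<le> ennreal (256 * e)" using e by (intro ennreal_leI) simp
    also have "sq_int ?T (\<lambda>x. (1 - \<psi> x) * g b x + (- \<psi> x * (H b x - g b x) + (?k3 x * H b x +
        (- ?D x * (P x - u x) + - ?D x * u x)))) = sq_int ?T (\<lambda>x. g b x - frechet_derivative F (at x) b)"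
    proof (rule sq_int_cong)
      fix x assume x: "x \<in> ?T"
      have "frechet_derivative F (at x) b = \<psi> x * frechet_derivative P (at x) b + ?D x * P x"
        unfolding F_def[abs_def] by (rule frechet_derivative_mult[OF \<psi>(1) sP])
      also have "\<dots> = \<psi> x * (of_real c * H b x) + ?D x * P x" unfolding DP[OF x b c(1)] ..
      finally have "(1 - \<psi> x) * g b x + (- \<psi> x * (H b x - g b x) + (?k3 x * H b x +
        (- ?D x * (P x - u x) + - ?D x * u x))) = g b x - frechet_derivative F (at x) b"
        by (simp add: algebra_simps)
      then show "norm ((1 - \<psi> x) * g b x + (- \<psi> x * (H b x - g b x) + (?k3 x * H b x +
        (- ?D x * (P x - u x) + - ?D x * u x)))) = norm (g b x - frechet_derivative F (at x) b)" by simp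
    qed
    finally show ?thesis .
  qed
  show ?thesis using sF uF gF by blast
qed

section \<open>The three properties of the Hartogs triangle\<close>

lemma hartogs_smooth_dense:
  "dense_in_seminormed (smooth_up_to_boundary hartogs_triangle) (W1 hartogs_triangle) (W1_norm hartogs_triangle)"
  unfolding dense_in_seminormed_def
proof (intro conjI ballI allI impI)
  let ?T = hartogs_triangle
  note T = open_hartogs_triangle bounded_hartogs_triangle
  have Tm: "?T \<in> sets borel" using T by simp
  show "smooth_up_to_boundary ?T \<subseteq> W1 ?T"
    using sobolev_rep_W1(1)[OF T sobolev_rep_smooth[OF Tm T(2)]] by (auto simp: smooth_up_to_boundary_def)
  fix f and \<epsilon> :: real assume f: "f \<in> W1 ?T" and \<epsilon>: "0 < \<epsilon>"
  obtain u g where r: "sobolev_rep ?T f u g" using W1_has_sobolev_rep[OF T f] by blast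
  interpret sobolev_fun ?T u g by (rule sobolev_rep_sobolev_fun[OF T r])
  obtain V where V: "finite V" "?T \<subseteq> (\<Union>v\<in>V. inner_part ?T (finite_cone v (1/8) (1/4)))"
    by (rule hartogs_triangle_cone_cover)
  obtain C where C: "(\<integral>\<^sup>+x. ennreal (norm (u x) ^ 4) \<partial>lborel) \<le> ennreal C * (sobolev_energy u g)\<^sup>2"
    using sobolev_inequality[OF T _ _ V] sobolev_fun_axioms by auto
  have L4: "(\<integral>\<^sup>+x. ennreal (norm (u x) ^ 4) \<partial>lborel) < \<infinity>"
    by (rule order_le_less_trans[OF C])
       (use sobolev_rep_W1(3)[OF T r] in \<open>simp add: ennreal_mult_less_top power2_eq_square\<close>)
  define e where "e = \<epsilon>\<^sup>2 / 2560"
  have e: "0 < e" using \<epsilon> by (simp add: e_def)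
  obtain F where F: "smooth F" "sq_int ?T (\<lambda>x. u x - F x) \<le> ennreal (256 * e)"
    "\<And>b. b \<in> Basis \<Longrightarrow> sq_int ?T (\<lambda>x. g b x - frechet_derivative F (at x) b) \<le> ennreal (256 * e)"
    using smooth_approximation[OF sobolev_fun_axioms L4 e] by blast
  have rF: "sobolev_rep ?T F (\<lambda>x. indicator ?T x * F x) (\<lambda>b x. indicator ?T x * frechet_derivative F (at x) b)"
    by (rule sobolev_rep_smooth[OF Tm T(2) F(1)]) simp
  note rd = sobolev_rep_diff[OF T(2) r rF]
  let ?en = "sobolev_energy (\<lambda>x. u x - indicator ?T x * F x) (\<lambda>b x. g b x - indicator ?T x * frechet_derivative F (at x) b)"
  have out: "sq_int UNIV (\<lambda>x. k x - indicator ?T x * G x) = sq_int ?T (\<lambda>x. k x - G x)" if "L2_fun ?T k" for k G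
  proof -
    have "sq_int UNIV (\<lambda>x. k x - indicator ?T x * G x) = sq_int ?T (\<lambda>x. k x - indicator ?T x * G x)"
      by (rule sq_int_support[symmetric]) (use that in \<open>auto simp: L2_fun_def\<close>)
    also have "\<dots> = sq_int ?T (\<lambda>x. k x - G x)" by (rule sq_int_cong) simp
    finally show ?thesis .
  qed
  have "?en \<le> ennreal (256 * e) + (\<Sum>b\<in>(Basis :: (complex \<times> complex) set). ennreal (256 * e))"
    unfolding sobolev_energy_def using F(2,3) out[OF u] out[OF g] by (intro add_mono sum_mono) auto
  also have "\<dots> = ennreal (1280 * e)"
  proof -
    have "(\<Sum>b\<in>(Basis :: (complex \<times> complex) set). ennreal (256 * e)) = ennreal (1024 * e)"
      using e by (subst sum_ennreal) auto
    then show ?thesis using e by (simp add: ennreal_plus[symmetric] del: ennreal_plus)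
  qed
  finally have "enn2real ?en \<le> 1280 * e" using e by (intro enn2real_leI) auto
  also have "\<dots> < \<epsilon>\<^sup>2" using \<epsilon> by (simp add: e_def)
  finally have "sqrt (enn2real ?en) < \<epsilon>" using \<epsilon> by (simp add: real_less_lsqrt)
  then have "W1_norm ?T (\<lambda>x. f x - F x) < \<epsilon>" unfolding sobolev_rep_W1(2)[OF T rd] .
  moreover have "F \<in> smooth_up_to_boundary ?T" using F(1) by (auto simp: smooth_up_to_boundary_def)
  ultimately show "\<exists>F\<in>smooth_up_to_boundary ?T. W1_norm ?T (\<lambda>x. f x - F x) < \<epsilon>" by blast
qed

lemma hartogs_sobolev_embedding:
  "bounded_inclusion (W1 hartogs_triangle) (W1_norm hartogs_triangle) (Lp 4 hartogs_triangle) (Lp_norm 4 hartogs_triangle)"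
proof -
  let ?T = hartogs_triangle
  note T = open_hartogs_triangle bounded_hartogs_triangle
  have Tm: "?T \<in> sets borel" using T by simp
  obtain V where V: "finite V" "?T \<subseteq> (\<Union>v\<in>V. inner_part ?T (finite_cone v (1/8) (1/4)))"
    by (rule hartogs_triangle_cone_cover)
  obtain C where C: "0 \<le> C" "\<And>u g. sobolev_fun ?T u g \<Longrightarrow>
      (\<integral>\<^sup>+x. ennreal (norm (u x) ^ 4) \<partial>lborel) \<le> ennreal C * (sobolev_energy u g)\<^sup>2"
    using sobolev_inequality[OF T _ _ V] by auto
  have main: "f \<in> Lp 4 ?T \<and> Lp_norm 4 ?T f \<le> C powr (1/4) * W1_norm ?T f" if f: "f \<in> W1 ?T" for f
  proof -
    obtain u g where r: "sobolev_rep ?T f u g" using W1_has_sobolev_rep[OF T f] by blast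
    have u: "L2_fun ?T u" "AE x in lborel. x \<in> ?T \<longrightarrow> f x = u x" using r by (auto simp: sobolev_rep_def)
    have um: "u \<in> borel_measurable borel" using u by (simp add: L2_fun_def)
    have u0: "u x = 0" if "x \<notin> ?T" for x using u(1) that unfolding L2_fun_def by blast
    obtain q where q: "sobolev_energy u g = ennreal q" "0 \<le> q"
      using sobolev_rep_W1(3)[OF T r] by (cases "sobolev_energy u g") auto
    have I: "(\<integral>\<^sup>+x\<in>?T. ennreal (norm (u x) powr 4) \<partial>lborel) = (\<integral>\<^sup>+x. ennreal (norm (u x) ^ 4) \<partial>lborel)"
      by (intro nn_integral_cong) (auto simp: indicator_def u0)
    have le: "(\<integral>\<^sup>+x. ennreal (norm (u x) ^ 4) \<partial>lborel) \<le> ennreal (C * q\<^sup>2)"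
      using C(2)[OF sobolev_rep_sobolev_fun[OF T r]] C(1) q by (simp add: ennreal_power ennreal_mult)
    note L = Lp_representative[OF Tm um u(2), of 4, unfolded I]
    have "f \<in> Lp 4 ?T" using L(1) le by (auto intro: order_le_less_trans)
    moreover have "Lp_norm 4 ?T f \<le> C powr (1/4) * W1_norm ?T f"
    proof -
      have "enn2real (\<integral>\<^sup>+x. ennreal (norm (u x) ^ 4) \<partial>lborel) \<le> C * q\<^sup>2"
        using le C(1) by (intro enn2real_leI) auto
      then have "Lp_norm 4 ?T f \<le> (C * q\<^sup>2) powr (1/4)"
        using L(2) by (auto intro!: powr_mono2)
      also have "\<dots> = C powr (1/4) * (q\<^sup>2) powr (1/4)" using C(1) by (simp add: powr_mult)
      also have "(q\<^sup>2) powr (1/4) = sqrt q"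
      proof (cases "q = 0")
        case False
        then have "(q\<^sup>2) powr (1/4) = q powr (2 * (1/4))"
          using q(2) by (subst powr_powr[symmetric]) simp
        then show ?thesis using q(2) by (simp add: powr_half_sqrt)
      qed simp
      also have "sqrt q = W1_norm ?T f" unfolding sobolev_rep_W1(2)[OF T r] q using q(2) by simp
      finally show ?thesis .
    qed
    ultimately show ?thesis by blast
  qed
  then show ?thesis unfolding bounded_inclusion_def by blast
qed

lemma hartogs_rellich:
  "compact_inclusion (W1 hartogs_triangle) (W1_norm hartogs_triangle) (Lp 2 hartogs_triangle) (Lp_norm 2 hartogs_triangle)"
  unfolding compact_inclusion_def
proof (intro conjI allI impI)
  let ?T = hartogs_triangle
  note T = open_hartogs_triangle bounded_hartogs_triangle
  have Tm: "?T \<in> sets borel" using T by simp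
  show "W1 ?T \<subseteq> Lp 2 ?T" by (auto simp: W1_def)
  obtain V where V: "finite V" "?T \<subseteq> (\<Union>v\<in>V. inner_part ?T (finite_cone v (1/8) (1/4)))"
    by (rule hartogs_triangle_cone_cover)
  fix f :: "nat \<Rightarrow> complex \<times> complex \<Rightarrow> complex"
  assume "(\<forall>n. f n \<in> W1 ?T) \<and> (\<exists>M. \<forall>n. W1_norm ?T (f n) \<le> M)"
  then obtain M where f: "\<And>n. f n \<in> W1 ?T" and M: "\<And>n. W1_norm ?T (f n) \<le> M" by blast
  have "\<exists>u g. sobolev_rep ?T (f n) u g" for n using W1_has_sobolev_rep[OF T f] by blast
  then obtain u g where r: "\<And>n. sobolev_rep ?T (f n) (u n) (g n)" by metis
  have M0: "0 \<le> M" using M[of 0] by (rule order_trans[rotated]) (simp add: W1_norm_def sum_nonneg)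
  have en: "sobolev_energy (u n) (g n) \<le> ennreal (M\<^sup>2)" for n
  proof -
    obtain q where q: "sobolev_energy (u n) (g n) = ennreal q" "0 \<le> q"
      using sobolev_rep_W1(3)[OF T r[of n]] by (cases "sobolev_energy (u n) (g n)") auto
    have "sqrt q \<le> M" using M[of n] unfolding sobolev_rep_W1(2)[OF T r] q using q(2) by simp
    then have "q \<le> M\<^sup>2" using q(2) by (simp add: sqrt_le_D)
    then show ?thesis unfolding q by (rule ennreal_leI)
  qed
  obtain w s where w: "strict_mono (s :: nat \<Rightarrow> nat)" "L2_fun ?T w" "(\<lambda>n. sq_int UNIV (\<lambda>x. u (s n) x - w x)) \<longlonglongrightarrow> 0"
    using rellich[of ?T u g "M\<^sup>2" "1/8" "1/4" V] sobolev_rep_sobolev_fun[OF T r] en V by auto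
  have "Lp_norm 2 ?T (\<lambda>x. f (s n) x - w x) = sqrt (enn2real (sq_int UNIV (\<lambda>x. u (s n) x - w x)))" for n
  proof -
    have ae: "AE x in lborel. x \<in> ?T \<longrightarrow> f (s n) x - w x = u (s n) x - w x"
      using r[of "s n"] unfolding sobolev_rep_def by (auto elim!: eventually_mono)
    have l2: "L2_fun ?T (\<lambda>x. u (s n) x - w x)"
      using r[of "s n"] w(2) by (auto simp: sobolev_rep_def intro: L2_fun_diff)
    have "(Lp_norm 2 ?T (\<lambda>x. f (s n) x - w x))\<^sup>2 = enn2real (sq_int UNIV (\<lambda>x. u (s n) x - w x))"
      by (rule L2_representative(2)[OF Tm l2 ae])
    moreover have "0 \<le> Lp_norm 2 ?T (\<lambda>x. f (s n) x - w x)" by (simp add: Lp_norm_def)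
    ultimately show ?thesis by (metis real_sqrt_abs abs_of_nonneg)
  qed
  moreover have "(\<lambda>n. enn2real (sq_int UNIV (\<lambda>x. u (s n) x - w x))) \<longlonglongrightarrow> 0"
    by (rule tendsto_enn2real) (use w(3) in simp_all)
  from tendsto_real_sqrt[OF this]
  have "(\<lambda>n. sqrt (enn2real (sq_int UNIV (\<lambda>x. u (s n) x - w x)))) \<longlonglongrightarrow> sqrt 0" .
  ultimately have "(\<lambda>n. Lp_norm 2 ?T (\<lambda>x. f (s n) x - w x)) \<longlonglongrightarrow> 0" by simp
  moreover have "w \<in> Lp 2 ?T" by (rule L2_representative(1)[OF Tm w(2)]) simp
  ultimately show "\<exists>g\<in>Lp 2 ?T. \<exists>r. strict_mono r \<and> (\<lambda>n. Lp_norm 2 ?T (\<lambda>x. f (r n) x - g x)) \<longlonglongrightarrow> 0"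
    using w(1) by blast
qed

theorem corollary2p14:
  shows "dense_in_seminormed (smooth_up_to_boundary hartogs_triangle)
           (W1 hartogs_triangle) (W1_norm hartogs_triangle)
       \<and> bounded_inclusion (W1 hartogs_triangle) (W1_norm hartogs_triangle)
           (Lp 4 hartogs_triangle) (Lp_norm 4 hartogs_triangle)
       \<and> compact_inclusion (W1 hartogs_triangle) (W1_norm hartogs_triangle)
           (Lp 2 hartogs_triangle) (Lp_norm 2 hartogs_triangle)"
  using hartogs_smooth_dense hartogs_sobolev_embedding hartogs_rellich by blast

end
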